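(* In the setting below, assume $\widehat W_{\infty,h}\subset W_{\sigma,h}$ for all $\sigma\in(0,\infty]$, $h\in(0,h_0]$, and for $\sigma\in(0,\infty]$ let $u_{\sigma,h}$ be a minimizer of $\mathcal E_\sigma$ over $W_{\sigma,h}$. Then for each fixed $h\in(0,h_0]$, $\|u_{\sigma,h}-u_{\infty,h}\|_{L^p(\Omega)}\to0$ as $\sigma\to\infty$.
   Context: Let $d\ge1$, $\Omega\subset\mathbb R^d$ a bounded Lipschitz domain with piecewise flat boundary, $p\in(1,\infty)$, $\beta\in[0,d+p)$, and $q(r):=r\big(\frac{1}{1+e^{-r^2}}-\frac12\big)$ for $r\ge0$. Let $\overline C_{d,p}:=\frac{\sqrt\pi\,\Gamma(\frac{d+p}{2})}{\Gamma(\frac{p+1}{2})\Gamma(\frac d2)}$. For $\delta>0$ put $\gamma[\delta](x,y):=\mathbb 1_{\{|y-x|<\delta q(\mathrm{dist}(x,\partial\Omega))\}}\,C^\gamma_{d,\beta,p}\,|x-y|^{-\beta}(\delta q(\mathrm{dist}(x,\partial\Omega)))^{-(d+p-\beta)}$, with $C^\gamma_{d,\beta,p}>0$ chosen so that $\int_{B(0,1)}C^\gamma_{d,\beta,p}|\xi|^{p-\beta}d\xi=\overline C_{d,p}$; let $[u]_\delta^p:=\int_\Omega\int_\Omega\gamma[\delta](x,y)|u(y)-u(x)|^pdydx$, $\mathfrak W^{\beta,p}[\delta;q](\Omega):=\{u\in L^p(\Omega):[u]_\delta<\infty\}$ with norm $(\|u\|^p_{L^p(\Omega)}+[u]^p_\delta)^{1/p}$,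 and $\mathring{\mathfrak W}^{\beta,p}[\delta;q](\Omega)$ its subspace of $u$ with $\int_\Omega u=0$. $\mathring W^{1,p}(\Omega)$ denotes mean-zero functions in $W^{1,p}(\Omega)$. Let $\lambda\in C^0(\overline\Omega)\cap C^\infty(\Omega)$, $\lambda\ge0$, with $\kappa_0\ge1$ such that $\kappa_0^{-1}\mathrm{dist}(x,\partial\Omega)\le\lambda(x)\le\kappa_0\mathrm{dist}(x,\partial\Omega)$ on $\overline\Omega$, and for every multi-index $\alpha$ a $\kappa_\alpha>0$ with $|D^\alpha\lambda(x)|\le\kappa_\alpha\mathrm{dist}(x,\partial\Omega)^{1-|\alpha|}$ in $\Omega$; $\kappa_1:=\max_{|\alpha|=1}\kappa_\alpha$. Set $\delta_0:=1/(3\max\{1,\kappa_1,8\kappa_0^3\})$ and $\eta_\delta(x):=\delta q(\lambda(x))$. Let $\rho\in L^\infty(\mathbb R)$ be even, with $\mathrm{supp}\rho$ a compact subset of $(-1,1)$, $\rho\ge0$ and nonincreasing on $[0,1)$, $\rho\ge C_\rho>0$ on $[-c_\rho,c_\rho]$ for some $c_\rho\in(0,1)$, and $\int_{B(0,1)}|z|^{p-\beta}\rho(|z|)dz=\overline C_{d,p}$. Let $\psi\in C^k(\mathbb R)$ for some $k\ge1$, even, $\psi\ge0$, with $[-c_\psi,c_\psi]\subset\mathrm{supp}\psi$, $\mathrm{supp}\psi$ a compact subset of $(-1,1)$ for some $c_\psi>0$, and $\int_{\mathbb R^d}\psi(|x|)dx=1$; define $K_\delta u(x):=\int_\Omega\eta_\delta(x)^{-d}\psi(|y-x|/\eta_\delta(x))u(y)dy$.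 Fix $f\in[W^{1,p}(\Omega)]^*$ with $\langle f,1\rangle=0$. For $\sigma\in(0,\infty)$ let $\delta_\sigma:=\min\{\delta_0,1/\sigma\}$, $\mathcal T_\sigma:=\mathring{\mathfrak W}^{\beta,p}[\delta_\sigma;q](\Omega)$, $\mathcal E_\sigma(u):=\frac1p\int_\Omega\int_\Omega\frac{\rho(|y-x|/\eta_{\delta_\sigma}(x))}{\eta_{\delta_\sigma}(x)^{d+p-\beta}|x-y|^\beta}|u(x)-u(y)|^pdydx-\langle f,K_{\delta_\sigma}u\rangle$; $\mathcal T_\infty:=\mathring W^{1,p}(\Omega)$ and $\mathcal E_\infty(u):=\frac1p\int_\Omega|\nabla u|^pdx-\langle f,u\rangle$. Let $\{\tau_h\}_{h\in(0,h_0]}$ be quasi-uniform, shape-regular triangulations of $\Omega$ with maximal element size $h$, and fix $N\in\mathbb N$. For $\sigma\in(0,\infty]$ let $W_{\sigma,h}:=\{v\in\mathcal T_\sigma: v|_\tau\in\mathcal P_N(\tau)\ \forall\tau\in\tau_h,\ \int_\Omega v=0\}$ ($\mathcal P_N$: polynomials of degree $\le N$), and let $\widehat W_{\infty,h}$ be the space of continuous piecewise linear functions on $\tau_h$ with zero mean. *)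

theory Defs
  imports "HOL-Analysis.Analysis"
begin

definition lipschitz_domain :: "'a::euclidean_space set \<Rightarrow> bool" where
  "lipschitz_domain \<Omega> \<longleftrightarrow> open \<Omega> \<and> connected \<Omega> \<and> bounded \<Omega> \<and> \<Omega> \<noteq> {} \<and>
     (\<forall>x\<in>frontier \<Omega>. \<exists>r>0. \<exists>e::'a. \<exists>g::'a \<Rightarrow> real. \<exists>L.
        norm e = 1 \<and> L-lipschitz_on UNIV g \<and>
        \<Omega> \<inter> ball x r = {y \<in> ball x r. y \<bullet> e < g (y - (y \<bullet> e) *\<^sub>R e)})"

definition piecewise_flat_boundary :: "'a::euclidean_space set \<Rightarrow> bool" where
  "piecewise_flat_boundary \<Omega> \<longleftrightarrow>
     (\<exists>H. finite H \<and> (\<forall>P\<in>H. \<exists>a b. a \<noteq> 0 \<and> P = {x. a \<bullet> x = b}) \<and> frontier \<Omega> \<subseteq> \<Union>H)"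

definition dist_bd :: "'a::euclidean_space set \<Rightarrow> 'a \<Rightarrow> real" where
  "dist_bd \<Omega> x = infdist x (frontier \<Omega>)"

text \<open>Iterated partial derivative along the list of (basis) directions es; a list of
 basis vectors represents a multi-index alpha, with |alpha| = length es.\<close>
fun iter_pd :: "'a::euclidean_space list \<Rightarrow> ('a \<Rightarrow> real) \<Rightarrow> 'a \<Rightarrow> real" where
  "iter_pd [] f = f"
| "iter_pd (e # es) f = (\<lambda>x. frechet_derivative (iter_pd es f) (at x) e)"

definition smooth_in :: "'a::euclidean_space set \<Rightarrow> ('a \<Rightarrow> real) \<Rightarrow> bool" where
  "smooth_in U f \<longleftrightarrow> (\<forall>es. set es \<subseteq> Basis \<longrightarrow> (\<forall>x\<in>U. iter_pd es f differentiable (at x)))"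

definition test_fun :: "'a::euclidean_space set \<Rightarrow> ('a \<Rightarrow> real) \<Rightarrow> bool" where
  "test_fun \<Omega> \<phi> \<longleftrightarrow> smooth_in UNIV \<phi> \<and>
     compact (closure {x. \<phi> x \<noteq> 0}) \<and> closure {x. \<phi> x \<noteq> 0} \<subseteq> \<Omega>"

definition Lp_on :: "real \<Rightarrow> 'a::euclidean_space set \<Rightarrow> ('a \<Rightarrow> real) \<Rightarrow> bool" where
  "Lp_on p \<Omega> u \<longleftrightarrow> u \<in> borel_measurable (lebesgue_on \<Omega>) \<and>
     integrable (lebesgue_on \<Omega>) (\<lambda>x. \<bar>u x\<bar> powr p)"

definition Lp_norm :: "real \<Rightarrow> 'a::euclidean_space set \<Rightarrow> ('a \<Rightarrow> real) \<Rightarrow> real" where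
  "Lp_norm p \<Omega> u = (\<integral>x. \<bar>u x\<bar> powr p \<partial>lebesgue_on \<Omega>) powr (1 / p)"

definition mean_zero :: "'a::euclidean_space set \<Rightarrow> ('a \<Rightarrow> real) \<Rightarrow> bool" where
  "mean_zero \<Omega> u \<longleftrightarrow> (\<integral>x. u x \<partial>lebesgue_on \<Omega>) = 0"

definition is_weak_grad :: "'a::euclidean_space set \<Rightarrow> ('a \<Rightarrow> real) \<Rightarrow> ('a \<Rightarrow> 'a) \<Rightarrow> bool" where
  "is_weak_grad \<Omega> u G \<longleftrightarrow> G \<in> borel_measurable (lebesgue_on \<Omega>) \<and>
     (\<forall>\<phi>. test_fun \<Omega> \<phi> \<longrightarrow> (\<forall>i\<in>Basis.
        (\<integral>x. u x * frechet_derivative \<phi> (at x) i \<partial>lebesgue_on \<Omega>)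
          = - (\<integral>x. (G x \<bullet> i) * \<phi> x \<partial>lebesgue_on \<Omega>)))"

definition W1p :: "real \<Rightarrow> 'a::euclidean_space set \<Rightarrow> ('a \<Rightarrow> real) \<Rightarrow> bool" where
  "W1p p \<Omega> u \<longleftrightarrow> Lp_on p \<Omega> u \<and>
     (\<exists>G. is_weak_grad \<Omega> u G \<and> Lp_on p \<Omega> (\<lambda>x. norm (G x)))"

definition weak_grad :: "real \<Rightarrow> 'a::euclidean_space set \<Rightarrow> ('a \<Rightarrow> real) \<Rightarrow> 'a \<Rightarrow> 'a" where
  "weak_grad p \<Omega> u = (SOME G. is_weak_grad \<Omega> u G \<and> Lp_on p \<Omega> (\<lambda>x. norm (G x)))"

definition W1p_norm :: "real \<Rightarrow> 'a::euclidean_space set \<Rightarrow> ('a \<Rightarrow> real) \<Rightarrow> real" where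
  "W1p_norm p \<Omega> u = ((\<integral>x. \<bar>u x\<bar> powr p \<partial>lebesgue_on \<Omega>)
       + (\<integral>x. norm (weak_grad p \<Omega> u x) powr p \<partial>lebesgue_on \<Omega>)) powr (1 / p)"

definition W1p_dual :: "real \<Rightarrow> 'a::euclidean_space set \<Rightarrow> (('a \<Rightarrow> real) \<Rightarrow> real) \<Rightarrow> bool" where
  "W1p_dual p \<Omega> f \<longleftrightarrow>
     (\<forall>u v. W1p p \<Omega> u \<longrightarrow> W1p p \<Omega> v \<longrightarrow> f (\<lambda>x. u x + v x) = f u + f v) \<and>
     (\<forall>u c. W1p p \<Omega> u \<longrightarrow> f (\<lambda>x. c * u x) = c * f u) \<and>
     (\<exists>C. \<forall>u. W1p p \<Omega> u \<longrightarrow> \<bar>f u\<bar> \<le> C * W1p_norm p \<Omega> u)"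

definition qfun :: "real \<Rightarrow> real" where
  "qfun r = r * (1 / (1 + exp (- (r ^ 2))) - 1 / 2)"

definition Cbar :: "nat \<Rightarrow> real \<Rightarrow> real" where
  "Cbar d p = sqrt pi * Gamma ((real d + p) / 2) / (Gamma ((p + 1) / 2) * Gamma (real d / 2))"

text \<open>C^gamma_{d,beta,p}, chosen so that the integral over the unit ball of C |xi|^(p-beta) is Cbar.\<close>
definition Cgamma :: "'a::euclidean_space itself \<Rightarrow> real \<Rightarrow> real \<Rightarrow> real" where
  "Cgamma _ \<beta> p = Cbar DIM('a) p /
      set_lebesgue_integral lborel (ball (0::'a) 1) (\<lambda>\<xi>. norm \<xi> powr (p - \<beta>))"

definition gamma_kernel :: "'a::euclidean_space set \<Rightarrow> real \<Rightarrow> real \<Rightarrow> real \<Rightarrow> 'a \<Rightarrow> 'a \<Rightarrow> real" where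
  "gamma_kernel \<Omega> \<beta> p \<delta> x y =
     (if dist y x < \<delta> * qfun (dist_bd \<Omega> x)
      then Cgamma TYPE('a) \<beta> p * dist x y powr (- \<beta>)
             * (\<delta> * qfun (dist_bd \<Omega> x)) powr (- (real DIM('a) + p - \<beta>))
      else 0)"

definition seminorm_p :: "'a::euclidean_space set \<Rightarrow> real \<Rightarrow> real \<Rightarrow> real \<Rightarrow> ('a \<Rightarrow> real) \<Rightarrow> ennreal" where
  "seminorm_p \<Omega> \<beta> p \<delta> u =
     (\<integral>\<^sup>+x. (\<integral>\<^sup>+y. ennreal (gamma_kernel \<Omega> \<beta> p \<delta> x y * \<bar>u y - u x\<bar> powr p) \<partial>lebesgue_on \<Omega>) \<partial>lebesgue_on \<Omega>)"

definition nonlocal_space0 :: "'a::euclidean_space set \<Rightarrow> real \<Rightarrow> real \<Rightarrow> real \<Rightarrow> ('a \<Rightarrow> real) set" where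
  "nonlocal_space0 \<Omega> \<beta> p \<delta> =
     {u. Lp_on p \<Omega> u \<and> seminorm_p \<Omega> \<beta> p \<delta> u < \<infinity> \<and> mean_zero \<Omega> u}"

definition W1p0 :: "real \<Rightarrow> 'a::euclidean_space set \<Rightarrow> ('a \<Rightarrow> real) set" where
  "W1p0 p \<Omega> = {u. W1p p \<Omega> u \<and> mean_zero \<Omega> u}"

definition delta0 :: "real \<Rightarrow> real \<Rightarrow> real" where
  "delta0 \<kappa>0 \<kappa>1 = 1 / (3 * max 1 (max \<kappa>1 (8 * \<kappa>0 ^ 3)))"

definition eta :: "('a \<Rightarrow> real) \<Rightarrow> real \<Rightarrow> 'a \<Rightarrow> real" where
  "eta lam \<delta> x = \<delta> * qfun (lam x)"

definition Kop :: "'a::euclidean_space set \<Rightarrow> ('a \<Rightarrow> real) \<Rightarrow> (real \<Rightarrow> real) \<Rightarrow> real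
                    \<Rightarrow> ('a \<Rightarrow> real) \<Rightarrow> 'a \<Rightarrow> real" where
  "Kop \<Omega> lam \<psi> \<delta> u x =
     (\<integral>y. \<psi> (dist y x / eta lam \<delta> x) / eta lam \<delta> x ^ DIM('a) * u y \<partial>lebesgue_on \<Omega>)"

definition E_nl :: "'a::euclidean_space set \<Rightarrow> real \<Rightarrow> real \<Rightarrow> ('a \<Rightarrow> real) \<Rightarrow> (real \<Rightarrow> real)
                    \<Rightarrow> (real \<Rightarrow> real) \<Rightarrow> (('a \<Rightarrow> real) \<Rightarrow> real) \<Rightarrow> real \<Rightarrow> ('a \<Rightarrow> real) \<Rightarrow> ereal" where
  "E_nl \<Omega> \<beta> p lam \<rho> \<psi> f \<delta> u =
     ereal (1 / p) * enn2ereal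
       (\<integral>\<^sup>+x. (\<integral>\<^sup>+y. ennreal (\<rho> (dist y x / eta lam \<delta> x)
               / (eta lam \<delta> x powr (real DIM('a) + p - \<beta>) * dist x y powr \<beta>)
               * \<bar>u x - u y\<bar> powr p) \<partial>lebesgue_on \<Omega>) \<partial>lebesgue_on \<Omega>)
     - ereal (f (Kop \<Omega> lam \<psi> \<delta> u))"

definition E_loc :: "'a::euclidean_space set \<Rightarrow> real \<Rightarrow> (('a \<Rightarrow> real) \<Rightarrow> real) \<Rightarrow> ('a \<Rightarrow> real) \<Rightarrow> ereal" where
  "E_loc \<Omega> p f u =
     ereal ((1 / p) * (\<integral>x. norm (weak_grad p \<Omega> u x) powr p \<partial>lebesgue_on \<Omega>) - f u)"

definition mesh_of :: "'a::euclidean_space set \<Rightarrow> 'a set set \<Rightarrow> bool" where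
  "mesh_of \<Omega> T \<longleftrightarrow> triangulation T \<and> (\<forall>t\<in>T. int DIM('a) simplex t) \<and> \<Union>T = closure \<Omega>"

definition inradius :: "'a::euclidean_space set \<Rightarrow> real" where
  "inradius t = Sup {r. \<exists>c. ball c r \<subseteq> t}"

definition poly_deg_le :: "nat \<Rightarrow> ('a::euclidean_space \<Rightarrow> real) \<Rightarrow> bool" where
  "poly_deg_le N P \<longleftrightarrow> (\<exists>c :: ('a \<Rightarrow> nat) \<Rightarrow> real.
     P = (\<lambda>x. \<Sum>k\<in>{k. (\<forall>i. i \<notin> Basis \<longrightarrow> k i = 0) \<and> (\<Sum>i\<in>Basis. k i) \<le> N}.
               c k * (\<Prod>i\<in>Basis. (x \<bullet> i) ^ k i)))"

definition fe_space :: "('a::euclidean_space \<Rightarrow> real) set \<Rightarrow> 'a set set \<Rightarrow> nat \<Rightarrow> ('a \<Rightarrow> real) set" where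
  "fe_space V T N = {v \<in> V. (\<forall>t\<in>T. \<exists>P. poly_deg_le N P \<and> (AE x in lebesgue_on t. v x = P x))}"

definition P1_space :: "'a::euclidean_space set \<Rightarrow> 'a set set \<Rightarrow> ('a \<Rightarrow> real) set" where
  "P1_space \<Omega> T = {v. continuous_on (closure \<Omega>) v \<and>
      (\<forall>t\<in>T. \<exists>P. poly_deg_le 1 P \<and> (\<forall>x\<in>t. v x = P x)) \<and> mean_zero \<Omega> v}"

definition is_minimizer :: "(('a \<Rightarrow> real) \<Rightarrow> ereal) \<Rightarrow> ('a \<Rightarrow> real) set \<Rightarrow> ('a \<Rightarrow> real) \<Rightarrow> bool" where
  "is_minimizer E V u \<longleftrightarrow> u \<in> V \<and> (\<forall>v\<in>V. E u \<le> E v)"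

end

theory Submission
  imports Defs "HOL-Probability.Distributions"
begin

text \<open>
  For a fixed mesh all minimizers lie, up to null sets, in the finite dimensional space of piecewise
  polynomials, so it suffices to follow coefficient vectors. Taylor expansion at interior points of the cells
  shows that the inner nonlocal integral of a piecewise polynomial \<open>u\<close> tends to \<open>|\<nabla>u|\<^sup>p\<close>; the
  constant is right because for a homogeneous integrand the normalisation of \<open>\<rho>\<close> can be computed with a Gaussian.
  Fatou's lemma gives the lower bound. If \<open>u\<close> is in \<open>W\<^sup>1\<^sup>,\<^sup>p\<close>, it is Lipschitz along segments inside the
  domain, and dominated convergence gives the matching upper bound.

  The gradient of the mollification \<open>K\<^sub>\<delta> u\<close> is bounded in \<open>L\<^sup>p\<close> by the nonlocal energy. Hence a limit of
  piecewise polynomials with bounded energies lies in \<open>W\<^sup>1\<^sup>,\<^sup>p\<close>, and the load terms converge. If coefficients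
  were unbounded, the normalised ones would converge to a nonzero mean-zero function with vanishing gradient,
  which is impossible on a connected domain. So a subsequence of the coefficients converges, its limit minimizes
  the local energy, and that minimizer is unique by strict convexity.
\<close>

section \<open>Test functions\<close>

text \<open>The obstacle is that, for a weakly singular kernel and fixed \<delta>, a piecewise
  polynomial may jump across faces and still have finite nonlocal energy. Nonlocal discrete
  minimizers therefore need not be Sobolev functions, and jumps have to be excluded in the limit.
  This is the role of the gradient bound for the mollification, whose constant must not depend on
  \<delta> although the width degenerates at the boundary. Uniformity comes from one property: the
  width varies by at most a tenth over its own ball. A second difficulty is that \<rho> is bounded
  below only on a fraction of that ball while the mollifier sees all of it; long-range differences
  are reduced to short-range ones by inserting intermediate points. The same bound on segments
  serves three times: as the dominating function for the energies of a Sobolev competitor, as the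
  proof that this competitor is admissible for the nonlocal problem, and, with constant zero, as the
  rigidity of functions with vanishing gradient. Since the limit of the coefficients is the same for
  every subsequence, convergence along subsequences gives the full limit in \<sigma>.\<close>

lemma borel_measurable_lebesgue_on_borel:
  "f \<in> borel_measurable borel \<Longrightarrow> f \<in> borel_measurable (lebesgue_on U)"
  by (intro measurable_restrict_space1 measurable_completion) simp

text \<open>The classical flat function \<open>exp (- 1 / x)\<close>, extended by zero. The divisor
  \<open>x ^ k\<close> is carried along so that derivatives are again combinations of members of the
  family.\<close>

definition flat_exp :: "nat \<Rightarrow> real \<Rightarrow> real" where
  "flat_exp k x = (if 0 < x then exp (- 1 / x) / x ^ k else 0)"

lemma flat_exp_tendsto_0: "(flat_exp k \<longlongrightarrow> 0) (at_right 0)"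
proof -
  have "((\<lambda>y::real. y ^ k / exp y) \<longlongrightarrow> 0) at_top"
    by (rule tendsto_power_div_exp_0)
  then have "((\<lambda>x::real. inverse x ^ k / exp (inverse x)) \<longlongrightarrow> 0) (at_right 0)"
    by (rule filterlim_compose) (rule filterlim_inverse_at_top_right)
  then show ?thesis
    by (rule Lim_transform_eventually)
       (auto simp: eventually_at_filter flat_exp_def exp_minus field_simps)
qed

lemma flat_exp_DERIV:
  "(flat_exp k has_real_derivative flat_exp (k + 2) x - real k * flat_exp (k + 1) x) (at x)"
proof -
  consider "x < 0" | "x = 0" | "x > 0" by linarith
  then show ?thesis
  proof cases
    case 1
    have "((\<lambda>x. 0) has_real_derivative 0) (at x)" by simp
    then have "(flat_exp k has_real_derivative 0) (at x)"
      by (rule has_field_derivative_transform_within_open[where S = "{..<0}"])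
         (use 1 in \<open>auto simp: flat_exp_def\<close>)
    then show ?thesis using 1 by (simp add: flat_exp_def)
  next
    case 3
    have "((\<lambda>x. exp (- 1 / x) / x ^ k) has_real_derivative
            flat_exp (k + 2) x - real k * flat_exp (k + 1) x) (at x)"
      using 3 by (auto intro!: derivative_eq_intros simp: flat_exp_def field_simps power2_eq_square)
        (metis One_nat_def less_numeral_extra(3) mult.commute not_gr_zero power_minus_mult)
    then show ?thesis
      by (rule has_field_derivative_transform_within_open[where S = "{0<..}"])
         (use 3 in \<open>auto simp: flat_exp_def\<close>)
  next
    case 2
    \<comment> \<open>From the right the difference quotient at 0 is
      \<open>flat_exp (k + 1) h\<close>, which tends to 0; from the left it vanishes.\<close>
    have "((\<lambda>h. flat_exp k h / h) \<longlongrightarrow> 0) (at_right 0)"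
      by (rule Lim_transform_eventually[OF flat_exp_tendsto_0[of "k + 1"]])
         (auto simp: eventually_at_filter flat_exp_def)
    moreover have "((\<lambda>h. flat_exp k h / h) \<longlongrightarrow> 0) (at_left 0)"
      by (rule Lim_transform_eventually[OF tendsto_const[of 0]])
         (auto simp: eventually_at_filter flat_exp_def)
    ultimately have "((\<lambda>h. flat_exp k h / h) \<longlongrightarrow> 0) (at 0)"
      by (simp add: filterlim_split_at)
    then show ?thesis using 2
      by (simp add: DERIV_def flat_exp_def)
  qed
qed

lemma flat_exp_nonneg: "0 \<le> flat_exp k x"
  by (simp add: flat_exp_def)

lemma flat_exp_0_le_1: "flat_exp 0 x \<le> 1"
  by (simp add: flat_exp_def)

text \<open>A class that contains every directional derivative of its members. Existence of all
  iterated partial derivatives then follows by induction on the list of directions, without any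
  formula for them.\<close>

inductive bump_algebra :: "('a::euclidean_space \<Rightarrow> real) \<Rightarrow> bool" where
  base: "bump_algebra (\<lambda>x. flat_exp k (m * (x \<bullet> i) + a))"
| const: "bump_algebra (\<lambda>x. c)"
| add: "bump_algebra f \<Longrightarrow> bump_algebra g \<Longrightarrow> bump_algebra (\<lambda>x. f x + g x)"
| mult: "bump_algebra f \<Longrightarrow> bump_algebra g \<Longrightarrow> bump_algebra (\<lambda>x. f x * g x)"

lemma bump_algebra_prod:
  assumes "\<And>i. i \<in> S \<Longrightarrow> bump_algebra (f i)"
  shows "bump_algebra (\<lambda>x. \<Prod>i\<in>S. f i x)"
  using assms
  by (induction S rule: infinite_finite_induct) (auto intro: bump_algebra.const bump_algebra.mult)

lemma bump_algebra_derivative: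
  assumes "bump_algebra f"
  shows "\<exists>f'. (\<forall>x. (f has_derivative f' x) (at x)) \<and> (\<forall>e. bump_algebra (\<lambda>x. f' x e))"
  using assms
proof induction
  case (base k m i a)
  let ?D = "\<lambda>x h. (flat_exp (k + 2) (m * (x \<bullet> i) + a) - real k * flat_exp (k + 1) (m * (x \<bullet> i) + a)) * (m * (h \<bullet> i))"
  have "((\<lambda>x. flat_exp k (m * (x \<bullet> i) + a)) has_derivative ?D x) (at x)" for x
  proof -
    have "((\<lambda>x. m * (x \<bullet> i) + a) has_derivative (\<lambda>h. m * (h \<bullet> i))) (at x)"
      by (auto intro!: derivative_eq_intros)
    from has_derivative_compose[OF this flat_exp_DERIV[THEN has_field_derivative_imp_has_derivative]]
    show ?thesis by simp
  qed
  moreover have "bump_algebra (\<lambda>x. ?D x e)" for e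
  proof -
    have "bump_algebra (\<lambda>x. (flat_exp (k + 2) (m * (x \<bullet> i) + a)
        + (- real k) * flat_exp (k + 1) (m * (x \<bullet> i) + a)) * (m * (e \<bullet> i)))"
      by (intro bump_algebra.intros)
    then show ?thesis by simp
  qed
  ultimately show ?case by (intro exI[of _ ?D]) simp
next
  case (const c)
  have "((\<lambda>x. c) has_derivative (\<lambda>h. 0)) (at x)" for x :: 'a by simp
  moreover have "bump_algebra (\<lambda>x::'a. 0)" by (rule bump_algebra.const)
  ultimately show ?case by (intro exI[of _ "\<lambda>x h. 0"]) simp
next
  case (add f g)
  then obtain f' g' where fg: "\<And>x. (f has_derivative f' x) (at x)" "\<And>e. bump_algebra (\<lambda>x. f' x e)"
     "\<And>x. (g has_derivative g' x) (at x)" "\<And>e. bump_algebra (\<lambda>x. g' x e)" by blast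
  show ?case
    by (rule exI[of _ "\<lambda>x h. f' x h + g' x h"])
       (auto intro!: has_derivative_add fg bump_algebra.add)
next
  case (mult f g)
  then obtain f' g' where fg: "\<And>x. (f has_derivative f' x) (at x)" "\<And>e. bump_algebra (\<lambda>x. f' x e)"
     "\<And>x. (g has_derivative g' x) (at x)" "\<And>e. bump_algebra (\<lambda>x. g' x e)" by blast
  show ?case
    by (rule exI[of _ "\<lambda>x h. f x * g' x h + f' x h * g x"])
       (auto intro!: has_derivative_mult fg bump_algebra.add bump_algebra.mult mult.hyps)
qed

lemma bump_algebra_smooth:
  assumes "bump_algebra f"
  shows "smooth_in UNIV f"
proof -
  have "bump_algebra (iter_pd es f)" for es
  proof (induction es)
    case Nil then show ?case using assms by simp
  next
    case (Cons e es)
    from bump_algebra_derivative[OF this] obtain f' where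
      f': "\<And>x. (iter_pd es f has_derivative f' x) (at x)" "\<And>e. bump_algebra (\<lambda>x. f' x e)" by blast
    have "frechet_derivative (iter_pd es f) (at x) = f' x" for x
      using f'(1) by (metis frechet_derivative_at)
    then show ?case using f'(2) by simp
  qed
  then show ?thesis
    unfolding smooth_in_def differentiable_def using bump_algebra_derivative by blast
qed

text \<open>Two flat factors per coordinate make the product positive exactly on the open box when
  \<open>m > 0\<close>. The steepness \<open>m\<close> is a parameter because large values
  approximate the indicator of the box, while \<open>m = 1\<close> serves as a fixed profile to be
  moved along a segment.\<close>

definition box_bump :: "real \<Rightarrow> 'a::euclidean_space \<Rightarrow> 'a \<Rightarrow> 'a \<Rightarrow> real" where
  "box_bump m a b x = (\<Prod>i\<in>Basis. flat_exp 0 (m * (x \<bullet> i) + (- m * (a \<bullet> i)))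
                                  * flat_exp 0 (- m * (x \<bullet> i) + m * (b \<bullet> i)))"

lemma box_bump_smooth: "smooth_in UNIV (box_bump m a b)"
  unfolding box_bump_def[abs_def]
  by (intro bump_algebra_smooth bump_algebra_prod bump_algebra.mult bump_algebra.base)

lemma box_bump_nonneg: "0 \<le> box_bump m a b x"
  unfolding box_bump_def by (intro prod_nonneg ballI mult_nonneg_nonneg flat_exp_nonneg)

lemma box_bump_le_1: "box_bump m a b x \<le> 1"
  unfolding box_bump_def
  by (intro prod_le_1 conjI mult_nonneg_nonneg flat_exp_nonneg mult_le_one flat_exp_0_le_1)

lemma box_bump_eq_0:
  assumes "0 < m" "x \<notin> box a b"
  shows "box_bump m a b x = 0"
proof -
  obtain i where i: "i \<in> Basis" "\<not> (a \<bullet> i < x \<bullet> i \<and> x \<bullet> i < b \<bullet> i)"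
    using assms(2) by (auto simp: mem_box)
  have "flat_exp 0 (m * (x \<bullet> i) + (- m * (a \<bullet> i))) * flat_exp 0 (- m * (x \<bullet> i) + m * (b \<bullet> i)) = 0"
    using i(2) assms(1) by (auto simp: flat_exp_def)
  then show ?thesis unfolding box_bump_def using i(1) by (auto intro: prod_zero)
qed

lemma box_bump_pos:
  assumes "0 < m" "x \<in> box a b"
  shows "0 < box_bump m a b x"
  unfolding box_bump_def using assms by (intro prod_pos) (auto simp: flat_exp_def mem_box)

lemma box_bump_translate: "box_bump m (a + v) (b + v) x = box_bump m a b (x - v)"
  by (simp add: box_bump_def algebra_simps)

lemma box_bump_test_fun:
  assumes "0 < m" "cbox a b \<subseteq> U"
  shows "test_fun U (box_bump m a b)"
proof -
  have "{x. box_bump m a b x \<noteq> 0} \<subseteq> cbox a b"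
    using box_bump_eq_0[OF assms(1)] box_subset_cbox by blast
  then have "closure {x. box_bump m a b x \<noteq> 0} \<subseteq> cbox a b"
    by (simp add: closure_minimal closed_cbox)
  then show ?thesis
    unfolding test_fun_def using assms box_bump_smooth
    by (auto simp: compact_eq_bounded_closed intro: bounded_subset[OF bounded_cbox])
qed

lemma box_bump_tendsto_indicator:
  "(\<lambda>n. box_bump (real (Suc n)) a b x) \<longlonglongrightarrow> indicator (box a b) x"
proof (cases "x \<in> box a b")
  case False
  then show ?thesis by (simp add: box_bump_eq_0)
next
  case True
  have lim: "(\<lambda>n. flat_exp 0 (real (Suc n) * s)) \<longlonglongrightarrow> 1" if "s > 0" for s
  proof -
    have "(\<lambda>n. exp (- 1 / s * (1 / real (Suc n)))) \<longlonglongrightarrow> exp (- 1 / s * 0)"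
      by (intro tendsto_intros LIMSEQ_Suc[OF lim_1_over_n])
    moreover have "exp (- 1 / s * (1 / real (Suc n))) = flat_exp 0 (real (Suc n) * s)" for n
      using that by (simp add: flat_exp_def field_simps del: of_nat_Suc)
    ultimately show ?thesis by simp
  qed
  have "(\<lambda>n. \<Prod>i\<in>Basis. flat_exp 0 (real (Suc n) * (x \<bullet> i - a \<bullet> i))
          * flat_exp 0 (real (Suc n) * (b \<bullet> i - x \<bullet> i))) \<longlonglongrightarrow> (\<Prod>i\<in>(Basis::'a set). 1 * 1)"
    using True by (intro tendsto_intros lim) (auto simp: mem_box)
  then show ?thesis using True by (simp add: box_bump_def algebra_simps)
qed

section \<open>Regularity and bounds of test functions\<close>

lemma test_fun_has_derivative:
  assumes "test_fun U \<phi>"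
  shows "(\<phi> has_derivative frechet_derivative \<phi> (at x)) (at x)"
proof -
  have "\<phi> differentiable at x"
    using assms by (auto simp: test_fun_def smooth_in_def dest: spec[of _ "[]"])
  then show ?thesis by (simp add: frechet_derivative_works)
qed

lemma test_fun_continuous: "test_fun U \<phi> \<Longrightarrow> continuous_on S \<phi>"
  by (intro continuous_at_imp_continuous_on ballI has_derivative_continuous[OF test_fun_has_derivative])

lemma test_fun_derivative_continuous:
  assumes "test_fun U \<phi>" "i \<in> Basis"
  shows "continuous_on S (\<lambda>x. frechet_derivative \<phi> (at x) i)"
proof -
  have "iter_pd [i] \<phi> differentiable at x" for x
    using assms unfolding test_fun_def smooth_in_def by (metis UNIV_I empty_iff insert_iff list.set(1) list.simps(15) subsetI)
  then have "(\<lambda>x. frechet_derivative \<phi> (at x) i) differentiable at x" for x by simp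
  then show ?thesis
    by (intro continuous_at_imp_continuous_on ballI differentiable_imp_continuous_within)
qed

lemma test_fun_derivative_support:
  assumes "test_fun U \<phi>" "x \<notin> closure {x. \<phi> x \<noteq> 0}"
  shows "frechet_derivative \<phi> (at x) = (\<lambda>h. 0)"
proof -
  have "((\<lambda>x. 0) has_derivative (\<lambda>h. 0)) (at x)" by simp
  then have "(\<phi> has_derivative (\<lambda>h. 0)) (at x)"
    by (rule has_derivative_transform_within_open[where s = "- closure {x. \<phi> x \<noteq> 0}"])
       (use assms(2) closure_subset[of "{x. \<phi> x \<noteq> 0}"] in \<open>auto\<close>)
  then show ?thesis by (metis frechet_derivative_at)
qed

lemma test_fun_bounded:
  assumes "test_fun U \<phi>"
  obtains B where "0 < B" "\<And>x. \<bar>\<phi> x\<bar> \<le> B" "\<And>x i. i \<in> Basis \<Longrightarrow> \<bar>frechet_derivative \<phi> (at x) i\<bar> \<le> B"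
proof -
  let ?S = "closure {x. \<phi> x \<noteq> 0}"
  have cS: "compact ?S" using assms by (simp add: test_fun_def)
  have bd: "\<exists>B>0. \<forall>x. \<bar>g x\<bar> \<le> B" if "continuous_on ?S g" "\<And>x. x \<notin> ?S \<Longrightarrow> g x = 0" for g :: "'a \<Rightarrow> real"
  proof -
    have "bounded (g ` ?S)" using compact_continuous_image[OF that(1) cS] compact_imp_bounded by blast
    then obtain B where "B > 0" "\<And>x. x \<in> ?S \<Longrightarrow> \<bar>g x\<bar> \<le> B" by (auto simp: bounded_pos)
    then show ?thesis using that(2) by (intro exI[of _ B]) (metis abs_zero less_imp_le)
  qed
  have "\<phi> x = 0" if "x \<notin> ?S" for x using that closure_subset[of "{x. \<phi> x \<noteq> 0}"] by auto
  then obtain B0 where B0: "B0 > 0" "\<And>x. \<bar>\<phi> x\<bar> \<le> B0"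
    using bd[OF test_fun_continuous[OF assms]] by blast
  have "\<forall>i\<in>Basis. \<exists>B>0. \<forall>x. \<bar>frechet_derivative \<phi> (at x) i\<bar> \<le> B"
    using bd[OF test_fun_derivative_continuous[OF assms]] test_fun_derivative_support[OF assms] by simp
  then obtain B where B: "\<And>i. i \<in> Basis \<Longrightarrow> B i > 0"
      "\<And>i x. i \<in> Basis \<Longrightarrow> \<bar>frechet_derivative \<phi> (at x) i\<bar> \<le> B i" by metis
  have "B i \<le> B0 + sum B Basis" if "i \<in> Basis" for i
    using B0(1) member_le_sum[of i Basis B] B(1) that by (fastforce intro: less_imp_le)
  moreover have "0 < B0 + sum B Basis" using B0(1) B(1) by (simp add: add_pos_pos sum_pos)
  moreover have "B0 \<le> B0 + sum B Basis" using B(1) by (simp add: sum_nonneg less_imp_le)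
  ultimately show ?thesis using B0(2) B(2) that by (meson order_trans)
qed

lemma test_fun_mono: "test_fun U \<phi> \<Longrightarrow> U \<subseteq> V \<Longrightarrow> test_fun V \<phi>"
  by (auto simp: test_fun_def)

text \<open>Fundamental lemma of the calculus of variations. Steep bumps turn the hypothesis into
  vanishing integrals of \<open>g\<close> over all boxes in \<open>U\<close>, and Lebesgue
  differentiation along shrinking cubes recovers \<open>g\<close> almost everywhere.\<close>

lemma AE_zero_if_test_fun_integrals_zero:
  fixes g :: "'a::euclidean_space \<Rightarrow> real"
  assumes U: "open U" and g: "integrable (lebesgue_on U) g"
    and z: "\<And>\<phi>. test_fun U \<phi> \<Longrightarrow> (\<integral>x. g x * \<phi> x \<partial>lebesgue_on U) = 0"
  shows "AE x in lebesgue_on U. g x = 0"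
proof -
  let ?G = "\<lambda>x. if x \<in> U then g x else 0"
  have Um[measurable]: "U \<in> sets lebesgue" using U by simp
  have "?G = (\<lambda>x. indicator U x *\<^sub>R g x)" by (auto simp: indicator_def)
  then have Gint: "integrable lebesgue ?G"
    using g Um by (simp add: integrable_restrict_space)
  have box0: "integral (cbox a b) ?G = 0" if ab: "cbox a b \<subseteq> U" for a b
  proof -
    have "(\<lambda>n. \<integral>x. g x * box_bump (real (Suc n)) a b x \<partial>lebesgue_on U) \<longlonglongrightarrow>
            (\<integral>x. g x * indicator (box a b) x \<partial>lebesgue_on U)"
    proof (rule integral_dominated_convergence[where w = "\<lambda>x. \<bar>g x\<bar>"])
      show "(\<lambda>x. g x * indicator (box a b) x) \<in> borel_measurable (lebesgue_on U)"
        using g by (intro borel_measurable_times borel_measurable_lebesgue_on_borel[of "indicator _"]) auto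
      show "(\<lambda>x. g x * box_bump (real (Suc n)) a b x) \<in> borel_measurable (lebesgue_on U)" for n
      proof -
        have "continuous_on UNIV (box_bump (real (Suc n)) a b)"
          by (rule test_fun_continuous, rule box_bump_test_fun[where U=UNIV]) auto
        then show ?thesis using g
          by (intro borel_measurable_times)
             (auto intro!: borel_measurable_lebesgue_on_borel borel_measurable_continuous_onI)
      qed
      show "AE x in lebesgue_on U. norm (g x * box_bump (real (Suc n)) a b x) \<le> \<bar>g x\<bar>" for n
        by (auto simp: abs_mult box_bump_nonneg intro!: mult_left_le box_bump_le_1)
      show "AE x in lebesgue_on U. (\<lambda>n. g x * box_bump (real (Suc n)) a b x) \<longlonglongrightarrow> g x * indicator (box a b) x"
        by (intro AE_I2 tendsto_intros box_bump_tendsto_indicator)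
    qed (use g in auto)
    moreover have "(\<integral>x. g x * box_bump (real (Suc n)) a b x \<partial>lebesgue_on U) = 0" for n
      using z[OF box_bump_test_fun[OF _ ab]] by simp
    ultimately have "(\<integral>x. g x * indicator (box a b) x \<partial>lebesgue_on U) = 0"
      by (simp add: LIMSEQ_const_iff)
    moreover have "(\<integral>x. g x * indicator (box a b) x \<partial>lebesgue_on U) =
       (\<integral>x. ?G x * indicator (box a b) x \<partial>lebesgue)"
      using Um by (subst integral_restrict_space) (auto intro!: Bochner_Integration.integral_cong simp: indicator_def)
    moreover have "\<dots> = (\<integral>x. ?G x \<partial>lebesgue_on (box a b))"
      by (subst integral_restrict_space) (auto intro!: Bochner_Integration.integral_cong simp: indicator_def)
    moreover have "\<dots> = integral (box a b) ?G"
    proof (rule lebesgue_integral_eq_integral)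
      have "integrable lebesgue (\<lambda>x. indicator (box a b) x *\<^sub>R ?G x)"
        using Gint by (intro integrable_mult_indicator) auto
      then show "integrable (lebesgue_on (box a b)) ?G" by (simp add: integrable_restrict_space)
    qed simp
    ultimately show ?thesis by (simp add: integral_open_interval)
  qed
  have Gio: "?G integrable_on cbox a b" for a b
    using integrable_on_lebesgue[OF Gint] by (meson integrable_on_subcbox subset_UNIV)
  obtain N where N: "negligible N"
    "\<And>x e. x \<notin> N \<Longrightarrow> 0 < e \<Longrightarrow> \<exists>d>0. \<forall>h. 0 < h \<and> h < d \<longrightarrow>
         norm (integral (cbox x (x + h *\<^sub>R One)) ?G /\<^sub>R h ^ DIM('a) - ?G x) < e"
    by (rule integrable_ccontinuous_explicit[OF Gio]) (rule that)
  have "g x = 0" if "x \<in> U" "x \<notin> N" for x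
  proof (rule ccontr)
    note xUN = that
    assume "g x \<noteq> 0"
    then obtain d where d: "d > 0" "\<And>h. 0 < h \<Longrightarrow> h < d \<Longrightarrow>
        norm (integral (cbox x (x + h *\<^sub>R One)) ?G /\<^sub>R h ^ DIM('a) - ?G x) < \<bar>g x\<bar>"
      using N(2)[OF xUN(2), of "\<bar>g x\<bar>"] xUN(1) by auto
    obtain r where r: "r > 0" "cball x r \<subseteq> U"
      using U xUN(1) open_contains_cball by blast
    \<comment> \<open>Dividing by the dimension keeps the cube in the ball: its points differ from
      \<open>x\<close> by at most \<open>h\<close> in each coordinate, and the norm is at most the
      coordinate sum.\<close>
    define h where "h = min (d / 2) (r / (DIM('a)))"
    have h: "0 < h" "h < d" "h * DIM('a) \<le> r" using d(1) r(1)
      by (auto simp: h_def min_def field_simps split: if_splits)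
    have "cbox x (x + h *\<^sub>R One) \<subseteq> cball x r"
    proof
      fix y assume y: "y \<in> cbox x (x + h *\<^sub>R One)"
      have "norm (y - x) \<le> (\<Sum>i\<in>Basis. \<bar>(y - x) \<bullet> i\<bar>)" by (rule norm_le_l1)
      also have "\<dots> \<le> (\<Sum>i\<in>(Basis::'a set). h)"
        using y by (intro sum_mono) (fastforce simp: mem_box inner_simps)
      also have "\<dots> \<le> r" using h(3) by (simp add: mult.commute)
      finally show "y \<in> cball x r" by (simp add: dist_norm norm_minus_commute)
    qed
    then have "integral (cbox x (x + h *\<^sub>R One)) ?G = 0" using box0 r(2) by blast
    then show False using d(2)[OF h(1,2)] xUN(1) by simp
  qed
  then have "{x \<in> U. g x \<noteq> 0} \<subseteq> N" by blast
  then have "AE x in lebesgue. x \<in> U \<longrightarrow> g x = 0"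
    using N(1) by (intro AE_I'[of N]) (auto simp: negligible_iff_null_sets)
  then show ?thesis using Um by (simp add: AE_restrict_space_iff)
qed

section \<open>Weak gradients\<close>

lemma nn_integral_lborel_affine:
  fixes t :: "'a::euclidean_space"
  assumes [measurable]: "f \<in> borel_measurable borel" and "c \<noteq> 0"
  shows "(\<integral>\<^sup>+x. f x \<partial>lborel) = ennreal (\<bar>c\<bar> ^ DIM('a)) * (\<integral>\<^sup>+x. f (t + c *\<^sub>R x) \<partial>lborel)"
  by (subst lborel_affine[OF assms(2), of t])
     (simp add: nn_integral_density nn_integral_distr nn_integral_cmult)

lemma integral_lborel_affine:
  fixes t :: "'a::euclidean_space" and f :: "'a \<Rightarrow> real"
  assumes [measurable]: "f \<in> borel_measurable borel" and "c \<noteq> 0"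
  shows "(\<integral>x. f x \<partial>lborel) = \<bar>c\<bar> ^ DIM('a) * (\<integral>x. f (t + c *\<^sub>R x) \<partial>lborel)"
  by (subst lborel_affine[OF assms(2), of t])
     (simp add: integral_density integral_distr)

lemma nn_integral_lebesgue_on:
  assumes "U \<in> sets lebesgue"
  shows "(\<integral>\<^sup>+x. f x \<partial>lebesgue_on U) = (\<integral>\<^sup>+x. f x * indicator U x \<partial>lborel)"
  using assms by (simp add: nn_integral_restrict_space nn_integral_completion)

lemma integral_lebesgue_on_borel:
  fixes f :: "'a::euclidean_space \<Rightarrow> real"
  assumes "f \<in> borel_measurable borel" "U \<in> sets borel"
  shows "(\<integral>x. f x \<partial>lebesgue_on U) = (\<integral>x. indicator U x * f x \<partial>lborel)"
  using assms by (simp add: integral_restrict_space integral_completion)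

lemma DERIV_limit_sequentially:
  assumes "(f has_real_derivative D) (at a)"
  shows "(\<lambda>n. (f (a + 1 / real (Suc n)) - f a) / (1 / real (Suc n))) \<longlonglongrightarrow> D"
proof -
  have "((\<lambda>h. (f (a + h) - f a) / h) \<longlongrightarrow> D) (at 0)" using assms by (simp add: DERIV_def)
  moreover have "filterlim (\<lambda>n. 1 / real (Suc n)) (at 0) sequentially"
    by (intro filterlim_atI LIMSEQ_Suc[OF lim_1_over_n]) auto
  ultimately show ?thesis by (rule filterlim_compose)
qed

text \<open>By translation invariance every difference quotient of \<open>w\<close> has integral
  zero. A bounded derivative makes \<open>w\<close> Lipschitz along \<open>i\<close>, so the
  quotients are dominated and the limit inherits the value zero.\<close>

lemma integral_directional_derivative_eq_0:
  fixes w w' :: "'a::euclidean_space \<Rightarrow> real"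
  assumes [measurable]: "w \<in> borel_measurable borel"
    and supp: "\<And>x. R < norm x \<Longrightarrow> w x = 0"
    and der: "\<And>x. ((\<lambda>t. w (x + t *\<^sub>R i)) has_real_derivative w' x) (at 0)"
    and wbd: "\<And>x. \<bar>w x\<bar> \<le> B" and bd: "\<And>x. \<bar>w' x\<bar> \<le> B"
  shows "integrable lborel w'" "(\<integral>x. w' x \<partial>lborel) = 0"
proof -
  have der': "((\<lambda>t. w (x + t *\<^sub>R i)) has_real_derivative w' (x + s *\<^sub>R i)) (at s)" for x s
  proof -
    have "((\<lambda>t. w ((x + s *\<^sub>R i) + (t - s) *\<^sub>R i)) has_real_derivative w' (x + s *\<^sub>R i) * 1) (at s)"
      by (rule DERIV_chain2[where g = "\<lambda>t. t - s"]) (use der in \<open>auto intro!: derivative_eq_intros\<close>)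
    then show ?thesis by (simp add: algebra_simps)
  qed
  have lip: "\<bar>w (x + t *\<^sub>R i) - w x\<bar> \<le> B * \<bar>t\<bar>" for x t
  proof -
    have "norm (w (x + t *\<^sub>R i) - w (x + 0 *\<^sub>R i)) \<le> B * norm (t - 0)"
      by (rule field_differentiable_bound[where S = UNIV and f' = "\<lambda>s. w' (x + s *\<^sub>R i)"])
         (use der' bd in auto)
    then show ?thesis by simp
  qed
  have ball_int: "integrable lborel (\<lambda>x. C * indicator (cball (0::'a) r) x)" for C r :: real
    using emeasure_lborel_cball_finite by (intro integrable_mult_right integrable_real_indicator) auto
  have wint: "integrable lborel w"
  proof (rule Bochner_Integration.integrable_bound[OF ball_int[of B R]])
    show "AE x in lborel. norm (w x) \<le> norm (B * indicator (cball 0 R) x)"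
      using wbd supp by (intro AE_I2) (force simp: indicator_def intro: order_trans)
  qed simp
  let ?q = "\<lambda>n x. (w (x + (1 / real (Suc n)) *\<^sub>R i) - w x) / (1 / real (Suc n))"
  have lim: "(\<lambda>n. ?q n x) \<longlonglongrightarrow> w' x" for x
    using DERIV_limit_sequentially[OF der[of x]] by simp
  have [measurable]: "w' \<in> borel_measurable borel"
    by (rule borel_measurable_LIMSEQ_real[OF lim]) simp
  \<comment> \<open>The steps \<open>1 / Suc n\<close> are at most 1, so all quotients vanish
    outside one ball of radius \<open>R + norm i\<close>.\<close>
  have qbd: "\<bar>?q n x\<bar> \<le> B * indicator (cball 0 (R + norm i)) x" for n x
    proof (cases "norm x > R + norm i")
      case True
      have "norm ((1 / real (Suc n)) *\<^sub>R i) \<le> norm i"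
        by (simp add: field_simps)
      moreover have "norm x - norm ((1 / real (Suc n)) *\<^sub>R i) \<le> norm (x + (1 / real (Suc n)) *\<^sub>R i)"
        using norm_triangle_ineq4[of "x + (1 / real (Suc n)) *\<^sub>R i" "(1 / real (Suc n)) *\<^sub>R i"] by simp
      moreover have "0 \<le> norm i" by simp
      ultimately have "w (x + (1 / real (Suc n)) *\<^sub>R i) = 0" "w x = 0" using True by (intro supp; linarith)+
      then show ?thesis using True by simp
    next
      case False
      have "\<bar>?q n x\<bar> \<le> B"
        using lip[of x "1 / real (Suc n)"] unfolding abs_divide
        by (subst pos_divide_le_eq) (auto simp del: of_nat_Suc)
      then show ?thesis using False by (simp add: indicator_def)
    qed
  show "integrable lborel w'"
    by (rule integrable_dominated_convergence[OF _ _ ball_int[of B "R + norm i"], where s = ?q])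
       (use lim qbd in auto)
  have conv: "(\<lambda>n. \<integral>x. ?q n x \<partial>lborel) \<longlonglongrightarrow> (\<integral>x. w' x \<partial>lborel)"
    by (rule integral_dominated_convergence[OF _ _ ball_int[of B "R + norm i"]])
       (use lim qbd in auto)
  have "(\<integral>x. ?q n x \<partial>lborel) = 0" for n
  proof -
    define c where "c = (1 / real (Suc n)) *\<^sub>R i"
    have "integrable lborel (\<lambda>x. w (c + x))"
      using wint by (subst (asm) lborel_distr_plus[of c, symmetric]) (simp add: integrable_distr_eq)
    moreover have "(\<integral>x. w (c + x) \<partial>lborel) = (\<integral>x. w x \<partial>lborel)"
      by (subst (2) lborel_distr_plus[of c, symmetric]) (simp add: integral_distr)
    ultimately show ?thesis using wint
      unfolding c_def[symmetric] add.commute[of _ c] by simp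
  qed
  then show "(\<integral>x. w' x \<partial>lborel) = 0"
    using conv by (simp add: LIMSEQ_const_iff)
qed

section \<open>Uniqueness of weak gradients and change of representatives\<close>

lemma Lp_on_integrable:
  assumes "U \<in> lmeasurable" "1 \<le> p" "Lp_on p U u"
  shows "integrable (lebesgue_on U) u"
proof (rule Bochner_Integration.integrable_bound[where f = "\<lambda>x. 1 + \<bar>u x\<bar> powr p"])
  interpret finite_measure "lebesgue_on U" by (rule finite_measure_lebesgue_on[OF assms(1)])
  show "integrable (lebesgue_on U) (\<lambda>x. 1 + \<bar>u x\<bar> powr p)"
    using assms(3) by (simp add: Lp_on_def)
  have "\<bar>t\<bar> \<le> 1 + \<bar>t\<bar> powr p" for t :: real
  proof (cases "\<bar>t\<bar> \<le> 1")
    case False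
    then have "\<bar>t\<bar> powr 1 \<le> \<bar>t\<bar> powr p" using assms(2) by (intro powr_mono) auto
    then show ?thesis using False by simp
  qed (use powr_ge_zero[of "\<bar>t\<bar>" p] in linarith)
  then show "AE x in lebesgue_on U. norm (u x) \<le> norm (1 + \<bar>u x\<bar> powr p)"
    by (auto simp: abs_of_nonneg add_nonneg_nonneg)
qed (use assms in \<open>simp add: Lp_on_def\<close>)

lemma weak_grad_AE_unique:
  fixes U :: "'a::euclidean_space set"
  assumes U: "open U" and GH: "is_weak_grad U u G" "is_weak_grad U u H"
    and int: "integrable (lebesgue_on U) (\<lambda>x. norm (G x))" "integrable (lebesgue_on U) (\<lambda>x. norm (H x))"
  shows "AE x in lebesgue_on U. G x = H x"
proof -
  have [measurable]: "G \<in> borel_measurable (lebesgue_on U)" "H \<in> borel_measurable (lebesgue_on U)"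
    using GH by (auto simp: is_weak_grad_def)
  have intc: "integrable (lebesgue_on U) (\<lambda>x. F x \<bullet> i)"
    if [measurable]: "F \<in> borel_measurable (lebesgue_on U)" and "integrable (lebesgue_on U) (\<lambda>x. norm (F x))" "i \<in> Basis"
    for F :: "'a \<Rightarrow> 'a" and i
    by (rule Bochner_Integration.integrable_bound[OF that(2)])
       (use Basis_le_norm[OF that(3)] in auto)
  have "AE x in lebesgue_on U. (G x - H x) \<bullet> i = 0" if i: "i \<in> Basis" for i
  proof (rule AE_zero_if_test_fun_integrals_zero[OF U])
    show "integrable (lebesgue_on U) (\<lambda>x. (G x - H x) \<bullet> i)"
      using intc[OF _ int(1) i] intc[OF _ int(2) i] by (simp add: inner_diff_left)
    fix \<phi> assume phi: "test_fun U \<phi>"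
    obtain B where B: "\<And>x. \<bar>\<phi> x\<bar> \<le> B" using test_fun_bounded[OF phi] by metis
    have [measurable]: "\<phi> \<in> borel_measurable (lebesgue_on U)"
      by (intro borel_measurable_lebesgue_on_borel borel_measurable_continuous_onI test_fun_continuous[OF phi])
    have prodint: "integrable (lebesgue_on U) (\<lambda>x. (F x \<bullet> i) * \<phi> x)"
      if "integrable (lebesgue_on U) (\<lambda>x. F x \<bullet> i)" for F :: "'a \<Rightarrow> 'a"
    proof (rule Bochner_Integration.integrable_bound[OF integrable_mult_left[OF that, of B]])
      show "AE x in lebesgue_on U. norm ((F x \<bullet> i) * \<phi> x) \<le> norm ((F x \<bullet> i) * B)"
        using B by (auto simp: abs_mult intro!: mult_left_mono order_trans[OF B])
    qed (use that in auto)
    have "(\<integral>x. (G x \<bullet> i) * \<phi> x \<partial>lebesgue_on U) = (\<integral>x. (H x \<bullet> i) * \<phi> x \<partial>lebesgue_on U)"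
    proof -
      have "(\<integral>x. u x * frechet_derivative \<phi> (at x) i \<partial>lebesgue_on U) = - (\<integral>x. (F x \<bullet> i) * \<phi> x \<partial>lebesgue_on U)"
        if "is_weak_grad U u F" for F using that phi i by (simp add: is_weak_grad_def)
      from this[OF GH(1)] this[OF GH(2)] show ?thesis by simp
    qed
    then show "(\<integral>x. (G x - H x) \<bullet> i * \<phi> x \<partial>lebesgue_on U) = 0"
      using prodint[OF intc[OF _ int(1) i]] prodint[OF intc[OF _ int(2) i]]
      unfolding inner_diff_left left_diff_distrib by (subst Bochner_Integration.integral_diff) simp_all
  qed
  then have "AE x in lebesgue_on U. \<forall>i\<in>Basis. (G x - H x) \<bullet> i = 0"
    by (intro AE_finite_allI) auto
  then show ?thesis by eventually_elim (simp add: euclidean_eq_iff[of "G _"] inner_diff_left)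
qed

lemma W1p_weak_grad:
  assumes "W1p p U u"
  shows "is_weak_grad U u (weak_grad p U u)" "Lp_on p U (\<lambda>x. norm (weak_grad p U u x))"
proof -
  have "\<exists>G. is_weak_grad U u G \<and> Lp_on p U (\<lambda>x. norm (G x))" using assms by (simp add: W1p_def)
  from someI_ex[OF this]
  show "is_weak_grad U u (weak_grad p U u)" "Lp_on p U (\<lambda>x. norm (weak_grad p U u x))"
    by (simp_all add: weak_grad_def)
qed

lemma W1pI: "Lp_on p U u \<Longrightarrow> is_weak_grad U u G \<Longrightarrow> Lp_on p U (\<lambda>x. norm (G x)) \<Longrightarrow> W1p p U u"
  by (auto simp: W1p_def)

lemma weak_grad_AE_eq:
  assumes "open U" "U \<in> lmeasurable" "1 \<le> p"
    and "Lp_on p U u" "is_weak_grad U u G" "Lp_on p U (\<lambda>x. norm (G x))"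
  shows "AE x in lebesgue_on U. weak_grad p U u x = G x"
  using W1p_weak_grad[OF W1pI[OF assms(4-6)]] assms
  by (intro weak_grad_AE_unique Lp_on_integrable) auto

text \<open>Replaces the choice made in \<open>weak_grad\<close> by any concrete weak gradient; this
  is what makes \<open>W1p_norm\<close> and \<open>E_loc\<close> computable.\<close>

lemma integral_weak_grad_eq:
  assumes "open U" "U \<in> lmeasurable" "1 \<le> p"
    and "Lp_on p U u" "is_weak_grad U u G" "Lp_on p U (\<lambda>x. norm (G x))"
  shows "(\<integral>x. norm (weak_grad p U u x) powr p \<partial>lebesgue_on U) = (\<integral>x. norm (G x) powr p \<partial>lebesgue_on U)"
proof (rule integral_cong_AE)
  show "AE x in lebesgue_on U. norm (weak_grad p U u x) powr p = norm (G x) powr p"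
    using weak_grad_AE_eq[OF assms] by eventually_elim simp
qed (use assms W1p_weak_grad[OF W1pI[OF assms(4-6)]] in \<open>auto simp: Lp_on_def is_weak_grad_def\<close>)

lemma is_weak_grad_cong_AE:
  assumes "AE x in lebesgue_on U. u x = v x" "u \<in> borel_measurable (lebesgue_on U)"
    "v \<in> borel_measurable (lebesgue_on U)" "is_weak_grad U u G"
  shows "is_weak_grad U v G"
  unfolding is_weak_grad_def
proof (intro conjI allI impI ballI)
  show "G \<in> borel_measurable (lebesgue_on U)" using assms(4) by (simp add: is_weak_grad_def)
  fix \<phi> and i :: 'a assume phi: "test_fun U \<phi>" and i: "i \<in> Basis"
  have [measurable]: "(\<lambda>x. frechet_derivative \<phi> (at x) i) \<in> borel_measurable (lebesgue_on U)"
    by (intro borel_measurable_lebesgue_on_borel borel_measurable_continuous_onI test_fun_derivative_continuous[OF phi i])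
  have "(\<integral>x. v x * frechet_derivative \<phi> (at x) i \<partial>lebesgue_on U) =
        (\<integral>x. u x * frechet_derivative \<phi> (at x) i \<partial>lebesgue_on U)"
    using assms(1-3) by (intro integral_cong_AE borel_measurable_times) auto
  then show "(\<integral>x. v x * frechet_derivative \<phi> (at x) i \<partial>lebesgue_on U) = - (\<integral>x. (G x \<bullet> i) * \<phi> x \<partial>lebesgue_on U)"
    using assms(4) phi i by (simp add: is_weak_grad_def)
qed

lemma Lp_on_cong_AE:
  assumes "AE x in lebesgue_on U. u x = v x" "v \<in> borel_measurable (lebesgue_on U)" "Lp_on p U u"
  shows "Lp_on p U v"
  unfolding Lp_on_def
proof (intro conjI)
  show "integrable (lebesgue_on U) (\<lambda>x. \<bar>v x\<bar> powr p)"
    by (rule integrable_cong_AE_imp[of _ "\<lambda>x. \<bar>u x\<bar> powr p"])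
       (use assms in \<open>auto simp: Lp_on_def\<close>)
qed (rule assms(2))

text \<open>Away from the closed support of the test function the product is locally zero, so the
  derivative is only needed inside the open set and the extension by zero stays differentiable.\<close>

lemma directional_integration_by_parts:
  fixes U :: "'a::euclidean_space set"
  assumes U: "open U" and V: "open V" "V \<subseteq> U" and [measurable]: "v \<in> borel_measurable borel"
    and phi: "test_fun V \<phi>" and i: "i \<in> Basis"
    and der: "\<And>x. x \<in> V \<Longrightarrow> ((\<lambda>t. v (x + t *\<^sub>R i)) has_real_derivative v' x) (at 0)"
    and bd: "\<And>C. compact C \<Longrightarrow> C \<subseteq> V \<Longrightarrow> \<exists>B. \<forall>x\<in>C. \<bar>v x\<bar> \<le> B \<and> \<bar>v' x\<bar> \<le> B"
    and v'm[measurable]: "v' \<in> borel_measurable borel"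
  shows "(\<integral>x. v x * frechet_derivative \<phi> (at x) i \<partial>lebesgue_on U) = - (\<integral>x. v' x * \<phi> x \<partial>lebesgue_on U)"
proof -
  let ?S = "closure {x. \<phi> x \<noteq> 0}"
  let ?D = "\<lambda>x. frechet_derivative \<phi> (at x) i"
  have S: "compact ?S" "?S \<subseteq> V" using phi by (auto simp: test_fun_def)
  obtain B0 where B0: "\<And>x. x \<in> ?S \<Longrightarrow> \<bar>v x\<bar> \<le> B0" "\<And>x. x \<in> ?S \<Longrightarrow> \<bar>v' x\<bar> \<le> B0" using bd[OF S] by blast
  obtain B1 where B1: "0 < B1" "\<And>x. \<bar>\<phi> x\<bar> \<le> B1" "\<And>x. \<bar>?D x\<bar> \<le> B1"
    using test_fun_bounded[OF phi] i by metis
  obtain R where R: "\<And>x. x \<in> ?S \<Longrightarrow> norm x \<le> R" using compact_imp_bounded[OF S(1)] bounded_iff by blast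
  have phi0: "\<phi> x = 0" "?D x = 0" if "x \<notin> ?S" for x
    using that test_fun_derivative_support[OF phi that] closure_subset[of "{x. \<phi> x \<noteq> 0}"] by auto
  have [measurable]: "\<phi> \<in> borel_measurable borel" "?D \<in> borel_measurable borel"
    by (intro borel_measurable_continuous_onI test_fun_continuous[OF phi] test_fun_derivative_continuous[OF phi i])+
  let ?w = "\<lambda>x. v x * \<phi> x" and ?w' = "\<lambda>x. v x * ?D x + v' x * \<phi> x"
  define K where "K = \<bar>B0\<bar> * B1"
  let ?B = "K + K"
  have Bn: "0 \<le> K" using B1(1) by (simp add: K_def)
  have p1: "\<bar>v x * g\<bar> \<le> K" "\<bar>v' x * g\<bar> \<le> K" if "x \<in> ?S" "\<bar>g\<bar> \<le> B1" for x g
    using B0[OF that(1)] that(2) unfolding abs_mult K_def by (intro mult_mono; linarith)+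
  have dphi: "((\<lambda>t. \<phi> (x + t *\<^sub>R i)) has_real_derivative ?D x) (at 0)" for x
  proof -
    have "((\<lambda>t. x + t *\<^sub>R i) has_derivative (\<lambda>t. t *\<^sub>R i)) (at 0)"
      by (auto intro!: derivative_eq_intros)
    from has_derivative_compose[OF this, of \<phi> "frechet_derivative \<phi> (at x)"]
    have "((\<lambda>t. \<phi> (x + t *\<^sub>R i)) has_derivative (\<lambda>t. frechet_derivative \<phi> (at x) (t *\<^sub>R i))) (at 0)"
      using test_fun_has_derivative[OF phi, of x] by simp
    moreover have "frechet_derivative \<phi> (at x) (t *\<^sub>R i) = ?D x * t" for t
      using has_derivative_linear[OF test_fun_has_derivative[OF phi, of x]] by (simp add: linear_cmul)
    ultimately show ?thesis by (simp add: has_field_derivative_def)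
  qed
  have der_w: "((\<lambda>t. ?w (x + t *\<^sub>R i)) has_real_derivative ?w' x) (at 0)" for x
  proof (cases "x \<in> V")
    case True
    show ?thesis
      using DERIV_mult[OF der[OF True] dphi[of x]] by (simp add: algebra_simps)
  next
    case False
    then have xS: "x \<notin> ?S" using S(2) by blast
    have "open ((\<lambda>t. x + t *\<^sub>R i) -` (- ?S))"
      by (intro open_vimage continuous_intros) auto
    moreover have "((\<lambda>t. 0) has_real_derivative 0) (at 0)" by simp
    moreover have "0 \<in> (\<lambda>t. x + t *\<^sub>R i) -` (- ?S)" using xS by simp
    moreover have "0 = ?w (x + t *\<^sub>R i)" if "t \<in> (\<lambda>t. x + t *\<^sub>R i) -` (- ?S)" for t
      using that phi0(1)[of "x + t *\<^sub>R i"] by simp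
    ultimately have "((\<lambda>t. ?w (x + t *\<^sub>R i)) has_real_derivative 0) (at 0)"
      by (metis (no_types, lifting) has_field_derivative_transform_within_open)
    then show ?thesis using phi0[OF xS] by simp
  qed
  have res: "integrable lborel ?w'" "(\<integral>x. ?w' x \<partial>lborel) = 0"
  proof (rule_tac [!] integral_directional_derivative_eq_0[where w = ?w and R = R and i = i and B = ?B, OF _ _ der_w])
    fix x
    show "R < norm x \<Longrightarrow> ?w x = 0" "R < norm x \<Longrightarrow> ?w x = 0" using phi0(1)[of x] R[of x] by auto
    have "\<bar>?w x\<bar> \<le> ?B"
      using p1(1)[OF _ B1(2), of x x] phi0(1)[of x] Bn by (cases "x \<in> ?S") fastforce+
    then show "\<bar>?w x\<bar> \<le> ?B" "\<bar>?w x\<bar> \<le> ?B" by auto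
    have "\<bar>?w' x\<bar> \<le> ?B"
      using p1(1)[OF _ B1(3), of x x] p1(2)[OF _ B1(2), of x x] phi0[of x] Bn by (cases "x \<in> ?S") fastforce+
    then show "\<bar>?w' x\<bar> \<le> ?B" "\<bar>?w' x\<bar> \<le> ?B" by auto
  qed simp_all
  have Sfin: "integrable lborel (\<lambda>x. (K) * indicator ?S x)"
    using emeasure_compact_finite[OF S(1)] S(1)
    by (intro integrable_mult_right integrable_real_indicator) (auto simp: compact_imp_closed)
  have "norm (v x * ?D x) \<le> norm (K * indicator ?S x)" "norm (v' x * \<phi> x) \<le> norm (K * indicator ?S x)" for x
    using p1(1)[OF _ B1(3), of x x] p1(2)[OF _ B1(2), of x x] phi0[of x] Bn by (cases "x \<in> ?S"; simp)+
  then have i1: "integrable lborel (\<lambda>x. v x * ?D x)" and i2: "integrable lborel (\<lambda>x. v' x * \<phi> x)"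
    by (intro Bochner_Integration.integrable_bound[OF Sfin]; simp)+
  have eq: "(\<integral>x. v x * ?D x \<partial>lborel) + (\<integral>x. v' x * \<phi> x \<partial>lborel) = 0"
    using res(2) i1 i2 by simp
  have on_U: "(\<integral>x. h x * g x \<partial>lebesgue_on U) = (\<integral>x. h x * g x \<partial>lborel)"
    if [measurable]: "h \<in> borel_measurable borel" "g \<in> borel_measurable borel"
      and "\<And>x. x \<notin> ?S \<Longrightarrow> g x = 0" for h g :: "'a \<Rightarrow> real"
  proof -
    have "indicator U x * (h x * g x) = h x * g x" for x
      using that(3)[of x] S(2) V(2) by (auto simp: indicator_def)
    then have "(\<lambda>x. indicator U x * (h x * g x)) = (\<lambda>x. h x * g x)" by blast
    then show ?thesis using U by (subst integral_lebesgue_on_borel) simp_all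
  qed
  have "(\<integral>x. v x * ?D x \<partial>lebesgue_on U) = (\<integral>x. v x * ?D x \<partial>lborel)"
       "(\<integral>x. v' x * \<phi> x \<partial>lebesgue_on U) = (\<integral>x. v' x * \<phi> x \<partial>lborel)"
    by (rule on_U[of v ?D], simp, simp, rule phi0, simp)
       (rule on_U[of v' \<phi>], simp, simp, rule phi0, simp)
  with eq show ?thesis by linarith
qed

section \<open>Directional moments of radial kernels\<close>

lemma nn_integral_powr_Icc_0:
  assumes "0 < e" "0 \<le> r"
  shows "(\<integral>\<^sup>+s. ennreal (e * s powr (e - 1)) * indicator {0..r} s \<partial>lborel) = ennreal (r powr e)"
proof -
  have "((\<lambda>s. s powr (e - 1)) has_integral (r powr e / e)) {0..r}"
    using has_integral_powr_from_0[of "e - 1" r] assms by simp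
  then have "((\<lambda>s. e * s powr (e - 1)) has_integral (e * (r powr e / e))) {0..r}"
    by (rule has_integral_mult_right)
  then have "((\<lambda>s. e * s powr (e - 1)) has_integral (r powr e)) {0..r}"
    using assms by simp
  from nn_integral_has_integral_lebesgue'[OF _ this] show ?thesis
    using assms by simp
qed

text \<open>The image of the measure with density \<open>F\<close> under the squared norm is
  determined by its distribution function. The substitution \<open>x = sqrt r z\<close> and
  homogeneity give \<open>a r^e\<close> with \<open>e = (d + q) / 2\<close>, which is also the
  distribution function of the density \<open>a e s^(e-1)\<close>. The two measures agree on
  half-lines, hence everywhere.\<close>

lemma nn_integral_homogeneous_norm_square:
  fixes F :: "'a::euclidean_space \<Rightarrow> real"
  assumes [measurable]: "F \<in> borel_measurable borel" and F0: "\<And>x. 0 \<le> F x"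
    and hom: "\<And>t x. 0 < t \<Longrightarrow> F (t *\<^sub>R x) = t powr q * F x"
    and e: "e = (real DIM('a) + q) / 2" "0 < e"
    and a: "(\<integral>\<^sup>+x. ennreal (F x) * indicator (cball 0 1) x \<partial>lborel) = ennreal a" "0 \<le> a"
    and [measurable]: "\<phi> \<in> borel_measurable borel"
  shows "(\<integral>\<^sup>+x. \<phi> ((norm x)\<^sup>2) * ennreal (F x) \<partial>lborel)
       = ennreal a * (\<integral>\<^sup>+s. \<phi> s * (ennreal (e * s powr (e - 1)) * indicator {0..} s) \<partial>lborel)"
proof -
  have [measurable]: "cball (0::'a) 1 \<in> sets borel" by simp
  let ?g = "\<lambda>s. ennreal a * (ennreal (e * s powr (e - 1)) * indicator {0..} s)"
  let ?M = "distr (density lborel (\<lambda>x. ennreal (F x))) borel (\<lambda>x. (norm x)\<^sup>2)"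
  let ?N = "density lborel ?g"
  have emM: "emeasure ?M {..r} = (if 0 \<le> r then ennreal (a * r powr e) else 0)" for r
  proof -
    have "emeasure ?M {..r} = (\<integral>\<^sup>+x. ennreal (F x) * indicator {x. (norm x)\<^sup>2 \<le> r} x \<partial>lborel)"
    proof -
      have *: "(\<lambda>x::'a. (norm x)\<^sup>2) -` {..r} = {x. (norm x)\<^sup>2 \<le> r}" by auto
      have "{x::'a. (norm x)\<^sup>2 \<le> r} \<in> sets borel" by measurable
      then show ?thesis
        by (subst emeasure_distr) (simp_all add: emeasure_density *)
    qed
    also have "\<dots> = (if 0 \<le> r then ennreal (a * r powr e) else 0)"
    proof (cases "0 < r")
      case True
      let ?t = "sqrt r"
      have "(\<integral>\<^sup>+x. ennreal (F x) * indicator {x. (norm x)\<^sup>2 \<le> r} x \<partial>lborel) =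
          ennreal (\<bar>?t\<bar> ^ DIM('a)) * (\<integral>\<^sup>+x. ennreal (F (0 + ?t *\<^sub>R x)) * indicator {x. (norm x)\<^sup>2 \<le> r} (0 + ?t *\<^sub>R x) \<partial>lborel)"
        using True by (intro nn_integral_lborel_affine[where t = 0]) auto
      also have "(\<lambda>x. ennreal (F (0 + ?t *\<^sub>R x)) * indicator {x. (norm x)\<^sup>2 \<le> r} (0 + ?t *\<^sub>R x)) =
          (\<lambda>x. ennreal (?t powr q) * (ennreal (F x) * indicator (cball 0 1) x))"
      proof
        fix x :: 'a
        have "(norm (?t *\<^sub>R x))\<^sup>2 \<le> r \<longleftrightarrow> norm x \<le> 1"
          using True power2_le_iff_abs_le[of "1::real" "norm x"] by (simp add: power_mult_distrib)
        then show "ennreal (F (0 + ?t *\<^sub>R x)) * indicator {x. (norm x)\<^sup>2 \<le> r} (0 + ?t *\<^sub>R x) =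
          ennreal (?t powr q) * (ennreal (F x) * indicator (cball 0 1) x)"
          using hom[of ?t x] True by (simp add: ennreal_mult indicator_def F0)
      qed
      also have "(\<integral>\<^sup>+x. ennreal (?t powr q) * (ennreal (F x) * indicator (cball 0 1) x) \<partial>lborel) = ennreal (?t powr q) * ennreal a"
        by (subst nn_integral_cmult, measurable) (rule arg_cong[OF a(1)])
      also have "ennreal (\<bar>?t\<bar> ^ DIM('a)) * (ennreal (?t powr q) * ennreal a) = ennreal (a * r powr e)"
      proof -
        have "\<bar>?t\<bar> ^ DIM('a) * (?t powr q) = ?t powr (real DIM('a) + q)"
          using True by (simp add: powr_add powr_realpow)
        also have "\<dots> = r powr e"
          using True by (simp add: powr_half_sqrt[symmetric] powr_powr e)
        finally show ?thesis
          using a(2) by (simp add: ennreal_mult[symmetric] mult_ac)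
      qed
      finally show ?thesis using True by simp
    next
      case False
      \<comment> \<open>For \<open>r \<le> 0\<close> the set contains at most the origin, which is a
        null set.\<close>
      have "AE x in lborel. ennreal (F x) * indicator {x. (norm x)\<^sup>2 \<le> r} x = 0"
      proof -
        have "AE x in lborel. x \<noteq> (0::'a)" by (rule AE_lborel_singleton)
        then show ?thesis
        proof eventually_elim
          case (elim x)
          then have "0 < (norm x)\<^sup>2" by simp
          then have "\<not> (norm x)\<^sup>2 \<le> r" using False by linarith
          then show ?case by simp
        qed
      qed
      moreover have "{x::'a. (norm x)\<^sup>2 \<le> r} \<in> sets borel" by measurable
      ultimately have "(\<integral>\<^sup>+x. ennreal (F x) * indicator {x. (norm x)\<^sup>2 \<le> r} x \<partial>lborel) = 0"
        by (subst nn_integral_0_iff_AE) simp_all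
      moreover have "r = 0 \<Longrightarrow> a * r powr e = 0" using e by simp
      ultimately show ?thesis using False by (cases "r = 0") simp_all
    qed
    finally show ?thesis .
  qed
  have emN: "emeasure ?N {..r} = (if 0 \<le> r then ennreal (a * r powr e) else 0)" for r
  proof -
    have "emeasure ?N {..r} = (\<integral>\<^sup>+s. ennreal a * (ennreal (e * s powr (e - 1)) * indicator {0..r} s) \<partial>lborel)"
      by (subst emeasure_density) (auto intro!: nn_integral_cong simp: indicator_def)
    also have "\<dots> = ennreal a * (\<integral>\<^sup>+s. (ennreal (e * s powr (e - 1)) * indicator {0..r} s) \<partial>lborel)"
      by (subst nn_integral_cmult) auto
    finally show ?thesis
      using nn_integral_powr_Icc_0[OF e(2), of r] a(2) by (simp add: ennreal_mult)
  qed
  have "?M = ?N"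
  proof (rule measure_eqI_generator_eq[where E = "range atMost" and \<Omega> = UNIV and A = "\<lambda>n. {..real n}"])
    show "Int_stable (range (atMost :: real \<Rightarrow> real set))"
      by (auto simp: Int_stable_def min_def intro!: exI[of _ "min _ _"])
    show "sets ?M = sigma_sets UNIV (range atMost)" "sets ?N = sigma_sets UNIV (range atMost)"
    proof -
      have "sets (borel::real measure) = sigma_sets UNIV (range atMost)" by (subst borel_eq_atMost) simp
      then show "sets ?M = sigma_sets UNIV (range atMost)" "sets ?N = sigma_sets UNIV (range atMost)" by simp_all
    qed
    show "(\<Union>n. {..real n}) = UNIV" using real_arch_simple by auto
  qed (use emM emN in auto)
  then have "(\<integral>\<^sup>+s. \<phi> s \<partial>?M) = (\<integral>\<^sup>+s. \<phi> s \<partial>?N)" by simp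
  moreover have "(\<integral>\<^sup>+s. \<phi> s \<partial>?M) = (\<integral>\<^sup>+x. \<phi> ((norm x)\<^sup>2) * ennreal (F x) \<partial>lborel)"
    by (simp add: nn_integral_distr nn_integral_density mult.commute)
  moreover have "(\<integral>\<^sup>+s. \<phi> s \<partial>?N) = ennreal a * (\<integral>\<^sup>+s. \<phi> s * (ennreal (e * s powr (e - 1)) * indicator {0..} s) \<partial>lborel)"
    by (subst nn_integral_density) (simp_all add: nn_integral_cmult[symmetric] mult_ac)
  ultimately show ?thesis by simp
qed

section \<open>Gaussian integrals of linear forms\<close>

lemma nn_integral_exp_powr:
  assumes "0 < e" and that: "0 \<le> c"
  shows "(\<integral>\<^sup>+s. ennreal (exp (- s)) * (ennreal (c * s powr (e - 1)) * indicator {0..} s) \<partial>lborel) = ennreal (c * Gamma e)"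
proof -
  have "(\<integral>\<^sup>+s. ennreal (exp (- s)) * (ennreal (c * s powr (e - 1)) * indicator {0..} s) \<partial>lborel) =
      (\<integral>\<^sup>+s. ennreal c * (ennreal (s powr (e - 1) / exp s) * indicator {0..} s) \<partial>lborel)"
    using that by (intro nn_integral_cong) (simp add: indicator_def ennreal_mult[symmetric] exp_minus field_simps)
  also have "\<dots> = ennreal c * (\<integral>\<^sup>+s. ennreal (s powr (e - 1) / exp s) * indicator {0..} s \<partial>lborel)"
    by (subst nn_integral_cmult) auto
  also have "(\<integral>\<^sup>+s. ennreal (s powr (e - 1) / exp s) * indicator {0..} s \<partial>lborel) = ennreal (Gamma e)"
    using nn_integral_has_integral_lebesgue'[OF _ Gamma_integral_real[OF assms(1)]] by simp
  finally show ?thesis using that assms by (simp add: ennreal_mult Gamma_real_pos less_imp_le)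
qed

text \<open>The standard deviation that removes the factor 1/2 from the exponent, so that products
  of normal densities are multiples of \<open>exp (- (norm z)\<^sup>2)\<close>.\<close>

abbreviation "gaussian_sd \<equiv> sqrt (1 / 2)"

lemma normal_density_gaussian_sd: "normal_density 0 gaussian_sd x = exp (- x\<^sup>2) / sqrt pi"
  by (simp add: normal_density_def real_sqrt_divide field_simps)

lemma nn_integral_normal_scale:
  assumes [measurable]: "h \<in> borel_measurable borel" and "c \<noteq> 0" "0 < \<sigma>"
  shows "(\<integral>\<^sup>+x. ennreal (normal_density 0 \<sigma> x) * h (c * x) \<partial>lborel)
       = (\<integral>\<^sup>+y. ennreal (normal_density 0 (\<bar>c\<bar> * \<sigma>) y) * h y \<partial>lborel)"
proof -
  have "normal_density 0 \<sigma> x = \<bar>c\<bar> * normal_density 0 (\<bar>c\<bar> * \<sigma>) (c * x)" for x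
    using assms by (simp add: normal_density_def real_sqrt_mult power_mult_distrib field_simps)
  then have "(\<integral>\<^sup>+x. ennreal (normal_density 0 \<sigma> x) * h (c * x) \<partial>lborel) =
      (\<integral>\<^sup>+x. ennreal \<bar>c\<bar> * (ennreal (normal_density 0 (\<bar>c\<bar> * \<sigma>) (0 + c * x)) * h (0 + c * x)) \<partial>lborel)"
    by (intro nn_integral_cong) (simp add: ennreal_mult mult.assoc)
  also have "\<dots> = (\<integral>\<^sup>+y. ennreal (normal_density 0 (\<bar>c\<bar> * \<sigma>) y) * h y \<partial>lborel)"
    using assms(2) by (subst (2) nn_integral_real_affine[where c = c and t = 0]) (simp_all add: nn_integral_cmult)
  finally show ?thesis .
qed

lemma nn_integral_normal_density: "0 < \<sigma> \<Longrightarrow> (\<integral>\<^sup>+x. ennreal (normal_density 0 \<sigma> x) \<partial>lborel) = 1"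
  using prob_space.emeasure_space_1[OF prob_space_normal_density[of \<sigma> 0]] by (simp add: emeasure_density)

text \<open>The sum of two independent centred normal variables. After rescaling, the double
  integral is one against a convolution of normal densities, in which variances add. Rescaling needs
  nonzero factors, hence the separate cases; the absolute value matches the square root supplied by
  the induction over coordinates.\<close>

lemma nn_integral_normal_combine:
  fixes a b :: real
  assumes [measurable]: "g \<in> borel_measurable borel"
  defines "n \<equiv> \<lambda>x. ennreal (normal_density 0 gaussian_sd x)"
  shows "(\<integral>\<^sup>+x. n x * (\<integral>\<^sup>+s. n s * g (a * x + \<bar>b\<bar> * s) \<partial>lborel) \<partial>lborel)
       = (\<integral>\<^sup>+s. n s * g (sqrt (a\<^sup>2 + b\<^sup>2) * s) \<partial>lborel)"
proof -
  have n1: "(\<integral>\<^sup>+x. n x \<partial>lborel) = 1" unfolding n_def by (rule nn_integral_normal_density) simp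
  have [measurable]: "n \<in> borel_measurable borel" unfolding n_def by measurable
  consider "a = 0" | "b = 0" "a \<noteq> 0" | "a \<noteq> 0" "b \<noteq> 0" by blast
  then show ?thesis
  proof cases
    case 1 then show ?thesis by (simp add: nn_integral_multc n1)
  next
    case 2
    have "(\<integral>\<^sup>+x. n x * g (a * x) \<partial>lborel) = (\<integral>\<^sup>+x. n x * g (\<bar>a\<bar> * x) \<partial>lborel)"
      unfolding n_def using 2 by (subst (1 2) nn_integral_normal_scale) simp_all
    then show ?thesis using 2 by (simp add: nn_integral_multc n1)
  next
    case 3
    let ?sa = "\<bar>a\<bar> * gaussian_sd" and ?sb = "\<bar>b\<bar> * gaussian_sd"
    let ?na = "\<lambda>x. ennreal (normal_density 0 ?sa x)" and ?nb = "\<lambda>x. ennreal (normal_density 0 ?sb x)"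
    have "(\<integral>\<^sup>+s. n s * g (t + \<bar>b\<bar> * s) \<partial>lborel) = (\<integral>\<^sup>+s. ?nb s * g (t + s) \<partial>lborel)" for t
      unfolding n_def using 3 by (subst nn_integral_normal_scale[where h = "\<lambda>y. g (t + y)"]) simp_all
    then have "(\<integral>\<^sup>+x. n x * (\<integral>\<^sup>+s. n s * g (a * x + \<bar>b\<bar> * s) \<partial>lborel) \<partial>lborel)
       = (\<integral>\<^sup>+x. n x * (\<integral>\<^sup>+s. ?nb s * g (a * x + s) \<partial>lborel) \<partial>lborel)" by simp
    also have "\<dots> = (\<integral>\<^sup>+y. ?na y * (\<integral>\<^sup>+s. ?nb s * g (y + s) \<partial>lborel) \<partial>lborel)"
      unfolding n_def using 3 by (subst nn_integral_normal_scale[where h = "\<lambda>y. \<integral>\<^sup>+s. ?nb s * g (y + s) \<partial>lborel"]) simp_all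
    also have "\<dots> = (\<integral>\<^sup>+y. (\<integral>\<^sup>+s. ?na y * (?nb s * g (y + s)) \<partial>lborel) \<partial>lborel)"
      by (subst nn_integral_cmult) simp_all
    also have "\<dots> = (\<integral>\<^sup>+s. (\<integral>\<^sup>+y. ?na y * (?nb s * g (y + s)) \<partial>lborel) \<partial>lborel)"
      by (rule lborel_pair.Fubini') simp
    also have "\<dots> = (\<integral>\<^sup>+s. (\<integral>\<^sup>+u. ?na (u - s) * (?nb s * g u) \<partial>lborel) \<partial>lborel)"
    proof (rule nn_integral_cong)
      fix s
      show "(\<integral>\<^sup>+y. ?na y * (?nb s * g (y + s)) \<partial>lborel) = (\<integral>\<^sup>+u. ?na (u - s) * (?nb s * g u) \<partial>lborel)"
        by (subst nn_integral_real_affine[where c = 1 and t = "-s"]) simp_all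
    qed
    also have "\<dots> = (\<integral>\<^sup>+u. (\<integral>\<^sup>+s. ?na (u - s) * (?nb s * g u) \<partial>lborel) \<partial>lborel)"
      by (rule lborel_pair.Fubini') simp
    also have "\<dots> = (\<integral>\<^sup>+u. (\<integral>\<^sup>+s. ennreal (normal_density 0 ?sa (u - s) * normal_density 0 ?sb s) \<partial>lborel) * g u \<partial>lborel)"
      by (subst nn_integral_multc[symmetric]) (simp_all add: ennreal_mult mult_ac)
    also have "\<dots> = (\<integral>\<^sup>+u. ennreal (normal_density 0 (sqrt (?sa\<^sup>2 + ?sb\<^sup>2)) u) * g u \<partial>lborel)"
      using conv_normal_density_zero_mean[of ?sa ?sb] 3 by (simp add: fun_eq_iff)
    also have "sqrt (?sa\<^sup>2 + ?sb\<^sup>2) = \<bar>sqrt (a\<^sup>2 + b\<^sup>2)\<bar> * gaussian_sd"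
      by (simp add: power_mult_distrib real_sqrt_mult[symmetric] algebra_simps real_sqrt_divide[symmetric] add_divide_distrib)
    also have "(\<integral>\<^sup>+u. ennreal (normal_density 0 (\<bar>sqrt (a\<^sup>2 + b\<^sup>2)\<bar> * gaussian_sd) u) * g u \<partial>lborel)
        = (\<integral>\<^sup>+s. n s * g (sqrt (a\<^sup>2 + b\<^sup>2) * s) \<partial>lborel)"
      unfolding n_def using 3 by (subst nn_integral_normal_scale) simp_all
    finally show ?thesis .
  qed
qed

text \<open>Induction over the coordinates: peeling off one coordinate leaves a sum of two
  independent normal variables, and the squared coefficients accumulate under the root.\<close>

lemma nn_integral_PiM_normal_linear:
  fixes w :: "'i \<Rightarrow> real"
  assumes "finite I" and [measurable]: "g \<in> borel_measurable borel"
  shows "(\<integral>\<^sup>+f. (\<Prod>i\<in>I. ennreal (normal_density 0 gaussian_sd (f i))) * g (\<Sum>i\<in>I. w i * f i) \<partial>(\<Pi>\<^sub>M i\<in>I. lborel))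
       = (\<integral>\<^sup>+s. ennreal (normal_density 0 gaussian_sd s) * g (sqrt (\<Sum>i\<in>I. (w i)\<^sup>2) * s) \<partial>lborel)"
  using assms(1,2)
proof (induction I arbitrary: g rule: finite_induct)
  case empty
  interpret product_sigma_finite "\<lambda>_::'i. lborel::real measure" ..
  show ?case by (subst nn_integral_empty) (simp_all add: nn_integral_multc nn_integral_normal_density)
next
  case (insert j I)
  interpret product_sigma_finite "\<lambda>_::'i. lborel::real measure" ..
  note [measurable] = insert.prems
  let ?n = "\<lambda>x. ennreal (normal_density 0 gaussian_sd x)"
  have [simp]: "(\<Prod>i\<in>I. ?n (if i = j then y else f i)) = (\<Prod>i\<in>I. ?n (f i))"
    "(\<Sum>i\<in>I. w i * (if i = j then y else f i)) = (\<Sum>i\<in>I. w i * f i)" for f y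
    using insert.hyps by (auto intro!: prod.cong sum.cong)
  have "(\<integral>\<^sup>+f. (\<Prod>i\<in>insert j I. ?n (f i)) * g (\<Sum>i\<in>insert j I. w i * f i) \<partial>(\<Pi>\<^sub>M i\<in>insert j I. lborel))
      = (\<integral>\<^sup>+y. (\<integral>\<^sup>+f. ?n y * ((\<Prod>i\<in>I. ?n (f i)) * g (w j * y + (\<Sum>i\<in>I. w i * f i))) \<partial>(\<Pi>\<^sub>M i\<in>I. lborel)) \<partial>lborel)"
    using insert.hyps by (subst product_nn_integral_insert_rev) (simp_all add: mult.assoc)
  also have "\<dots> = (\<integral>\<^sup>+y. ?n y * (\<integral>\<^sup>+f. (\<Prod>i\<in>I. ?n (f i)) * g (w j * y + (\<Sum>i\<in>I. w i * f i)) \<partial>(\<Pi>\<^sub>M i\<in>I. lborel)) \<partial>lborel)"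
    by (subst nn_integral_cmult) simp_all
  also have "\<dots> = (\<integral>\<^sup>+y. ?n y * (\<integral>\<^sup>+s. ?n s * g (w j * y + \<bar>sqrt (\<Sum>i\<in>I. (w i)\<^sup>2)\<bar> * s) \<partial>lborel) \<partial>lborel)"
    using insert.IH[of "\<lambda>z. g (w j * _ + z)"] by (simp add: sum_nonneg)
  also have "\<dots> = (\<integral>\<^sup>+s. ?n s * g (sqrt ((w j)\<^sup>2 + (sqrt (\<Sum>i\<in>I. (w i)\<^sup>2))\<^sup>2) * s) \<partial>lborel)"
    by (rule nn_integral_normal_combine) simp
  finally show ?case using insert.hyps by (simp add: sum_nonneg)
qed

text \<open>The Gaussian weight factorises over an orthonormal basis, so
  \<open>v \<bullet> z\<close> is distributed like a one-dimensional normal variable scaled by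
  \<open>norm v\<close>; the direction of \<open>v\<close> disappears.\<close>

lemma nn_integral_gaussian_inner:
  fixes v :: "'a::euclidean_space"
  assumes [measurable]: "g \<in> borel_measurable borel"
  shows "(\<integral>\<^sup>+z. ennreal (exp (- (norm z)\<^sup>2)) * g (v \<bullet> z) \<partial>lborel)
       = ennreal (sqrt pi ^ DIM('a)) * (\<integral>\<^sup>+s. ennreal (normal_density 0 gaussian_sd s) * g (norm v * s) \<partial>lborel)"
proof -
  let ?n = "\<lambda>x. ennreal (normal_density 0 gaussian_sd x)"
  let ?P = "\<Pi>\<^sub>M b\<in>(Basis::'a set). (lborel::real measure)"
  let ?T = "\<lambda>f. \<Sum>b\<in>(Basis::'a set). f b *\<^sub>R b"
  have 1: "ennreal (exp (- (norm (?T f))\<^sup>2)) = ennreal (sqrt pi ^ DIM('a)) * (\<Prod>i\<in>Basis. ?n (f i))" for f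
  proof -
    have "(norm (?T f))\<^sup>2 = (\<Sum>i\<in>Basis. (f i)\<^sup>2)"
      by (subst norm_sum_Pythagorean) (auto simp: pairwise_def orthogonal_def inner_Basis power_mult_distrib)
    then have "exp (- (norm (?T f))\<^sup>2) = (\<Prod>i\<in>(Basis::'a set). exp (- (f i)\<^sup>2))"
      by (simp add: exp_sum sum_negf[symmetric])
    also have "\<dots> = (\<Prod>i\<in>(Basis::'a set). sqrt pi * normal_density 0 gaussian_sd (f i))"
      by (simp add: normal_density_gaussian_sd)
    also have "\<dots> = sqrt pi ^ DIM('a) * (\<Prod>i\<in>(Basis::'a set). normal_density 0 gaussian_sd (f i))"
      by (simp add: prod.distrib)
    finally show ?thesis by (simp add: ennreal_mult prod_ennreal prod_nonneg)
  qed
  have 2: "v \<bullet> ?T f = (\<Sum>i\<in>Basis. (v \<bullet> i) * f i)" for f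
    by (simp add: inner_sum_right mult.commute)
  have "(\<integral>\<^sup>+z. ennreal (exp (- (norm z)\<^sup>2)) * g (v \<bullet> z) \<partial>lborel)
      = (\<integral>\<^sup>+f. ennreal (exp (- (norm (?T f))\<^sup>2)) * g (v \<bullet> ?T f) \<partial>?P)"
    by (subst lborel_eq) (simp add: nn_integral_distr)
  also have "\<dots> = (\<integral>\<^sup>+f. ennreal (sqrt pi ^ DIM('a)) * ((\<Prod>i\<in>Basis. ?n (f i)) * g (\<Sum>i\<in>Basis. (v \<bullet> i) * f i)) \<partial>?P)"
    by (intro nn_integral_cong) (simp only: 1 2 mult.assoc)
  also have "\<dots> = ennreal (sqrt pi ^ DIM('a)) * (\<integral>\<^sup>+f. (\<Prod>i\<in>Basis. ?n (f i)) * g (\<Sum>i\<in>Basis. (v \<bullet> i) * f i) \<partial>?P)"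
    by (subst nn_integral_cmult) simp_all
  also have "(\<integral>\<^sup>+f. (\<Prod>i\<in>Basis. ?n (f i)) * g (\<Sum>i\<in>Basis. (v \<bullet> i) * f i) \<partial>?P)
      = (\<integral>\<^sup>+s. ?n s * g (norm v * s) \<partial>lborel)"
    by (subst nn_integral_PiM_normal_linear) (simp_all add: norm_eq_sqrt_inner euclidean_inner[of v v] power2_eq_square)
  finally show ?thesis .
qed

lemma Cbar_pos: "0 < p \<Longrightarrow> 0 < d \<Longrightarrow> 0 < Cbar d p"
  unfolding Cbar_def by (intro divide_pos_pos mult_pos_pos Gamma_real_pos) auto

lemma nn_integral_cball_finite:
  fixes F :: "'a::euclidean_space \<Rightarrow> real"
  assumes [measurable]: "F \<in> borel_measurable borel" and F: "\<And>x. 0 \<le> F x" "\<And>x. norm x \<le> 1 \<Longrightarrow> F x \<le> B"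
  obtains a where "0 \<le> a" "(\<integral>\<^sup>+x. ennreal (F x) * indicator (cball 0 1) x \<partial>lborel) = ennreal a"
proof -
  have "(\<integral>\<^sup>+x. ennreal (F x) * indicator (cball 0 1) x \<partial>lborel) \<le> (\<integral>\<^sup>+(x::'a). ennreal B * indicator (cball 0 1) x \<partial>lborel)"
    using F by (intro nn_integral_mono) (auto simp: indicator_def intro: ennreal_leI)
  also have "\<dots> = ennreal B * emeasure lborel (cball (0::'a) 1)" by (rule nn_integral_cmult_indicator) simp
  also have "\<dots> < \<infinity>" using emeasure_lborel_cball_finite[of "0::'a" 1] by (simp add: ennreal_mult_less_top)
  finally have "(\<integral>\<^sup>+x. ennreal (F x) * indicator (cball 0 1) x \<partial>lborel) < \<infinity>" .
  then show ?thesis using that by (cases "\<integral>\<^sup>+x. ennreal (F x) * indicator (cball 0 1) x \<partial>lborel" rule: ennreal_cases) auto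
qed

text \<open>For homogeneous \<open>F\<close> the integral of \<open>\<phi>(|x|\<^sup>2) F(x)\<close> depends on \<open>F\<close> only through its integral over
  the unit ball, so the ratio of the directional and the full moment can be read off a Gaussian.\<close>

lemma directional_moment:
  fixes v :: "'a::euclidean_space"
  assumes p: "0 < p" and [measurable]: "\<phi> \<in> borel_measurable borel"
  shows "ennreal (Cbar DIM('a) p) * (\<integral>\<^sup>+z. \<phi> ((norm z)\<^sup>2) * ennreal (\<bar>v \<bullet> z\<bar> powr p) \<partial>lborel)
       = ennreal (norm v powr p) * (\<integral>\<^sup>+(z::'a). \<phi> ((norm z)\<^sup>2) * ennreal (norm z powr p) \<partial>lborel)"
proof -
  let ?d = "real DIM('a)"
  define e where "e = (?d + p) / 2"
  have e: "0 < e" using p by (simp add: e_def add_pos_pos)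
  have cs: "\<bar>v \<bullet> z\<bar> powr p \<le> norm v powr p" if "norm z \<le> 1" for z
  proof -
    have "\<bar>v \<bullet> z\<bar> \<le> norm v * 1"
      using Cauchy_Schwarz_ineq2[of v z] that mult_left_mono[of "norm z" 1 "norm v"] by simp
    then show ?thesis using p by (intro powr_mono2) auto
  qed
  obtain av where av: "0 \<le> av" "(\<integral>\<^sup>+z. ennreal (\<bar>v \<bullet> z\<bar> powr p) * indicator (cball 0 1) z \<partial>lborel) = ennreal av"
    by (rule nn_integral_cball_finite[where F = "\<lambda>z. \<bar>v \<bullet> z\<bar> powr p", OF _ _ cs]) auto
  have one: "norm z powr p \<le> 1" if "norm z \<le> 1" for z :: 'a
    using that p powr_mono2[of p "norm z" 1] by simp
  obtain ap where ap: "0 \<le> ap" "(\<integral>\<^sup>+(z::'a). ennreal (norm z powr p) * indicator (cball 0 1) z \<partial>lborel) = ennreal ap"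
    by (rule nn_integral_cball_finite[where F = "\<lambda>z::'a. norm z powr p", OF _ _ one]) auto
  obtain a0 where a0: "0 \<le> a0" "(\<integral>\<^sup>+(z::'a). ennreal 1 * indicator (cball 0 1) z \<partial>lborel) = ennreal a0"
    by (rule nn_integral_cball_finite[where F = "\<lambda>z::'a. 1" and B = 1]) auto
  obtain a1 where a1: "0 \<le> a1" "(\<integral>\<^sup>+(z::real). ennreal (norm z powr p) * indicator (cball 0 1) z \<partial>lborel) = ennreal a1"
    by (rule nn_integral_cball_finite[where F = "\<lambda>z::real. norm z powr p" and B = 1])
       (use p powr_mono2[of p _ 1] in auto)
  have radial_v: "(\<integral>\<^sup>+z. \<theta> ((norm z)\<^sup>2) * ennreal (\<bar>v \<bullet> z\<bar> powr p) \<partial>lborel)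
      = ennreal av * (\<integral>\<^sup>+s. \<theta> s * (ennreal (e * s powr (e - 1)) * indicator {0..} s) \<partial>lborel)"
    if "\<theta> \<in> borel_measurable borel" for \<theta>
    by (rule nn_integral_homogeneous_norm_square[where q = p, OF _ _ _ _ e av(2,1) that])
       (auto simp: e_def abs_mult powr_mult)
  have radial_p: "(\<integral>\<^sup>+(z::'a). \<theta> ((norm z)\<^sup>2) * ennreal (norm z powr p) \<partial>lborel)
      = ennreal ap * (\<integral>\<^sup>+s. \<theta> s * (ennreal (e * s powr (e - 1)) * indicator {0..} s) \<partial>lborel)"
    if "\<theta> \<in> borel_measurable borel" for \<theta>
    by (rule nn_integral_homogeneous_norm_square[where q = p, OF _ _ _ _ e ap(2,1) that])
       (auto simp: e_def abs_mult powr_mult)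
  have d2: "0 < ?d / 2" by simp
  have radial_0: "(\<integral>\<^sup>+(z::'a). \<theta> ((norm z)\<^sup>2) * ennreal 1 \<partial>lborel)
      = ennreal a0 * (\<integral>\<^sup>+s. \<theta> s * (ennreal (?d / 2 * s powr (?d / 2 - 1)) * indicator {0..} s) \<partial>lborel)"
    if "\<theta> \<in> borel_measurable borel" for \<theta>
    by (rule nn_integral_homogeneous_norm_square[where q = 0, OF _ _ _ _ d2 a0(2,1) that]) auto
  have p2: "0 < (1 + p) / 2" using p by simp
  have radial_1: "(\<integral>\<^sup>+(z::real). \<theta> ((norm z)\<^sup>2) * ennreal (norm z powr p) \<partial>lborel)
      = ennreal a1 * (\<integral>\<^sup>+s. \<theta> s * (ennreal ((1 + p) / 2 * s powr ((1 + p) / 2 - 1)) * indicator {0..} s) \<partial>lborel)"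
    if "\<theta> \<in> borel_measurable borel" for \<theta>
    by (rule nn_integral_homogeneous_norm_square[where q = p, OF _ _ _ _ p2 a1(2,1) that])
       (auto simp: abs_mult powr_mult)
  have a1v: "a1 = 2 / (1 + p)"
  proof -
    have "ennreal a1 = (\<integral>\<^sup>+(z::real). ennreal (norm z powr p) * indicator (cball 0 1) z \<partial>lborel)" using a1 by simp
    also have "\<dots> = (\<integral>\<^sup>+(z::real). ennreal (norm z powr p) * indicator {0..1} z + ennreal (norm z powr p) * indicator {-1..0} z \<partial>lborel)"
      using p by (intro nn_integral_cong) (auto simp: indicator_def dist_real_def)
    also have "\<dots> = (\<integral>\<^sup>+(z::real). ennreal (norm z powr p) * indicator {0..1} z \<partial>lborel) + (\<integral>\<^sup>+(z::real). ennreal (norm z powr p) * indicator {-1..0} z \<partial>lborel)"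
      by (rule nn_integral_add) auto
    also have "(\<integral>\<^sup>+(z::real). ennreal (norm z powr p) * indicator {-1..0} z \<partial>lborel) = (\<integral>\<^sup>+(z::real). ennreal (norm z powr p) * indicator {0..1} z \<partial>lborel)"
      by (subst nn_integral_real_affine[where c = "-1" and t = 0]) (auto intro!: nn_integral_cong simp: indicator_def)
    also have "(\<integral>\<^sup>+(z::real). ennreal (norm z powr p) * indicator {0..1} z \<partial>lborel) = ennreal (1 / (1 + p))"
      using nn_integral_has_integral_lebesgue'[OF _ has_integral_powr_from_0[of p 1]] p
      by (auto simp: add.commute indicator_def intro!: nn_integral_cong cong: nn_integral_cong elim!: trans[rotated])
    also have "ennreal (1 / (1 + p)) + ennreal (1 / (1 + p)) = ennreal (2 / (1 + p))"
      using p by (subst ennreal_plus[symmetric]) auto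
    finally show ?thesis using a1(1) p by simp
  qed
  let ?E = "\<lambda>s. ennreal (exp (- s))"
  have E[measurable]: "?E \<in> borel_measurable borel" by measurable
  \<comment> \<open>The Gaussian integral of the constant 1 identifies \<open>a0\<close>, the volume
    of the unit ball.\<close>
  have g0: "a0 * (?d / 2 * Gamma (?d / 2)) = sqrt pi ^ DIM('a)"
  proof -
    have "ennreal (sqrt pi ^ DIM('a)) = (\<integral>\<^sup>+(z::'a). ?E ((norm z)\<^sup>2) * ennreal 1 \<partial>lborel)"
      using nn_integral_gaussian_inner[of "\<lambda>_. 1" "0::'a"] by (simp add: nn_integral_normal_density)
    also have "\<dots> = ennreal (a0 * (?d / 2 * Gamma (?d / 2)))"
      using a0(1) by (subst radial_0[OF E], subst nn_integral_exp_powr[OF d2])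
        (simp_all add: ennreal_mult[symmetric] Gamma_real_pos less_imp_le)
    finally show ?thesis using a0(1) by (simp add: Gamma_real_pos less_imp_le)
  qed
  \<comment> \<open>The Gaussian moment of order \<open>p\<close> is computed twice: with weight
    \<open>exp (- s)\<close> against a homogeneous function of degree \<open>p\<close>, and with
    weight \<open>exp (- s) s^(p/2)\<close> against the constant 1. This ties \<open>ap\<close> to
    \<open>a0\<close>.\<close>
  have gp: "ap * (e * Gamma e) = a0 * (?d / 2 * Gamma e)"
  proof -
    have [measurable]: "(\<lambda>s. ?E s * ennreal (s powr (p / 2))) \<in> borel_measurable borel" by measurable
    have pp: "((norm z)\<^sup>2) powr (p / 2) = norm z powr p" for z :: 'a
      by (cases "z = 0") (auto simp: powr_numeral[symmetric] powr_powr simp del: powr_numeral)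
    have "ennreal (ap * (e * Gamma e)) = (\<integral>\<^sup>+(z::'a). ?E ((norm z)\<^sup>2) * ennreal (norm z powr p) \<partial>lborel)"
      using ap(1) e by (subst radial_p[OF E], subst nn_integral_exp_powr[OF e])
        (simp_all add: ennreal_mult[symmetric] Gamma_real_pos less_imp_le)
    also have "\<dots> = (\<integral>\<^sup>+(z::'a). (?E ((norm z)\<^sup>2) * ennreal (((norm z)\<^sup>2) powr (p / 2))) * ennreal 1 \<partial>lborel)"
      by (simp add: pp)
    also have "\<dots> = ennreal a0 * (\<integral>\<^sup>+s. (?E s * ennreal (s powr (p / 2))) * (ennreal (?d / 2 * s powr (?d / 2 - 1)) * indicator {0..} s) \<partial>lborel)"
      by (rule radial_0) measurable
    also have "(\<integral>\<^sup>+s. (?E s * ennreal (s powr (p / 2))) * (ennreal (?d / 2 * s powr (?d / 2 - 1)) * indicator {0..} s) \<partial>lborel)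
        = (\<integral>\<^sup>+s. ?E s * (ennreal (?d / 2 * s powr (e - 1)) * indicator {0..} s) \<partial>lborel)"
    proof (rule nn_integral_cong)
      fix s :: real
      have "s powr (p / 2) * (?d / 2 * s powr (?d / 2 - 1)) = ?d / 2 * s powr (e - 1)"
        by (simp add: powr_add[symmetric] e_def add_divide_distrib algebra_simps)
      then show "(?E s * ennreal (s powr (p / 2))) * (ennreal (?d / 2 * s powr (?d / 2 - 1)) * indicator {0..} s)
         = ?E s * (ennreal (?d / 2 * s powr (e - 1)) * indicator {0..} s)"
        by (simp add: mult.assoc ennreal_mult[symmetric] flip: mult.assoc[of "ennreal _" "ennreal _" "indicator _ _"])
           (simp add: indicator_def ennreal_mult[symmetric] mult.assoc)
    qed
    also have "\<dots> = ennreal (?d / 2 * Gamma e)" by (rule nn_integral_exp_powr[OF e]) simp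
    finally show ?thesis using ap(1) a0(1) e
      by (simp add: ennreal_mult[symmetric] Gamma_real_pos less_imp_le)
  qed
  \<comment> \<open>For the directional moment the Gaussian integral reduces to dimension one, which
    brings in \<open>Gamma ((p + 1) / 2)\<close> and \<open>norm v\<close>.\<close>
  have gv: "av * (e * Gamma e) = norm v powr p * (sqrt pi ^ DIM('a) / sqrt pi * Gamma ((p + 1) / 2))"
  proof -
    have m: "(\<integral>\<^sup>+s. ennreal (normal_density 0 gaussian_sd s) * ennreal (\<bar>norm v * s\<bar> powr p) \<partial>lborel)
        = ennreal (norm v powr p / sqrt pi * Gamma ((p + 1) / 2))"
    proof -
      have "(\<integral>\<^sup>+s. ennreal (normal_density 0 gaussian_sd s) * ennreal (\<bar>norm v * s\<bar> powr p) \<partial>lborel)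
          = (\<integral>\<^sup>+(s::real). ennreal (norm v powr p / sqrt pi) * (?E ((norm s)\<^sup>2) * ennreal (norm s powr p)) \<partial>lborel)"
        by (intro nn_integral_cong)
           (simp add: normal_density_gaussian_sd abs_mult powr_mult ennreal_mult[symmetric] mult_ac)
      also have "\<dots> = ennreal (norm v powr p / sqrt pi) * (\<integral>\<^sup>+(s::real). ?E ((norm s)\<^sup>2) * ennreal (norm s powr p) \<partial>lborel)"
        by (rule nn_integral_cmult) measurable
      also have "(\<integral>\<^sup>+(s::real). ?E ((norm s)\<^sup>2) * ennreal (norm s powr p) \<partial>lborel) = ennreal (a1 * ((1 + p) / 2 * Gamma ((1 + p) / 2)))"
        using a1(1) p by (subst radial_1[OF E], subst nn_integral_exp_powr[OF p2])
          (simp_all add: ennreal_mult[symmetric] Gamma_real_pos less_imp_le)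
      also have "a1 * ((1 + p) / 2 * Gamma ((1 + p) / 2)) = Gamma ((p + 1) / 2)"
        using p by (simp add: a1v field_simps)
      finally show ?thesis using p by (simp add: ennreal_mult[symmetric] Gamma_real_pos less_imp_le)
    qed
    have "ennreal (av * (e * Gamma e)) = (\<integral>\<^sup>+z. ?E ((norm z)\<^sup>2) * ennreal (\<bar>v \<bullet> z\<bar> powr p) \<partial>lborel)"
      using av(1) e by (subst radial_v[OF E], subst nn_integral_exp_powr[OF e])
        (simp_all add: ennreal_mult[symmetric] Gamma_real_pos less_imp_le)
    also have "\<dots> = ennreal (sqrt pi ^ DIM('a)) * ennreal (norm v powr p / sqrt pi * Gamma ((p + 1) / 2))"
      using nn_integral_gaussian_inner[of "\<lambda>s. ennreal (\<bar>s\<bar> powr p)" v] by (simp add: m)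
    finally show ?thesis using av(1) e p
      by (simp add: ennreal_mult[symmetric] Gamma_real_pos less_imp_le mult_ac)
  qed
  \<comment> \<open>Dividing the full moment by the directional one leaves exactly the quotient of
    Gamma values in \<open>Cbar\<close>.\<close>
  have key: "Cbar DIM('a) p * av = norm v powr p * ap"
  proof -
    have Gs: "0 < Gamma e" "0 < Gamma ((p + 1) / 2)" "0 < Gamma (?d / 2)" using e p by (auto intro!: Gamma_real_pos)
    note ne = Gs[THEN less_imp_neq, THEN not_sym]
    have ne2: "Gamma ((1 + p) / 2) \<noteq> 0" using ne(2) by (simp only: add.commute not_False_eq_True)
    have apv: "ap = sqrt pi ^ DIM('a) / (Gamma (?d / 2) * e)"
    proof -
      have "(ap * e) * Gamma e = (a0 * (?d / 2)) * Gamma e" using gp by (simp only: mult.assoc)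
      then have "ap * e = a0 * (?d / 2)" using Gs by simp
      then have "ap * e * Gamma (?d / 2) = sqrt pi ^ DIM('a)" using g0 by (simp only: mult.assoc)
      then show ?thesis using e by (simp add: eq_divide_eq mult_ac ne)
    qed
    have avv: "av = norm v powr p * (sqrt pi ^ DIM('a) / sqrt pi * Gamma ((p + 1) / 2)) / (e * Gamma e)"
      using gv e by (simp add: eq_divide_eq ne mult_ac)
    have "Cbar DIM('a) p = sqrt pi * Gamma e / (Gamma ((p + 1) / 2) * Gamma (?d / 2))"
      by (simp add: Cbar_def e_def)
    then show ?thesis unfolding apv avv using e by (simp add: field_simps ne ne2)
  qed
  show ?thesis
    unfolding radial_v[OF assms(2)] radial_p[OF assms(2)] mult.assoc[symmetric]
    using key av(1) ap(1) p Cbar_pos[of p "DIM('a)"] by (simp add: ennreal_mult[symmetric] less_imp_le)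
qed

section \<open>Functionals on the Sobolev space\<close>

text \<open>Bounding the sum by twice the larger norm needs no convexity and costs only the factor
  \<open>2 powr p\<close>.\<close>

lemma norm_add_powr_le:
  fixes a b :: "'b::real_normed_vector"
  assumes "0 < p"
  shows "norm (a + b) powr p \<le> 2 powr p * (norm a powr p + norm b powr p)"
proof -
  let ?m = "max (norm a) (norm b)"
  have "norm (a + b) \<le> 2 * ?m" using norm_triangle_ineq[of a b] by linarith
  then have "norm (a + b) powr p \<le> (2 * ?m) powr p" using assms by (intro powr_mono2) auto
  also have "\<dots> = 2 powr p * ?m powr p" by (simp add: powr_mult)
  also have "?m powr p \<le> norm a powr p + norm b powr p" by (simp add: max_def)
  finally show ?thesis by simp
qed

lemma norm_powr_tendsto:
  assumes "(h \<longlongrightarrow> l) F" "0 < p"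
  shows "((\<lambda>x. norm (h x) powr p) \<longlongrightarrow> norm l powr p) F"
  using assms by (intro tendsto_powr' tendsto_norm tendsto_const) auto

lemma integrable_norm_add_powr:
  fixes u v :: "'a \<Rightarrow> 'b::{banach, second_countable_topology}"
  assumes "0 < p" and [measurable]: "u \<in> borel_measurable M" "v \<in> borel_measurable M"
    and "integrable M (\<lambda>x. norm (u x) powr p)" "integrable M (\<lambda>x. norm (v x) powr p)"
  shows "integrable M (\<lambda>x. norm (u x + v x) powr p)"
proof (rule Bochner_Integration.integrable_bound)
  show "integrable M (\<lambda>x. 2 powr p * (norm (u x) powr p + norm (v x) powr p))" using assms by auto
  show "AE x in M. norm (norm (u x + v x) powr p) \<le> norm (2 powr p * (norm (u x) powr p + norm (v x) powr p))"
    using norm_add_powr_le[OF assms(1)] by (auto simp: abs_of_nonneg)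
qed simp

text \<open>A Brezis--Lieb type estimate: the part of \<open>|S + G\<^sub>n|\<^sup>p\<close> not controlled by \<open>|G\<^sub>n|\<^sup>p\<close> is
  dominated by \<open>|S|\<^sup>p\<close>, so adding an almost everywhere null sequence increases the integral by a
  constant that does not depend on \<open>S\<close>.\<close>

lemma eventually_integral_norm_add_powr_le:
  fixes S :: "'a \<Rightarrow> 'b::{banach, second_countable_topology}" and G :: "nat \<Rightarrow> 'a \<Rightarrow> 'b"
  assumes p: "0 < p" and [measurable]: "S \<in> borel_measurable M" "\<And>n. G n \<in> borel_measurable M"
    and S: "integrable M (\<lambda>x. norm (S x) powr p)"
    and G: "\<And>n. integrable M (\<lambda>x. norm (G n x) powr p)" "\<And>n. (\<integral>x. norm (G n x) powr p \<partial>M) \<le> C"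
    and lim: "AE x in M. (\<lambda>n. G n x) \<longlonglongrightarrow> 0"
  shows "\<forall>\<^sub>F n in sequentially. (\<integral>x. norm (S x + G n x) powr p \<partial>M) \<le> (\<integral>x. norm (S x) powr p \<partial>M) + (2 powr p * C + 1)"
proof -
  \<comment> \<open>The subtracted term caps the remainder by
    \<open>2 powr p * norm (S x) powr p\<close>, so dominated convergence applies to it; the
    integral of the subtracted term is at most \<open>2 powr p * C\<close>.\<close>
  let ?h = "\<lambda>n x. max 0 (norm (S x + G n x) powr p - 2 powr p * norm (G n x) powr p)"
  have hb: "norm (?h n x) \<le> 2 powr p * norm (S x) powr p" for n x
    using norm_add_powr_le[OF p, of "S x" "G n x"] by (simp add: algebra_simps)
  have dom: "integrable M (\<lambda>x. 2 powr p * norm (S x) powr p)" using S by simp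
  have "(\<lambda>n. \<integral>x. ?h n x \<partial>M) \<longlonglongrightarrow> (\<integral>x. norm (S x) powr p \<partial>M)"
  proof (rule integral_dominated_convergence[OF _ _ dom])
    show "AE x in M. (\<lambda>n. ?h n x) \<longlonglongrightarrow> norm (S x) powr p"
      using lim
    proof eventually_elim
      case (elim x)
      have "(\<lambda>n. ?h n x) \<longlonglongrightarrow> max 0 (norm (S x + 0) powr p - 2 powr p * norm (0::'b) powr p)"
        by (intro tendsto_intros norm_powr_tendsto elim p)
      then show ?case by simp
    qed
  qed (use hb in simp_all)
  then have ev: "\<forall>\<^sub>F n in sequentially. (\<integral>x. ?h n x \<partial>M) < (\<integral>x. norm (S x) powr p \<partial>M) + 1"
    by (rule order_tendstoD) simp
  have hint: "integrable M (?h n)" for n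
    by (rule Bochner_Integration.integrable_bound[OF dom]) (use hb in auto)
  have "(\<integral>x. norm (S x + G n x) powr p \<partial>M) \<le> (\<integral>x. ?h n x \<partial>M) + 2 powr p * C" for n
  proof -
    have "(\<integral>x. norm (S x + G n x) powr p \<partial>M) \<le> (\<integral>x. ?h n x + 2 powr p * norm (G n x) powr p \<partial>M)"
      by (rule integral_mono) (use integrable_norm_add_powr[OF p _ _ S G(1)] hint G(1) in auto)
    also have "\<dots> = (\<integral>x. ?h n x \<partial>M) + 2 powr p * (\<integral>x. norm (G n x) powr p \<partial>M)"
      using hint[of n] G(1)[of n] by simp
    also have "\<dots> \<le> (\<integral>x. ?h n x \<partial>M) + 2 powr p * C" using G(2)[of n] by simp
    finally show ?thesis .
  qed
  note le = this
  show ?thesis using ev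
  proof eventually_elim
    case (elim n)
    with le[of n] show ?case by linarith
  qed
qed

text \<open>A direct substitute for Vitali's theorem: the part of \<open>\<bar>t\<bar>\<close>
  exceeding \<open>e \<bar>t\<bar>^p\<close> is bounded, because \<open>p > 1\<close>, so its
  integral tends to zero by dominated convergence on a finite measure space; the rest contributes at
  most \<open>e * C\<close>.\<close>

lemma integral_abs_diff_tendsto_0_if_Lp_bounded:
  fixes d :: "nat \<Rightarrow> 'a \<Rightarrow> real"
  assumes p: "1 < p" and M: "finite_measure M" and [measurable]: "\<And>n. d n \<in> borel_measurable M"
    and d: "\<And>n. integrable M (\<lambda>x. \<bar>d n x\<bar> powr p)" "\<And>n. (\<integral>x. \<bar>d n x\<bar> powr p \<partial>M) \<le> C"
    and lim: "AE x in M. (\<lambda>n. d n x) \<longlonglongrightarrow> 0"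
  shows "(\<lambda>n. \<integral>x. \<bar>d n x\<bar> \<partial>M) \<longlonglongrightarrow> 0"
proof -
  interpret finite_measure M by (rule M)
  have dint: "integrable M (\<lambda>x. \<bar>d n x\<bar>)" for n
  proof (rule Bochner_Integration.integrable_bound[where f = "\<lambda>x. 1 + \<bar>d n x\<bar> powr p"])
    have "\<bar>t\<bar> \<le> 1 + \<bar>t\<bar> powr p" for t :: real
    proof (cases "\<bar>t\<bar> \<le> 1")
      case False
      then have "\<bar>t\<bar> powr 1 \<le> \<bar>t\<bar> powr p" using p by (intro powr_mono) auto
      then show ?thesis using False by simp
    qed (use powr_ge_zero[of "\<bar>t\<bar>" p] in linarith)
    then show "AE x in M. norm \<bar>d n x\<bar> \<le> norm (1 + \<bar>d n x\<bar> powr p)" by (auto simp: abs_of_nonneg add_nonneg_nonneg)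
  qed (use d in auto)
  show ?thesis
  proof (rule LIMSEQ_I)
    fix r :: real assume r: "0 < r"
    define e where "e = r / (2 * (\<bar>C\<bar> + 1))"
    have e: "0 < e" using r by (simp add: e_def add_nonneg_pos)
    have eC: "e * C \<le> r / 2"
    proof -
      have "e * C \<le> e * (\<bar>C\<bar> + 1)" using e by (intro mult_left_mono) auto
      also have "\<dots> = r / 2" using r by (simp add: e_def add_pos_nonneg field_simps)
      finally show ?thesis .
    qed
    \<comment> \<open>Beyond this threshold \<open>e \<bar>t\<bar>^p\<close> is at least
      \<open>\<bar>t\<bar>\<close>, so the truncated function vanishes there.\<close>
    define K where "K = e powr (- 1 / (p - 1))"
    let ?h = "\<lambda>n x. max 0 (\<bar>d n x\<bar> - e * \<bar>d n x\<bar> powr p)"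
    have hb: "norm (?h n x) \<le> K" for n x
    proof (cases "\<bar>d n x\<bar> \<le> K")
      case True
      have "0 \<le> e * \<bar>d n x\<bar> powr p" using e by simp
      then show ?thesis using True by (auto simp: K_def)
    next
      case False
      have K0: "0 < K" using e by (simp add: K_def)
      then have t: "0 < \<bar>d n x\<bar>" using False by linarith
      have "K powr (p - 1) \<le> \<bar>d n x\<bar> powr (p - 1)" using False K0 p by (intro powr_mono2) auto
      moreover have "K powr (p - 1) = 1 / e"
      proof -
        have "K powr (p - 1) = e powr (- 1)" unfolding K_def powr_powr using p by simp
        then show ?thesis using e by (simp add: powr_minus_divide)
      qed
      ultimately have "1 \<le> e * \<bar>d n x\<bar> powr (p - 1)" using e by (simp add: field_simps)
      then have "\<bar>d n x\<bar> * 1 \<le> \<bar>d n x\<bar> * (e * \<bar>d n x\<bar> powr (p - 1))" by (intro mult_left_mono) auto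
      also have "\<dots> = e * \<bar>d n x\<bar> powr p" using t by (simp add: powr_diff)
      finally show ?thesis using K0 by simp
    qed
    have "(\<lambda>n. \<integral>x. ?h n x \<partial>M) \<longlonglongrightarrow> (\<integral>x. 0 \<partial>M)"
    proof (rule integral_dominated_convergence[where w = "\<lambda>_. K"])
      show "AE x in M. (\<lambda>n. ?h n x) \<longlonglongrightarrow> 0"
        using lim
      proof eventually_elim
        case (elim x)
        have "(\<lambda>n. max 0 (\<bar>d n x\<bar> - e * norm (d n x) powr p)) \<longlonglongrightarrow> max 0 (\<bar>0\<bar> - e * norm (0::real) powr p)"
          by (intro tendsto_intros norm_powr_tendsto elim) (use p in auto)
        then show ?case by simp
      qed
    qed (use hb in auto)
    then have "\<forall>\<^sub>F n in sequentially. (\<integral>x. ?h n x \<partial>M) < r / 2" using r by (intro order_tendstoD) auto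
    then obtain n0 where n0: "\<And>n. n \<ge> n0 \<Longrightarrow> (\<integral>x. ?h n x \<partial>M) < r / 2" by (auto simp: eventually_sequentially)
    have hint: "integrable M (?h n)" for n
      by (rule Bochner_Integration.integrable_bound[where f = "\<lambda>_. K"]) (use hb in \<open>auto intro: order_trans\<close>)
    have "(\<integral>x. \<bar>d n x\<bar> \<partial>M) \<le> (\<integral>x. ?h n x \<partial>M) + e * C" for n
    proof -
      have "(\<integral>x. \<bar>d n x\<bar> \<partial>M) \<le> (\<integral>x. ?h n x + e * \<bar>d n x\<bar> powr p \<partial>M)"
        by (rule integral_mono) (use hint dint d in auto)
      also have "\<dots> = (\<integral>x. ?h n x \<partial>M) + e * (\<integral>x. \<bar>d n x\<bar> powr p \<partial>M)" using hint d by simp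
      also have "e * (\<integral>x. \<bar>d n x\<bar> powr p \<partial>M) \<le> e * C" using d(2)[of n] e by simp
      finally show ?thesis by simp
    qed
    note le = this
    have "norm ((\<integral>x. \<bar>d n x\<bar> \<partial>M) - 0) < r" if "n \<ge> n0" for n
    proof -
      have "0 \<le> (\<integral>x. \<bar>d n x\<bar> \<partial>M)" by (rule integral_nonneg_AE) simp
      then show ?thesis using n0[OF that] eC le[of n] by simp
    qed
    then show "\<exists>no. \<forall>n\<ge>no. norm ((\<integral>x. \<bar>d n x\<bar> \<partial>M) - 0) < r" by blast
  qed
qed

section \<open>Linear operations on weak gradients\<close>

lemma is_weak_grad_integrable:
  fixes U :: "'a::euclidean_space set"
  assumes phi: "test_fun U \<phi>" and i: "i \<in> Basis"
  shows "integrable (lebesgue_on U) u \<Longrightarrow> integrable (lebesgue_on U) (\<lambda>x. u x * frechet_derivative \<phi> (at x) i)"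
    and "integrable (lebesgue_on U) (\<lambda>x. norm (G x)) \<Longrightarrow> G \<in> borel_measurable (lebesgue_on U)
      \<Longrightarrow> integrable (lebesgue_on U) (\<lambda>x. (G x \<bullet> i) * \<phi> x)"
proof -
  obtain B where B: "0 < B" "\<And>x. \<bar>\<phi> x\<bar> \<le> B" "\<And>x. \<bar>frechet_derivative \<phi> (at x) i\<bar> \<le> B"
    using test_fun_bounded[OF phi] i by metis
  have [measurable]: "\<phi> \<in> borel_measurable (lebesgue_on U)"
     "(\<lambda>x. frechet_derivative \<phi> (at x) i) \<in> borel_measurable (lebesgue_on U)"
    by (intro borel_measurable_lebesgue_on_borel borel_measurable_continuous_onI
        test_fun_continuous[OF phi] test_fun_derivative_continuous[OF phi i])+
  show "integrable (lebesgue_on U) (\<lambda>x. u x * frechet_derivative \<phi> (at x) i)" if "integrable (lebesgue_on U) u"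
  proof (rule Bochner_Integration.integrable_bound[OF integrable_mult_left[OF that, of B]])
    show "AE x in lebesgue_on U. norm (u x * frechet_derivative \<phi> (at x) i) \<le> norm (u x * B)"
      using B by (auto simp: abs_mult intro!: mult_left_mono)
  qed (use that in measurable)
  show "integrable (lebesgue_on U) (\<lambda>x. (G x \<bullet> i) * \<phi> x)"
    if "integrable (lebesgue_on U) (\<lambda>x. norm (G x))" and [measurable]: "G \<in> borel_measurable (lebesgue_on U)"
  proof (rule Bochner_Integration.integrable_bound[OF integrable_mult_left[OF that(1), of B]])
    show "AE x in lebesgue_on U. norm ((G x \<bullet> i) * \<phi> x) \<le> norm (norm (G x) * B)"
      using B Basis_le_norm[OF i] by (auto simp: abs_mult intro!: mult_mono)
  qed measurable
qed

lemma is_weak_grad_add: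
  assumes "is_weak_grad U u G" "is_weak_grad U v H" "integrable (lebesgue_on U) u" "integrable (lebesgue_on U) v"
    "integrable (lebesgue_on U) (\<lambda>x. norm (G x))" "integrable (lebesgue_on U) (\<lambda>x. norm (H x))"
  shows "is_weak_grad U (\<lambda>x. u x + v x) (\<lambda>x. G x + H x)"
proof -
  have m[measurable]: "G \<in> borel_measurable (lebesgue_on U)" "H \<in> borel_measurable (lebesgue_on U)"
    using assms by (auto simp: is_weak_grad_def)
  show ?thesis
    unfolding is_weak_grad_def
  proof (intro conjI allI impI ballI)
    show "(\<lambda>x. G x + H x) \<in> borel_measurable (lebesgue_on U)" by measurable
    fix \<phi> and i :: 'a assume a: "test_fun U \<phi>" "i \<in> Basis"
    note I = is_weak_grad_integrable[OF a]
    have "(\<integral>x. u x * frechet_derivative \<phi> (at x) i \<partial>lebesgue_on U) = - (\<integral>x. (G x \<bullet> i) * \<phi> x \<partial>lebesgue_on U)"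
      "(\<integral>x. v x * frechet_derivative \<phi> (at x) i \<partial>lebesgue_on U) = - (\<integral>x. (H x \<bullet> i) * \<phi> x \<partial>lebesgue_on U)"
      using assms(1,2) a by (simp_all add: is_weak_grad_def)
    then show "(\<integral>x. (u x + v x) * frechet_derivative \<phi> (at x) i \<partial>lebesgue_on U) = - (\<integral>x. ((G x + H x) \<bullet> i) * \<phi> x \<partial>lebesgue_on U)"
      unfolding distrib_right inner_add_left
      using I(1)[OF assms(3)] I(1)[OF assms(4)] I(2)[OF assms(5) m(1)] I(2)[OF assms(6) m(2)]
      by (simp add: Bochner_Integration.integral_add)
  qed
qed

lemma is_weak_grad_scale:
  assumes "is_weak_grad U u G"
  shows "is_weak_grad U (\<lambda>x. c * u x) (\<lambda>x. c *\<^sub>R G x)"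
  using assms unfolding is_weak_grad_def by (auto simp: mult.assoc)

lemma Lp_on_add:
  assumes "0 < p" "Lp_on p U u" "Lp_on p U v"
  shows "Lp_on p U (\<lambda>x. u x + v x)"
  using assms integrable_norm_add_powr[of p u "lebesgue_on U" v] by (auto simp: Lp_on_def)

lemma Lp_on_norm_add:
  fixes G H :: "'a::euclidean_space \<Rightarrow> 'a"
  assumes "0 < p" "Lp_on p U (\<lambda>x. norm (G x))" "Lp_on p U (\<lambda>x. norm (H x))"
    "G \<in> borel_measurable (lebesgue_on U)" "H \<in> borel_measurable (lebesgue_on U)"
  shows "Lp_on p U (\<lambda>x. norm (G x + H x))"
  using assms integrable_norm_add_powr[of p G "lebesgue_on U" H] by (auto simp: Lp_on_def)

lemma Lp_on_scale:
  assumes "Lp_on p U u"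
  shows "Lp_on p U (\<lambda>x. c * u x)"
  using assms by (auto simp: Lp_on_def abs_mult powr_mult)

text \<open>The predicate carries the weak gradient explicitly, because \<^const>\<open>weak_grad\<close> is a choice.\<close>

definition sobolev_pair :: "real \<Rightarrow> 'a::euclidean_space set \<Rightarrow> ('a \<Rightarrow> real) \<Rightarrow> ('a \<Rightarrow> 'a) \<Rightarrow> bool" where
  "sobolev_pair p U u G \<longleftrightarrow> Lp_on p U u \<and> is_weak_grad U u G \<and> Lp_on p U (\<lambda>x. norm (G x))"

lemma W1p_iff_sobolev_pair: "W1p p U u \<longleftrightarrow> (\<exists>G. sobolev_pair p U u G)"
  by (auto simp: W1p_def sobolev_pair_def)

lemma sobolev_pair_measurable:
  "sobolev_pair p U u G \<Longrightarrow> u \<in> borel_measurable (lebesgue_on U)"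
  "sobolev_pair p U u G \<Longrightarrow> G \<in> borel_measurable (lebesgue_on U)"
  by (auto simp: sobolev_pair_def Lp_on_def is_weak_grad_def)

lemma sobolev_pair_add:
  assumes "1 \<le> p" "U \<in> lmeasurable" "sobolev_pair p U u G" "sobolev_pair p U v H"
  shows "sobolev_pair p U (\<lambda>x. u x + v x) (\<lambda>x. G x + H x)"
  using assms sobolev_pair_measurable[OF assms(3)] sobolev_pair_measurable[OF assms(4)] unfolding sobolev_pair_def
  by (intro conjI Lp_on_add is_weak_grad_add Lp_on_norm_add Lp_on_integrable[OF assms(2,1)]) auto

lemma sobolev_pair_scale:
  assumes "sobolev_pair p U u G"
  shows "sobolev_pair p U (\<lambda>x. c * u x) (\<lambda>x. c *\<^sub>R G x)"
  using assms Lp_on_scale[of p U "\<lambda>x. norm (G x)" "\<bar>c\<bar>"] unfolding sobolev_pair_def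
  by (auto intro: Lp_on_scale is_weak_grad_scale)

lemma W1p_norm_sobolev_pair:
  assumes "open U" "U \<in> lmeasurable" "1 \<le> p" "sobolev_pair p U u G"
  shows "W1p_norm p U u = ((\<integral>x. \<bar>u x\<bar> powr p \<partial>lebesgue_on U) + (\<integral>x. norm (G x) powr p \<partial>lebesgue_on U)) powr (1 / p)"
  using integral_weak_grad_eq[OF assms(1-3), of u G] assms(4) by (simp add: W1p_norm_def sobolev_pair_def)

text \<open>\<open>f\<close> acts on functions and not on classes. The difference of two
  representatives has zero as a weak gradient, so its Sobolev norm is zero and the dual bound forces
  equal values.\<close>

lemma W1p_dual_cong_AE:
  fixes U :: "'a::euclidean_space set"
  assumes f: "W1p_dual p U f" and U: "open U" "U \<in> lmeasurable" and p: "1 \<le> p"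
    and uv: "W1p p U u" "W1p p U v" and eq: "AE x in lebesgue_on U. u x = v x"
  shows "f u = f v"
proof -
  obtain G H where G: "sobolev_pair p U u G" and H: "sobolev_pair p U v H"
    using uv by (auto simp: W1p_iff_sobolev_pair)
  let ?w = "\<lambda>x. u x + (-1) * v x"
  note sG = sobolev_pair_measurable[OF G] and sH = sobolev_pair_measurable[OF H]
  have pair: "sobolev_pair p U ?w (\<lambda>x. G x + (-1) *\<^sub>R H x)"
    by (intro sobolev_pair_add sobolev_pair_scale p U G H)
  have "is_weak_grad U ?w (\<lambda>x. 0)"
  proof (rule is_weak_grad_cong_AE[where u = "\<lambda>x. 0"])
    show "AE x in lebesgue_on U. 0 = ?w x" using eq by eventually_elim simp
    show "?w \<in> borel_measurable (lebesgue_on U)" using sG(1) sH(1) by measurable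
    show "is_weak_grad U (\<lambda>x. 0) (\<lambda>x. 0)" by (simp add: is_weak_grad_def)
  qed simp
  then have pair0: "sobolev_pair p U ?w (\<lambda>x. 0)"
    using pair p by (simp add: sobolev_pair_def Lp_on_def)
  have "(\<integral>x. \<bar>?w x\<bar> powr p \<partial>lebesgue_on U) = 0"
    using eq p by (intro integral_eq_zero_AE) (auto elim: eventually_mono)
  then have n0: "W1p_norm p U ?w = 0"
    using W1p_norm_sobolev_pair[OF U p pair0] p by simp
  have "W1p p U ?w" "W1p p U (\<lambda>x. (-1) * v x)"
    using pair sobolev_pair_scale[OF H, of "-1"] by (auto simp: W1p_iff_sobolev_pair)
  moreover obtain C where "\<And>u. W1p p U u \<Longrightarrow> \<bar>f u\<bar> \<le> C * W1p_norm p U u"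
    using f by (auto simp: W1p_dual_def)
  ultimately have "f ?w = 0" using n0 by fastforce
  moreover have "f ?w = f u + f (\<lambda>x. (-1) * v x)"
    using f uv(1) \<open>W1p p U (\<lambda>x. (-1) * v x)\<close> unfolding W1p_dual_def by blast
  moreover have "f (\<lambda>x. (-1) * v x) = (-1) * f v"
    using f uv(2) unfolding W1p_dual_def by blast
  ultimately show ?thesis by simp
qed

lemma W1p_dual_bound:
  fixes U :: "'a::euclidean_space set"
  assumes f: "W1p_dual p U f" and U: "open U" "U \<in> lmeasurable" and p: "1 \<le> p"
  obtains C where "0 < C" "\<And>u G. sobolev_pair p U u G \<Longrightarrow>
    \<bar>f u\<bar> \<le> C * ((\<integral>x. \<bar>u x\<bar> powr p \<partial>lebesgue_on U) + (\<integral>x. norm (G x) powr p \<partial>lebesgue_on U)) powr (1 / p)"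
proof -
  obtain C where C: "\<And>u. W1p p U u \<Longrightarrow> \<bar>f u\<bar> \<le> C * W1p_norm p U u"
    using f by (auto simp: W1p_dual_def)
  have "\<bar>f u\<bar> \<le> (\<bar>C\<bar> + 1) * ((\<integral>x. \<bar>u x\<bar> powr p \<partial>lebesgue_on U) + (\<integral>x. norm (G x) powr p \<partial>lebesgue_on U)) powr (1 / p)"
    if "sobolev_pair p U u G" for u G
  proof -
    have "\<bar>f u\<bar> \<le> C * W1p_norm p U u" using C that by (auto simp: W1p_iff_sobolev_pair)
    also have "\<dots> \<le> (\<bar>C\<bar> + 1) * W1p_norm p U u" by (intro mult_right_mono) (auto simp: W1p_norm_def)
    finally show ?thesis using W1p_norm_sobolev_pair[OF U p that] by simp
  qed
  then show ?thesis using that[of "\<bar>C\<bar> + 1"] by simp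
qed

text \<open>This replaces weak compactness: if the values stayed away from zero, sums of \<open>k\<close> well chosen
  members would have values of order \<open>k\<close> but norms of order \<open>k\<^sup>1\<^sup>/\<^sup>p\<close>.\<close>

lemma W1p_dual_tendsto_0:
  fixes U :: "'a::euclidean_space set"
  assumes f: "W1p_dual p U f" and U: "open U" "U \<in> lmeasurable" and p: "1 < p"
    and pair: "\<And>n. sobolev_pair p U (g n) (G n)"
    and bd: "\<And>n. (\<integral>x. \<bar>g n x\<bar> powr p \<partial>lebesgue_on U) \<le> C" "\<And>n. (\<integral>x. norm (G n x) powr p \<partial>lebesgue_on U) \<le> C"
    and lim: "AE x in lebesgue_on U. (\<lambda>n. g n x) \<longlonglongrightarrow> 0" "AE x in lebesgue_on U. (\<lambda>n. G n x) \<longlonglongrightarrow> 0"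
  shows "(\<lambda>n. f (g n)) \<longlonglongrightarrow> 0"
proof (rule ccontr)
  assume "\<not> ?thesis"
  then obtain e where e: "0 < e" "\<And>n0. \<exists>n\<ge>n0. e \<le> \<bar>f (g n)\<bar>"
    unfolding LIMSEQ_iff by (auto simp: not_less)
  have p0: "0 < p" and p1: "1 \<le> p" using p by auto
  define s where "s n = (if f (g n) < 0 then -1 else 1 :: real)" for n
  have s: "\<bar>s n\<bar> = 1" for n by (simp add: s_def)
  let ?g = "\<lambda>n x. s n * g n x" and ?G = "\<lambda>n x. s n *\<^sub>R G n x"
  have pair': "sobolev_pair p U (?g n) (?G n)" for n by (rule sobolev_pair_scale[OF pair])
  have fs: "f (?g n) = \<bar>f (g n)\<bar>" for n
  proof -
    have "f (?g n) = s n * f (g n)"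
      using f pair[of n] unfolding W1p_dual_def W1p_iff_sobolev_pair by blast
    then show ?thesis by (simp add: s_def)
  qed
  have sabs: "\<bar>?g n x\<bar> = \<bar>g n x\<bar>" "norm (?G n x) = norm (G n x)" for n x by (simp_all add: abs_mult s)
  have lim': "AE x in lebesgue_on U. (\<lambda>n. ?g n x) \<longlonglongrightarrow> 0" "AE x in lebesgue_on U. (\<lambda>n. ?G n x) \<longlonglongrightarrow> 0"
  proof -
    show "AE x in lebesgue_on U. (\<lambda>n. ?g n x) \<longlonglongrightarrow> 0" using lim(1)
      by eventually_elim (subst tendsto_rabs_zero_iff[symmetric], simp only: sabs tendsto_rabs_zero)
    show "AE x in lebesgue_on U. (\<lambda>n. ?G n x) \<longlonglongrightarrow> 0" using lim(2)
      by eventually_elim (subst tendsto_norm_zero_iff[symmetric], simp only: sabs tendsto_norm_zero)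
  qed
  \<comment> \<open>The increment from \<open>eventually_integral_norm_add_powr_le\<close>. It does
    not depend on the sum built so far, so \<open>k\<close> summands cost at most
    \<open>k * K\<close>.\<close>
  define K where "K = 2 powr p * C + 1"
  have "\<exists>h H. sobolev_pair p U h H \<and> (\<integral>x. \<bar>h x\<bar> powr p \<partial>lebesgue_on U) \<le> real k * K
        \<and> (\<integral>x. norm (H x) powr p \<partial>lebesgue_on U) \<le> real k * K \<and> real k * e \<le> f h" for k
  proof (induction k)
    case 0
    have "W1p p U (\<lambda>x. 0)"
      unfolding W1p_iff_sobolev_pair using p0 by (intro exI[of _ "\<lambda>x. 0"]) (simp add: sobolev_pair_def Lp_on_def is_weak_grad_def)
    then have "f (\<lambda>x. 0 * 0) = 0 * f (\<lambda>x. 0)" using f unfolding W1p_dual_def by fastforce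
    then have "f (\<lambda>x. 0) = 0" by simp
    then show ?case
      using p0 by (intro exI[of _ "\<lambda>x. 0"]) (simp add: sobolev_pair_def Lp_on_def is_weak_grad_def)
  next
    case (Suc k)
    then obtain h H where h: "sobolev_pair p U h H" "(\<integral>x. \<bar>h x\<bar> powr p \<partial>lebesgue_on U) \<le> real k * K"
      "(\<integral>x. norm (H x) powr p \<partial>lebesgue_on U) \<le> real k * K" "real k * e \<le> f h" by blast
    have 1: "\<forall>\<^sub>F n in sequentially. (\<integral>x. norm (h x + ?g n x) powr p \<partial>lebesgue_on U) \<le> (\<integral>x. norm (h x) powr p \<partial>lebesgue_on U) + (2 powr p * C + 1)"
      by (rule eventually_integral_norm_add_powr_le[OF p0 _ _ _ _ _ lim'(1)])
         (use h(1) pair' bd(1) in \<open>auto simp: sobolev_pair_def Lp_on_def sabs\<close>)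
    have 2: "\<forall>\<^sub>F n in sequentially. (\<integral>x. norm (H x + ?G n x) powr p \<partial>lebesgue_on U) \<le> (\<integral>x. norm (H x) powr p \<partial>lebesgue_on U) + (2 powr p * C + 1)"
      by (rule eventually_integral_norm_add_powr_le[OF p0 _ _ _ _ _ lim'(2)])
         (use h(1) pair' bd(2) in \<open>auto simp: sobolev_pair_def Lp_on_def is_weak_grad_def s\<close>)
    obtain n0 where n0: "\<And>n. n \<ge> n0 \<Longrightarrow> (\<integral>x. norm (h x + ?g n x) powr p \<partial>lebesgue_on U) \<le> (\<integral>x. norm (h x) powr p \<partial>lebesgue_on U) + K"
      "\<And>n. n \<ge> n0 \<Longrightarrow> (\<integral>x. norm (H x + ?G n x) powr p \<partial>lebesgue_on U) \<le> (\<integral>x. norm (H x) powr p \<partial>lebesgue_on U) + K"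
      using eventually_conj[OF 1 2] unfolding eventually_sequentially K_def by blast
    obtain n where n: "n \<ge> n0" "e \<le> \<bar>f (g n)\<bar>" using e(2) by blast
    have "f (\<lambda>x. h x + ?g n x) = f h + f (?g n)"
      using f h(1) pair' unfolding W1p_dual_def W1p_iff_sobolev_pair by blast
    then show ?case
      using n0[OF n(1)] n(2) h fs[of n] sobolev_pair_add[OF p1 U(2) h(1) pair', of n]
      by (intro exI[of _ "\<lambda>x. h x + ?g n x"] exI[of _ "\<lambda>x. H x + ?G n x"]) (auto simp: algebra_simps)
  qed
  moreover obtain B where B: "0 < B" "\<And>u G. sobolev_pair p U u G \<Longrightarrow>
    \<bar>f u\<bar> \<le> B * ((\<integral>x. \<bar>u x\<bar> powr p \<partial>lebesgue_on U) + (\<integral>x. norm (G x) powr p \<partial>lebesgue_on U)) powr (1 / p)"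
    using W1p_dual_bound[OF f U p1] by blast
  ultimately have le: "real k * e \<le> B * (real k * (2 * K)) powr (1 / p)" for k
  proof -
    fix k
    assume "\<And>k. \<exists>h H. sobolev_pair p U h H \<and> (\<integral>x. \<bar>h x\<bar> powr p \<partial>lebesgue_on U) \<le> real k * K
        \<and> (\<integral>x. norm (H x) powr p \<partial>lebesgue_on U) \<le> real k * K \<and> real k * e \<le> f h"
    then obtain h H where h: "sobolev_pair p U h H" "(\<integral>x. \<bar>h x\<bar> powr p \<partial>lebesgue_on U) \<le> real k * K"
      "(\<integral>x. norm (H x) powr p \<partial>lebesgue_on U) \<le> real k * K" "real k * e \<le> f h" by blast
    have "real k * e \<le> \<bar>f h\<bar>" using h(4) by linarith
    also have "\<dots> \<le> B * ((\<integral>x. \<bar>h x\<bar> powr p \<partial>lebesgue_on U) + (\<integral>x. norm (H x) powr p \<partial>lebesgue_on U)) powr (1 / p)"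
      by (rule B(2)[OF h(1)])
    also have "\<dots> \<le> B * (real k * (2 * K)) powr (1 / p)"
      using h(2,3) B(1) p by (intro mult_left_mono powr_mono2) (auto intro!: add_nonneg_nonneg integral_nonneg_AE)
    finally show "real k * e \<le> B * (real k * (2 * K)) powr (1 / p)" .
  qed
  have "0 \<le> C" using bd(1)[of 0] by (rule order_trans[rotated]) (auto intro: integral_nonneg_AE)
  then have K: "0 < K" by (simp add: K_def add_nonneg_pos)
  \<comment> \<open>The inequality \<open>k e \<le> B (2 k K)^(1/p)\<close> says that
    \<open>k powr (1 - 1 / p)\<close> is at most \<open>A\<close>; as \<open>p > 1\<close>, a large
    \<open>k\<close> violates it.\<close>
  define A r where "A = B * (2 * K) powr (1 / p) / e" and "r = 1 - 1 / p"
  have A: "0 < A" and r: "0 < r" using B(1) K e(1) p by (simp_all add: A_def r_def)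
  obtain k :: nat where k0: "A powr (1 / r) < real k" using reals_Archimedean2 by blast
  have k: "0 < k" using k0 A by (cases "k = 0") (auto simp: not_less[symmetric])
  have "A = (A powr (1 / r)) powr r" using A r by (simp add: powr_powr)
  also have "\<dots> < real k powr r" using k0 r by (intro powr_less_mono2) auto
  finally have kA: "A < real k powr r" .
  have "B * (2 * K) powr (1 / p) < e * real k powr (1 - 1 / p)" using kA e(1) by (simp add: field_simps A_def r_def)
  then have "B * (2 * K) powr (1 / p) * real k powr (1 / p) < e * real k powr (1 - 1 / p) * real k powr (1 / p)"
    using k by simp
  also have "\<dots> = e * real k" using k by (simp add: powr_add[symmetric] mult.assoc)
  finally show False using le[of k] K by (simp add: powr_mult mult_ac)
qed

section \<open>Mollification with variable width\<close>

text \<open>Differentiation under the integral at a single point: derivatives are required only at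
  0, and the Lipschitz bound relative to 0 dominates the difference quotients.\<close>

lemma has_real_derivative_integral:
  fixes F :: "real \<Rightarrow> 'b \<Rightarrow> real"
  assumes e: "0 < e" and F: "\<And>t. \<bar>t\<bar> < e \<Longrightarrow> integrable M (F t)"
    and der: "\<And>y. y \<in> space M \<Longrightarrow> ((\<lambda>t. F t y) has_real_derivative F' y) (at 0)"
    and lip: "\<And>t y. \<bar>t\<bar> < e \<Longrightarrow> y \<in> space M \<Longrightarrow> \<bar>F t y - F 0 y\<bar> \<le> \<bar>t\<bar> * w y"
    and w: "integrable M w" and [measurable]: "F' \<in> borel_measurable M"
  shows "((\<lambda>t. \<integral>y. F t y \<partial>M) has_real_derivative (\<integral>y. F' y \<partial>M)) (at 0)"
proof -
  have "((\<lambda>h. ((\<integral>y. F (0 + h) y \<partial>M) - (\<integral>y. F 0 y \<partial>M)) / h) \<longlongrightarrow> (\<integral>y. F' y \<partial>M)) (at 0)"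
    unfolding tendsto_at_iff_sequentially
  proof (intro allI impI)
    fix X :: "nat \<Rightarrow> real" assume X0: "\<forall>i. X i \<in> UNIV - {0}" and X: "X \<longlonglongrightarrow> 0"
    obtain n0 where n0: "\<And>n. n \<ge> n0 \<Longrightarrow> \<bar>X n\<bar> < e"
      using X e unfolding LIMSEQ_iff by fastforce
    let ?Y = "\<lambda>n. X (n + n0)"
    let ?q = "\<lambda>n y. (F (?Y n) y - F 0 y) / ?Y n"
    have Ye: "\<bar>?Y n\<bar> < e" and Y0: "?Y n \<noteq> 0" for n using n0 X0 by auto
    have F0: "integrable M (F 0)" using F e by simp
    have qb: "norm (?q n y) \<le> w y" if "y \<in> space M" for n y
      using lip[OF Ye[of n] that] Y0[of n] by (simp add: abs_divide field_simps)
    have lim: "(\<lambda>n. \<integral>y. ?q n y \<partial>M) \<longlonglongrightarrow> (\<integral>y. F' y \<partial>M)"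
    proof (rule integral_dominated_convergence[OF _ _ w])
      show "AE y in M. (\<lambda>n. ?q n y) \<longlonglongrightarrow> F' y"
      proof (rule AE_I2)
        fix y assume "y \<in> space M"
        then have "((\<lambda>h. (F (0 + h) y - F 0 y) / h) \<longlongrightarrow> F' y) (at 0)" using der by (simp add: DERIV_def)
        moreover have "filterlim ?Y (at 0) sequentially"
          using Y0 by (intro filterlim_atI LIMSEQ_ignore_initial_segment X) auto
        ultimately have "(\<lambda>n. (F (0 + ?Y n) y - F 0 y) / ?Y n) \<longlonglongrightarrow> F' y" by (rule filterlim_compose)
        then show "(\<lambda>n. ?q n y) \<longlonglongrightarrow> F' y" by simp
      qed
      show "?q n \<in> borel_measurable M" for n using F[OF Ye[of n]] F0 by measurable
    qed (use qb in auto)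
    have eq: "(\<integral>y. ?q n y \<partial>M) = ((\<integral>y. F (0 + ?Y n) y \<partial>M) - (\<integral>y. F 0 y \<partial>M)) / ?Y n" for n
      using F[OF Ye[of n]] F0 by simp
    from lim have "(\<lambda>n. ((\<integral>y. F (0 + X n) y \<partial>M) - (\<integral>y. F 0 y \<partial>M)) / X n) \<longlonglongrightarrow> (\<integral>y. F' y \<partial>M)"
      unfolding eq by (rule LIMSEQ_offset)
    then show "((\<lambda>h. ((\<integral>y. F (0 + h) y \<partial>M) - (\<integral>y. F 0 y \<partial>M)) / h) \<circ> X) \<longlonglongrightarrow> (\<integral>y. F' y \<partial>M)"
      by (simp add: o_def)
  qed
  then show ?thesis by (simp add: DERIV_def)
qed

text \<open>Mollification whose width \<eta> depends on the point and is so small that the ball of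
  radius \<open>\<eta> x\<close> stays in \<Omega>, so that \<open>u\<close> never has to be
  extended. The condition \<open>\<psi>' 0 = 0\<close> makes the radial profile differentiable at
  its centre; \<open>B\<close> bounds the profile and its derivative.\<close>

locale collar_kernel =
  fixes \<Omega> :: "'a::euclidean_space set" and \<eta> :: "'a \<Rightarrow> real" and \<eta>' :: "'a \<Rightarrow> 'a \<Rightarrow> real"
    and \<psi> \<psi>' :: "real \<Rightarrow> real" and B :: real
  assumes open_dom: "open \<Omega>" and bounded_dom: "bounded \<Omega>"
    and eta_meas[measurable]: "\<eta> \<in> borel_measurable borel"
    and eta'_meas: "\<And>i. i \<in> Basis \<Longrightarrow> \<eta>' i \<in> borel_measurable borel"
    and eta_pos: "\<And>x. x \<in> \<Omega> \<Longrightarrow> 0 < \<eta> x"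
    and eta_ball: "\<And>x. x \<in> \<Omega> \<Longrightarrow> ball x (\<eta> x) \<subseteq> \<Omega>"
    and eta_cont: "continuous_on \<Omega> \<eta>"
    and eta_deriv: "\<And>i x. i \<in> Basis \<Longrightarrow> x \<in> \<Omega> \<Longrightarrow> ((\<lambda>t. \<eta> (x + t *\<^sub>R i)) has_real_derivative \<eta>' i x) (at 0)"
    and eta'_le: "\<And>i x. i \<in> Basis \<Longrightarrow> x \<in> \<Omega> \<Longrightarrow> \<bar>\<eta>' i x\<bar> \<le> 1"
    and psi_deriv: "\<And>s. (\<psi> has_real_derivative \<psi>' s) (at s)"
    and psi'_meas[measurable]: "\<psi>' \<in> borel_measurable borel"
    and psi_bound: "\<And>s. \<bar>\<psi> s\<bar> \<le> B" "\<And>s. \<bar>\<psi>' s\<bar> \<le> B"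
    and psi'_0: "\<psi>' 0 = 0"
    and psi_supp: "\<And>s. 1 \<le> s \<Longrightarrow> \<psi> s = 0" "\<And>s. 1 \<le> s \<Longrightarrow> \<psi>' s = 0"
    and psi_nonneg: "\<And>s. 0 \<le> \<psi> s"
    and psi_norm: "(\<integral>x. \<psi> (norm (x::'a)) \<partial>lborel) = 1"
begin

section \<open>The kernel and its derivative in the centre\<close>

lemma psi_meas[measurable]: "\<psi> \<in> borel_measurable borel"
  by (intro borel_measurable_continuous_onI continuous_at_imp_continuous_on ballI DERIV_isCont[OF psi_deriv])

lemma dom_meas[measurable]: "\<Omega> \<in> sets borel" using open_dom by simp

lemma B_nonneg: "0 \<le> B" using psi_bound(1)[of 0] by linarith

definition Dpsi :: "'a \<Rightarrow> 'a \<Rightarrow> real" where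
  "Dpsi z v = (if z = 0 then 0 else \<psi>' (norm z) * (v \<bullet> sgn z))"

text \<open>Away from the origin this is the chain rule. At the origin the norm is not
  differentiable, but the difference quotient of \<psi> at 0 composed with the norm tends to
  \<open>\<psi>' 0 = 0\<close>.\<close>

lemma Dpsi_has_derivative: "((\<lambda>z. \<psi> (norm z)) has_derivative Dpsi z) (at z)"
proof (cases "z = 0")
  case False
  have "((\<lambda>z. \<psi> (norm z)) has_derivative (\<lambda>v. \<psi>' (norm z) * (v \<bullet> sgn z))) (at z)"
    using has_derivative_compose[OF has_derivative_norm[OF False]
      psi_deriv[THEN has_field_derivative_imp_has_derivative]] by simp
  then show ?thesis using False by (simp add: Dpsi_def[abs_def])
next
  case True
  have "((\<lambda>s. (\<psi> (0 + s) - \<psi> 0) / s) \<longlongrightarrow> 0) (at 0)" using psi_deriv[of 0] psi'_0 by (simp add: DERIV_def)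
  moreover have "filterlim (\<lambda>h::'a. norm h) (at 0) (at 0)"
    by (intro filterlim_atI tendsto_norm_zero tendsto_ident_at) (auto simp: eventually_at_filter)
  ultimately have "((\<lambda>h::'a. (\<psi> (0 + norm h) - \<psi> 0) / norm h) \<longlongrightarrow> 0) (at 0)" by (rule filterlim_compose)
  then have "((\<lambda>h::'a. norm ((\<psi> (norm (0 + h)) - \<psi> (norm (0::'a))) - 0) / norm h) \<longlongrightarrow> 0) (at 0)"
    by (subst (asm) tendsto_rabs_zero_iff[symmetric]) (simp add: abs_divide)
  then have "((\<lambda>z::'a. \<psi> (norm z)) has_derivative (\<lambda>v. 0)) (at 0)"
    by (simp add: has_derivative_at)
  then show ?thesis using True by (simp add: Dpsi_def[abs_def])
qed

lemma Dpsi_le: "\<bar>Dpsi z v\<bar> \<le> B * norm v"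
proof (cases "z = 0")
  case False
  have "\<bar>v \<bullet> sgn z\<bar> \<le> norm v * norm (sgn z)" by (rule Cauchy_Schwarz_ineq2)
  then have "\<bar>v \<bullet> sgn z\<bar> \<le> norm v" using False by (simp add: norm_sgn)
  then show ?thesis using False psi_bound(2)[of "norm z"] B_nonneg
    by (auto simp: Dpsi_def abs_mult intro!: mult_mono)
qed (simp add: Dpsi_def B_nonneg)

lemma Dpsi_eq_0: "1 \<le> norm z \<Longrightarrow> Dpsi z v = 0"
  by (simp add: Dpsi_def psi_supp)

definition ker :: "'a \<Rightarrow> 'a \<Rightarrow> real" where
  "ker x y = \<psi> (norm (y - x) / \<eta> x) / \<eta> x ^ DIM('a)"

text \<open>Derivative of \<open>ker\<close> in its centre along \<open>i\<close>. The vector fed to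
  \<open>Dpsi\<close> is the velocity of the rescaled point \<open>(y - x) / \<eta> x\<close>, which
  moves with the centre and with the width; the last term comes from the normalising power of the
  width.\<close>

definition dker :: "'a \<Rightarrow> 'a \<Rightarrow> 'a \<Rightarrow> real" where
  "dker i x y = (let z = (1 / \<eta> x) *\<^sub>R (y - x) in
     Dpsi z (- (\<eta>' i x / \<eta> x) *\<^sub>R z - (1 / \<eta> x) *\<^sub>R i) / \<eta> x ^ DIM('a)
     - real DIM('a) * \<psi> (norm z) * \<eta>' i x / \<eta> x ^ Suc DIM('a))"

lemma ker_eq_0: "x \<in> \<Omega> \<Longrightarrow> \<eta> x \<le> norm (y - x) \<Longrightarrow> ker x y = 0"
  using eta_pos[of x] by (simp add: ker_def psi_supp)

lemma dker_eq_0: "x \<in> \<Omega> \<Longrightarrow> \<eta> x \<le> norm (y - x) \<Longrightarrow> dker i x y = 0"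
  using eta_pos[of x] by (simp add: dker_def Let_def psi_supp Dpsi_eq_0)

lemma ker_nonneg: "x \<in> \<Omega> \<Longrightarrow> 0 \<le> ker x y"
  using eta_pos[of x] psi_nonneg by (simp add: ker_def)

lemma ker_le:
  assumes "x \<in> \<Omega>"
  shows "\<bar>ker x y\<bar> \<le> B / \<eta> x ^ DIM('a) * indicator (ball x (\<eta> x)) y"
proof (cases "norm (y - x) < \<eta> x")
  case True
  have "\<bar>\<psi> (norm (y - x) / \<eta> x)\<bar> / \<eta> x ^ DIM('a) \<le> B / \<eta> x ^ DIM('a)"
    using eta_pos[OF assms] by (intro divide_right_mono psi_bound) simp
  then show ?thesis using True eta_pos[OF assms] by (simp add: ker_def dist_norm norm_minus_commute)
next
  case False
  then show ?thesis using ker_eq_0[OF assms, of y] by (simp add: dist_norm norm_minus_commute)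
qed

text \<open>The velocity in \<open>dker\<close> has norm at most \<open>2 / \<eta> x\<close>, and
  the normalising power contributes the dimension; each carries a factor \<open>B\<close>.\<close>

definition "C_ker = (real DIM('a) + 2) * B"

lemma C_ker_nonneg: "0 \<le> C_ker" using B_nonneg by (simp add: C_ker_def)

lemma dker_le:
  assumes "i \<in> Basis" "x \<in> \<Omega>"
  shows "\<bar>dker i x y\<bar> \<le> C_ker / \<eta> x ^ Suc DIM('a) * indicator (ball x (\<eta> x)) y"
proof (cases "norm (y - x) < \<eta> x")
  case False
  then show ?thesis using dker_eq_0[OF assms(2), of y i] C_ker_nonneg eta_pos[OF assms(2)] by simp
next
  case True
  let ?z = "(1 / \<eta> x) *\<^sub>R (y - x)"
  let ?V = "- (\<eta>' i x / \<eta> x) *\<^sub>R ?z - (1 / \<eta> x) *\<^sub>R i"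
  have e: "0 < \<eta> x" by (rule eta_pos[OF assms(2)])
  have e': "\<bar>\<eta>' i x\<bar> \<le> 1" using eta'_le assms by blast
  have z: "norm ?z \<le> 1" using True e by simp
  have "norm ?V \<le> norm ((\<eta>' i x / \<eta> x) *\<^sub>R ?z) + norm ((1 / \<eta> x) *\<^sub>R i)"
    using norm_triangle_ineq4[of "- (\<eta>' i x / \<eta> x) *\<^sub>R ?z" "(1 / \<eta> x) *\<^sub>R i"] by (simp del: scaleR_scaleR)
  also have "norm ((\<eta>' i x / \<eta> x) *\<^sub>R ?z) = \<bar>\<eta>' i x\<bar> * norm ?z / \<eta> x" using e by (simp add: abs_mult)
  also have "\<bar>\<eta>' i x\<bar> * norm ?z / \<eta> x \<le> 1 / \<eta> x" using e e' z by (intro divide_right_mono mult_le_one) auto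
  also have "norm ((1 / \<eta> x) *\<^sub>R i) = 1 / \<eta> x" using e assms(1) by simp
  finally have V: "norm ?V \<le> 2 / \<eta> x" by simp
  have "\<bar>Dpsi ?z ?V / \<eta> x ^ DIM('a)\<bar> = \<bar>Dpsi ?z ?V\<bar> / \<eta> x ^ DIM('a)"
    by (simp only: abs_divide abs_of_pos[OF zero_less_power[OF e]])
  also have "\<dots> \<le> B * (2 / \<eta> x) / \<eta> x ^ DIM('a)"
    by (rule divide_right_mono[OF order_trans[OF Dpsi_le mult_left_mono[OF V B_nonneg]]]) (use e in simp)
  also have "\<dots> = 2 * B / \<eta> x ^ Suc DIM('a)" by simp
  finally have 1: "\<bar>Dpsi ?z ?V / \<eta> x ^ DIM('a)\<bar> \<le> 2 * B / \<eta> x ^ Suc DIM('a)" .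
  have "\<bar>real DIM('a) * \<psi> (norm ?z) * \<eta>' i x\<bar> \<le> real DIM('a) * B * 1"
    unfolding abs_mult using psi_bound(1)[of "norm ?z"] e' B_nonneg by (intro mult_mono) auto
  then have 2: "\<bar>real DIM('a) * \<psi> (norm ?z) * \<eta>' i x / \<eta> x ^ Suc DIM('a)\<bar> \<le> real DIM('a) * B / \<eta> x ^ Suc DIM('a)"
    unfolding abs_divide using e by (simp add: divide_right_mono)
  have "\<bar>dker i x y\<bar> \<le> 2 * B / \<eta> x ^ Suc DIM('a) + real DIM('a) * B / \<eta> x ^ Suc DIM('a)"
    unfolding dker_def Let_def using 1 2 by linarith
  also have "\<dots> = C_ker / \<eta> x ^ Suc DIM('a)"
    unfolding C_ker_def add_divide_distrib[symmetric] by (simp add: algebra_simps)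
  finally show ?thesis using True by (simp add: indicator_def dist_norm norm_minus_commute)
qed

lemma ker_deriv:
  assumes "i \<in> Basis" "x \<in> \<Omega>"
  shows "((\<lambda>t. ker (x + t *\<^sub>R i) y) has_real_derivative dker i x y) (at 0)"
proof -
  have e: "0 < \<eta> x" by (rule eta_pos[OF assms(2)])
  let ?h = "\<lambda>t. \<eta> (x + t *\<^sub>R i)"
  let ?Z = "\<lambda>t. (1 / ?h t) *\<^sub>R (y - (x + t *\<^sub>R i))"
  let ?z = "(1 / \<eta> x) *\<^sub>R (y - x)"
  let ?V = "- (\<eta>' i x / \<eta> x) *\<^sub>R ?z - (1 / \<eta> x) *\<^sub>R i"
  have h: "(?h has_real_derivative \<eta>' i x) (at 0)" by (rule eta_deriv[OF assms])
  have hinv: "((\<lambda>t. 1 / ?h t) has_real_derivative - (\<eta>' i x / (\<eta> x)\<^sup>2)) (at 0)"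
    using e by (auto intro!: derivative_eq_intros h simp: power2_eq_square)
  have "((\<lambda>t. y - (x + t *\<^sub>R i)) has_vector_derivative - i) (at 0)"
    by (auto intro!: derivative_eq_intros)
  from has_vector_derivative_scaleR[OF hinv this]
  have "(?Z has_vector_derivative (1 / ?h 0) *\<^sub>R (- i) + (- (\<eta>' i x / (\<eta> x)\<^sup>2)) *\<^sub>R (y - (x + 0 *\<^sub>R i))) (at 0)" .
  moreover have "(1 / ?h 0) *\<^sub>R (- i) + (- (\<eta>' i x / (\<eta> x)\<^sup>2)) *\<^sub>R (y - (x + 0 *\<^sub>R i)) = ?V"
    by (simp add: power2_eq_square)
  ultimately have Z: "(?Z has_vector_derivative ?V) (at 0)" by (simp only:)
  have "((\<lambda>t. \<psi> (norm (?Z t))) has_derivative (\<lambda>t. Dpsi ?z (t *\<^sub>R ?V))) (at 0)"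
    using has_derivative_compose[OF Z[unfolded has_vector_derivative_def], of "\<lambda>z. \<psi> (norm z)" "Dpsi ?z"]
      Dpsi_has_derivative[of ?z] by simp
  moreover have "Dpsi ?z (t *\<^sub>R ?V) = Dpsi ?z ?V * t" for t
    using has_derivative_linear[OF Dpsi_has_derivative[of ?z]] by (simp add: linear_cmul)
  ultimately have 1: "((\<lambda>t. \<psi> (norm (?Z t))) has_real_derivative Dpsi ?z ?V) (at 0)"
    by (simp add: has_field_derivative_def)
  have 2: "((\<lambda>t. (1 / ?h t) ^ DIM('a)) has_real_derivative real DIM('a) * (- (\<eta>' i x / (\<eta> x)\<^sup>2) * (1 / \<eta> x) ^ (DIM('a) - 1))) (at 0)"
    using DERIV_power[OF hinv, of "DIM('a)"] by simp
  have dd: "(1 / \<eta> x) ^ (DIM('a) - 1) / (\<eta> x)\<^sup>2 = 1 / \<eta> x ^ Suc DIM('a)"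
  proof -
    obtain d where d: "DIM('a) = Suc d" using DIM_positive not0_implies_Suc by blast
    show ?thesis using e by (simp add: d power_divide power2_eq_square)
  qed
  have d: "((\<lambda>t. \<psi> (norm (?Z t)) * (1 / ?h t) ^ DIM('a)) has_real_derivative dker i x y) (at 0)"
  proof -
    have "((\<lambda>t. \<psi> (norm (?Z t)) * (1 / ?h t) ^ DIM('a)) has_real_derivative
       Dpsi ?z ?V * (1 / \<eta> x) ^ DIM('a) + real DIM('a) * (- (\<eta>' i x / (\<eta> x)\<^sup>2) * (1 / \<eta> x) ^ (DIM('a) - 1)) * \<psi> (norm ?z)) (at 0)"
      using DERIV_mult[OF 1 2] by simp
    also have "Dpsi ?z ?V * (1 / \<eta> x) ^ DIM('a) + real DIM('a) * (- (\<eta>' i x / (\<eta> x)\<^sup>2) * (1 / \<eta> x) ^ (DIM('a) - 1)) * \<psi> (norm ?z)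
       = Dpsi ?z ?V * (1 / \<eta> x) ^ DIM('a) - real DIM('a) * \<eta>' i x * \<psi> (norm ?z) * ((1 / \<eta> x) ^ (DIM('a) - 1) / (\<eta> x)\<^sup>2)"
      by simp
    also have "\<dots> = dker i x y" unfolding dd by (simp add: dker_def Let_def power_divide)
    finally show ?thesis .
  qed
  \<comment> \<open>The two forms of the kernel agree where the width is positive, which continuity
    grants near \<open>t = 0\<close>.\<close>
  have ev: "\<forall>\<^sub>F t in nhds 0. \<psi> (norm (?Z t)) * (1 / ?h t) ^ DIM('a) = ker (x + t *\<^sub>R i) y"
  proof -
    have "(?h \<longlongrightarrow> \<eta> x) (nhds 0)" using DERIV_isCont[OF h] by (simp add: isCont_def tendsto_nhds_iff)
    then have "\<forall>\<^sub>F t in nhds 0. 0 < ?h t" using e by (rule order_tendstoD)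
    then show ?thesis
      by eventually_elim (simp add: ker_def power_divide norm_minus_commute)
  qed
  show ?thesis by (rule DERIV_cong_ev[OF refl ev refl, THEN iffD1, OF d])
qed

lemma ker_measurable[measurable]: "(\<lambda>p. ker (fst p) (snd p)) \<in> borel_measurable (lborel \<Otimes>\<^sub>M lborel)"
  unfolding ker_def by measurable

lemma ker_measurable2[measurable]: "(\<lambda>y. ker x y) \<in> borel_measurable borel"
  unfolding ker_def by measurable

lemma Dpsi_measurable[measurable (raw)]:
  assumes [measurable]: "f \<in> borel_measurable M" "g \<in> borel_measurable M"
  shows "(\<lambda>x. Dpsi (f x) (g x)) \<in> borel_measurable M"
  unfolding Dpsi_def sgn_div_norm by measurable

lemma dker_measurable:
  assumes "i \<in> Basis"
  shows "(\<lambda>p. dker i (fst p) (snd p)) \<in> borel_measurable (lborel \<Otimes>\<^sub>M lborel)"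
proof -
  note eta'_meas[OF assms, measurable]
  show ?thesis unfolding dker_def Let_def by measurable
qed

lemma dker_measurable2[measurable]: "(\<lambda>y. dker i x y) \<in> borel_measurable borel"
  unfolding dker_def Let_def by measurable

text \<open>The operator \<open>Kop\<close> for Borel functions, written over \<open>lborel\<close>,
  where measurability of parameter integrals is at hand; \<open>Kop_eq_KK\<close> relates the
  two.\<close>

definition Kc :: "('a \<Rightarrow> real) \<Rightarrow> 'a \<Rightarrow> real" where
  "Kc u x = (\<integral>y. indicator \<Omega> y * (ker x y * u y) \<partial>lborel)"

definition dKc :: "'a \<Rightarrow> ('a \<Rightarrow> real) \<Rightarrow> 'a \<Rightarrow> real" where
  "dKc i u x = (\<integral>y. indicator \<Omega> y * (dker i x y * u y) \<partial>lborel)"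

lemma Kc_measurable[measurable]:
  assumes [measurable]: "u \<in> borel_measurable borel"
  shows "Kc u \<in> borel_measurable borel"
proof -
  have "(\<lambda>x. \<integral>y. indicator \<Omega> y * (ker x y * u y) \<partial>lborel) \<in> borel_measurable lborel"
    by (rule lborel.borel_measurable_lebesgue_integral) (simp add: split_def)
  then show ?thesis by (simp add: Kc_def[abs_def])
qed

lemma dKc_measurable:
  assumes [measurable]: "u \<in> borel_measurable borel" and i: "i \<in> Basis"
  shows "dKc i u \<in> borel_measurable borel"
proof -
  note dker_measurable[OF i, measurable]
  have "(\<lambda>x. \<integral>y. indicator \<Omega> y * (dker i x y * u y) \<partial>lborel) \<in> borel_measurable lborel"
    by (rule lborel.borel_measurable_lebesgue_integral) (simp add: split_def)
  then show ?thesis by (simp add: dKc_def[abs_def])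
qed

lemma dom_finite: "emeasure lborel \<Omega> < \<infinity>"
  by (rule emeasure_bounded_finite[OF bounded_dom])

lemma integrable_const_dom: "integrable lborel (\<lambda>y. c * indicator \<Omega> y :: real)"
  using dom_finite by (intro integrable_mult_right integrable_real_indicator) auto

lemma integrable_ker:
  assumes [measurable]: "u \<in> borel_measurable borel" and u: "\<And>y. y \<in> \<Omega> \<Longrightarrow> \<bar>u y\<bar> \<le> C" and x: "x \<in> \<Omega>"
  shows "integrable lborel (\<lambda>y. indicator \<Omega> y * (ker x y * u y))"
proof (rule Bochner_Integration.integrable_bound[OF integrable_const_dom[of "B / \<eta> x ^ DIM('a) * C"]])
  have "\<bar>ker x y\<bar> \<le> B / \<eta> x ^ DIM('a)" for y
  proof (rule order_trans[OF ker_le[OF x]])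
    show "B / \<eta> x ^ DIM('a) * indicator (ball x (\<eta> x)) y \<le> B / \<eta> x ^ DIM('a)"
      using B_nonneg eta_pos[OF x] by (intro mult_left_le) (auto simp: indicator_def)
  qed
  then have "\<bar>ker x y * u y\<bar> \<le> B / \<eta> x ^ DIM('a) * C" if "y \<in> \<Omega>" for y
    unfolding abs_mult using u[OF that] B_nonneg eta_pos[OF x] by (intro mult_mono) auto
  then have "norm (indicator \<Omega> y * (ker x y * u y)) \<le> B / \<eta> x ^ DIM('a) * C * indicator \<Omega> y" for y
    by (cases "y \<in> \<Omega>") simp_all
  then show "AE y in lborel. norm (indicator \<Omega> y * (ker x y * u y)) \<le> norm (B / \<eta> x ^ DIM('a) * C * indicator \<Omega> y)"
    by (intro AE_I2) (rule order_trans, assumption, simp only: real_norm_def abs_ge_self)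
qed measurable

lemma integrable_dker:
  assumes [measurable]: "u \<in> borel_measurable borel" and u: "\<And>y. y \<in> \<Omega> \<Longrightarrow> \<bar>u y\<bar> \<le> C"
    and x: "x \<in> \<Omega>" and i: "i \<in> Basis"
  shows "integrable lborel (\<lambda>y. indicator \<Omega> y * (dker i x y * u y))"
proof (rule Bochner_Integration.integrable_bound[OF integrable_const_dom[of "C_ker / \<eta> x ^ Suc DIM('a) * C"]])
  have "\<bar>dker i x y\<bar> \<le> C_ker / \<eta> x ^ Suc DIM('a)" for y
  proof (rule order_trans[OF dker_le[OF i x]])
    show "C_ker / \<eta> x ^ Suc DIM('a) * indicator (ball x (\<eta> x)) y \<le> C_ker / \<eta> x ^ Suc DIM('a)"
      using C_ker_nonneg eta_pos[OF x] by (intro mult_left_le) (auto simp: indicator_def)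
  qed
  then have "\<bar>dker i x y * u y\<bar> \<le> C_ker / \<eta> x ^ Suc DIM('a) * C" if "y \<in> \<Omega>" for y
    unfolding abs_mult using u[OF that] C_ker_nonneg eta_pos[OF x] by (intro mult_mono) auto
  then have "norm (indicator \<Omega> y * (dker i x y * u y)) \<le> C_ker / \<eta> x ^ Suc DIM('a) * C * indicator \<Omega> y" for y
    by (cases "y \<in> \<Omega>") simp_all
  then show "AE y in lborel. norm (indicator \<Omega> y * (dker i x y * u y)) \<le> norm (C_ker / \<eta> x ^ Suc DIM('a) * C * indicator \<Omega> y)"
    by (intro AE_I2) (rule order_trans, assumption, simp only: real_norm_def abs_ge_self)
qed measurable

lemma Kc_deriv:
  assumes u[measurable]: "u \<in> borel_measurable borel" and ub: "\<And>y. y \<in> \<Omega> \<Longrightarrow> \<bar>u y\<bar> \<le> C"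
    and x: "x \<in> \<Omega>" and i: "i \<in> Basis"
  shows "((\<lambda>t. Kc u (x + t *\<^sub>R i)) has_real_derivative dKc i u x) (at 0)"
proof -
  obtain r where r: "0 < r" "cball x r \<subseteq> \<Omega>" using open_dom x open_contains_cball by blast
  \<comment> \<open>The width has a positive minimum on a compact ball around \<open>x\<close>. This
    bounds \<open>dker\<close> uniformly there and makes the kernel Lipschitz in its centre.\<close>
  obtain z where z: "z \<in> cball x r" "\<And>w. w \<in> cball x r \<Longrightarrow> \<eta> z \<le> \<eta> w"
    using continuous_attains_inf[OF compact_cball, of x r \<eta>] continuous_on_subset[OF eta_cont r(2)] r(1) by auto
  define m where "m = \<eta> z"
  have m: "0 < m" "\<And>w. w \<in> cball x r \<Longrightarrow> m \<le> \<eta> w" using z eta_pos r(2) by (auto simp: m_def)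
  define L where "L = C_ker / m ^ Suc DIM('a)"
  have L0: "0 \<le> L" using C_ker_nonneg m(1) by (simp add: L_def)
  have inb: "x + s *\<^sub>R i \<in> cball x r" if "\<bar>s\<bar> \<le> r" for s using that i by (simp add: dist_norm)
  have dk: "\<bar>dker i w y\<bar> \<le> L" if "w \<in> cball x r" for w y
  proof -
    have w: "w \<in> \<Omega>" using that r(2) by blast
    have "\<bar>dker i w y\<bar> \<le> C_ker / \<eta> w ^ Suc DIM('a) * indicator (ball w (\<eta> w)) y" by (rule dker_le[OF i w])
    also have "\<dots> \<le> C_ker / \<eta> w ^ Suc DIM('a)"
      using C_ker_nonneg eta_pos[OF w] by (intro mult_left_le) (auto simp: indicator_def)
    also have "\<dots> \<le> L" unfolding L_def
      using C_ker_nonneg m(1) m(2)[OF that] by (intro divide_left_mono power_mono) auto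
    finally show ?thesis .
  qed
  have lip: "\<bar>ker (x + t *\<^sub>R i) y - ker x y\<bar> \<le> L * \<bar>t\<bar>" if t: "\<bar>t\<bar> < r" for t y
  proof -
    have "norm (ker (x + t *\<^sub>R i) y - ker (x + 0 *\<^sub>R i) y) \<le> L * norm (t - 0)"
    proof (rule field_differentiable_bound[where S = "{-r..r}" and f' = "\<lambda>s. dker i (x + s *\<^sub>R i) y"])
      fix s assume s: "s \<in> {-r..r}"
      then have sb: "x + s *\<^sub>R i \<in> cball x r" by (intro inb) auto
      have "((\<lambda>t. ker ((x + s *\<^sub>R i) + (t - s) *\<^sub>R i) y) has_real_derivative dker i (x + s *\<^sub>R i) y * 1) (at s)"
        using ker_deriv[OF i, of "x + s *\<^sub>R i" y] sb r(2)
        by (intro DERIV_chain2[where g = "\<lambda>t. t - s"]) (auto intro!: derivative_eq_intros)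
      then have "((\<lambda>t. ker (x + t *\<^sub>R i) y) has_real_derivative dker i (x + s *\<^sub>R i) y) (at s)"
        by (simp add: algebra_simps)
      then show "((\<lambda>t. ker (x + t *\<^sub>R i) y) has_field_derivative dker i (x + s *\<^sub>R i) y) (at s within {-r..r})"
        by (rule has_field_derivative_at_within)
      show "norm (dker i (x + s *\<^sub>R i) y) \<le> L" using dk[OF sb] by simp
    qed (use t r in auto)
    then show ?thesis by simp
  qed
  have "((\<lambda>t. \<integral>y. indicator \<Omega> y * (ker (x + t *\<^sub>R i) y * u y) \<partial>lborel) has_real_derivative
      (\<integral>y. indicator \<Omega> y * (dker i x y * u y) \<partial>lborel)) (at 0)"
  proof (rule has_real_derivative_integral[OF r(1), where w = "\<lambda>y. L * \<bar>C\<bar> * indicator \<Omega> y"])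
    fix t :: real assume t: "\<bar>t\<bar> < r"
    then have "x + t *\<^sub>R i \<in> \<Omega>" using inb[of t] r(2) by auto
    then show "integrable lborel (\<lambda>y. indicator \<Omega> y * (ker (x + t *\<^sub>R i) y * u y))"
      by (intro integrable_ker[OF u ub])
    fix y
    show "\<bar>indicator \<Omega> y * (ker (x + t *\<^sub>R i) y * u y) - indicator \<Omega> y * (ker (x + 0 *\<^sub>R i) y * u y)\<bar>
         \<le> \<bar>t\<bar> * (L * \<bar>C\<bar> * indicator \<Omega> y)"
    proof (cases "y \<in> \<Omega>")
      case True
      have "\<bar>(ker (x + t *\<^sub>R i) y - ker x y) * u y\<bar> \<le> (L * \<bar>t\<bar>) * \<bar>C\<bar>"
        unfolding abs_mult using lip[OF t, of y] ub[OF True] L0 by (intro mult_mono) auto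
      then show ?thesis using True by (simp add: algebra_simps)
    qed simp
  next
    fix y
    show "((\<lambda>t. indicator \<Omega> y * (ker (x + t *\<^sub>R i) y * u y)) has_real_derivative indicator \<Omega> y * (dker i x y * u y)) (at 0)"
      by (intro DERIV_cmult DERIV_cmult_right ker_deriv[OF i x])
  qed (use integrable_const_dom in auto)
  then show ?thesis by (simp add: Kc_def dKc_def)
qed

lemma integrable_psi_norm:
  fixes g :: "'a \<Rightarrow> real"
  assumes [measurable]: "g \<in> borel_measurable borel" and g: "\<And>z. norm z \<le> 1 \<Longrightarrow> \<bar>g z\<bar> \<le> C"
  shows "integrable lborel (\<lambda>z. \<psi> (norm z) * g z)"
proof (rule Bochner_Integration.integrable_bound[where f = "\<lambda>z. B * C * indicator (cball 0 1) z"])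
  show "integrable lborel (\<lambda>z::'a. B * C * indicator (cball 0 1) z)"
    using emeasure_lborel_cball_finite by (intro integrable_mult_right integrable_real_indicator) auto
  have "\<bar>\<psi> (norm z) * g z\<bar> \<le> B * C" if "norm z \<le> 1" for z
    unfolding abs_mult using psi_bound(1)[of "norm z"] g[OF that] B_nonneg by (intro mult_mono) auto
  then have "norm (\<psi> (norm z) * g z) \<le> B * C * indicator (cball 0 1) z" for z
    using psi_supp(1)[of "norm z"] by (cases "norm z \<le> 1") simp_all
  then show "AE z in lborel. norm (\<psi> (norm z) * g z) \<le> norm (B * C * indicator (cball 0 1) z)"
    by (intro AE_I2) (rule order_trans, assumption, simp only: real_norm_def abs_ge_self)
qed measurable

text \<open>The kernel vanishes outside a ball contained in \<Omega>, so the restriction to \<Omega>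
  drops out and the substitution \<open>y = x + \<eta> x z\<close> applies.\<close>

lemma ker_scale:
  assumes x: "x \<in> \<Omega>" and [measurable]: "g \<in> borel_measurable borel"
  shows "(\<integral>y. indicator \<Omega> y * (ker x y * g y) \<partial>lborel) = (\<integral>z. \<psi> (norm z) * g (x + \<eta> x *\<^sub>R z) \<partial>lborel)"
proof -
  have e: "0 < \<eta> x" by (rule eta_pos[OF x])
  have "indicator \<Omega> y * (ker x y * g y) = ker x y * g y" for y
    using ker_eq_0[OF x, of y] eta_ball[OF x] by (cases "norm (y - x) < \<eta> x") (auto simp: indicator_def dist_norm norm_minus_commute)
  then have "(\<integral>y. indicator \<Omega> y * (ker x y * g y) \<partial>lborel) = (\<integral>y. ker x y * g y \<partial>lborel)" by presburger
  also have "\<dots> = \<bar>\<eta> x\<bar> ^ DIM('a) * (\<integral>z. ker x (x + \<eta> x *\<^sub>R z) * g (x + \<eta> x *\<^sub>R z) \<partial>lborel)"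
    using e by (intro integral_lborel_affine) auto
  also have "(\<integral>z. ker x (x + \<eta> x *\<^sub>R z) * g (x + \<eta> x *\<^sub>R z) \<partial>lborel) =
     (\<integral>z. (1 / \<eta> x ^ DIM('a)) * (\<psi> (norm z) * g (x + \<eta> x *\<^sub>R z)) \<partial>lborel)"
    using e by (intro Bochner_Integration.integral_cong) (auto simp: ker_def)
  finally show ?thesis using e by simp
qed

lemma Kc_1: "x \<in> \<Omega> \<Longrightarrow> Kc (\<lambda>_. 1) x = 1"
  using ker_scale[of x "\<lambda>_. 1"] psi_norm by (simp add: Kc_def)

lemma Kc_inner:
  assumes "x \<in> \<Omega>"
  shows "Kc (\<lambda>y. y \<bullet> b) x = x \<bullet> b"
proof -
  have i1: "integrable lborel (\<lambda>z::'a. \<psi> (norm z))" using integrable_psi_norm[of "\<lambda>_. 1" 1] by simp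
  have i2: "integrable lborel (\<lambda>z. \<psi> (norm z) * (z \<bullet> b))"
  proof (rule integrable_psi_norm[where C = "norm b"])
    fix z :: 'a assume "norm z \<le> 1"
    then have "norm z * norm b \<le> 1 * norm b" by (intro mult_right_mono) auto
    then show "\<bar>z \<bullet> b\<bar> \<le> norm b" using Cauchy_Schwarz_ineq2[of z b] by linarith
  qed simp
  \<comment> \<open>Reflection at the origin: the integrand is odd.\<close>
  have "(\<integral>z. \<psi> (norm z) * (z \<bullet> b) \<partial>lborel) = \<bar>-1\<bar> ^ DIM('a) * (\<integral>z. \<psi> (norm (0 + (-1) *\<^sub>R z)) * ((0 + (-1) *\<^sub>R z) \<bullet> b) \<partial>lborel)"
    by (rule integral_lborel_affine) auto
  then have odd: "(\<integral>z. \<psi> (norm z) * (z \<bullet> b) \<partial>lborel) = 0" by simp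
  have "Kc (\<lambda>y. y \<bullet> b) x = (\<integral>z. \<psi> (norm z) * ((x + \<eta> x *\<^sub>R z) \<bullet> b) \<partial>lborel)"
    unfolding Kc_def using assms by (rule ker_scale) simp
  also have "\<dots> = (\<integral>z. (x \<bullet> b) * \<psi> (norm z) + \<eta> x * (\<psi> (norm z) * (z \<bullet> b)) \<partial>lborel)"
    by (simp add: inner_add_left algebra_simps)
  also have "\<dots> = x \<bullet> b" using i1 i2 odd psi_norm by simp
  finally show ?thesis .
qed

text \<open>Constants are reproduced at every point, whatever the width is there, so differentiating
  the identity \<open>Kc_1\<close> gives zero.\<close>

lemma dKc_1:
  assumes x: "x \<in> \<Omega>" and i: "i \<in> Basis"
  shows "dKc i (\<lambda>_. 1) x = 0"
proof -
  have op: "open ((\<lambda>t. x + t *\<^sub>R i) -` \<Omega>)" by (intro open_vimage continuous_intros open_dom)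
  have z0: "0 \<in> (\<lambda>t. x + t *\<^sub>R i) -` \<Omega>" using x by simp
  have "((\<lambda>t. 1) has_real_derivative dKc i (\<lambda>_. 1) x) (at 0)"
    by (rule has_field_derivative_transform_within_open[OF Kc_deriv[of "\<lambda>_. 1" 1, OF _ _ x i] op z0]) (auto simp: Kc_1)
  then show ?thesis by (metis DERIV_unique DERIV_const)
qed

text \<open>Linear functions are reproduced as well, by symmetry of the radial kernel, so the
  variation of the width leaves no trace in the derivative.\<close>

lemma dKc_inner:
  assumes x: "x \<in> \<Omega>" and i: "i \<in> Basis"
  shows "dKc i (\<lambda>y. y \<bullet> b) x = i \<bullet> b"
proof -
  obtain R where R: "\<And>y. y \<in> \<Omega> \<Longrightarrow> norm y \<le> R" using bounded_dom bounded_iff by blast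
  have bd: "\<bar>y \<bullet> b\<bar> \<le> R * norm b" if "y \<in> \<Omega>" for y
    using Cauchy_Schwarz_ineq2[of y b] mult_right_mono[OF R[OF that], of "norm b"] by simp
  have op: "open ((\<lambda>t. x + t *\<^sub>R i) -` \<Omega>)" by (intro open_vimage continuous_intros open_dom)
  have z0: "0 \<in> (\<lambda>t. x + t *\<^sub>R i) -` \<Omega>" using x by simp
  have "((\<lambda>t. (x + t *\<^sub>R i) \<bullet> b) has_real_derivative dKc i (\<lambda>y. y \<bullet> b) x) (at 0)"
    by (rule has_field_derivative_transform_within_open[OF Kc_deriv[OF _ bd x i] op z0]) (auto simp: Kc_inner)
  moreover have "((\<lambda>t. (x + t *\<^sub>R i) \<bullet> b) has_real_derivative i \<bullet> b) (at 0)"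
    by (auto intro!: derivative_eq_intros simp: inner_add_left)
  ultimately show ?thesis by (rule DERIV_unique)
qed

lemma Kc_abs_le:
  assumes [measurable]: "u \<in> borel_measurable borel" and ub: "\<And>y. y \<in> \<Omega> \<Longrightarrow> \<bar>u y\<bar> \<le> C" and x: "x \<in> \<Omega>"
  shows "\<bar>Kc u x\<bar> \<le> C"
proof -
  have "\<bar>Kc u x\<bar> \<le> (\<integral>y. \<bar>indicator \<Omega> y * (ker x y * u y)\<bar> \<partial>lborel)"
    unfolding Kc_def by (rule integral_abs_bound)
  also have "\<dots> \<le> (\<integral>y. C * (indicator \<Omega> y * (ker x y * 1)) \<partial>lborel)"
  proof (rule integral_mono)
    show "integrable lborel (\<lambda>y. \<bar>indicator \<Omega> y * (ker x y * u y)\<bar>)"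
      using integrable_ker[OF _ ub x] by simp
    show "integrable lborel (\<lambda>y. C * (indicator \<Omega> y * (ker x y * 1)))"
      using integrable_ker[of "\<lambda>_. 1" 1, OF _ _ x] by simp
    fix y show "\<bar>indicator \<Omega> y * (ker x y * u y)\<bar> \<le> C * (indicator \<Omega> y * (ker x y * 1))"
      using ub[of y] ker_nonneg[OF x, of y] by (cases "y \<in> \<Omega>") (auto simp: abs_mult mult.commute[of C] intro: mult_left_mono)
  qed
  also have "\<dots> = C" using Kc_1[OF x] by (simp add: Kc_def)
  finally show ?thesis .
qed

text \<open>Because \<open>dKc\<close> kills constants, any \<open>c\<close> may be subtracted from
  \<open>u\<close>, and the derivative is controlled by the oscillation of \<open>u\<close> on one
  ball. The choice \<open>c = u x\<close> leads to the energy bound, an additional affine correction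
  to the Taylor estimate.\<close>

lemma dKc_abs_le:
  assumes [measurable]: "u \<in> borel_measurable borel" and ub: "\<And>y. y \<in> \<Omega> \<Longrightarrow> \<bar>u y\<bar> \<le> C"
    and x: "x \<in> \<Omega>" and i: "i \<in> Basis"
  shows "\<bar>dKc i u x\<bar> \<le> C_ker / \<eta> x ^ Suc DIM('a) * (\<integral>y. indicator (ball x (\<eta> x)) y * \<bar>u y - c\<bar> \<partial>lborel)"
proof -
  have i1: "integrable lborel (\<lambda>y. indicator \<Omega> y * (dker i x y * u y))" by (rule integrable_dker[OF _ ub x i]) simp_all
  have i2: "integrable lborel (\<lambda>y. indicator \<Omega> y * (dker i x y * 1))" by (rule integrable_dker[where C = 1, OF _ _ x i]) simp_all
  have ubc: "\<bar>u y - c\<bar> \<le> C + \<bar>c\<bar>" if "y \<in> \<Omega>" for y using ub[OF that] by linarith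
  have "dKc i u x = dKc i u x - c * dKc i (\<lambda>_. 1) x" using dKc_1[OF x i] by simp
  also have "\<dots> = (\<integral>y. indicator \<Omega> y * (dker i x y * u y) - c * (indicator \<Omega> y * (dker i x y * 1)) \<partial>lborel)"
    unfolding dKc_def using i1 i2 by simp
  also have "\<dots> = (\<integral>y. indicator \<Omega> y * (dker i x y * (u y - c)) \<partial>lborel)"
    by (intro Bochner_Integration.integral_cong) (auto simp: algebra_simps)
  also have "\<bar>\<dots>\<bar> \<le> (\<integral>y. \<bar>indicator \<Omega> y * (dker i x y * (u y - c))\<bar> \<partial>lborel)"
    by (rule integral_abs_bound)
  also have "\<dots> \<le> (\<integral>y. C_ker / \<eta> x ^ Suc DIM('a) * (indicator (ball x (\<eta> x)) y * \<bar>u y - c\<bar>) \<partial>lborel)"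
  proof (rule integral_mono)
    have j: "integrable lborel (\<lambda>y. indicator \<Omega> y * (dker i x y * (u y - c)))"
      by (rule integrable_dker[OF _ ubc x i]) simp_all
    then show "integrable lborel (\<lambda>y. \<bar>indicator \<Omega> y * (dker i x y * (u y - c))\<bar>)" by simp
    have "integrable lborel (\<lambda>y. indicator (ball x (\<eta> x)) y * \<bar>u y - c\<bar>)"
    proof (rule Bochner_Integration.integrable_bound[OF integrable_const_dom[of "C + \<bar>c\<bar>"]])
      have "norm (indicator (ball x (\<eta> x)) y * \<bar>u y - c\<bar>) \<le> (C + \<bar>c\<bar>) * indicator \<Omega> y" for y
        using ubc[of y] eta_ball[OF x] by (cases "y \<in> \<Omega>") (auto simp: indicator_def)
      then show "AE y in lborel. norm (indicator (ball x (\<eta> x)) y * \<bar>u y - c\<bar>) \<le> norm ((C + \<bar>c\<bar>) * indicator \<Omega> y)"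
        by (intro AE_I2) (rule order_trans, assumption, simp only: real_norm_def abs_ge_self)
    qed (intro borel_measurable_times borel_measurable_indicator, auto)
    then show "integrable lborel (\<lambda>y. C_ker / \<eta> x ^ Suc DIM('a) * (indicator (ball x (\<eta> x)) y * \<bar>u y - c\<bar>))" by simp
    fix y
    have "\<bar>indicator \<Omega> y * (dker i x y * (u y - c))\<bar> \<le> \<bar>dker i x y\<bar> * \<bar>u y - c\<bar>"
      by (simp add: indicator_def abs_mult)
    also have "\<dots> \<le> (C_ker / \<eta> x ^ Suc DIM('a) * indicator (ball x (\<eta> x)) y) * \<bar>u y - c\<bar>"
      by (intro mult_right_mono dker_le[OF i x]) simp
    finally show "\<bar>indicator \<Omega> y * (dker i x y * (u y - c))\<bar> \<le> C_ker / \<eta> x ^ Suc DIM('a) * (indicator (ball x (\<eta> x)) y * \<bar>u y - c\<bar>)"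
      by (simp add: mult.assoc)
  qed
  finally show ?thesis by simp
qed

lemma integral_ball_le:
  assumes x: "x \<in> \<Omega>" and [measurable]: "h \<in> borel_measurable borel"
    and h: "\<And>y. y \<in> ball x (\<eta> x) \<Longrightarrow> \<bar>h y\<bar> \<le> K"
  shows "(\<integral>y. indicator (ball x (\<eta> x)) y * \<bar>h y\<bar> \<partial>lborel) \<le> K * unit_ball_vol (real DIM('a)) * \<eta> x ^ DIM('a)"
proof -
  have fin: "integrable lborel (\<lambda>y. K * indicator (ball x (\<eta> x)) y)"
    using emeasure_lborel_ball_finite by (intro integrable_mult_right integrable_real_indicator) auto
  have "(\<integral>y. indicator (ball x (\<eta> x)) y * \<bar>h y\<bar> \<partial>lborel) \<le> (\<integral>y. K * indicator (ball x (\<eta> x)) y \<partial>lborel)"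
  proof (rule integral_mono[OF _ fin])
    show "integrable lborel (\<lambda>y. indicator (ball x (\<eta> x)) y * \<bar>h y\<bar>)"
      by (rule Bochner_Integration.integrable_bound[OF fin])
         (auto simp: indicator_def intro!: AE_I2 order_trans[OF h])
  qed (use h in \<open>auto simp: indicator_def\<close>)
  also have "\<dots> = K * unit_ball_vol (real DIM('a)) * \<eta> x ^ DIM('a)"
    using eta_pos[OF x] by (simp add: content_ball)
  finally show ?thesis .
qed

text \<open>Subtracting the affine part, on which the derivative is exact by
  \<open>dKc_inner\<close>, leaves an oscillation of size \<open>e * \<eta> x\<close>. The powers of
  the width then cancel against the volume of the ball, so the bound is independent of the
  width.\<close>

lemma dKc_taylor:
  assumes u[measurable]: "u \<in> borel_measurable borel" and ub: "\<And>y. y \<in> \<Omega> \<Longrightarrow> \<bar>u y\<bar> \<le> C"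
    and x: "x \<in> \<Omega>" and i: "i \<in> Basis"
    and tay: "\<And>y. y \<in> ball x (\<eta> x) \<Longrightarrow> \<bar>u y - u x - a \<bullet> (y - x)\<bar> \<le> e * norm (y - x)" and e: "0 \<le> e"
  shows "\<bar>dKc i u x - a \<bullet> i\<bar> \<le> C_ker * unit_ball_vol (real DIM('a)) * e"
proof -
  obtain R where R: "\<And>y. y \<in> \<Omega> \<Longrightarrow> norm y \<le> R" using bounded_dom bounded_iff by blast
  have bd: "\<bar>y \<bullet> a\<bar> \<le> R * norm a" if "y \<in> \<Omega>" for y
    using Cauchy_Schwarz_ineq2[of y a] mult_right_mono[OF R[OF that], of "norm a"] by simp
  have bd2: "\<bar>u y - y \<bullet> a\<bar> \<le> C + R * norm a" if "y \<in> \<Omega>" for y using bd[OF that] ub[OF that] by linarith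
  have "dKc i u x - a \<bullet> i = dKc i u x - dKc i (\<lambda>y. y \<bullet> a) x" using dKc_inner[OF x i, of a] by (simp only: inner_commute[of a i])
  also have "\<dots> = dKc i (\<lambda>y. u y - y \<bullet> a) x"
    unfolding dKc_def using integrable_dker[OF u ub x i] integrable_dker[OF _ bd x i]
    by (subst Bochner_Integration.integral_diff[symmetric]) (auto simp: right_diff_distrib)
  also have "\<bar>\<dots>\<bar> \<le> C_ker / \<eta> x ^ Suc DIM('a) * (\<integral>y. indicator (ball x (\<eta> x)) y * \<bar>(u y - y \<bullet> a) - (u x - x \<bullet> a)\<bar> \<partial>lborel)"
    by (rule dKc_abs_le[OF _ bd2 x i]) simp_all
  also have "\<dots> \<le> C_ker / \<eta> x ^ Suc DIM('a) * ((e * \<eta> x) * unit_ball_vol (real DIM('a)) * \<eta> x ^ DIM('a))"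
  proof (intro mult_left_mono integral_ball_le[OF x])
    fix y assume y: "y \<in> ball x (\<eta> x)"
    have "(u y - y \<bullet> a) - (u x - x \<bullet> a) = u y - u x - a \<bullet> (y - x)" by (simp add: inner_diff_right inner_commute)
    moreover have "e * norm (y - x) \<le> e * \<eta> x" using y e by (intro mult_left_mono) (auto simp: dist_norm norm_minus_commute)
    ultimately show "\<bar>(u y - y \<bullet> a) - (u x - x \<bullet> a)\<bar> \<le> e * \<eta> x" using tay[OF y] by linarith
  qed (use C_ker_nonneg eta_pos[OF x] in auto)
  also have "\<dots> = C_ker * unit_ball_vol (real DIM('a)) * e" using eta_pos[OF x] by simp
  finally show ?thesis .
qed

lemma Kc_near:
  assumes u[measurable]: "u \<in> borel_measurable borel" and ub: "\<And>y. y \<in> \<Omega> \<Longrightarrow> \<bar>u y\<bar> \<le> C"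
    and x: "x \<in> \<Omega>" and near: "\<And>y. y \<in> ball x (\<eta> x) \<Longrightarrow> \<bar>u y - c\<bar> \<le> e" and e: "0 \<le> e"
  shows "\<bar>Kc u x - c\<bar> \<le> e"
proof -
  \<comment> \<open>Cutting off outside the ball does not change the mollification at
    \<open>x\<close> and turns the local bound into a global one.\<close>
  let ?v = "\<lambda>y. indicator (ball x (\<eta> x)) y * (u y - c)"
  have "Kc u x - c = Kc u x - c * Kc (\<lambda>_. 1) x" using Kc_1[OF x] by simp
  also have "\<dots> = (\<integral>y. indicator \<Omega> y * (ker x y * u y) - c * (indicator \<Omega> y * (ker x y * 1)) \<partial>lborel)"
    unfolding Kc_def using integrable_ker[OF u ub x] integrable_ker[of "\<lambda>_. 1" 1, OF _ _ x] by simp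
  also have "\<dots> = (\<integral>y. indicator \<Omega> y * (ker x y * (u y - c)) \<partial>lborel)"
    by (intro Bochner_Integration.integral_cong) (auto simp: algebra_simps)
  also have "\<dots> = Kc ?v x"
    unfolding Kc_def using ker_eq_0[OF x] by (intro Bochner_Integration.integral_cong) (auto simp: indicator_def dist_norm norm_minus_commute not_less)
  also have "\<bar>\<dots>\<bar> \<le> e"
    by (rule Kc_abs_le[OF _ _ x]) (use near e in \<open>auto simp: indicator_def\<close>)
  finally show ?thesis .
qed

definition grad_Kc :: "('a \<Rightarrow> real) \<Rightarrow> 'a \<Rightarrow> 'a" where
  "grad_Kc u x = (\<Sum>i\<in>Basis. dKc i u x *\<^sub>R i)"

lemma grad_Kc_inner: "i \<in> Basis \<Longrightarrow> grad_Kc u x \<bullet> i = dKc i u x"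
  unfolding grad_Kc_def by (rule inner_sum_left_Basis)

lemma grad_Kc_measurable: "u \<in> borel_measurable borel \<Longrightarrow> grad_Kc u \<in> borel_measurable borel"
  unfolding grad_Kc_def[abs_def] by (intro borel_measurable_sum borel_measurable_scaleR dKc_measurable) auto

lemma Kc_is_weak_grad:
  assumes u[measurable]: "u \<in> borel_measurable borel" and ub: "\<And>y. \<bar>u y\<bar> \<le> C"
  shows "is_weak_grad \<Omega> (Kc u) (grad_Kc u)"
  unfolding is_weak_grad_def
proof (intro conjI allI impI ballI)
  show "grad_Kc u \<in> borel_measurable (lebesgue_on \<Omega>)"
    by (intro borel_measurable_lebesgue_on_borel grad_Kc_measurable u)
  fix \<phi> and i :: 'a assume phi: "test_fun \<Omega> \<phi>" and i: "i \<in> Basis"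
  have "(\<integral>x. Kc u x * frechet_derivative \<phi> (at x) i \<partial>lebesgue_on \<Omega>) = - (\<integral>x. dKc i u x * \<phi> x \<partial>lebesgue_on \<Omega>)"
  proof (rule directional_integration_by_parts[OF open_dom open_dom subset_refl Kc_measurable[OF u] phi i])
    show "((\<lambda>t. Kc u (x + t *\<^sub>R i)) has_real_derivative dKc i u x) (at 0)" if "x \<in> \<Omega>" for x
      by (rule Kc_deriv[OF u ub that i])
    show "dKc i u \<in> borel_measurable borel" by (rule dKc_measurable[OF u i])
    fix S assume S: "compact S" "S \<subseteq> \<Omega>"
    show "\<exists>K. \<forall>x\<in>S. \<bar>Kc u x\<bar> \<le> K \<and> \<bar>dKc i u x\<bar> \<le> K"
    proof (cases "S = {}")
      case False
      \<comment> \<open>On a compact subset the width stays away from zero, so the factor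
        \<open>1 / \<eta> x\<close> in the derivative bound is harmless there.\<close>
      obtain z where z: "z \<in> S" "\<And>w. w \<in> S \<Longrightarrow> \<eta> z \<le> \<eta> w"
        using continuous_attains_inf[OF S(1) False continuous_on_subset[OF eta_cont S(2)]] by auto
      have z0: "0 < \<eta> z" using z S eta_pos by blast
      define K where "K = C_ker * C * unit_ball_vol (real DIM('a))"
      have C0: "0 \<le> C" using ub[of 0] by linarith
      have K0: "0 \<le> K" using C_ker_nonneg C0 by (simp add: K_def)
      have "\<bar>dKc i u x\<bar> \<le> K / \<eta> z" if xS: "x \<in> S" for x
      proof -
        have x: "x \<in> \<Omega>" using xS S by blast
        have "\<bar>dKc i u x\<bar> \<le> C_ker / \<eta> x ^ Suc DIM('a) * (\<integral>y. indicator (ball x (\<eta> x)) y * \<bar>u y - 0\<bar> \<partial>lborel)"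
          by (rule dKc_abs_le[OF u ub x i])
        also have "\<dots> \<le> C_ker / \<eta> x ^ Suc DIM('a) * (C * unit_ball_vol (real DIM('a)) * \<eta> x ^ DIM('a))"
          using C_ker_nonneg eta_pos[OF x] ub by (intro mult_left_mono integral_ball_le[OF x]) auto
        also have "\<dots> = K / \<eta> x" using eta_pos[OF x] by (simp add: K_def)
        also have "\<dots> \<le> K / \<eta> z" using K0 z0 z(2)[OF xS] by (intro divide_left_mono) auto
        finally show ?thesis .
      qed
      moreover have "\<bar>Kc u x\<bar> \<le> C" if "x \<in> S" for x
        by (rule Kc_abs_le[OF u ub]) (use that S(2) in blast)
      moreover have "0 \<le> K / \<eta> z" using K0 z0 by simp
      ultimately have "\<forall>x\<in>S. \<bar>Kc u x\<bar> \<le> C + K / \<eta> z \<and> \<bar>dKc i u x\<bar> \<le> C + K / \<eta> z"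
        using C0 by (meson add_increasing add_increasing2)
      then show ?thesis by blast
    qed simp
  qed
  then show "(\<integral>x. Kc u x * frechet_derivative \<phi> (at x) i \<partial>lebesgue_on \<Omega>) = - (\<integral>x. (grad_Kc u x \<bullet> i) * \<phi> x \<partial>lebesgue_on \<Omega>)"
    using grad_Kc_inner[OF i] by simp
qed

end

section \<open>Gradient bound by the nonlocal energy\<close>

text \<open>Jensen's inequality up to the factor \<open>2 powr p\<close>. It comes from the
  pointwise bound \<open>f \<le> a + a^(1-p) f^p\<close>, integrated with the value of
  \<open>a\<close> for which both terms on the right have the same integral.\<close>

lemma integral_powr_le_Jensen:
  fixes f :: "'a \<Rightarrow> real"
  assumes p: "1 < p" and M: "finite_measure M" and [measurable]: "f \<in> borel_measurable M"
    and f0: "\<And>x. 0 \<le> f x" and fb: "\<And>x. f x \<le> C"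
  shows "(\<integral>x. f x \<partial>M) powr p \<le> 2 powr p * measure M (space M) powr (p - 1) * (\<integral>x. f x powr p \<partial>M)"
proof -
  interpret finite_measure M by (rule M)
  let ?m = "measure M (space M)" and ?I = "\<integral>x. f x powr p \<partial>M"
  have fi: "integrable M f"
    by (rule integrable_const_bound[where B = C]) (use f0 fb in auto)
  have fpi: "integrable M (\<lambda>x. f x powr p)"
    by (rule integrable_const_bound[where B = "C powr p"]) (use f0 fb p in \<open>auto intro!: powr_mono2\<close>)
  have I0: "0 \<le> ?I" by (intro integral_nonneg_AE) simp
  show ?thesis
  proof (cases "?I = 0")
    case True
    then have "AE x in M. f x powr p = 0"
      using integral_nonneg_eq_0_iff_AE[OF fpi] by simp
    then have "AE x in M. f x = 0" by eventually_elim simp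
    then have "(\<integral>x. f x \<partial>M) = 0" by (rule integral_eq_zero_AE)
    then show ?thesis using p I0 by simp
  next
    case False
    then have I: "0 < ?I" using I0 by linarith
    have m: "0 < ?m"
    proof (rule ccontr)
      assume "\<not> 0 < ?m"
      then have "?m = 0" using measure_nonneg[of M "space M"] by linarith
      then have "emeasure M (space M) = 0" by (simp add: emeasure_eq_measure)
      then have "AE x in M. f x powr p = 0" by (intro AE_I[of _ _ "space M"]) auto
      then show False using False by (simp add: integral_eq_zero_AE)
    qed
    define a where "a = (?I / ?m) powr (1 / p)"
    have a: "0 < a" using I m by (simp add: a_def)
    have ap: "a powr p = ?I / ?m" using I m p by (simp add: a_def powr_powr)
    have le: "f x \<le> a + a powr (1 - p) * f x powr p" for x
    proof (cases "f x \<le> a")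
      case True
      then show ?thesis by (simp add: add_increasing2)
    next
      case False
      then have fx: "0 < f x" using a by linarith
      have "f x powr (1 - p) \<le> a powr (1 - p)"
        using False a p by (intro powr_mono2') auto
      then have "f x powr (1 - p) * f x powr p \<le> a powr (1 - p) * f x powr p" by (intro mult_right_mono) auto
      moreover have "f x powr (1 - p) * f x powr p = f x" using fx by (simp add: powr_add[symmetric])
      ultimately show ?thesis using a by linarith
    qed
    have "(\<integral>x. f x \<partial>M) \<le> (\<integral>x. a + a powr (1 - p) * f x powr p \<partial>M)"
      using fi fpi le by (intro integral_mono) auto
    also have "\<dots> = a * ?m + a powr (1 - p) * ?I" using fpi by (simp add: mult.commute)
    also have "a powr (1 - p) * ?I = a * ?m"
    proof -
      have "a powr (1 - p) = a / (?I / ?m)" using a ap by (simp add: powr_diff)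
      then show ?thesis using I m by simp
    qed
    finally have "(\<integral>x. f x \<partial>M) powr p \<le> (2 * (a * ?m)) powr p"
      using p f0 by (intro powr_mono2) (auto intro: integral_nonneg_AE)
    also have "\<dots> = 2 powr p * (a powr p * ?m powr p)" using a m by (simp add: powr_mult)
    also have "a powr p * ?m powr p = ?I * ?m powr (p - 1)" using ap m by (simp add: powr_diff)
    finally show ?thesis by (simp add: mult_ac)
  qed
qed

lemma powr_uminus_eq: "0 < a \<Longrightarrow> a powr (- s) = (1 / a) powr (s :: real)"
  by (simp add: powr_minus_divide powr_divide)

text \<open>The width varies by at most a tenth over its own ball. This makes \<open>x\<close> and
  \<open>y\<close> interchangeable in the energies up to fixed factors, since
  \<open>9/10 \<eta> x \<le> \<eta> y \<le> 11/10 \<eta> x\<close>.\<close>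

locale collar_kernel_lip = collar_kernel +
  assumes eta_comp: "\<And>x y. x \<in> \<Omega> \<Longrightarrow> norm (y - x) < \<eta> x \<Longrightarrow> \<bar>\<eta> y - \<eta> x\<bar> \<le> \<eta> x / 10"
begin

definition near :: "real \<Rightarrow> 'a \<Rightarrow> 'a \<Rightarrow> ennreal" where
  "near r x y = (if x \<in> \<Omega> \<and> norm (y - x) < r * \<eta> x then 1 else 0)"

definition qdiff :: "real \<Rightarrow> ('a \<Rightarrow> real) \<Rightarrow> 'a \<Rightarrow> 'a \<Rightarrow> ennreal" where
  "qdiff p u x y = ennreal (\<eta> x powr (- (real DIM('a) + p)) * \<bar>u x - u y\<bar> powr p)"

text \<open>A model energy: only differences within the fraction \<open>r\<close> of the width
  count, and the weight has no singularity on the diagonal.\<close>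

definition Qen :: "real \<Rightarrow> ('a \<Rightarrow> real) \<Rightarrow> real \<Rightarrow> ennreal" where
  "Qen p u r = (\<integral>\<^sup>+x. (\<integral>\<^sup>+y. near r x y * qdiff p u x y \<partial>lborel) \<partial>lborel)"

lemma near_measurable[measurable]:
  "(\<lambda>z. near r (fst z) (snd z)) \<in> borel_measurable (borel \<Otimes>\<^sub>M borel)"
  unfolding near_def by measurable

lemma near_measurable'[measurable (raw)]:
  assumes [measurable]: "f \<in> borel_measurable M" "g \<in> borel_measurable M"
  shows "(\<lambda>z. near r (f z) (g z)) \<in> borel_measurable M"
  unfolding near_def by measurable

lemma qdiff_measurable[measurable (raw)]:
  assumes [measurable]: "u \<in> borel_measurable borel" "f \<in> borel_measurable M" "g \<in> borel_measurable M"
  shows "(\<lambda>z. qdiff p u (f z) (g z)) \<in> borel_measurable M"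
  unfolding qdiff_def by measurable

lemma nn_integral_near:
  assumes "x \<in> \<Omega>" "0 \<le> r"
  shows "(\<integral>\<^sup>+y. near r x y \<partial>lborel) = ennreal (unit_ball_vol (real DIM('a)) * (r * \<eta> x) ^ DIM('a))"
proof -
  have "near r x y = indicator (ball x (r * \<eta> x)) y" for y
    using assms by (simp add: near_def indicator_def dist_norm norm_minus_commute)
  then show ?thesis using assms eta_pos[OF assms(1)] by (simp add: emeasure_ball)
qed

lemma nn_integral_near_le:
  assumes "0 \<le> r"
  shows "ennreal (1 / \<eta> x ^ DIM('a)) * (\<integral>\<^sup>+y. near r x y \<partial>lborel) \<le> ennreal (unit_ball_vol (real DIM('a)) * r ^ DIM('a))"
proof (cases "x \<in> \<Omega>")
  case True
  have "1 / \<eta> x ^ DIM('a) * (unit_ball_vol (real DIM('a)) * (r * \<eta> x) ^ DIM('a)) = unit_ball_vol (real DIM('a)) * r ^ DIM('a)"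
    using eta_pos[OF True] by (simp add: power_mult_distrib)
  then show ?thesis using assms eta_pos[OF True]
    unfolding nn_integral_near[OF True assms] by (subst ennreal_mult[symmetric]) simp_all
next
  case False
  then show ?thesis by (simp add: near_def)
qed

text \<open>The factors stem from the triangle inequality (\<open>2 powr p\<close>), from exchanging
  the widths at \<open>x\<close> and \<open>y\<close> in the weights (powers of
  \<open>11 / 10\<close>), from the averaging ball of radius \<open>r / 8\<close> (the power of 8),
  and from the two volumes that are integrated out (the sum).\<close>

definition "Q_step p = 2 powr p * (11 / 10) powr (2 * real DIM('a) + p) * 8 ^ DIM('a) * (1 + (10 / 9) ^ DIM('a))"

lemma Q_step_pos: "0 < Q_step p" by (simp add: Q_step_def add_pos_pos)

lemma near_le_near: "near r x y \<le> near s x y" if "r \<le> s"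
proof -
  have "r * \<eta> x \<le> s * \<eta> x" if "x \<in> \<Omega>" using eta_pos[OF that] \<open>r \<le> s\<close> by simp
  then show ?thesis by (auto simp: near_def)
qed

lemma near_swap:
  assumes "near r x y \<noteq> 0" "r \<le> 1"
  shows "near (r * (10 / 9)) y x = 1" "y \<in> \<Omega>" "\<eta> x \<le> 10 / 9 * \<eta> y" "\<eta> y \<le> 11 / 10 * \<eta> x"
proof -
  have x: "x \<in> \<Omega>" and n: "norm (y - x) < r * \<eta> x" using assms(1) by (auto simp: near_def split: if_splits)
  have e: "0 < \<eta> x" by (rule eta_pos[OF x])
  have "r * \<eta> x \<le> 1 * \<eta> x" using assms(2) e by (intro mult_right_mono) auto
  then have n1: "norm (y - x) < \<eta> x" using n by linarith
  then show y: "y \<in> \<Omega>" using eta_ball[OF x] by (auto simp: dist_norm norm_minus_commute)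
  have c: "\<bar>\<eta> y - \<eta> x\<bar> \<le> \<eta> x / 10" by (rule eta_comp[OF x n1])
  then show 1: "\<eta> x \<le> 10 / 9 * \<eta> y" "\<eta> y \<le> 11 / 10 * \<eta> x" by linarith+
  have r: "0 < r" using n e by (smt (verit) norm_ge_zero zero_less_mult_pos2)
  have "r * \<eta> x \<le> r * (10 / 9 * \<eta> y)" using r 1 by (intro mult_left_mono) auto
  then have "norm (x - y) < r * (10 / 9) * \<eta> y" using n by (simp add: norm_minus_commute mult.assoc)
  then show "near (r * (10 / 9)) y x = 1" using y by (simp add: near_def)
qed

text \<open>A difference at range \<open>r\<close> is split at a third point \<open>z\<close> near
  the midpoint, the estimate is averaged over such \<open>z\<close>, and in each half the endpoint
  that no longer occurs in the difference is integrated out.\<close>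

lemma Qen_step:
  assumes p: "1 < p" and r: "0 < r" "r \<le> 1" and u[measurable]: "u \<in> borel_measurable borel"
  shows "Qen p u r \<le> ennreal (Q_step p) * Qen p u (3 / 4 * r)"
proof -
  let ?d = "real DIM('a)" and ?w = "unit_ball_vol (real DIM('a))" and ?s = "3 / 4 * r"
  have w: "0 < ?w" by (simp add: unit_ball_vol_pos)
  define c where "c = 1 / (?w * (r / 8) ^ DIM('a))"
  define K where "K = c * (2 powr p * (11 / 10) powr (2 * ?d + p))"
  have c0: "0 < c" using w r by (simp add: c_def)
  have K0: "0 < K" using c0 by (simp add: K_def)
  let ?e = "\<lambda>x. ennreal (1 / \<eta> x ^ DIM('a))"
  let ?T = "\<lambda>x y z. ennreal K * (?e x * near r x y * (near ?s x z * qdiff p u x z) + ?e y * near (r * (10 / 9)) y x * (near ?s y z * qdiff p u y z))"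
  have pt: "near r x y * qdiff p u x y \<le> (\<integral>\<^sup>+z. ?T x y z \<partial>lborel)" for x y
  proof (cases "near r x y = 0")
    case False
    have x: "x \<in> \<Omega>" and n: "norm (y - x) < r * \<eta> x" and n1: "near r x y = 1"
      using False by (auto simp: near_def split: if_splits)
    note sw = near_swap[OF False r(2)]
    have e: "0 < \<eta> x" and ey: "0 < \<eta> y" using eta_pos[OF x] eta_pos[OF sw(2)] by auto
    \<comment> \<open>From any point of this ball both endpoints lie within
      \<open>1/2 + 1/8 = 5/8\<close> of \<open>r * \<eta> x\<close>. Measured by
      \<open>\<eta> y\<close> this becomes at most \<open>5/8 * 10/9 = 25/36 < 3/4\<close>, so one
      smaller range serves both halves.\<close>
    let ?m = "(1 / 2) *\<^sub>R (x + y)" and ?R = "r / 8 * \<eta> x"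
    let ?q = "\<eta> x powr (- (?d + p)) * \<bar>u x - u y\<bar> powr p"
    have R: "0 < ?R" using r e by simp
    have pz: "ennreal (c * (1 / \<eta> x ^ DIM('a)) * ?q) * indicator (ball ?m ?R) z \<le> ?T x y z" for z
    proof (cases "z \<in> ball ?m ?R")
      case True
      have zm: "norm (z - ?m) < ?R" using True by (simp add: dist_norm norm_minus_commute)
      have "z - x = (z - ?m) + (1 / 2) *\<^sub>R (y - x)" by (simp add: algebra_simps flip: scaleR_add_left)
      then have "norm (z - x) \<le> norm (z - ?m) + norm ((1 / 2) *\<^sub>R (y - x))" by (metis norm_triangle_ineq)
      then have zx: "norm (z - x) < 5 / 8 * (r * \<eta> x)" using zm n by simp
      have "z - y = (z - ?m) + (1 / 2) *\<^sub>R (x - y)" by (simp add: algebra_simps flip: scaleR_add_left)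
      then have "norm (z - y) \<le> norm (z - ?m) + norm ((1 / 2) *\<^sub>R (x - y))" by (metis norm_triangle_ineq)
      then have zy: "norm (z - y) < 5 / 8 * (r * \<eta> x)" using zm n by (simp add: norm_minus_commute)
      have "0 < r * \<eta> x" using e r by simp
      then have "norm (z - x) < ?s * \<eta> x" using zx unfolding mult.assoc by linarith
      then have nx: "near ?s x z = 1" using x by (simp add: near_def)
      have "5 / 8 * (r * \<eta> x) \<le> 5 / 8 * (r * (10 / 9 * \<eta> y))" using sw(3) r by (intro mult_left_mono) auto
      also have "\<dots> \<le> ?s * \<eta> y" using ey r by simp
      finally have ny: "near ?s y z = 1" using zy sw(2) by (simp add: near_def)
      have exy: "1 / \<eta> x \<le> 11 / 10 * (1 / \<eta> y)" using sw(4) e ey by (simp add: field_simps)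
      have e1: "1 / \<eta> x ^ DIM('a) \<le> (11 / 10) powr ?d * (1 / \<eta> y ^ DIM('a))"
      proof -
        have "(1 / \<eta> x) ^ DIM('a) \<le> (11 / 10 * (1 / \<eta> y)) ^ DIM('a)" using exy e by (intro power_mono) auto
        also have "\<dots> = (11 / 10) ^ DIM('a) * (1 / \<eta> y ^ DIM('a))"
          by (simp only: power_mult_distrib power_divide power_one)
        also have "(11 / 10 :: real) ^ DIM('a) = (11 / 10) powr ?d" by (simp add: powr_realpow)
        finally show ?thesis by (simp add: power_divide)
      qed
      have e2: "\<eta> x powr (- (?d + p)) \<le> (11 / 10) powr (?d + p) * \<eta> y powr (- (?d + p))"
      proof -
        have "\<eta> x powr (- (?d + p)) = (1 / \<eta> x) powr (?d + p)" by (rule powr_uminus_eq[OF e])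
        also have "\<dots> \<le> (11 / 10 * (1 / \<eta> y)) powr (?d + p)" using exy e p by (intro powr_mono2) auto
        also have "\<dots> = (11 / 10) powr (?d + p) * (1 / \<eta> y) powr (?d + p)" by (rule powr_mult)
        also have "(1 / \<eta> y) powr (?d + p) = \<eta> y powr (- (?d + p))" by (rule powr_uminus_eq[OF ey, symmetric])
        finally show ?thesis .
      qed
      define A where "A = (1 / \<eta> x ^ DIM('a)) * (\<eta> x powr (- (?d + p)) * \<bar>u x - u z\<bar> powr p)"
      define B' where "B' = (1 / \<eta> y ^ DIM('a)) * (\<eta> y powr (- (?d + p)) * \<bar>u y - u z\<bar> powr p)"
      have A0: "0 \<le> A" and B0: "0 \<le> B'" using e ey by (simp_all add: A_def B'_def)
      let ?g = "(11 / 10 :: real) powr (2 * ?d + p)"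
      have g1: "1 \<le> ?g" using p by (intro ge_one_powr_ge_zero) auto
      have "(1 / \<eta> x ^ DIM('a)) * (\<eta> x powr (- (?d + p)) * \<bar>u z - u y\<bar> powr p) \<le>
         ((11 / 10) powr ?d * (1 / \<eta> y ^ DIM('a))) * (((11 / 10) powr (?d + p) * \<eta> y powr (- (?d + p))) * \<bar>u z - u y\<bar> powr p)"
        using e1 e2 e ey by (intro mult_mono) auto
      also have "\<dots> = ((11 / 10) powr ?d * (11 / 10) powr (?d + p)) * B'"
        by (simp add: B'_def abs_minus_commute mult_ac)
      also have "(11 / 10 :: real) powr ?d * (11 / 10) powr (?d + p) = ?g"
        unfolding powr_add[symmetric] by simp
      finally have h2: "(1 / \<eta> x ^ DIM('a)) * (\<eta> x powr (- (?d + p)) * \<bar>u z - u y\<bar> powr p) \<le> ?g * B'" .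
      have "\<bar>u x - u y\<bar> powr p \<le> 2 powr p * (\<bar>u x - u z\<bar> powr p + \<bar>u z - u y\<bar> powr p)"
        using norm_add_powr_le[of p "u x - u z" "u z - u y"] p by simp
      then have "(1 / \<eta> x ^ DIM('a)) * (\<eta> x powr (- (?d + p)) * \<bar>u x - u y\<bar> powr p) \<le>
         (1 / \<eta> x ^ DIM('a)) * (\<eta> x powr (- (?d + p)) * (2 powr p * (\<bar>u x - u z\<bar> powr p + \<bar>u z - u y\<bar> powr p)))"
        using e by (intro mult_left_mono) auto
      also have "\<dots> = 2 powr p * (A + (1 / \<eta> x ^ DIM('a)) * (\<eta> x powr (- (?d + p)) * \<bar>u z - u y\<bar> powr p))"
        by (simp add: A_def algebra_simps add_divide_distrib)
      also have "\<dots> \<le> 2 powr p * (?g * A + ?g * B')"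
        using h2 mult_right_mono[OF g1 A0] by (intro mult_left_mono add_mono) auto
      finally have "c * ((1 / \<eta> x ^ DIM('a)) * ?q) \<le> c * (2 powr p * (?g * A + ?g * B'))"
        using c0 by (intro mult_left_mono) auto
      then have fin: "c * (1 / \<eta> x ^ DIM('a)) * ?q \<le> K * (A + B')"
        by (simp add: K_def algebra_simps)
      have "?T x y z = ennreal (K * (A + B'))"
        using nx ny n1 sw(1) e ey K0 A0 B0
        by (simp add: qdiff_def A_def B'_def ennreal_mult[symmetric] ennreal_plus[symmetric] del: ennreal_plus)
      then show ?thesis using True fin by (simp add: ennreal_leI)
    qed simp
    have "near r x y * qdiff p u x y = ennreal ?q" using n1 by (simp add: qdiff_def)
    also have "\<dots> = ennreal (c * (1 / \<eta> x ^ DIM('a)) * ?q) * ennreal (?w * ?R ^ DIM('a))"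
      using e r c0 w[THEN less_imp_neq, THEN not_sym] by (simp add: ennreal_mult[symmetric] c_def power_mult_distrib power_divide)
    also have "\<dots> = (\<integral>\<^sup>+z. ennreal (c * (1 / \<eta> x ^ DIM('a)) * ?q) * indicator (ball ?m ?R) z \<partial>lborel)"
      using R by (subst nn_integral_cmult_indicator) (auto simp: emeasure_ball)
    also have "\<dots> \<le> (\<integral>\<^sup>+z. ?T x y z \<partial>lborel)" by (intro nn_integral_mono pz)
    finally show ?thesis .
  qed simp
  have "Qen p u r \<le> (\<integral>\<^sup>+x. (\<integral>\<^sup>+y. (\<integral>\<^sup>+z. ?T x y z \<partial>lborel) \<partial>lborel) \<partial>lborel)"
    unfolding Qen_def by (intro nn_integral_mono pt)
  also have "\<dots> = ennreal K * ((\<integral>\<^sup>+x. (\<integral>\<^sup>+y. (\<integral>\<^sup>+z. ?e x * near r x y * (near ?s x z * qdiff p u x z) \<partial>lborel) \<partial>lborel) \<partial>lborel)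
     + (\<integral>\<^sup>+x. (\<integral>\<^sup>+y. (\<integral>\<^sup>+z. ?e y * near (r * (10 / 9)) y x * (near ?s y z * qdiff p u y z) \<partial>lborel) \<partial>lborel) \<partial>lborel))"
    by (simp add: nn_integral_cmult nn_integral_add)
  also have "\<dots> \<le> ennreal K * (ennreal (?w * r ^ DIM('a)) * Qen p u ?s + ennreal (?w * (r * (10 / 9)) ^ DIM('a)) * Qen p u ?s)"
  proof (intro mult_left_mono add_mono)
    have "(\<integral>\<^sup>+x. (\<integral>\<^sup>+y. (\<integral>\<^sup>+z. ?e x * near r x y * (near ?s x z * qdiff p u x z) \<partial>lborel) \<partial>lborel) \<partial>lborel)
       = (\<integral>\<^sup>+x. (?e x * (\<integral>\<^sup>+y. near r x y \<partial>lborel)) * (\<integral>\<^sup>+z. near ?s x z * qdiff p u x z \<partial>lborel) \<partial>lborel)"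
      by (simp add: nn_integral_cmult nn_integral_multc)
    also have "\<dots> \<le> (\<integral>\<^sup>+x. ennreal (?w * r ^ DIM('a)) * (\<integral>\<^sup>+z. near ?s x z * qdiff p u x z \<partial>lborel) \<partial>lborel)"
      using r by (intro nn_integral_mono mult_right_mono nn_integral_near_le) auto
    also have "\<dots> = ennreal (?w * r ^ DIM('a)) * Qen p u ?s"
      unfolding Qen_def by (rule nn_integral_cmult) measurable
    finally show "(\<integral>\<^sup>+x. (\<integral>\<^sup>+y. (\<integral>\<^sup>+z. ?e x * near r x y * (near ?s x z * qdiff p u x z) \<partial>lborel) \<partial>lborel) \<partial>lborel)
        \<le> ennreal (?w * r ^ DIM('a)) * Qen p u ?s" .
    have "(\<integral>\<^sup>+x. (\<integral>\<^sup>+y. (\<integral>\<^sup>+z. ?e y * near (r * (10 / 9)) y x * (near ?s y z * qdiff p u y z) \<partial>lborel) \<partial>lborel) \<partial>lborel)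
       = (\<integral>\<^sup>+y. (\<integral>\<^sup>+x. (\<integral>\<^sup>+z. ?e y * near (r * (10 / 9)) y x * (near ?s y z * qdiff p u y z) \<partial>lborel) \<partial>lborel) \<partial>lborel)"
      by (rule lborel_pair.Fubini') simp
    also have "\<dots> = (\<integral>\<^sup>+y. (?e y * (\<integral>\<^sup>+x. near (r * (10 / 9)) y x \<partial>lborel)) * (\<integral>\<^sup>+z. near ?s y z * qdiff p u y z \<partial>lborel) \<partial>lborel)"
      by (simp add: nn_integral_cmult nn_integral_multc)
    also have "\<dots> \<le> (\<integral>\<^sup>+y. ennreal (?w * (r * (10 / 9)) ^ DIM('a)) * (\<integral>\<^sup>+z. near ?s y z * qdiff p u y z \<partial>lborel) \<partial>lborel)"
      using r by (intro nn_integral_mono mult_right_mono nn_integral_near_le) auto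
    also have "\<dots> = ennreal (?w * (r * (10 / 9)) ^ DIM('a)) * Qen p u ?s"
      unfolding Qen_def by (rule nn_integral_cmult) measurable
    finally show "(\<integral>\<^sup>+x. (\<integral>\<^sup>+y. (\<integral>\<^sup>+z. ?e y * near (r * (10 / 9)) y x * (near ?s y z * qdiff p u y z) \<partial>lborel) \<partial>lborel) \<partial>lborel)
        \<le> ennreal (?w * (r * (10 / 9)) ^ DIM('a)) * Qen p u ?s" .
  qed simp_all
  also have "\<dots> = ennreal (K * (?w * r ^ DIM('a) + ?w * (r * (10 / 9)) ^ DIM('a))) * Qen p u ?s"
    using K0 w r by (simp add: ennreal_mult ennreal_plus distrib_right mult.assoc)
  also have "K * (?w * r ^ DIM('a) + ?w * (r * (10 / 9)) ^ DIM('a)) = Q_step p"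
    using r w[THEN less_imp_neq, THEN not_sym] by (simp add: K_def c_def Q_step_def power_mult_distrib power_divide field_simps)
  finally show ?thesis .
qed

lemma Qen_mono: "r \<le> s \<Longrightarrow> Qen p u r \<le> Qen p u s"
  unfolding Qen_def by (intro nn_integral_mono mult_right_mono near_le_near) auto

text \<open>Iteration of \<open>Qen_step\<close> from the full range down to a range below
  \<open>c\<close>, which will be the radius on which \<rho> is bounded below.\<close>

lemma Qen_1_le:
  assumes p: "1 < p" and u: "u \<in> borel_measurable borel" and k: "(3 / 4) ^ k \<le> c"
  shows "Qen p u 1 \<le> ennreal (Q_step p ^ k) * Qen p u c"
proof -
  have "Qen p u 1 \<le> ennreal (Q_step p ^ j) * Qen p u ((3 / 4) ^ j)" for j
  proof (induction j)
    case (Suc j)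
    have "Qen p u ((3 / 4) ^ j) \<le> ennreal (Q_step p) * Qen p u (3 / 4 * (3 / 4) ^ j)"
      by (rule Qen_step[OF p _ _ u]) (auto intro: power_le_one)
    from mult_left_mono[OF this, of "ennreal (Q_step p ^ j)"]
    have "ennreal (Q_step p ^ j) * Qen p u ((3 / 4) ^ j) \<le> ennreal (Q_step p ^ Suc j) * Qen p u ((3 / 4) ^ Suc j)"
      using Q_step_pos[of p] by (simp add: ennreal_mult mult_ac less_imp_le)
    with Suc show ?case by (rule order_trans)
  qed simp
  from this[of k] show ?thesis
    using mult_left_mono[OF Qen_mono[OF k, of p u], of "ennreal (Q_step p ^ k)"] by (meson order_trans zero_le)
qed

definition "C_grad p = 2 powr p * C_ker powr p * unit_ball_vol (real DIM('a)) powr (p - 1)"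

text \<open>\<open>dKc_abs_le\<close> with \<open>c = u x\<close>, followed by Jensen. The exponents
  of the width balance: \<open>-(d + 1) p\<close> from the kernel and \<open>d (p - 1)\<close> from
  the volume add up to \<open>-(d + p)\<close>, the weight of the model energy.\<close>

lemma dKc_powr_le:
  assumes p: "1 < p" and u[measurable]: "u \<in> borel_measurable borel" and ub: "\<And>y. \<bar>u y\<bar> \<le> C"
    and x: "x \<in> \<Omega>" and i: "i \<in> Basis"
  shows "ennreal (\<bar>dKc i u x\<bar> powr p) \<le> ennreal (C_grad p) * (\<integral>\<^sup>+y. near 1 x y * qdiff p u x y \<partial>lborel)"
proof -
  let ?d = "real DIM('a)" and ?w = "unit_ball_vol (real DIM('a))"
  have e: "0 < \<eta> x" by (rule eta_pos[OF x])
  have w: "0 < ?w" by (simp add: unit_ball_vol_pos)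
  let ?B = "ball x (\<eta> x)" and ?f = "\<lambda>y. \<bar>u y - u x\<bar>"
  let ?M = "restrict_space lborel ?B"
  have em: "emeasure ?M (space ?M) = ennreal (?w * \<eta> x ^ DIM('a))"
    using e by (simp add: emeasure_restrict_space emeasure_ball space_restrict_space)
  interpret M: finite_measure ?M by (rule finite_measureI, subst em) simp
  have mM: "measure ?M (space ?M) = ?w * \<eta> x ^ DIM('a)"
    using em e w by (simp add: measure_def)
  have [measurable]: "?f \<in> borel_measurable ?M" by (intro measurable_restrict_space1) simp
  have fb: "?f y \<le> 2 * C" for y using ub[of y] ub[of x] by linarith
  have J: "(\<integral>y. ?f y \<partial>?M) powr p \<le> 2 powr p * (?w * \<eta> x ^ DIM('a)) powr (p - 1) * (\<integral>y. ?f y powr p \<partial>?M)"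
    using integral_powr_le_Jensen[OF p M.finite_measure_axioms, of ?f "2 * C"] fb unfolding mM by simp
  have eqi: "(\<integral>y. indicator ?B y * h y \<partial>lborel) = (\<integral>y. h y \<partial>?M)" for h :: "'a \<Rightarrow> real"
    by (subst integral_restrict_space) auto
  have ip: "integrable ?M (\<lambda>y. ?f y powr p)"
    by (rule M.integrable_const_bound[where B = "(2 * C) powr p"]) (use fb p in \<open>auto intro!: powr_mono2\<close>)
  have "\<bar>dKc i u x\<bar> \<le> C_ker / \<eta> x ^ Suc DIM('a) * (\<integral>y. ?f y \<partial>?M)"
    using dKc_abs_le[OF u ub x i, of "u x"] by (simp add: eqi)
  then have "\<bar>dKc i u x\<bar> powr p \<le> (C_ker / \<eta> x ^ Suc DIM('a) * (\<integral>y. ?f y \<partial>?M)) powr p"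
    using p by (intro powr_mono2) auto
  also have "\<dots> = (C_ker / \<eta> x ^ Suc DIM('a)) powr p * (\<integral>y. ?f y \<partial>?M) powr p"
    by (rule powr_mult)
  also have "\<dots> \<le> (C_ker / \<eta> x ^ Suc DIM('a)) powr p * (2 powr p * (?w * \<eta> x ^ DIM('a)) powr (p - 1) * (\<integral>y. ?f y powr p \<partial>?M))"
    using J by (intro mult_left_mono) auto
  also have "\<dots> = C_grad p * (\<eta> x powr (- (?d + p)) * (\<integral>y. ?f y powr p \<partial>?M))"
  proof -
    have e1: "(C_ker / \<eta> x ^ Suc DIM('a)) powr p = C_ker powr p * \<eta> x powr (- ((?d + 1) * p))"
    proof -
      have "\<eta> x ^ Suc DIM('a) = \<eta> x powr (?d + 1)" using e by (simp add: powr_realpow[symmetric] add.commute del: power_Suc)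
      then show ?thesis using C_ker_nonneg e by (simp add: powr_divide powr_powr powr_minus_divide)
    qed
    have e2: "(?w * \<eta> x ^ DIM('a)) powr (p - 1) = ?w powr (p - 1) * \<eta> x powr (?d * (p - 1))"
      using w e by (simp add: powr_mult powr_realpow[symmetric] powr_powr)
    have e3: "\<eta> x powr (- ((?d + 1) * p)) * \<eta> x powr (?d * (p - 1)) = \<eta> x powr (- (?d + p))"
      unfolding powr_add[symmetric] by (simp add: algebra_simps)
    show ?thesis unfolding C_grad_def e1 e2 e3[symmetric] by (simp only: mult_ac)
  qed
  finally have le: "\<bar>dKc i u x\<bar> powr p \<le> C_grad p * (\<eta> x powr (- (?d + p)) * (\<integral>y. ?f y powr p \<partial>?M))" .
  have "(\<integral>\<^sup>+y. near 1 x y * qdiff p u x y \<partial>lborel) = (\<integral>\<^sup>+y. ennreal (\<eta> x powr (- (?d + p))) * (ennreal (?f y powr p) * indicator ?B y) \<partial>lborel)"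
    using x e by (intro nn_integral_cong) (auto simp: near_def qdiff_def indicator_def dist_norm norm_minus_commute abs_minus_commute ennreal_mult)
  also have "\<dots> = ennreal (\<eta> x powr (- (?d + p))) * (\<integral>\<^sup>+y. ennreal (?f y powr p) * indicator ?B y \<partial>lborel)"
    by (rule nn_integral_cmult) (intro borel_measurable_times_ennreal borel_measurable_indicator, auto)
  also have "(\<integral>\<^sup>+y. ennreal (?f y powr p) * indicator ?B y \<partial>lborel) = (\<integral>\<^sup>+y. ennreal (?f y powr p) \<partial>?M)"
    by (subst nn_integral_restrict_space) auto
  also have "\<dots> = ennreal (\<integral>y. ?f y powr p \<partial>?M)"
    using ip by (intro nn_integral_eq_integral) auto
  finally have "ennreal (C_grad p) * (\<integral>\<^sup>+y. near 1 x y * qdiff p u x y \<partial>lborel)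
     = ennreal (C_grad p * (\<eta> x powr (- (?d + p)) * (\<integral>y. ?f y powr p \<partial>?M)))"
    by (simp add: C_grad_def ennreal_mult[symmetric] integral_nonneg_AE)
  then show ?thesis using le by (simp add: ennreal_leI)
qed

end

section \<open>The width function\<close>

definition qfun' :: "real \<Rightarrow> real" where
  "qfun' r = (1 / (1 + exp (- (r ^ 2))) - 1 / 2) + r * (2 * r * exp (- (r ^ 2)) / (1 + exp (- (r ^ 2))) ^ 2)"

lemma qfun_deriv: "(qfun has_real_derivative qfun' r) (at r)"
proof -
  have "1 + exp (- (r ^ 2)) \<noteq> 0" using exp_gt_zero[of "- (r ^ 2)"] by linarith
  then have "((\<lambda>r. r * (1 / (1 + exp (- (r ^ 2))) - 1 / 2)) has_real_derivative qfun' r) (at r)"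
    unfolding qfun'_def by (auto intro!: derivative_eq_intros simp: power2_eq_square)
  then show ?thesis by (simp add: qfun_def[abs_def])
qed

text \<open>Rests on \<open>r^2 exp (- r^2) \<le> 1\<close>. A bound on the whole line makes the
  gradient of the width proportional to \<delta> uniformly over \<Omega>.\<close>

lemma qfun'_abs_le: "\<bar>qfun' r\<bar> \<le> 3"
proof -
  define e where "e = exp (- (r ^ 2))"
  have e: "0 < e" "e \<le> 1" by (simp_all add: e_def)
  have "r\<^sup>2 \<le> exp (r\<^sup>2)" using exp_ge_add_one_self[of "r\<^sup>2"] by linarith
  then have r1: "r\<^sup>2 * e \<le> 1" unfolding e_def exp_minus by (simp add: field_simps)
  have "\<bar>1 / (1 + e) - 1 / 2\<bar> \<le> 1"
  proof -
    have "0 \<le> 1 / (1 + e)" "1 / (1 + e) \<le> 1" using e by simp_all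
    then show ?thesis by linarith
  qed
  moreover have "\<bar>r * (2 * r * e / (1 + e) ^ 2)\<bar> \<le> 2"
  proof -
    have "1 \<le> (1 + e)\<^sup>2" using e by (intro one_le_power) simp
    then have "2 * (r\<^sup>2 * e) / (1 + e)\<^sup>2 \<le> 2 * (r\<^sup>2 * e) / 1" using e by (intro divide_left_mono) auto
    then have "2 * (r\<^sup>2 * e) / (1 + e)\<^sup>2 \<le> 2" using r1 by simp
    moreover have "r * (2 * r * e / (1 + e) ^ 2) = 2 * (r\<^sup>2 * e) / (1 + e)\<^sup>2" by (simp add: power2_eq_square)
    moreover have "0 \<le> 2 * (r\<^sup>2 * e) / (1 + e)\<^sup>2" using e by simp
    ultimately show ?thesis by (simp only: abs_of_nonneg)
  qed
  ultimately show ?thesis unfolding qfun'_def e_def[symmetric] by linarith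
qed

lemma qfun_pos: "0 < r \<Longrightarrow> 0 < qfun r"
proof -
  assume r: "0 < r"
  then have "exp (- (r ^ 2)) < 1" by simp
  then have "1 / 2 < 1 / (1 + exp (- (r ^ 2)))"
    using exp_gt_zero[of "- (r ^ 2)"] by (intro divide_strict_left_mono) (auto simp: add_pos_pos)
  then show ?thesis using r by (simp add: qfun_def)
qed

lemma qfun_le: "0 \<le> r \<Longrightarrow> qfun r \<le> r"
proof -
  assume r: "0 \<le> r"
  have "1 / (1 + exp (- (r ^ 2))) \<le> 1" by (simp add: divide_le_eq add_pos_pos)
  then have "r * (1 / (1 + exp (- (r ^ 2))) - 1 / 2) \<le> r * 1" using r by (intro mult_left_mono) auto
  then show ?thesis by (simp add: qfun_def)
qed

text \<open>A ball is connected; if it left \<Omega> it would contain a frontier point closer than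
  the distance to the frontier.\<close>

lemma ball_dist_bd_subset:
  assumes "x \<in> \<Omega>"
  shows "ball x (dist_bd \<Omega> x) \<subseteq> \<Omega>"
proof (rule ccontr)
  assume "\<not> ?thesis"
  then have "ball x (dist_bd \<Omega> x) - \<Omega> \<noteq> {}" by auto
  moreover have "dist_bd \<Omega> x \<noteq> 0" using calculation by auto
  then have "0 < dist_bd \<Omega> x" using infdist_nonneg[of x "frontier \<Omega>"] by (simp add: dist_bd_def)
  then have "x \<in> ball x (dist_bd \<Omega> x) \<inter> \<Omega>" using assms by simp
  then have "ball x (dist_bd \<Omega> x) \<inter> \<Omega> \<noteq> {}" by blast
  ultimately have "ball x (dist_bd \<Omega> x) \<inter> frontier \<Omega> \<noteq> {}"
    by (intro connected_Int_frontier) auto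
  then obtain z where z: "dist x z < infdist x (frontier \<Omega>)" "z \<in> frontier \<Omega>" by (auto simp: dist_bd_def)
  then show False using infdist_le[of z "frontier \<Omega>" x] by linarith
qed

lemma dist_bd_pos:
  fixes \<Omega> :: "'a::euclidean_space set"
  assumes "open \<Omega>" "bounded \<Omega>" "x \<in> \<Omega>"
  shows "0 < dist_bd \<Omega> x"
proof -
  have "\<Omega> \<noteq> UNIV" using assms(2) not_bounded_UNIV by auto
  then have "frontier \<Omega> \<noteq> {}" using assms(3) by (auto simp: frontier_eq_empty)
  moreover have "x \<notin> frontier \<Omega>" using assms(1,3) by (auto simp: frontier_def interior_open)
  ultimately show ?thesis unfolding dist_bd_def by (intro infdist_pos_not_in_closed) auto
qed

text \<open>For \<open>\<bar>\<alpha>\<bar> = 1\<close> the weight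
  \<open>dist^(1 - \<bar>\<alpha>\<bar>)\<close> is 1, so the hypothesis on \<lambda> becomes a
  constant bound on each partial derivative. Together with the two-sided comparison it controls the
  width up to the boundary.\<close>

locale domain_weight =
  fixes \<Omega> :: "'a::euclidean_space set" and lam :: "'a \<Rightarrow> real" and \<kappa>0 :: real and \<kappa> :: "'a \<Rightarrow> real"
  assumes open_dom: "open \<Omega>" and bounded_dom: "bounded \<Omega>"
    and lam_smooth: "smooth_in \<Omega> lam" and kappa0: "1 \<le> \<kappa>0"
    and lam_lower: "\<And>x. x \<in> \<Omega> \<Longrightarrow> dist_bd \<Omega> x / \<kappa>0 \<le> lam x"
    and lam_upper: "\<And>x. x \<in> \<Omega> \<Longrightarrow> lam x \<le> \<kappa>0 * dist_bd \<Omega> x"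
    and lam_deriv: "\<And>i x. i \<in> Basis \<Longrightarrow> x \<in> \<Omega> \<Longrightarrow> \<bar>frechet_derivative lam (at x) i\<bar> \<le> \<kappa> i"
begin

text \<open>Extended by zero because \<lambda> is controlled only on \<Omega>, while the kernel
  needs a width that is Borel on the whole space.\<close>

definition width :: "real \<Rightarrow> 'a \<Rightarrow> real" where
  "width \<delta> x = (if x \<in> \<Omega> then eta lam \<delta> x else 0)"

definition dwidth :: "real \<Rightarrow> 'a \<Rightarrow> 'a \<Rightarrow> real" where
  "dwidth \<delta> i x = (if x \<in> \<Omega> then \<delta> * (qfun' (lam x) * frechet_derivative lam (at x) i) else 0)"

definition "kappa_sum = (\<Sum>i\<in>Basis. \<bar>\<kappa> i\<bar>)"

text \<open>The first entry makes the gradient of the width at most \<open>1 / 10\<close>, the 30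
  being ten times the bound 3 of \<open>qfun'_abs_le\<close>; the second keeps the width below the
  distance to the boundary. Since \<sigma> tends to infinity, the parameters eventually fall below
  this threshold.\<close>

definition "delta_max = min (1 / (30 * (kappa_sum + 1))) (1 / \<kappa>0)"

lemma kappa_sum_nonneg: "0 \<le> kappa_sum" by (simp add: kappa_sum_def sum_nonneg)

lemma delta_max_pos: "0 < delta_max"
  using kappa_sum_nonneg kappa0 by (simp add: delta_max_def)

lemma lam_has_derivative: "x \<in> \<Omega> \<Longrightarrow> (lam has_derivative frechet_derivative lam (at x)) (at x)"
proof -
  assume "x \<in> \<Omega>"
  moreover have "\<forall>es. set es \<subseteq> Basis \<longrightarrow> (\<forall>x\<in>\<Omega>. iter_pd es lam differentiable (at x))"
    using lam_smooth by (simp only: smooth_in_def)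
  from this[rule_format, of "[]" x] have "x \<in> \<Omega> \<Longrightarrow> lam differentiable at x" by simp
  ultimately show ?thesis by (simp add: frechet_derivative_works)
qed

lemma lam_pos: "x \<in> \<Omega> \<Longrightarrow> 0 < lam x"
  using lam_lower[of x] dist_bd_pos[OF open_dom bounded_dom, of x] kappa0
  by (meson divide_pos_pos less_le_trans zero_less_one)

lemma lam_derivative_le:
  assumes "x \<in> \<Omega>"
  shows "\<bar>frechet_derivative lam (at x) v\<bar> \<le> kappa_sum * norm v"
proof -
  let ?D = "frechet_derivative lam (at x)"
  have lin: "linear ?D" using lam_has_derivative[OF assms] by (rule has_derivative_linear)
  have "?D v = ?D (\<Sum>i\<in>Basis. (v \<bullet> i) *\<^sub>R i)" by (simp add: euclidean_representation)
  also have "\<dots> = (\<Sum>i\<in>Basis. (v \<bullet> i) * ?D i)" by (simp add: linear_sum[OF lin] linear_cmul[OF lin])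
  finally have "\<bar>?D v\<bar> \<le> (\<Sum>i\<in>Basis. \<bar>(v \<bullet> i) * ?D i\<bar>)" by (metis sum_abs)
  also have "\<dots> \<le> (\<Sum>i\<in>Basis. norm v * \<bar>\<kappa> i\<bar>)"
  proof (rule sum_mono)
    fix i :: 'a assume i: "i \<in> Basis"
    have "\<bar>?D i\<bar> \<le> \<bar>\<kappa> i\<bar>" using lam_deriv[OF i assms] by linarith
    then show "\<bar>(v \<bullet> i) * ?D i\<bar> \<le> norm v * \<bar>\<kappa> i\<bar>"
      unfolding abs_mult using Basis_le_norm[OF i, of v] by (intro mult_mono) auto
  qed
  also have "\<dots> = kappa_sum * norm v" by (simp add: kappa_sum_def sum_distrib_left mult.commute)
  finally show ?thesis .
qed

lemma eta_has_derivative: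
  assumes "x \<in> \<Omega>"
  shows "(eta lam \<delta> has_derivative (\<lambda>v. \<delta> * (qfun' (lam x) * frechet_derivative lam (at x) v))) (at x)"
proof -
  have "((\<lambda>x. qfun (lam x)) has_derivative (\<lambda>v. qfun' (lam x) * frechet_derivative lam (at x) v)) (at x)"
    by (rule has_derivative_compose[OF lam_has_derivative[OF assms] qfun_deriv[THEN has_field_derivative_imp_has_derivative]])
  then show ?thesis unfolding eta_def[abs_def] by (rule has_derivative_mult_right)
qed

lemma width_has_derivative:
  assumes "x \<in> \<Omega>"
  shows "(width \<delta> has_derivative (\<lambda>v. \<delta> * (qfun' (lam x) * frechet_derivative lam (at x) v))) (at x)"
  by (rule has_derivative_transform_within_open[OF eta_has_derivative[OF assms] open_dom assms])
     (simp add: width_def)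

lemma width_continuous: "continuous_on \<Omega> (width \<delta>)"
  by (intro continuous_at_imp_continuous_on ballI has_derivative_continuous[OF width_has_derivative])

lemma derivative_abs_le:
  assumes "x \<in> \<Omega>" "0 \<le> \<delta>"
  shows "\<bar>\<delta> * (qfun' (lam x) * frechet_derivative lam (at x) v)\<bar> \<le> (3 * \<delta> * kappa_sum) * norm v"
proof -
  have "\<bar>qfun' (lam x)\<bar> * \<bar>frechet_derivative lam (at x) v\<bar> \<le> 3 * (kappa_sum * norm v)"
    using qfun'_abs_le lam_derivative_le[OF assms(1), of v] by (intro mult_mono) auto
  then have "\<delta> * (\<bar>qfun' (lam x)\<bar> * \<bar>frechet_derivative lam (at x) v\<bar>) \<le> \<delta> * (3 * (kappa_sum * norm v))"
    using assms(2) by (rule mult_left_mono)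
  then show ?thesis using assms(2) by (simp add: abs_mult mult_ac)
qed

lemma delta_max_bound:
  assumes "0 < \<delta>" "\<delta> \<le> delta_max"
  shows "3 * \<delta> * kappa_sum \<le> 1 / 10" "\<delta> * \<kappa>0 \<le> 1"
proof -
  have "\<delta> \<le> 1 / (30 * (kappa_sum + 1))" "\<delta> \<le> 1 / \<kappa>0" using assms by (auto simp: delta_max_def)
  then have "\<delta> * (30 * (kappa_sum + 1)) \<le> 1" "\<delta> * \<kappa>0 \<le> 1"
    using kappa_sum_nonneg kappa0 by (simp_all add: pos_le_divide_eq)
  then show "3 * \<delta> * kappa_sum \<le> 1 / 10" "\<delta> * \<kappa>0 \<le> 1" using assms(1) by (simp_all add: algebra_simps)
qed

lemma width_pos: "0 < \<delta> \<Longrightarrow> x \<in> \<Omega> \<Longrightarrow> 0 < width \<delta> x"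
  using lam_pos qfun_pos by (simp add: width_def eta_def)

lemma width_le:
  assumes "0 < \<delta>" "x \<in> \<Omega>"
  shows "width \<delta> x \<le> \<delta> * \<kappa>0 * dist_bd \<Omega> x"
proof -
  have "qfun (lam x) \<le> \<kappa>0 * dist_bd \<Omega> x"
    using qfun_le[of "lam x"] lam_pos[OF assms(2)] lam_upper[OF assms(2)] by linarith
  then show ?thesis using assms by (simp add: width_def eta_def mult.assoc)
qed

lemma width_ball:
  assumes "0 < \<delta>" "\<delta> \<le> delta_max" "x \<in> \<Omega>"
  shows "ball x (width \<delta> x) \<subseteq> \<Omega>"
proof -
  have "width \<delta> x \<le> \<delta> * \<kappa>0 * dist_bd \<Omega> x" by (rule width_le[OF assms(1,3)])
  also have "\<dots> \<le> 1 * dist_bd \<Omega> x"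
    using delta_max_bound(2)[OF assms(1,2)] dist_bd_pos[OF open_dom bounded_dom assms(3)] by (intro mult_right_mono) auto
  finally show ?thesis using ball_dist_bd_subset[OF assms(3)] subset_ball[of "width \<delta> x" "dist_bd \<Omega> x" x] by auto
qed

lemma width_measurable: "width \<delta> \<in> borel_measurable borel"
proof -
  have "(\<lambda>x. indicator \<Omega> x *\<^sub>R width \<delta> x) \<in> borel_measurable borel"
    by (rule borel_measurable_continuous_on_indicator[OF _ width_continuous]) (simp add: open_dom)
  moreover have "(\<lambda>x. indicator \<Omega> x *\<^sub>R width \<delta> x) = width \<delta>" by (auto simp: width_def indicator_def)
  ultimately show ?thesis by simp
qed

lemma dwidth_measurable:
  assumes "i \<in> Basis"
  shows "dwidth \<delta> i \<in> borel_measurable borel"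
proof -
  let ?h = "\<lambda>x. \<delta> * (qfun' (lam x) * frechet_derivative lam (at x) i)"
  have c1: "continuous_on \<Omega> lam"
    by (intro continuous_at_imp_continuous_on ballI has_derivative_continuous[OF lam_has_derivative])
  have "(\<lambda>x. frechet_derivative lam (at x) i) differentiable at x" if "x \<in> \<Omega>" for x
  proof -
    have "\<forall>es. set es \<subseteq> Basis \<longrightarrow> (\<forall>x\<in>\<Omega>. iter_pd es lam differentiable (at x))"
      using lam_smooth by (simp only: smooth_in_def)
    from this[rule_format, of "[i]" x] show ?thesis using assms that by simp
  qed
  then have c2: "continuous_on \<Omega> (\<lambda>x. frechet_derivative lam (at x) i)"
    by (intro continuous_at_imp_continuous_on ballI differentiable_imp_continuous_within)
  have "1 + exp (- (s ^ 2)) \<noteq> 0" for s :: real using exp_gt_zero[of "- (s ^ 2)"] by linarith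
  then have c3: "continuous_on UNIV qfun'"
    unfolding qfun'_def[abs_def] by (intro continuous_intros ballI power_not_zero)
  have "continuous_on \<Omega> (\<lambda>x. qfun' (lam x))" by (rule continuous_on_compose2[OF c3 c1]) simp
  then have "continuous_on \<Omega> ?h" by (intro continuous_on_mult continuous_on_const c2)
  then have "(\<lambda>x. indicator \<Omega> x *\<^sub>R ?h x) \<in> borel_measurable borel"
    by (intro borel_measurable_continuous_on_indicator) (simp add: open_dom)
  moreover have "(\<lambda>x. indicator \<Omega> x *\<^sub>R ?h x) = dwidth \<delta> i" by (auto simp: dwidth_def indicator_def)
  ultimately show ?thesis by simp
qed

lemma width_deriv:
  assumes "x \<in> \<Omega>"
  shows "((\<lambda>t. width \<delta> (x + t *\<^sub>R i)) has_real_derivative dwidth \<delta> i x) (at 0)"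
proof -
  let ?D = "\<lambda>v. \<delta> * (qfun' (lam x) * frechet_derivative lam (at x) v)"
  have "((\<lambda>t. x + t *\<^sub>R i) has_derivative (\<lambda>t. t *\<^sub>R i)) (at 0)"
    by (auto intro!: derivative_eq_intros)
  from has_derivative_compose[OF this, of "width \<delta>" ?D]
  have "((\<lambda>t. width \<delta> (x + t *\<^sub>R i)) has_derivative (\<lambda>t. ?D (t *\<^sub>R i))) (at 0)"
    using width_has_derivative[OF assms] by simp
  moreover have "?D (t *\<^sub>R i) = dwidth \<delta> i x * t" for t
    using has_derivative_linear[OF lam_has_derivative[OF assms]] assms by (simp add: linear_cmul dwidth_def)
  ultimately show ?thesis by (simp add: has_field_derivative_def)
qed

text \<open>The ball is convex and lies in \<Omega>, so the gradient bound \<open>1 / 10\<close> can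
  be used along segments from its centre.\<close>

lemma width_comp:
  assumes d: "0 < \<delta>" "\<delta> \<le> delta_max" and x: "x \<in> \<Omega>" and n: "norm (y - x) < width \<delta> x"
  shows "\<bar>width \<delta> y - width \<delta> x\<bar> \<le> width \<delta> x / 10"
proof -
  let ?S = "ball x (width \<delta> x)"
  have S: "?S \<subseteq> \<Omega>" by (rule width_ball[OF d x])
  have "norm (width \<delta> y - width \<delta> x) \<le> (1 / 10) * norm (y - x)"
  proof (rule differentiable_bound[where S = ?S and f' = "\<lambda>z v. \<delta> * (qfun' (lam z) * frechet_derivative lam (at z) v)"])
    fix z assume z: "z \<in> ?S"
    then have zo: "z \<in> \<Omega>" using S by blast
    show "(width \<delta> has_derivative (\<lambda>v. \<delta> * (qfun' (lam z) * frechet_derivative lam (at z) v))) (at z within ?S)"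
      by (rule has_derivative_at_withinI[OF width_has_derivative[OF zo]])
    show "onorm (\<lambda>v. \<delta> * (qfun' (lam z) * frechet_derivative lam (at z) v)) \<le> 1 / 10"
    proof (rule onorm_le)
      fix v
      have "\<bar>\<delta> * (qfun' (lam z) * frechet_derivative lam (at z) v)\<bar> \<le> (3 * \<delta> * kappa_sum) * norm v"
        using derivative_abs_le[OF zo] d by simp
      also have "\<dots> \<le> 1 / 10 * norm v" using delta_max_bound(1)[OF d] by (intro mult_right_mono) auto
      finally show "norm (\<delta> * (qfun' (lam z) * frechet_derivative lam (at z) v)) \<le> 1 / 10 * norm v" by simp
    qed
  qed (use n width_pos[OF d(1) x] in \<open>auto simp: dist_norm norm_minus_commute\<close>)
  then show ?thesis using n by simp
qed

lemma dwidth_le: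
  assumes d: "0 < \<delta>" "\<delta> \<le> delta_max" and "i \<in> Basis" "x \<in> \<Omega>"
  shows "\<bar>dwidth \<delta> i x\<bar> \<le> 1"
proof -
  have "\<bar>dwidth \<delta> i x\<bar> \<le> (3 * \<delta> * kappa_sum) * norm i"
    unfolding dwidth_def using derivative_abs_le[OF assms(4), of \<delta> i] d(1) assms(4) by simp
  also have "\<dots> = 3 * \<delta> * kappa_sum" using assms(3) by simp
  finally show ?thesis using delta_max_bound(1)[OF d] by linarith
qed

end

lemma C1_compact_support_bounds:
  fixes \<psi> :: "real \<Rightarrow> real"
  assumes C1: "\<psi> C1_differentiable_on UNIV" and even: "\<forall>x. \<psi> (- x) = \<psi> x"
    and supp: "closure {x. \<psi> x \<noteq> 0} \<subseteq> {-1<..<1}"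
  obtains \<psi>' B where "\<And>s. (\<psi> has_real_derivative \<psi>' s) (at s)" "\<psi>' \<in> borel_measurable borel"
    "\<And>s. \<bar>\<psi> s\<bar> \<le> B" "\<And>s. \<bar>\<psi>' s\<bar> \<le> B" "\<psi>' 0 = 0" "\<And>s. 1 \<le> s \<Longrightarrow> \<psi> s = 0" "\<And>s. 1 \<le> s \<Longrightarrow> \<psi>' s = 0"
proof -
  obtain D where D: "\<And>s. (\<psi> has_vector_derivative D s) (at s)" "continuous_on UNIV D"
    using C1 by (auto simp: C1_differentiable_on_def)
  have der: "(\<psi> has_real_derivative D s) (at s)" for s
    using D(1) by (simp add: has_real_derivative_iff_has_vector_derivative)
  let ?S = "closure {x. \<psi> x \<noteq> 0}"
  have out: "\<psi> s = 0" "D s = 0" if "s \<notin> ?S" for s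
  proof -
    show "\<psi> s = 0" using that closure_subset[of "{x. \<psi> x \<noteq> 0}"] by auto
    have "((\<lambda>x. 0) has_real_derivative 0) (at s)" by simp
    then have "(\<psi> has_real_derivative 0) (at s)"
      by (rule has_field_derivative_transform_within_open[where S = "- ?S"])
         (use that closure_subset[of "{x. \<psi> x \<noteq> 0}"] in auto)
    from DERIV_unique[OF der this] show "D s = 0" .
  qed
  have notin: "s \<notin> ?S" if "1 \<le> \<bar>s\<bar>" for s
  proof
    assume "s \<in> ?S"
    then have "s \<in> {-1<..<1}" using supp by blast
    then show False using that by auto
  qed
  have bd: "\<exists>B. \<forall>s. \<bar>h s\<bar> \<le> B" if "continuous_on UNIV h" "\<And>s. s \<notin> ?S \<Longrightarrow> h s = 0" for h :: "real \<Rightarrow> real"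
  proof -
    have "bounded (h ` {-1..1})"
      using compact_continuous_image[OF continuous_on_subset[OF that(1)], of "{-1..1}"] compact_imp_bounded by auto
    then obtain B where B: "\<And>s. s \<in> {-1..1} \<Longrightarrow> \<bar>h s\<bar> \<le> B" unfolding bounded_iff by fastforce
    have "\<bar>h s\<bar> \<le> B" for s
    proof (cases "s \<in> {-1..1}")
      case False
      then have "h s = 0" by (intro that(2) notin) auto
      then show ?thesis using B[of 0] by simp
    qed (rule B)
    then show ?thesis by blast
  qed
  have "continuous_on UNIV \<psi>" by (intro continuous_at_imp_continuous_on ballI DERIV_isCont[OF der])
  then obtain B1 where B1: "\<And>s. \<bar>\<psi> s\<bar> \<le> B1" using bd[of \<psi>, OF _ out(1)] by blast
  obtain B2 where B2: "\<And>s. \<bar>D s\<bar> \<le> B2" using bd[of D, OF D(2) out(2)] by blast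
  \<comment> \<open>Evenness gives \<open>D 0 = - D 0\<close>, which is the source of
    \<open>\<psi>' 0 = 0\<close>.\<close>
  have "((\<lambda>x. \<psi> (- x)) has_real_derivative D 0 * (- 1)) (at 0)"
    by (rule DERIV_chain2[where g = uminus]) (use der[of 0] in \<open>auto intro!: derivative_eq_intros\<close>)
  moreover have "(\<lambda>x. \<psi> (- x)) = \<psi>" using even by auto
  ultimately have "(\<psi> has_real_derivative D 0 * (- 1)) (at 0)" by simp
  from DERIV_unique[OF this der] have D0: "D 0 = 0" by simp
  show ?thesis
  proof (rule that[of D "max B1 B2"])
    show "D \<in> borel_measurable borel" using D(2) by (rule borel_measurable_continuous_onI)
    fix s :: real
    show "\<bar>\<psi> s\<bar> \<le> max B1 B2" "\<bar>D s\<bar> \<le> max B1 B2" using B1[of s] B2[of s] by auto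
    assume "1 \<le> s"
    then have "s \<notin> ?S" by (intro notin) simp
    then show "\<psi> s = 0" "D s = 0" by (rule out)+
  qed (rule der D0)+
qed

lemma (in domain_weight) collar_kernel_lip_width:
  assumes psi: "\<And>s. (\<psi> has_real_derivative \<psi>' s) (at s)" "\<psi>' \<in> borel_measurable borel"
    "\<And>s. \<bar>\<psi> s\<bar> \<le> B" "\<And>s. \<bar>\<psi>' s\<bar> \<le> B" "\<psi>' 0 = 0" "\<And>s. 1 \<le> s \<Longrightarrow> \<psi> s = 0" "\<And>s. 1 \<le> s \<Longrightarrow> \<psi>' s = 0"
    "\<And>s. 0 \<le> \<psi> s" "(\<integral>x. \<psi> (norm (x::'a)) \<partial>lborel) = 1"
    and d: "0 < \<delta>" "\<delta> \<le> delta_max"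
  shows "collar_kernel_lip \<Omega> (width \<delta>) (dwidth \<delta>) \<psi> \<psi>' B"
proof (unfold_locales, goal_cases)
  case 1 then show ?case by (rule open_dom)
next
  case 2 then show ?case by (rule bounded_dom)
next
  case 3 then show ?case by (rule width_measurable)
next
  case 4 then show ?case by (rule dwidth_measurable)
next
  case 5 then show ?case by (rule width_pos[OF d(1)])
next
  case 6 then show ?case by (rule width_ball[OF d])
next
  case 7 then show ?case by (rule width_continuous)
next
  case 8 then show ?case by (intro width_deriv)
next
  case 9 then show ?case by (rule dwidth_le[OF d])
next
  case 10 then show ?case by (rule psi(1))
next
  case 11 then show ?case by (rule psi(2))
next
  case 12 then show ?case by (rule psi(3))
next
  case 13 then show ?case by (rule psi(4))
next
  case 14 then show ?case by (rule psi(5))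
next
  case 15 then show ?case by (rule psi(6))
next
  case 16 then show ?case by (rule psi(7))
next
  case 17 then show ?case by (rule psi(8))
next
  case 18 then show ?case by (rule psi(9))
next
  case 19 then show ?case by (rule width_comp[OF d])
qed

section \<open>Local limit on piecewise smooth functions\<close>

text \<open>The discrete problem without its mesh: finitely many bounded Borel functions
  \<open>b j\<close>, differentiable with gradients \<open>g j\<close> on an open set
  \<open>D\<close> of full measure in \<Omega>, and free to jump elsewhere. The normalisation of
  \<rho> is a nonnegative integral, so finiteness is part of the equation.\<close>

locale piecewise_setting =
  fixes \<Omega> D :: "'a::euclidean_space set" and p \<beta> :: real
    and \<eta> :: "real \<Rightarrow> 'a \<Rightarrow> real" and \<eta>' :: "real \<Rightarrow> 'a \<Rightarrow> 'a \<Rightarrow> real" and \<delta>1 M :: real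
    and \<psi> \<psi>' \<rho> :: "real \<Rightarrow> real" and B c\<^sub>\<rho> C\<^sub>\<rho> :: real
    and f :: "('a \<Rightarrow> real) \<Rightarrow> real"
    and I :: "'i set" and b :: "'i \<Rightarrow> 'a \<Rightarrow> real" and g :: "'i \<Rightarrow> 'a \<Rightarrow> 'a" and Bb :: real
  assumes conn_dom: "connected \<Omega>" and D: "open D" "D \<subseteq> \<Omega>" "negligible (\<Omega> - D)"
    and p: "1 < p" and beta: "0 \<le> \<beta>"
    and d1: "0 < \<delta>1"
    and collar: "\<And>\<delta>. 0 < \<delta> \<Longrightarrow> \<delta> \<le> \<delta>1 \<Longrightarrow> collar_kernel_lip \<Omega> (\<eta> \<delta>) (\<eta>' \<delta>) \<psi> \<psi>' B"
    and eta_small: "\<And>\<delta> x. 0 < \<delta> \<Longrightarrow> x \<in> \<Omega> \<Longrightarrow> \<eta> \<delta> x \<le> \<delta> * M"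
    and rho_meas[measurable]: "\<rho> \<in> borel_measurable borel"
    and rho_nonneg: "\<And>s. 0 \<le> s \<Longrightarrow> 0 \<le> \<rho> s" and rho_supp: "\<And>s. 1 \<le> s \<Longrightarrow> \<rho> s = 0"
    and rho_pos: "0 < C\<^sub>\<rho>" "0 < c\<^sub>\<rho>" "c\<^sub>\<rho> < 1" "\<And>s. 0 \<le> s \<Longrightarrow> s \<le> c\<^sub>\<rho> \<Longrightarrow> C\<^sub>\<rho> \<le> \<rho> s"
    and rho_norm: "(\<integral>\<^sup>+z. ennreal (norm z powr (p - \<beta>) * \<rho> (norm (z::'a))) \<partial>lborel) = ennreal (Cbar DIM('a) p)"
    and f_dual: "W1p_dual p \<Omega> f"
    and fin: "finite I"
    and b_meas: "\<And>j. j \<in> I \<Longrightarrow> b j \<in> borel_measurable borel"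
    and g_meas: "\<And>j. j \<in> I \<Longrightarrow> g j \<in> borel_measurable borel"
    and b_bound: "\<And>j x. j \<in> I \<Longrightarrow> \<bar>b j x\<bar> \<le> Bb" and g_bound: "\<And>j x. j \<in> I \<Longrightarrow> norm (g j x) \<le> Bb"
    and b_deriv: "\<And>j x. j \<in> I \<Longrightarrow> x \<in> D \<Longrightarrow> (b j has_derivative (\<lambda>h. g j x \<bullet> h)) (at x)"
begin

abbreviation Leb :: "'a measure" where "Leb \<equiv> lebesgue_on \<Omega>"

lemma open_dom: "open \<Omega>" and bounded_dom: "bounded \<Omega>"
  using collar[OF d1 order_refl] by (auto simp: collar_kernel_lip_def collar_kernel_def)

lemma dom_borel[measurable]: "\<Omega> \<in> sets borel" using open_dom by simp

lemma lmeas_dom: "\<Omega> \<in> lmeasurable"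
  using open_dom bounded_dom by (simp add: lmeasurable_open)

lemma p0: "0 < p" and p1: "1 \<le> p" using p by auto

section \<open>Functions with given coefficients\<close>

definition U :: "('i \<Rightarrow> real) \<Rightarrow> 'a \<Rightarrow> real" where "U c x = (\<Sum>j\<in>I. c j * b j x)"
definition Gr :: "('i \<Rightarrow> real) \<Rightarrow> 'a \<Rightarrow> 'a" where "Gr c x = (\<Sum>j\<in>I. c j *\<^sub>R g j x)"
definition csum :: "('i \<Rightarrow> real) \<Rightarrow> real" where "csum c = (\<Sum>j\<in>I. \<bar>c j\<bar>)"

lemma csum_nonneg: "0 \<le> csum c" by (simp add: csum_def sum_nonneg)

lemma U_meas[measurable]: "U c \<in> borel_measurable borel"
  unfolding U_def[abs_def] by (intro borel_measurable_sum borel_measurable_times b_meas) auto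

lemma Gr_meas[measurable]: "Gr c \<in> borel_measurable borel"
  unfolding Gr_def[abs_def] by (intro borel_measurable_sum borel_measurable_scaleR g_meas) auto

lemma U_bound: "\<bar>U c x\<bar> \<le> csum c * Bb"
proof -
  have "\<bar>U c x\<bar> \<le> (\<Sum>j\<in>I. \<bar>c j * b j x\<bar>)" unfolding U_def by (rule sum_abs)
  also have "\<dots> \<le> (\<Sum>j\<in>I. \<bar>c j\<bar> * Bb)"
    using b_bound by (intro sum_mono) (auto simp: abs_mult intro: mult_left_mono)
  finally show ?thesis by (simp add: csum_def sum_distrib_right)
qed

lemma Gr_bound: "norm (Gr c x) \<le> csum c * Bb"
proof -
  have "norm (Gr c x) \<le> (\<Sum>j\<in>I. norm (c j *\<^sub>R g j x))" unfolding Gr_def by (rule norm_sum)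
  also have "\<dots> \<le> (\<Sum>j\<in>I. \<bar>c j\<bar> * Bb)"
    using g_bound by (intro sum_mono) (auto intro: mult_left_mono)
  finally show ?thesis by (simp add: csum_def sum_distrib_right)
qed

lemma U_add: "U (\<lambda>j. c j + c' j) x = U c x + U c' x" by (simp add: U_def distrib_right sum.distrib)
lemma U_scale: "U (\<lambda>j. s * c j) x = s * U c x" by (simp add: U_def sum_distrib_left mult.assoc)
lemma Gr_add: "Gr (\<lambda>j. c j + c' j) x = Gr c x + Gr c' x" by (simp add: Gr_def scaleR_add_left sum.distrib)
lemma Gr_scale: "Gr (\<lambda>j. s * c j) x = s *\<^sub>R Gr c x" by (simp add: Gr_def scaleR_sum_right)

lemma U_deriv: "x \<in> D \<Longrightarrow> (U c has_derivative (\<lambda>h. Gr c x \<bullet> h)) (at x)"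
proof -
  assume x: "x \<in> D"
  have "((\<lambda>x. \<Sum>j\<in>I. c j * b j x) has_derivative (\<lambda>h. \<Sum>j\<in>I. c j * (g j x \<bullet> h))) (at x)"
    by (intro has_derivative_sum has_derivative_mult_right b_deriv x)
  then show ?thesis by (simp add: U_def[abs_def] Gr_def inner_sum_left)
qed

text \<open>The radius depends on \<open>x\<close> and \<open>e\<close> but not on the coefficients,
  because the remainder is linear in them. One radius thus serves a whole sequence of coefficient
  vectors.\<close>

lemma U_taylor:
  assumes x: "x \<in> D" and e: "0 < e"
  obtains r where "0 < r" "ball x r \<subseteq> D"
    "\<And>c y. y \<in> ball x r \<Longrightarrow> \<bar>U c y - U c x - Gr c x \<bullet> (y - x)\<bar> \<le> e * csum c * norm (y - x)"
proof -
  have "\<forall>j\<in>I. \<exists>r>0. \<forall>y. norm (y - x) < r \<longrightarrow> \<bar>b j y - b j x - g j x \<bullet> (y - x)\<bar> \<le> e * norm (y - x)"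
  proof
    fix j assume "j \<in> I"
    from b_deriv[OF this x] e show "\<exists>r>0. \<forall>y. norm (y - x) < r \<longrightarrow> \<bar>b j y - b j x - g j x \<bullet> (y - x)\<bar> \<le> e * norm (y - x)"
      unfolding has_derivative_at_alt by (auto simp del: norm_conv_dist)
  qed
  then obtain r where r: "\<And>j. j \<in> I \<Longrightarrow> 0 < r j"
    "\<And>j y. j \<in> I \<Longrightarrow> norm (y - x) < r j \<Longrightarrow> \<bar>b j y - b j x - g j x \<bullet> (y - x)\<bar> \<le> e * norm (y - x)" by metis
  obtain r0 where r0: "0 < r0" "ball x r0 \<subseteq> D" using D(1) x open_contains_ball by blast
  define R where "R = Min (insert r0 (r ` I))"
  have R: "0 < R" "R \<le> r0" "\<And>j. j \<in> I \<Longrightarrow> R \<le> r j" using r(1) r0(1) fin by (auto simp: R_def)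
  show ?thesis
  proof (rule that[of R])
    show "0 < R" by (rule R)
    show "ball x R \<subseteq> D" using R(2) r0(2) by (meson order_trans subset_ball)
    fix c y assume y: "y \<in> ball x R"
    have "U c y - U c x - Gr c x \<bullet> (y - x) = (\<Sum>j\<in>I. c j * (b j y - b j x - g j x \<bullet> (y - x)))"
      by (simp add: U_def Gr_def inner_sum_left right_diff_distrib sum_subtractf)
    also have "\<bar>\<dots>\<bar> \<le> (\<Sum>j\<in>I. \<bar>c j * (b j y - b j x - g j x \<bullet> (y - x))\<bar>)" by (rule sum_abs)
    also have "\<dots> \<le> (\<Sum>j\<in>I. \<bar>c j\<bar> * (e * norm (y - x)))"
    proof (rule sum_mono)
      fix j assume j: "j \<in> I"
      have "norm (y - x) < r j" using y R(3)[OF j] by (simp add: dist_norm norm_minus_commute)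
      then show "\<bar>c j * (b j y - b j x - g j x \<bullet> (y - x))\<bar> \<le> \<bar>c j\<bar> * (e * norm (y - x))"
        unfolding abs_mult using r(2)[OF j] by (intro mult_left_mono) auto
    qed
    also have "\<dots> = e * csum c * norm (y - x)" by (simp add: csum_def sum_distrib_left sum_distrib_right mult_ac)
    finally show "\<bar>U c y - U c x - Gr c x \<bullet> (y - x)\<bar> \<le> e * csum c * norm (y - x)" .
  qed
qed

definition conv :: "(nat \<Rightarrow> 'i \<Rightarrow> real) \<Rightarrow> ('i \<Rightarrow> real) \<Rightarrow> bool" where
  "conv cs c \<longleftrightarrow> (\<forall>j\<in>I. (\<lambda>n. cs n j) \<longlonglongrightarrow> c j)"

lemma conv_U: "conv cs c \<Longrightarrow> (\<lambda>n. U (cs n) x) \<longlonglongrightarrow> U c x"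
  unfolding U_def conv_def by (intro tendsto_sum tendsto_mult) auto

lemma conv_Gr: "conv cs c \<Longrightarrow> (\<lambda>n. Gr (cs n) x) \<longlonglongrightarrow> Gr c x"
  unfolding Gr_def conv_def by (intro tendsto_sum tendsto_scaleR) auto

lemma conv_csum: "conv cs c \<Longrightarrow> (\<lambda>n. csum (cs n)) \<longlonglongrightarrow> csum c"
  unfolding csum_def conv_def by (intro tendsto_sum tendsto_rabs) auto

lemma conv_csum_bounded:
  assumes "conv cs c"
  obtains S where "0 < S" "\<And>n. csum (cs n) \<le> S"
proof -
  obtain S where "0 < S" "\<And>n. \<bar>csum (cs n)\<bar> \<le> S"
    using convergent_imp_Bseq[OF convergentI[OF conv_csum[OF assms]]] by (auto elim!: BseqE)
  then show ?thesis using that[of S] by (meson abs_le_D1)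
qed

section \<open>Pointwise limits of the mollifications and their gradients\<close>

lemma eta_tendsto_0:
  assumes "\<And>n. 0 < d n" "d \<longlonglongrightarrow> 0" "x \<in> \<Omega>" "\<And>n. d n \<le> \<delta>1"
  shows "(\<lambda>n. \<eta> (d n) x) \<longlonglongrightarrow> 0"
proof (rule tendsto_sandwich[of "\<lambda>_. 0" _ _ "\<lambda>n. d n * M"])
  have "0 < \<eta> (d n) x" for n
    using collar[OF assms(1,4)] assms(3) by (simp add: collar_kernel_lip_def collar_kernel_def)
  then show "\<forall>\<^sub>F n in sequentially. 0 \<le> \<eta> (d n) x" by (simp add: less_imp_le)
  show "\<forall>\<^sub>F n in sequentially. \<eta> (d n) x \<le> d n * M" using eta_small assms by simp
  show "(\<lambda>n. d n * M) \<longlonglongrightarrow> 0" using tendsto_mult_right[OF assms(2), of M] by simp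
qed simp

abbreviation KK :: "real \<Rightarrow> ('a \<Rightarrow> real) \<Rightarrow> 'a \<Rightarrow> real" where "KK \<delta> \<equiv> collar_kernel.Kc \<Omega> (\<eta> \<delta>) \<psi>"
abbreviation GK :: "real \<Rightarrow> ('a \<Rightarrow> real) \<Rightarrow> 'a \<Rightarrow> 'a" where "GK \<delta> \<equiv> collar_kernel.grad_Kc \<Omega> (\<eta> \<delta>) (\<eta>' \<delta>) \<psi> \<psi>'"

lemma eventually_eta_less:
  assumes "\<And>n. 0 < d n" "d \<longlonglongrightarrow> 0" "x \<in> \<Omega>" "\<And>n. d n \<le> \<delta>1" "0 < r"
  shows "\<forall>\<^sub>F n in sequentially. \<eta> (d n) x < r"
  using eta_tendsto_0[OF assms(1-4)] assms(5) by (rule order_tendstoD)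

lemma KK_tendsto:
  assumes cv: "conv cs c" and d: "\<And>n. 0 < d n" "d \<longlonglongrightarrow> 0" "\<And>n. d n \<le> \<delta>1" and x: "x \<in> D"
  shows "(\<lambda>n. KK (d n) (U (cs n)) x) \<longlonglongrightarrow> U c x"
proof -
  obtain S where S: "0 < S" "\<And>n. csum (cs n) \<le> S" using conv_csum_bounded[OF cv] by blast
  have xo: "x \<in> \<Omega>" using x D by blast
  obtain r where r: "0 < r" "ball x r \<subseteq> D"
    "\<And>c y. y \<in> ball x r \<Longrightarrow> \<bar>U c y - U c x - Gr c x \<bullet> (y - x)\<bar> \<le> 1 * csum c * norm (y - x)"
    using U_taylor[OF x zero_less_one] by blast
  have Bb0: "0 \<le> S * \<bar>Bb\<bar>" using S by simp
  have ev: "\<forall>\<^sub>F n in sequentially. norm (KK (d n) (U (cs n)) x - U (cs n) x) \<le> (S + S * \<bar>Bb\<bar>) * \<eta> (d n) x"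
    using eventually_eta_less[OF d(1,2) xo d(3) r(1)]
  proof eventually_elim
    case (elim n)
    interpret K: collar_kernel_lip \<Omega> "\<eta> (d n)" "\<eta>' (d n)" \<psi> \<psi>' B by (rule collar[OF d(1,3)])
    have e0: "0 < \<eta> (d n) x" by (rule K.eta_pos[OF xo])
    have "\<bar>KK (d n) (U (cs n)) x - U (cs n) x\<bar> \<le> (S + S * \<bar>Bb\<bar>) * \<eta> (d n) x"
    proof (rule K.Kc_near[OF U_meas U_bound xo])
      fix y assume y: "y \<in> ball x (\<eta> (d n) x)"
      have ny: "norm (y - x) \<le> \<eta> (d n) x" using y by (simp add: dist_norm norm_minus_commute)
      have "\<bar>U (cs n) y - U (cs n) x - Gr (cs n) x \<bullet> (y - x)\<bar> \<le> csum (cs n) * norm (y - x)"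
        using r(3)[of y "cs n"] y elim by simp
      moreover have "csum (cs n) * norm (y - x) \<le> S * \<eta> (d n) x" using S ny csum_nonneg by (intro mult_mono) auto
      moreover have "\<bar>Gr (cs n) x \<bullet> (y - x)\<bar> \<le> norm (Gr (cs n) x) * norm (y - x)" by (rule Cauchy_Schwarz_ineq2)
      moreover have "norm (Gr (cs n) x) * norm (y - x) \<le> (S * \<bar>Bb\<bar>) * \<eta> (d n) x"
      proof (intro mult_mono ny Bb0)
        have "norm (Gr (cs n) x) \<le> csum (cs n) * Bb" by (rule Gr_bound)
        also have "\<dots> \<le> csum (cs n) * \<bar>Bb\<bar>" using csum_nonneg by (intro mult_left_mono) auto
        also have "\<dots> \<le> S * \<bar>Bb\<bar>" using S by (intro mult_right_mono) auto
        finally show "norm (Gr (cs n) x) \<le> S * \<bar>Bb\<bar>" .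
      qed simp
      ultimately show "\<bar>U (cs n) y - U (cs n) x\<bar> \<le> (S + S * \<bar>Bb\<bar>) * \<eta> (d n) x"
        unfolding distrib_right by linarith
    qed (use e0 S Bb0 in simp)
    then show ?case by simp
  qed
  have "(\<lambda>n. (S + S * \<bar>Bb\<bar>) * \<eta> (d n) x) \<longlonglongrightarrow> (S + S * \<bar>Bb\<bar>) * 0"
    by (intro tendsto_mult tendsto_const eta_tendsto_0[OF d(1,2) xo d(3)])
  then have "(\<lambda>n. KK (d n) (U (cs n)) x - U (cs n) x) \<longlonglongrightarrow> 0"
    using Lim_null_comparison[OF ev] by simp
  from tendsto_add[OF this conv_U[OF cv, of x]] show ?thesis by simp
qed

text \<open>The value of \<open>C_ker\<close> in all interpretations of the kernel locale, restated
  as one constant for all \<delta>.\<close>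

definition "C_K = (real DIM('a) + 2) * B"

text \<open>At a point of \<open>D\<close> the ball of radius \<open>\<eta> (d n) x\<close>
  eventually lies in the ball of \<open>U_taylor\<close>. Jumps are then out of sight, and
  \<open>dKc_taylor\<close> gives the gradient up to any prescribed error.\<close>

lemma GK_tendsto:
  assumes cv: "conv cs c" and d: "\<And>n. 0 < d n" "d \<longlonglongrightarrow> 0" "\<And>n. d n \<le> \<delta>1" and x: "x \<in> D"
  shows "(\<lambda>n. GK (d n) (U (cs n)) x) \<longlonglongrightarrow> Gr c x"
proof -
  obtain S where S: "0 < S" "\<And>n. csum (cs n) \<le> S" using conv_csum_bounded[OF cv] by blast
  have xo: "x \<in> \<Omega>" using x D by blast
  have "(\<lambda>n. (GK (d n) (U (cs n)) x - Gr (cs n) x) \<bullet> i) \<longlonglongrightarrow> 0" if i: "i \<in> Basis" for i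
  proof (rule LIMSEQ_I)
    fix e :: real assume e: "0 < e"
    let ?w = "unit_ball_vol (real DIM('a))"
    have CK0: "0 \<le> C_K"
    proof -
      interpret K: collar_kernel_lip \<Omega> "\<eta> \<delta>1" "\<eta>' \<delta>1" \<psi> \<psi>' B by (rule collar[OF d1 order_refl])
      show ?thesis using K.B_nonneg by (simp add: C_K_def)
    qed
    define P where "P = C_K * ?w + 1"
    define \<epsilon> where "\<epsilon> = e / (P * (2 * S))"
    have w: "0 < ?w" by (simp add: unit_ball_vol_pos)
    have pos: "0 < P" using CK0 w by (simp add: P_def add_nonneg_pos)
    have eps: "0 < \<epsilon>" using e S pos by (simp add: \<epsilon>_def)
    have small: "C_K * ?w * (\<epsilon> * S) < e"
    proof -
      have "C_K * ?w * (\<epsilon> * S) \<le> P * (\<epsilon> * S)" using eps S unfolding P_def by (intro mult_right_mono) auto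
      also have "\<dots> = e / 2" using pos S(1) by (simp add: \<epsilon>_def)
      finally show ?thesis using e by linarith
    qed
    obtain r where r: "0 < r" "ball x r \<subseteq> D"
      "\<And>c y. y \<in> ball x r \<Longrightarrow> \<bar>U c y - U c x - Gr c x \<bullet> (y - x)\<bar> \<le> \<epsilon> * csum c * norm (y - x)"
      using U_taylor[OF x eps] by blast
    have "\<forall>\<^sub>F n in sequentially. norm ((GK (d n) (U (cs n)) x - Gr (cs n) x) \<bullet> i - 0) < e"
      using eventually_eta_less[OF d(1,2) xo d(3) r(1)]
    proof eventually_elim
      case (elim n)
      interpret K: collar_kernel_lip \<Omega> "\<eta> (d n)" "\<eta>' (d n)" \<psi> \<psi>' B by (rule collar[OF d(1,3)])
      have "\<bar>K.dKc i (U (cs n)) x - Gr (cs n) x \<bullet> i\<bar> \<le> K.C_ker * ?w * (\<epsilon> * S)"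
      proof (rule K.dKc_taylor[OF U_meas U_bound xo i])
        fix y assume y: "y \<in> ball x (\<eta> (d n) x)"
        have "\<bar>U (cs n) y - U (cs n) x - Gr (cs n) x \<bullet> (y - x)\<bar> \<le> \<epsilon> * csum (cs n) * norm (y - x)"
          using r(3)[of y "cs n"] y elim by simp
        also have "\<dots> \<le> \<epsilon> * S * norm (y - x)" using S eps by (intro mult_right_mono mult_left_mono) auto
        finally show "\<bar>U (cs n) y - U (cs n) x - Gr (cs n) x \<bullet> (y - x)\<bar> \<le> \<epsilon> * S * norm (y - x)" .
      qed (use eps S in simp)
      then have "\<bar>K.dKc i (U (cs n)) x - Gr (cs n) x \<bullet> i\<bar> < e"
        using small by (simp add: K.C_ker_def C_K_def)
      then show ?case using K.grad_Kc_inner[OF i, of "U (cs n)" x] by (simp add: inner_diff_left)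
    qed
    then show "\<exists>no. \<forall>n\<ge>no. norm ((GK (d n) (U (cs n)) x - Gr (cs n) x) \<bullet> i - 0) < e"
      by (simp add: eventually_sequentially)
  qed
  then have "(\<lambda>n. \<Sum>i\<in>Basis. ((GK (d n) (U (cs n)) x - Gr (cs n) x) \<bullet> i) *\<^sub>R i) \<longlonglongrightarrow> (\<Sum>i\<in>(Basis::'a set). 0 *\<^sub>R i)"
    by (intro tendsto_sum tendsto_scaleR tendsto_const) auto
  then have "(\<lambda>n. GK (d n) (U (cs n)) x - Gr (cs n) x) \<longlonglongrightarrow> 0"
    by (simp only: euclidean_representation) simp
  from tendsto_add[OF this conv_Gr[OF cv, of x]] show ?thesis by simp
qed

section \<open>The nonlocal energy and its pointwise limit\<close>

definition inner_energy :: "real \<Rightarrow> ('a \<Rightarrow> real) \<Rightarrow> 'a \<Rightarrow> ennreal" where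
  "inner_energy \<delta> u x = (\<integral>\<^sup>+y. ennreal (\<rho> (dist y x / \<eta> \<delta> x)
     / (\<eta> \<delta> x powr (real DIM('a) + p - \<beta>) * dist x y powr \<beta>) * \<bar>u x - u y\<bar> powr p) \<partial>Leb)"

definition J :: "real \<Rightarrow> ('a \<Rightarrow> real) \<Rightarrow> ennreal" where
  "J \<delta> u = (\<integral>\<^sup>+x. inner_energy \<delta> u x \<partial>Leb)"

text \<open>Under \<open>y = x + \<eta> z\<close> the Jacobian and the powers of the width combine
  so that only the difference quotient of \<open>u\<close> at scale \<eta> remains. The restriction
  to \<Omega> drops because \<rho> vanishes from 1 on.\<close>

lemma inner_energy_scale:
  assumes d: "0 < \<delta>" "\<delta> \<le> \<delta>1" and x: "x \<in> \<Omega>" and [measurable]: "u \<in> borel_measurable borel"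
  shows "inner_energy \<delta> u x = (\<integral>\<^sup>+z. ennreal (\<rho> (norm z) / norm z powr \<beta> * (\<bar>u (x + \<eta> \<delta> x *\<^sub>R z) - u x\<bar> / \<eta> \<delta> x) powr p) \<partial>lborel)"
proof -
  interpret K: collar_kernel_lip \<Omega> "\<eta> \<delta>" "\<eta>' \<delta>" \<psi> \<psi>' B by (rule collar[OF d])
  let ?e = "\<eta> \<delta> x" and ?d = "real DIM('a)"
  have e: "0 < ?e" by (rule K.eta_pos[OF x])
  let ?h = "\<lambda>y. ennreal (\<rho> (dist y x / ?e) / (?e powr (?d + p - \<beta>) * dist x y powr \<beta>) * \<bar>u x - u y\<bar> powr p)"
  have ind: "?h y * indicator \<Omega> y = ?h y" for y
  proof (cases "dist y x < ?e")
    case True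
    then have "y \<in> \<Omega>" using K.eta_ball[OF x] by (auto simp: dist_commute)
    then show ?thesis by simp
  next
    case False
    then have "\<rho> (dist y x / ?e) = 0" using e by (intro rho_supp) simp
    then show ?thesis by simp
  qed
  have "inner_energy \<delta> u x = (\<integral>\<^sup>+y. ?h y \<partial>lborel)"
  proof -
    have "\<Omega> \<in> sets lebesgue" using open_dom by simp
    then show ?thesis unfolding inner_energy_def by (simp only: nn_integral_lebesgue_on ind)
  qed
  also have "\<dots> = ennreal (\<bar>?e\<bar> ^ DIM('a)) * (\<integral>\<^sup>+z. ?h (x + ?e *\<^sub>R z) \<partial>lborel)"
    using e by (intro nn_integral_lborel_affine) auto
  also have "\<dots> = (\<integral>\<^sup>+z. ennreal (\<bar>?e\<bar> ^ DIM('a)) * ?h (x + ?e *\<^sub>R z) \<partial>lborel)"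
    by (rule nn_integral_cmult[symmetric]) measurable
  also have "\<dots> = (\<integral>\<^sup>+z. ennreal (\<rho> (norm z) / norm z powr \<beta> * (\<bar>u (x + ?e *\<^sub>R z) - u x\<bar> / ?e) powr p) \<partial>lborel)"
  proof (rule nn_integral_cong)
    fix z :: 'a
    have 1: "dist (x + ?e *\<^sub>R z) x / ?e = norm z" "dist x (x + ?e *\<^sub>R z) = ?e * norm z"
      using e by (simp_all add: dist_norm)
    have 2: "?e powr (?d + p - \<beta>) * (?e * norm z) powr \<beta> = ?e ^ DIM('a) * (?e powr p * norm z powr \<beta>)"
    proof -
      have "?e powr (?d + p - \<beta>) * (?e powr \<beta> * norm z powr \<beta>) = ?e powr (?d + p) * norm z powr \<beta>"
        by (simp add: powr_add[symmetric] flip: mult.assoc)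
      also have "?e powr (?d + p) = ?e ^ DIM('a) * ?e powr p" using e by (simp add: powr_add powr_realpow)
      finally show ?thesis using e by (simp add: powr_mult mult_ac)
    qed
    have 3: "(\<bar>u (x + ?e *\<^sub>R z) - u x\<bar> / ?e) powr p = \<bar>u x - u (x + ?e *\<^sub>R z)\<bar> powr p / ?e powr p"
      using e by (simp add: powr_divide abs_minus_commute)
    have "?e ^ DIM('a) * (\<rho> (norm z) / (?e ^ DIM('a) * (?e powr p * norm z powr \<beta>)) * \<bar>u x - u (x + ?e *\<^sub>R z)\<bar> powr p)
       = \<rho> (norm z) / norm z powr \<beta> * (\<bar>u x - u (x + ?e *\<^sub>R z)\<bar> powr p / ?e powr p)"
      using e by simp
    then show "ennreal (\<bar>?e\<bar> ^ DIM('a)) * ?h (x + ?e *\<^sub>R z) = ennreal (\<rho> (norm z) / norm z powr \<beta> * (\<bar>u (x + ?e *\<^sub>R z) - u x\<bar> / ?e) powr p)"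
      unfolding 1 2 3 using e rho_nonneg by (subst ennreal_mult'[symmetric]) simp_all
  qed
  finally show ?thesis .
qed

text \<open>\<open>directional_moment\<close> for the radial weight \<rho> divided by the power
  \<beta> of the norm; the normalisation of \<rho> is exactly what cancels
  \<open>Cbar\<close>.\<close>

lemma rho_directional:
  "(\<integral>\<^sup>+z. ennreal (\<rho> (norm z) / norm z powr \<beta> * \<bar>v \<bullet> z\<bar> powr p) \<partial>lborel) = ennreal (norm (v::'a) powr p)"
proof -
  let ?\<phi> = "\<lambda>s. ennreal (\<rho> (sqrt s) / sqrt s powr \<beta>)"
  have C: "0 < Cbar DIM('a) p" using p0 by (intro Cbar_pos) auto
  have 1: "?\<phi> ((norm z)\<^sup>2) * ennreal t = ennreal (\<rho> (norm z) / norm z powr \<beta> * t)" if "0 \<le> t" for z :: 'a and t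
  proof -
    have "?\<phi> ((norm z)\<^sup>2) = ennreal (\<rho> (norm z) / norm z powr \<beta>)" by simp
    moreover have "0 \<le> \<rho> (norm z) / norm z powr \<beta>" using rho_nonneg by simp
    ultimately show ?thesis by (simp only: ennreal_mult[OF _ that])
  qed
  have "(\<integral>\<^sup>+(z::'a). ?\<phi> ((norm z)\<^sup>2) * ennreal (norm z powr p) \<partial>lborel) = ennreal (Cbar DIM('a) p)"
  proof -
    have eq: "(\<rho> (norm z) / norm z powr \<beta>) * norm z powr p = norm z powr (p - \<beta>) * \<rho> (norm z)" for z :: 'a
      by (simp add: powr_diff)
    show ?thesis using rho_norm unfolding 1[OF powr_ge_zero] eq .
  qed
  then have "ennreal (Cbar DIM('a) p) * (\<integral>\<^sup>+z. ?\<phi> ((norm z)\<^sup>2) * ennreal (\<bar>v \<bullet> z\<bar> powr p) \<partial>lborel)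
      = ennreal (norm v powr p) * ennreal (Cbar DIM('a) p)"
    using directional_moment[OF p0, of ?\<phi> v] by simp
  then have "(\<integral>\<^sup>+z. ?\<phi> ((norm z)\<^sup>2) * ennreal (\<bar>v \<bullet> z\<bar> powr p) \<partial>lborel) = ennreal (norm v powr p)"
    using C by (subst (asm) mult.commute[of _ "ennreal (Cbar DIM('a) p)"]) (simp add: ennreal_mult_cancel_left)
  then show ?thesis unfolding 1[OF powr_ge_zero] .
qed

lemma inner_energy_le:
  assumes d: "0 < \<delta>" "\<delta> \<le> \<delta>1" and x: "x \<in> \<Omega>" and u[measurable]: "u \<in> borel_measurable borel"
    and lip: "AE y in lborel. dist y x < \<eta> \<delta> x \<longrightarrow> \<bar>u y - u x\<bar> \<le> L * dist y x" and L: "0 \<le> L"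
  shows "inner_energy \<delta> u x \<le> ennreal (L powr p * Cbar DIM('a) p)"
proof -
  interpret K: collar_kernel_lip \<Omega> "\<eta> \<delta>" "\<eta>' \<delta>" \<psi> \<psi>' B by (rule collar[OF d])
  let ?e = "\<eta> \<delta> x" and ?d = "real DIM('a)"
  have e: "0 < ?e" by (rule K.eta_pos[OF x])
  have "AE z in lborel. dist (x + ?e *\<^sub>R z) x < ?e \<longrightarrow> \<bar>u (x + ?e *\<^sub>R z) - u x\<bar> \<le> L * dist (x + ?e *\<^sub>R z) x"
  proof -
    \<comment> \<open>The Lipschitz bound is available for almost every \<open>y\<close> only; the
      affine substitution preserves null sets.\<close>
    have "AE y in density (distr lborel borel (\<lambda>z. x + ?e *\<^sub>R z)) (\<lambda>_. \<bar>?e\<bar> ^ DIM('a)). dist y x < ?e \<longrightarrow> \<bar>u y - u x\<bar> \<le> L * dist y x"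
      using lip by (subst lborel_affine[of ?e x, symmetric]) (use e in auto)
    then show ?thesis using e by (subst (asm) AE_density) (auto simp: AE_distr_iff)
  qed
  then have "inner_energy \<delta> u x \<le> (\<integral>\<^sup>+(z::'a). ennreal (L powr p) * ennreal (norm z powr (p - \<beta>) * \<rho> (norm z)) \<partial>lborel)"
    unfolding inner_energy_scale[OF d x u]
  proof (intro nn_integral_mono_AE, elim AE_mp, intro AE_I2 impI)
    fix z :: 'a assume *: "dist (x + ?e *\<^sub>R z) x < ?e \<longrightarrow> \<bar>u (x + ?e *\<^sub>R z) - u x\<bar> \<le> L * dist (x + ?e *\<^sub>R z) x"
    show "ennreal (\<rho> (norm z) / norm z powr \<beta> * (\<bar>u (x + ?e *\<^sub>R z) - u x\<bar> / ?e) powr p)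
        \<le> ennreal (L powr p) * ennreal (norm z powr (p - \<beta>) * \<rho> (norm z))"
    proof (cases "norm z < 1")
      case False then show ?thesis by (simp add: rho_supp)
    next
      case True
      then have "\<bar>u (x + ?e *\<^sub>R z) - u x\<bar> \<le> L * (?e * norm z)" using * e by (simp add: dist_norm)
      then have "\<bar>u (x + ?e *\<^sub>R z) - u x\<bar> / ?e \<le> L * norm z" using e by (simp add: field_simps)
      then have "(\<bar>u (x + ?e *\<^sub>R z) - u x\<bar> / ?e) powr p \<le> (L * norm z) powr p"
        using p e by (intro powr_mono2) auto
      also have "\<dots> = L powr p * norm z powr p" using L by (simp add: powr_mult)
      finally have "\<rho> (norm z) / norm z powr \<beta> * (\<bar>u (x + ?e *\<^sub>R z) - u x\<bar> / ?e) powr p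
          \<le> \<rho> (norm z) / norm z powr \<beta> * (L powr p * norm z powr p)"
        using rho_nonneg by (intro mult_left_mono) auto
      also have "\<dots> = L powr p * (norm z powr (p - \<beta>) * \<rho> (norm z))" by (simp add: powr_diff)
      finally show ?thesis using rho_nonneg by (simp add: ennreal_mult[symmetric] ennreal_leI)
    qed
  qed
  also have "\<dots> = ennreal (L powr p) * ennreal (Cbar DIM('a) p)"
    using rho_norm by (subst nn_integral_cmult) auto
  also have "\<dots> = ennreal (L powr p * Cbar DIM('a) p)"
    using Cbar_pos[OF p0, of "DIM('a)"] by (simp add: ennreal_mult)
  finally show ?thesis .
qed

lemma inner_energy_tendsto:
  assumes cv: "conv cs c" and d: "\<And>n. 0 < d n" "d \<longlonglongrightarrow> 0" "\<And>n. d n \<le> \<delta>1" and x: "x \<in> D"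
  shows "(\<lambda>n. inner_energy (d n) (U (cs n)) x) \<longlonglongrightarrow> ennreal (norm (Gr c x) powr p)"
proof -
  have xo: "x \<in> \<Omega>" using x D by blast
  obtain S where S: "0 < S" "\<And>n. csum (cs n) \<le> S" using conv_csum_bounded[OF cv] by blast
  define e where "e n = \<eta> (d n) x" for n
  have e0: "0 < e n" for n
    using collar[OF d(1,3)] xo by (simp add: e_def collar_kernel_lip_def collar_kernel_def)
  have elim0: "e \<longlonglongrightarrow> 0" unfolding e_def[abs_def] by (rule eta_tendsto_0[OF d(1,2) xo d(3)])
  let ?q = "\<lambda>n z. \<bar>U (cs n) (x + e n *\<^sub>R z) - U (cs n) x\<bar> / e n"
  let ?k = "\<lambda>n z. ennreal (\<rho> (norm z) / norm z powr \<beta> * ?q n z powr p)"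
  obtain r0 where r0: "0 < r0" "ball x r0 \<subseteq> D"
    "\<And>c y. y \<in> ball x r0 \<Longrightarrow> \<bar>U c y - U c x - Gr c x \<bullet> (y - x)\<bar> \<le> 1 * csum c * norm (y - x)"
    using U_taylor[OF x zero_less_one] by blast
  have "\<forall>\<^sub>F n in sequentially. e n < r0" using elim0 r0(1) by (rule order_tendstoD)
  then obtain n0 where n0: "\<And>n. n \<ge> n0 \<Longrightarrow> e n < r0" by (auto simp: eventually_sequentially)
  \<comment> \<open>A Lipschitz constant relative to \<open>x\<close>, uniform in \<open>n\<close>:
    \<open>S\<close> covers the Taylor remainder with tolerance 1, the second term the
    gradients.\<close>
  define L where "L = S + S * \<bar>Bb\<bar>"
  have qb: "?q n z \<le> L * norm z" if "n \<ge> n0" "norm z < 1" for n z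
  proof -
    have "e n * norm z < e n * 1" using that(2) e0[of n] by (intro mult_strict_left_mono) auto
    moreover have "norm (e n *\<^sub>R z) = e n * norm z" using e0[of n] by simp
    ultimately have nz: "norm (e n *\<^sub>R z) < r0" using n0[OF that(1)] by linarith
    then have "x + e n *\<^sub>R z \<in> ball x r0" by (simp add: dist_norm)
    from r0(3)[OF this, of "cs n"]
    have 1: "\<bar>U (cs n) (x + e n *\<^sub>R z) - U (cs n) x - Gr (cs n) x \<bullet> (e n *\<^sub>R z)\<bar> \<le> csum (cs n) * (e n * norm z)"
      using e0[of n] by simp
    have 2: "\<bar>Gr (cs n) x \<bullet> (e n *\<^sub>R z)\<bar> \<le> norm (Gr (cs n) x) * (e n * norm z)"
      using Cauchy_Schwarz_ineq2[of "Gr (cs n) x" "e n *\<^sub>R z"] e0[of n] by simp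
    have 3: "csum (cs n) * (e n * norm z) \<le> S * (e n * norm z)" using S e0[of n] by (intro mult_right_mono) auto
    have "norm (Gr (cs n) x) \<le> S * \<bar>Bb\<bar>"
    proof -
      have "norm (Gr (cs n) x) \<le> csum (cs n) * Bb" by (rule Gr_bound)
      also have "\<dots> \<le> csum (cs n) * \<bar>Bb\<bar>" using csum_nonneg by (intro mult_left_mono) auto
      also have "\<dots> \<le> S * \<bar>Bb\<bar>" using S by (intro mult_right_mono) auto
      finally show ?thesis .
    qed
    then have 4: "norm (Gr (cs n) x) * (e n * norm z) \<le> (S * \<bar>Bb\<bar>) * (e n * norm z)" using e0[of n] by (intro mult_right_mono) auto
    have "\<bar>U (cs n) (x + e n *\<^sub>R z) - U (cs n) x\<bar> \<le> L * (e n * norm z)"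
      unfolding L_def distrib_right using 1 2 3 4 by linarith
    then show ?thesis using e0[of n] by (simp add: field_simps)
  qed
  have ql: "(\<lambda>n. ?q n z) \<longlonglongrightarrow> \<bar>Gr c x \<bullet> z\<bar>" for z
  proof (cases "z = 0")
    case False
    have "(\<lambda>n. (U (cs n) (x + e n *\<^sub>R z) - U (cs n) x) / e n - Gr (cs n) x \<bullet> z) \<longlonglongrightarrow> 0"
    proof (rule LIMSEQ_I)
      fix t :: real assume t: "0 < t"
      define \<epsilon> where "\<epsilon> = t / (2 * (S * norm z))"
      have eps: "0 < \<epsilon>" using t S False by (simp add: \<epsilon>_def)
      obtain r where r: "0 < r" "ball x r \<subseteq> D"
        "\<And>c y. y \<in> ball x r \<Longrightarrow> \<bar>U c y - U c x - Gr c x \<bullet> (y - x)\<bar> \<le> \<epsilon> * csum c * norm (y - x)"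
        using U_taylor[OF x eps] by blast
      have "0 < r / norm z" using r False by simp
      then have "\<forall>\<^sub>F n in sequentially. e n < r / norm z" using elim0 by (intro order_tendstoD)
      then obtain m where m: "\<And>n. n \<ge> m \<Longrightarrow> e n < r / norm z" by (auto simp: eventually_sequentially)
      have "norm ((U (cs n) (x + e n *\<^sub>R z) - U (cs n) x) / e n - Gr (cs n) x \<bullet> z - 0) < t" if "n \<ge> m" for n
      proof -
        have "norm (e n *\<^sub>R z) < r" using m[OF that] False e0[of n] by (simp add: field_simps)
        then have "x + e n *\<^sub>R z \<in> ball x r" by (simp add: dist_norm)
        from r(3)[OF this, of "cs n"]
        have "\<bar>U (cs n) (x + e n *\<^sub>R z) - U (cs n) x - e n * (Gr (cs n) x \<bullet> z)\<bar> \<le> \<epsilon> * csum (cs n) * (e n * norm z)"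
          using e0[of n] by simp
        also have "\<dots> \<le> \<epsilon> * S * (e n * norm z)" using S eps e0[of n] by (intro mult_right_mono mult_left_mono) auto
        also have "\<dots> = e n * (t / 2)" using S False by (simp add: \<epsilon>_def)
        also have "\<dots> < e n * t" using e0[of n] t by simp
        finally have "\<bar>U (cs n) (x + e n *\<^sub>R z) - U (cs n) x - e n * (Gr (cs n) x \<bullet> z)\<bar> / e n < t"
          using e0[of n] by (simp add: pos_divide_less_eq mult.commute)
        moreover have "(U (cs n) (x + e n *\<^sub>R z) - U (cs n) x) / e n - Gr (cs n) x \<bullet> z
           = (U (cs n) (x + e n *\<^sub>R z) - U (cs n) x - e n * (Gr (cs n) x \<bullet> z)) / e n"
          using e0[of n] by (simp add: diff_divide_distrib)
        ultimately show ?thesis using e0[of n] by (simp add: abs_divide)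
      qed
      then show "\<exists>no. \<forall>n\<ge>no. norm ((U (cs n) (x + e n *\<^sub>R z) - U (cs n) x) / e n - Gr (cs n) x \<bullet> z - 0) < t" by blast
    qed
    from tendsto_add[OF this tendsto_inner[OF conv_Gr[OF cv, of x] tendsto_const[of z]]]
    have "(\<lambda>n. (U (cs n) (x + e n *\<^sub>R z) - U (cs n) x) / e n) \<longlonglongrightarrow> Gr c x \<bullet> z" by simp
    from tendsto_rabs[OF this] show ?thesis using e0 by (simp add: abs_divide abs_of_pos)
  qed simp
  have "(\<lambda>n. \<integral>\<^sup>+z. ?k (n + n0) z \<partial>lborel) \<longlonglongrightarrow> (\<integral>\<^sup>+z. ennreal (\<rho> (norm z) / norm z powr \<beta> * \<bar>Gr c x \<bullet> z\<bar> powr p) \<partial>lborel)"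
  proof (rule nn_integral_dominated_convergence[where w = "\<lambda>z. ennreal (L powr p) * ennreal (norm z powr (p - \<beta>) * \<rho> (norm z))"])
    have "(\<integral>\<^sup>+(z::'a). ennreal (L powr p) * ennreal (norm z powr (p - \<beta>) * \<rho> (norm z)) \<partial>lborel) = ennreal (L powr p) * ennreal (Cbar DIM('a) p)"
      using rho_norm by (subst nn_integral_cmult) auto
    then show "(\<integral>\<^sup>+(z::'a). ennreal (L powr p) * ennreal (norm z powr (p - \<beta>) * \<rho> (norm z)) \<partial>lborel) < \<infinity>"
      by (simp add: ennreal_mult_less_top)
    show "AE z in lborel. ?k (n + n0) z \<le> ennreal (L powr p) * ennreal (norm z powr (p - \<beta>) * \<rho> (norm z))" for n
    proof (rule AE_I2)
      fix z :: 'a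
      show "?k (n + n0) z \<le> ennreal (L powr p) * ennreal (norm z powr (p - \<beta>) * \<rho> (norm z))"
      proof (cases "norm z < 1")
        case False then show ?thesis by (simp add: rho_supp)
      next
        case True
        have "?q (n + n0) z powr p \<le> (L * norm z) powr p"
          using qb[OF _ True, of "n + n0"] p e0[of "n + n0"] by (intro powr_mono2) auto
        also have "\<dots> = L powr p * norm z powr p" by (simp add: powr_mult)
        finally have "\<rho> (norm z) / norm z powr \<beta> * ?q (n + n0) z powr p \<le> \<rho> (norm z) / norm z powr \<beta> * (L powr p * norm z powr p)"
          using rho_nonneg by (intro mult_left_mono) auto
        also have "\<dots> = L powr p * (norm z powr (p - \<beta>) * \<rho> (norm z))" by (simp add: powr_diff)
        finally show ?thesis using rho_nonneg by (simp add: ennreal_mult[symmetric] ennreal_leI)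
      qed
    qed
    show "AE z in lborel. (\<lambda>n. ?k (n + n0) z) \<longlonglongrightarrow> ennreal (\<rho> (norm z) / norm z powr \<beta> * \<bar>Gr c x \<bullet> z\<bar> powr p)"
    proof (rule AE_I2)
      fix z :: 'a
      have "(\<lambda>n. ?q n z powr p) \<longlonglongrightarrow> \<bar>Gr c x \<bullet> z\<bar> powr p"
        using ql[of z] p0 e0 by (intro tendsto_powr') (auto intro!: always_eventually simp: less_imp_le)
      then have "(\<lambda>n. ?k n z) \<longlonglongrightarrow> ennreal (\<rho> (norm z) / norm z powr \<beta> * \<bar>Gr c x \<bullet> z\<bar> powr p)"
        by (intro tendsto_ennrealI tendsto_mult tendsto_const)
      then show "(\<lambda>n. ?k (n + n0) z) \<longlonglongrightarrow> ennreal (\<rho> (norm z) / norm z powr \<beta> * \<bar>Gr c x \<bullet> z\<bar> powr p)"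
        by (rule LIMSEQ_ignore_initial_segment)
    qed
  qed measurable
  then have "(\<lambda>n. \<integral>\<^sup>+z. ?k n z \<partial>lborel) \<longlonglongrightarrow> (\<integral>\<^sup>+z. ennreal (\<rho> (norm z) / norm z powr \<beta> * \<bar>Gr c x \<bullet> z\<bar> powr p) \<partial>lborel)"
    by (rule LIMSEQ_offset)
  then show ?thesis
    unfolding inner_energy_scale[OF d(1,3) xo U_meas] rho_directional e_def .
qed

lemma AE_dom_D: "AE x in Leb. x \<in> D"
proof -
  have "AE x in lebesgue. x \<in> \<Omega> \<longrightarrow> x \<in> D"
    by (rule AE_I'[of "\<Omega> - D"]) (use D(3) in \<open>auto simp: negligible_iff_null_sets\<close>)
  then show ?thesis using open_dom by (simp add: AE_restrict_space_iff)
qed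

lemma finite_measure_dom: "finite_measure Leb"
  by (rule finite_measure_lebesgue_on[OF lmeas_dom])

lemma Lp_on_bounded:
  assumes "u \<in> borel_measurable borel" "\<And>x. x \<in> \<Omega> \<Longrightarrow> \<bar>u x\<bar> \<le> C"
  shows "Lp_on p \<Omega> u"
proof -
  interpret finite_measure "Leb" by (rule finite_measure_dom)
  have [measurable]: "u \<in> borel_measurable Leb" by (rule borel_measurable_lebesgue_on_borel[OF assms(1)])
  have "integrable Leb (\<lambda>x. \<bar>u x\<bar> powr p)"
  proof (rule integrable_const_bound[where B = "C powr p"])
    show "AE x in Leb. norm (\<bar>u x\<bar> powr p) \<le> C powr p"
      using assms(2) p0 by (intro AE_I2) (auto intro!: powr_mono2)
  qed measurable
  then show ?thesis by (simp add: Lp_on_def)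
qed

lemma inner_energy_meas:
  assumes d: "0 < \<delta>" "\<delta> \<le> \<delta>1" and [measurable]: "u \<in> borel_measurable borel"
  shows "inner_energy \<delta> u \<in> borel_measurable borel"
proof -
  interpret K: collar_kernel_lip \<Omega> "\<eta> \<delta>" "\<eta>' \<delta>" \<psi> \<psi>' B by (rule collar[OF d])
  have "\<Omega> \<in> sets lebesgue" using open_dom by simp
  then have "inner_energy \<delta> u = (\<lambda>x. \<integral>\<^sup>+y. ennreal (\<rho> (dist y x / \<eta> \<delta> x)
     / (\<eta> \<delta> x powr (real DIM('a) + p - \<beta>) * dist x y powr \<beta>) * \<bar>u x - u y\<bar> powr p) * indicator \<Omega> y \<partial>lborel)"
    unfolding inner_energy_def[abs_def] by (simp only: nn_integral_lebesgue_on)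
  also have "\<dots> \<in> borel_measurable lborel"
    by (rule lborel.borel_measurable_nn_integral) (simp add: split_def)
  finally show ?thesis by simp
qed

lemma J_eq_lborel: "J \<delta> u = (\<integral>\<^sup>+x. inner_energy \<delta> u x * indicator \<Omega> x \<partial>lborel)"
  unfolding J_def using open_dom by (simp add: nn_integral_lebesgue_on)

text \<open>Within the fraction \<open>c\<^sub>\<rho>\<close> of the width \<rho> is at least
  \<open>C\<^sub>\<rho>\<close>, and the power \<beta> of the distance is at most that of the width
  because \<beta> is nonnegative; so the singular weight dominates the model weight.\<close>

lemma J_lower_bound:
  assumes d: "0 < \<delta>" "\<delta> \<le> \<delta>1" and [measurable]: "u \<in> borel_measurable borel"
  shows "ennreal C\<^sub>\<rho> * collar_kernel_lip.Qen \<Omega> (\<eta> \<delta>) p u c\<^sub>\<rho> \<le> J \<delta> u"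
proof -
  interpret K: collar_kernel_lip \<Omega> "\<eta> \<delta>" "\<eta>' \<delta>" \<psi> \<psi>' B by (rule collar[OF d])
  let ?d = "real DIM('a)"
  let ?h = "\<lambda>x y. ennreal (\<rho> (dist y x / \<eta> \<delta> x)
     / (\<eta> \<delta> x powr (?d + p - \<beta>) * dist x y powr \<beta>) * \<bar>u x - u y\<bar> powr p)"
  have le: "ennreal C\<^sub>\<rho> * (K.near c\<^sub>\<rho> x y * K.qdiff p u x y) \<le> ?h x y * indicator \<Omega> y * indicator \<Omega> x" for x y
  \<comment> \<open>The diagonal is separate because \<open>dist x y powr \<beta>\<close> is 0 there
    and the quotient takes the default value 0; the difference of \<open>u\<close> vanishes as
    well.\<close>
  proof (cases "x \<in> \<Omega> \<and> norm (y - x) < c\<^sub>\<rho> * \<eta> \<delta> x \<and> y \<noteq> x")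
    case True
    then have x: "x \<in> \<Omega>" and n: "norm (y - x) < c\<^sub>\<rho> * \<eta> \<delta> x" and ne: "y \<noteq> x" by auto
    have e: "0 < \<eta> \<delta> x" by (rule K.eta_pos[OF x])
    have "c\<^sub>\<rho> * \<eta> \<delta> x \<le> 1 * \<eta> \<delta> x" using rho_pos(3) e by (intro mult_right_mono) auto
    then have n1: "norm (y - x) < \<eta> \<delta> x" using n by linarith
    then have y: "y \<in> \<Omega>" using K.eta_ball[OF x] by (auto simp: dist_norm norm_minus_commute)
    have r: "C\<^sub>\<rho> \<le> \<rho> (dist y x / \<eta> \<delta> x)"
      using n e by (intro rho_pos(4)) (auto simp: dist_norm field_simps)
    have dp: "0 < dist x y" using ne by simp
    have "dist x y powr \<beta> \<le> \<eta> \<delta> x powr \<beta>" using n1 beta by (intro powr_mono2) (auto simp: dist_norm norm_minus_commute)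
    then have "\<eta> \<delta> x powr (?d + p - \<beta>) * dist x y powr \<beta> \<le> \<eta> \<delta> x powr (?d + p - \<beta>) * \<eta> \<delta> x powr \<beta>"
      by (intro mult_left_mono) auto
    also have "\<dots> = \<eta> \<delta> x powr (?d + p)" by (simp add: powr_add[symmetric])
    finally have "C\<^sub>\<rho> / \<eta> \<delta> x powr (?d + p) \<le> \<rho> (dist y x / \<eta> \<delta> x) / (\<eta> \<delta> x powr (?d + p - \<beta>) * dist x y powr \<beta>)"
      using r rho_pos(1) e dp by (intro frac_le) auto
    then have "C\<^sub>\<rho> / \<eta> \<delta> x powr (?d + p) * \<bar>u x - u y\<bar> powr p \<le>
       \<rho> (dist y x / \<eta> \<delta> x) / (\<eta> \<delta> x powr (?d + p - \<beta>) * dist x y powr \<beta>) * \<bar>u x - u y\<bar> powr p"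
      by (intro mult_right_mono) auto
    moreover have "C\<^sub>\<rho> / \<eta> \<delta> x powr (?d + p) = C\<^sub>\<rho> * \<eta> \<delta> x powr (- (?d + p))"
      by (simp only: powr_minus_divide) simp
    moreover have "ennreal C\<^sub>\<rho> * (K.near c\<^sub>\<rho> x y * K.qdiff p u x y) = ennreal (C\<^sub>\<rho> * \<eta> \<delta> x powr (- (?d + p)) * \<bar>u x - u y\<bar> powr p)"
      using x n rho_pos(1) by (simp add: K.near_def K.qdiff_def ennreal_mult mult.assoc)
    ultimately show ?thesis using x y by (simp add: ennreal_leI)
  next
    case False
    then have "K.near c\<^sub>\<rho> x y = 0 \<or> K.qdiff p u x y = 0" using p by (auto simp: K.near_def K.qdiff_def)
    then show ?thesis by auto
  qed
  have m: "(\<lambda>y. K.near c\<^sub>\<rho> x y * K.qdiff p u x y) \<in> borel_measurable lborel" for x by measurable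
  have m2: "(\<lambda>x. \<integral>\<^sup>+y. K.near c\<^sub>\<rho> x y * K.qdiff p u x y \<partial>lborel) \<in> borel_measurable lborel"
    by (rule lborel.borel_measurable_nn_integral) (simp add: split_def)
  have "ennreal C\<^sub>\<rho> * K.Qen p u c\<^sub>\<rho> = (\<integral>\<^sup>+x. (\<integral>\<^sup>+y. ennreal C\<^sub>\<rho> * (K.near c\<^sub>\<rho> x y * K.qdiff p u x y) \<partial>lborel) \<partial>lborel)"
    unfolding K.Qen_def by (simp only: nn_integral_cmult[OF m] nn_integral_cmult[OF m2])
  also have "\<dots> \<le> (\<integral>\<^sup>+x. (\<integral>\<^sup>+y. ?h x y * indicator \<Omega> y * indicator \<Omega> x \<partial>lborel) \<partial>lborel)"
    by (intro nn_integral_mono le)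
  also have "\<dots> = J \<delta> u"
    unfolding J_eq_lborel
  proof (rule nn_integral_cong)
    fix x
    have "inner_energy \<delta> u x = (\<integral>\<^sup>+y. ?h x y * indicator \<Omega> y \<partial>lborel)"
      unfolding inner_energy_def by (rule nn_integral_lebesgue_on) (use open_dom in simp)
    then show "(\<integral>\<^sup>+y. ?h x y * indicator \<Omega> y * indicator \<Omega> x \<partial>lborel) = inner_energy \<delta> u x * indicator \<Omega> x"
      by (cases "x \<in> \<Omega>") simp_all
  qed
  finally show ?thesis .
qed

text \<open>Chains \<open>dKc_powr_le\<close>, \<open>Qen_1_le\<close> and
  \<open>J_lower_bound\<close>. The number \<open>k\<close> of range reductions depends only on
  \<open>c\<^sub>\<rho>\<close>, so one constant serves all \<delta>.\<close>

lemma GK_energy_bound: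
  obtains C where "0 \<le> C" "\<And>\<delta> u Cu. 0 < \<delta> \<Longrightarrow> \<delta> \<le> \<delta>1 \<Longrightarrow> u \<in> borel_measurable borel \<Longrightarrow> (\<And>y. \<bar>u y\<bar> \<le> Cu) \<Longrightarrow>
     (\<integral>\<^sup>+x. ennreal (norm (GK \<delta> u x) powr p) \<partial>Leb) \<le> ennreal C * J \<delta> u"
proof -
  let ?d = "real DIM('a)"
  obtain k where "(3 / 4 :: real) ^ k < c\<^sub>\<rho>"
    using real_arch_pow_inv[OF rho_pos(2), of "3 / 4"] by auto
  then have k: "(3 / 4 :: real) ^ k \<le> c\<^sub>\<rho>" by simp
  define Cg where "Cg = 2 powr p * C_K powr p * unit_ball_vol ?d powr (p - 1)"
  define Qs where "Qs = 2 powr p * (11 / 10) powr (2 * ?d + p) * 8 ^ DIM('a) * (1 + (10 / 9) ^ DIM('a))"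
  have Cg0: "0 \<le> Cg" and Qs0: "0 < Qs" by (simp_all add: Cg_def Qs_def add_pos_pos)
  define C where "C = ?d powr p * ?d * Cg * (Qs ^ k / C\<^sub>\<rho>)"
  show ?thesis
  proof (rule that[of C])
    show "0 \<le> C" using Cg0 Qs0 rho_pos(1) by (simp add: C_def)
    fix \<delta> Cu :: real and u :: "'a \<Rightarrow> real" assume d: "0 < \<delta>" "\<delta> \<le> \<delta>1" and u[measurable]: "u \<in> borel_measurable borel" and ub: "\<And>y. \<bar>u y\<bar> \<le> Cu"
    interpret K: collar_kernel_lip \<Omega> "\<eta> \<delta>" "\<eta>' \<delta>" \<psi> \<psi>' B by (rule collar[OF d])
    let ?q = "\<lambda>x. \<integral>\<^sup>+y. K.near 1 x y * K.qdiff p u x y \<partial>lborel"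
    have Kc: "K.C_grad p = Cg" "K.Q_step p = Qs"
      by (simp_all add: K.C_grad_def Cg_def K.C_ker_def C_K_def K.Q_step_def Qs_def)
    have pt: "ennreal (norm (GK \<delta> u x) powr p) \<le> ennreal (?d powr p * ?d * Cg) * ?q x" if x: "x \<in> \<Omega>" for x
    proof -
      define m where "m = Max ((\<lambda>i. \<bar>K.dKc i u x\<bar>) ` Basis)"
      have mle: "\<bar>K.dKc i u x\<bar> \<le> m" if "i \<in> Basis" for i using that by (simp add: m_def)
      have "m \<in> (\<lambda>i. \<bar>K.dKc i u x\<bar>) ` Basis" unfolding m_def by (intro Max_in) auto
      then obtain i0 where i0: "i0 \<in> Basis" "m = \<bar>K.dKc i0 u x\<bar>" by blast
      have "norm (GK \<delta> u x) \<le> (\<Sum>i\<in>Basis. \<bar>GK \<delta> u x \<bullet> i\<bar>)" by (rule norm_le_l1)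
      also have "\<dots> \<le> (\<Sum>i\<in>(Basis::'a set). m)" using mle K.grad_Kc_inner by (intro sum_mono) simp
      finally have "norm (GK \<delta> u x) \<le> ?d * m" by simp
      then have "norm (GK \<delta> u x) powr p \<le> (?d * m) powr p" using p by (intro powr_mono2) auto
      also have "\<dots> = ?d powr p * \<bar>K.dKc i0 u x\<bar> powr p" by (simp add: powr_mult i0(2))
      finally have "ennreal (norm (GK \<delta> u x) powr p) \<le> ennreal (?d powr p) * ennreal (\<bar>K.dKc i0 u x\<bar> powr p)"
        by (simp add: ennreal_mult[symmetric] ennreal_leI)
      also have "\<dots> \<le> ennreal (?d powr p) * (ennreal Cg * ?q x)"
        using K.dKc_powr_le[OF p u ub x i0(1)] unfolding Kc by (intro mult_left_mono) auto
      also have "\<dots> = ennreal (?d powr p * 1 * Cg) * ?q x" using Cg0 by (simp add: ennreal_mult mult.assoc)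
      also have "\<dots> \<le> ennreal (?d powr p * ?d * Cg) * ?q x"
      proof (intro mult_right_mono ennreal_leI mult_left_mono)
        show "1 \<le> ?d" using DIM_positive[where 'a='a] by linarith
      qed (use Cg0 in auto)
      finally show ?thesis .
    qed
    have "(\<integral>\<^sup>+x. ennreal (norm (GK \<delta> u x) powr p) \<partial>Leb) \<le> (\<integral>\<^sup>+x. ennreal (?d powr p * ?d * Cg) * ?q x \<partial>Leb)"
      by (intro nn_integral_mono pt) simp
    also have "\<dots> = (\<integral>\<^sup>+x. (ennreal (?d powr p * ?d * Cg) * ?q x) * indicator \<Omega> x \<partial>lborel)"
      by (rule nn_integral_lebesgue_on) (use open_dom in simp)
    also have "\<dots> \<le> (\<integral>\<^sup>+x. ennreal (?d powr p * ?d * Cg) * ?q x \<partial>lborel)"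
      by (intro nn_integral_mono) (auto simp: indicator_def)
    also have "\<dots> = ennreal (?d powr p * ?d * Cg) * K.Qen p u 1"
    proof -
      have "?q \<in> borel_measurable lborel"
        by (rule lborel.borel_measurable_nn_integral) (simp add: split_def)
      then show ?thesis unfolding K.Qen_def by (rule nn_integral_cmult)
    qed
    also have "\<dots> \<le> ennreal (?d powr p * ?d * Cg) * (ennreal (Qs ^ k) * K.Qen p u c\<^sub>\<rho>)"
      using K.Qen_1_le[OF p u k] unfolding Kc by (intro mult_left_mono) auto
    also have "\<dots> = ennreal C * (ennreal C\<^sub>\<rho> * K.Qen p u c\<^sub>\<rho>)"
    proof -
      have "?d powr p * ?d * Cg * Qs ^ k = C * C\<^sub>\<rho>" using rho_pos(1) by (simp add: C_def)
      then have "ennreal (?d powr p * ?d * Cg) * ennreal (Qs ^ k) = ennreal C * ennreal C\<^sub>\<rho>"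
        using Cg0 Qs0 rho_pos(1) \<open>0 \<le> C\<close> by (simp add: ennreal_mult[symmetric])
      then show ?thesis by (simp only: mult.assoc[symmetric])
    qed
    also have "\<dots> \<le> ennreal C * J \<delta> u"
      by (intro mult_left_mono J_lower_bound[OF d u]) simp
    finally show "(\<integral>\<^sup>+x. ennreal (norm (GK \<delta> u x) powr p) \<partial>Leb) \<le> ennreal C * J \<delta> u" .
  qed
qed

lemma GK_meas:
  assumes d: "0 < \<delta>" "\<delta> \<le> \<delta>1" and "u \<in> borel_measurable borel"
  shows "GK \<delta> u \<in> borel_measurable borel" "KK \<delta> u \<in> borel_measurable borel"
proof -
  interpret K: collar_kernel_lip \<Omega> "\<eta> \<delta>" "\<eta>' \<delta>" \<psi> \<psi>' B by (rule collar[OF d])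
  show "GK \<delta> u \<in> borel_measurable borel" "KK \<delta> u \<in> borel_measurable borel"
    using K.grad_Kc_measurable[OF assms(3)] K.Kc_measurable[OF assms(3)] by auto
qed

lemma KK_abs_le:
  assumes d: "0 < \<delta>" "\<delta> \<le> \<delta>1" and "x \<in> \<Omega>"
  shows "\<bar>KK \<delta> (U c) x\<bar> \<le> csum c * Bb"
proof -
  interpret K: collar_kernel_lip \<Omega> "\<eta> \<delta>" "\<eta>' \<delta>" \<psi> \<psi>' B by (rule collar[OF d])
  show ?thesis by (rule K.Kc_abs_le[OF U_meas U_bound assms(3)])
qed

lemma KK_sobolev_pair:
  assumes d: "0 < \<delta>" "\<delta> \<le> \<delta>1"
    and C: "0 \<le> C" "(\<integral>\<^sup>+x. ennreal (norm (GK \<delta> (U c) x) powr p) \<partial>Leb) \<le> ennreal C"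
  shows "sobolev_pair p \<Omega> (KK \<delta> (U c)) (GK \<delta> (U c))"
    "(\<integral>x. norm (GK \<delta> (U c) x) powr p \<partial>Leb) \<le> C"
proof -
  interpret K: collar_kernel_lip \<Omega> "\<eta> \<delta>" "\<eta>' \<delta>" \<psi> \<psi>' B by (rule collar[OF d])
  have [measurable]: "GK \<delta> (U c) \<in> borel_measurable Leb"
    by (intro borel_measurable_lebesgue_on_borel GK_meas[OF d] U_meas)
  have int: "integrable Leb (\<lambda>x. norm (GK \<delta> (U c) x) powr p)"
    using C by (intro integrableI_bounded) (auto intro: le_less_trans)
  then have "Lp_on p \<Omega> (\<lambda>x. norm (GK \<delta> (U c) x))" by (simp add: Lp_on_def)
  moreover have "Lp_on p \<Omega> (KK \<delta> (U c))"
    by (rule Lp_on_bounded[OF GK_meas(2)[OF d U_meas] KK_abs_le[OF d]])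
  moreover have "is_weak_grad \<Omega> (KK \<delta> (U c)) (GK \<delta> (U c))" by (rule K.Kc_is_weak_grad[OF U_meas U_bound])
  ultimately show "sobolev_pair p \<Omega> (KK \<delta> (U c)) (GK \<delta> (U c))" by (simp add: sobolev_pair_def)
  have "ennreal (\<integral>x. norm (GK \<delta> (U c) x) powr p \<partial>Leb) \<le> ennreal C"
    using C(2) by (subst (asm) nn_integral_eq_integral[OF int]) auto
  then show "(\<integral>x. norm (GK \<delta> (U c) x) powr p \<partial>Leb) \<le> C" using C(1) by simp
qed

lemma integral_Gr_powr: "(\<integral>\<^sup>+x. ennreal (norm (Gr c x) powr p) \<partial>Leb) = ennreal (\<integral>x. norm (Gr c x) powr p \<partial>Leb)"
  and Gr_Lp: "Lp_on p \<Omega> (\<lambda>x. norm (Gr c x))" and U_Lp: "Lp_on p \<Omega> (U c)"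
proof -
  show L: "Lp_on p \<Omega> (\<lambda>x. norm (Gr c x))"
    by (rule Lp_on_bounded[where C = "csum c * Bb"]) (use Gr_bound in auto)
  show "Lp_on p \<Omega> (U c)" by (rule Lp_on_bounded[OF U_meas U_bound])
  show "(\<integral>\<^sup>+x. ennreal (norm (Gr c x) powr p) \<partial>Leb) = ennreal (\<integral>x. norm (Gr c x) powr p \<partial>Leb)"
    using L by (intro nn_integral_eq_integral) (auto simp: Lp_on_def)
qed

lemma J_liminf:
  assumes cv: "conv cs c" and d: "\<And>n. 0 < d n" "d \<longlonglongrightarrow> 0" "\<And>n. d n \<le> \<delta>1"
  shows "ennreal (\<integral>x. norm (Gr c x) powr p \<partial>Leb) \<le> liminf (\<lambda>n. J (d n) (U (cs n)))"
proof -
  have "(\<integral>\<^sup>+x. ennreal (norm (Gr c x) powr p) \<partial>Leb) = (\<integral>\<^sup>+x. liminf (\<lambda>n. inner_energy (d n) (U (cs n)) x) \<partial>Leb)"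
  proof (rule nn_integral_cong_AE)
    show "AE x in Leb. ennreal (norm (Gr c x) powr p) = liminf (\<lambda>n. inner_energy (d n) (U (cs n)) x)"
      using AE_dom_D
      by eventually_elim (rule lim_imp_Liminf[OF sequentially_bot inner_energy_tendsto[OF cv d], symmetric])
  qed
  also have "\<dots> \<le> liminf (\<lambda>n. \<integral>\<^sup>+x. inner_energy (d n) (U (cs n)) x \<partial>Leb)"
    by (rule nn_integral_liminf) (intro borel_measurable_lebesgue_on_borel inner_energy_meas[OF d(1,3)] U_meas)
  finally show ?thesis by (simp add: integral_Gr_powr J_def)
qed

text \<open>Bounded energies bound the gradients of the mollifications in L^p. Since these converge
  almost everywhere and \<open>p > 1\<close>, they converge in L^1, so the weak gradient identity
  passes to the limit and no jump survives. The functional is then applied to Sobolev pairs that are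
  bounded and tend to zero almost everywhere.\<close>

lemma limit_pair_and_functional:
  assumes cv: "conv cs c" and d: "\<And>n. 0 < d n" "d \<longlonglongrightarrow> 0" "\<And>n. d n \<le> \<delta>1"
    and A: "0 \<le> A" "\<And>n. J (d n) (U (cs n)) \<le> ennreal A"
  shows "sobolev_pair p \<Omega> (U c) (Gr c)" "(\<lambda>n. f (KK (d n) (U (cs n)))) \<longlonglongrightarrow> f (U c)"
proof -
  let ?M = "Leb"
  let ?k = "\<lambda>n. KK (d n) (U (cs n))" and ?G = "\<lambda>n. GK (d n) (U (cs n))"
  interpret finite_measure ?M by (rule finite_measure_dom)
  obtain C where C: "0 \<le> C" "\<And>\<delta> u Cu. 0 < \<delta> \<Longrightarrow> \<delta> \<le> \<delta>1 \<Longrightarrow> u \<in> borel_measurable borel \<Longrightarrow> (\<And>y. \<bar>u y\<bar> \<le> Cu) \<Longrightarrow>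
     (\<integral>\<^sup>+x. ennreal (norm (GK \<delta> u x) powr p) \<partial>?M) \<le> ennreal C * J \<delta> u" using GK_energy_bound by blast
  have CA: "(\<integral>\<^sup>+x. ennreal (norm (?G n x) powr p) \<partial>?M) \<le> ennreal (C * A)" for n
  proof -
    have "(\<integral>\<^sup>+x. ennreal (norm (?G n x) powr p) \<partial>?M) \<le> ennreal C * J (d n) (U (cs n))"
      by (rule C(2)[OF d(1,3) U_meas U_bound])
    also have "\<dots> \<le> ennreal C * ennreal A" by (intro mult_left_mono A) simp
    finally show ?thesis using C A by (simp add: ennreal_mult)
  qed
  have CA0: "0 \<le> C * A" using C A by simp
  have pair: "sobolev_pair p \<Omega> (?k n) (?G n)" and Gb: "(\<integral>x. norm (?G n x) powr p \<partial>?M) \<le> C * A" for n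
    using KK_sobolev_pair[OF d(1,3) CA0 CA] by auto
  obtain S where S: "0 < S" "\<And>n. csum (cs n) \<le> S" using conv_csum_bounded[OF cv] by blast
  define R where "R = max S (csum c) * \<bar>Bb\<bar>"
  have csR: "csum (cs n) * Bb \<le> R" "csum c * Bb \<le> R" for n
  proof -
    have "t * Bb \<le> R" if "t \<le> max S (csum c)" "0 \<le> t" for t
    proof -
      have "t * Bb \<le> t * \<bar>Bb\<bar>" using that by (intro mult_left_mono) auto
      also have "\<dots> \<le> R" unfolding R_def using that by (intro mult_right_mono) auto
      finally show ?thesis .
    qed
    then show "csum (cs n) * Bb \<le> R" "csum c * Bb \<le> R" using S csum_nonneg by (simp_all add: max.coboundedI1 max.coboundedI2)
  qed
  have kb: "\<bar>?k n x\<bar> \<le> R" if "x \<in> \<Omega>" for n x using KK_abs_le[OF d(1,3) that, of n "cs n"] csR(1)[of n] by linarith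
  have Ub: "\<bar>U c x\<bar> \<le> R" for x using U_bound[of c x] csR(2) by linarith
  have R0: "0 \<le> R" using Ub[of 0] by linarith
  have limk: "AE x in ?M. (\<lambda>n. ?k n x) \<longlonglongrightarrow> U c x"
    using AE_dom_D by eventually_elim (rule KK_tendsto[OF cv d])
  have limG: "AE x in ?M. (\<lambda>n. ?G n x) \<longlonglongrightarrow> Gr c x"
    using AE_dom_D by eventually_elim (rule GK_tendsto[OF cv d])
  have km[measurable]: "?k n \<in> borel_measurable ?M" and Gm[measurable]: "?G n \<in> borel_measurable ?M" for n
    using sobolev_pair_measurable[OF pair] by auto
  have Um[measurable]: "U c \<in> borel_measurable ?M" and Grm[measurable]: "Gr c \<in> borel_measurable ?M"
    by (auto intro: borel_measurable_lebesgue_on_borel)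
  let ?dG = "\<lambda>n x. ?G n x + (-1) *\<^sub>R Gr c x"
  have dG_int: "integrable ?M (\<lambda>x. norm (?dG n x) powr p)" for n
    using pair[of n] Gr_Lp[of c] by (intro integrable_norm_add_powr[OF p0]) (auto simp: sobolev_pair_def Lp_on_def)
  define E where "E = 2 powr p * (C * A + (\<integral>x. norm (Gr c x) powr p \<partial>?M))"
  have dG_le: "(\<integral>x. norm (?dG n x) powr p \<partial>?M) \<le> E" for n
  proof -
    have i1: "integrable ?M (\<lambda>x. norm (?G n x) powr p)" and i2: "integrable ?M (\<lambda>x. norm (Gr c x) powr p)"
      using pair[of n] Gr_Lp[of c] by (auto simp: sobolev_pair_def Lp_on_def)
    have "(\<integral>x. norm (?dG n x) powr p \<partial>?M) \<le> (\<integral>x. 2 powr p * (norm (?G n x) powr p + norm (Gr c x) powr p) \<partial>?M)"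
      using norm_add_powr_le[OF p0, of "?G n _" "(-1) *\<^sub>R Gr c _"] i1 i2 dG_int by (intro integral_mono) auto
    also have "\<dots> = 2 powr p * ((\<integral>x. norm (?G n x) powr p \<partial>?M) + (\<integral>x. norm (Gr c x) powr p \<partial>?M))"
      using i1 i2 by simp
    also have "\<dots> \<le> E" unfolding E_def using Gb[of n] by (intro mult_left_mono) auto
    finally show ?thesis .
  qed
  have wg: "is_weak_grad \<Omega> (U c) (Gr c)"
    unfolding is_weak_grad_def
  proof (intro conjI allI impI ballI Grm)
    fix \<phi> and i :: 'a assume phi: "test_fun \<Omega> \<phi>" and i: "i \<in> Basis"
    let ?D = "\<lambda>x. frechet_derivative \<phi> (at x) i"
    obtain Bp where Bp: "0 < Bp" "\<And>x. \<bar>\<phi> x\<bar> \<le> Bp" "\<And>x. \<bar>?D x\<bar> \<le> Bp" using test_fun_bounded[OF phi] i by metis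
    have [measurable]: "\<phi> \<in> borel_measurable ?M" "?D \<in> borel_measurable ?M"
      by (intro borel_measurable_lebesgue_on_borel borel_measurable_continuous_onI
        test_fun_continuous[OF phi] test_fun_derivative_continuous[OF phi i])+
    have lim1: "(\<lambda>n. \<integral>x. ?k n x * ?D x \<partial>?M) \<longlonglongrightarrow> (\<integral>x. U c x * ?D x \<partial>?M)"
    proof (rule integral_dominated_convergence[where w = "\<lambda>_. R * Bp"])
      show "AE x in ?M. (\<lambda>n. ?k n x * ?D x) \<longlonglongrightarrow> U c x * ?D x"
        using limk by eventually_elim (intro tendsto_mult tendsto_const)
      show "AE x in ?M. norm (?k n x * ?D x) \<le> R * Bp" for n
        using kb Bp R0 by (intro AE_I2) (auto simp: abs_mult intro!: mult_mono)
    qed auto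
    let ?e = "\<lambda>n x. ?dG n x \<bullet> i"
    have eb: "\<bar>?e n x\<bar> powr p \<le> norm (?dG n x) powr p" for n x
      using Basis_le_norm[OF i, of "?dG n x"] p0 by (intro powr_mono2) auto
    have ei: "integrable ?M (\<lambda>x. \<bar>?e n x\<bar> powr p)" for n
      by (rule Bochner_Integration.integrable_bound[OF dG_int[of n]]) (use eb in auto)
    have "(\<lambda>n. \<integral>x. \<bar>?e n x\<bar> \<partial>?M) \<longlonglongrightarrow> 0"
    proof (rule integral_abs_diff_tendsto_0_if_Lp_bounded[OF p finite_measure_dom _ ei])
      show "(\<integral>x. \<bar>?e n x\<bar> powr p \<partial>?M) \<le> E" for n
        using integral_mono[OF ei[of n] dG_int[of n]] eb dG_le[of n] by (meson order_trans)
      show "AE x in ?M. (\<lambda>n. ?e n x) \<longlonglongrightarrow> 0"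
        using limG
      proof eventually_elim
        case (elim x)
        have "(\<lambda>n. (?G n x + (-1) *\<^sub>R Gr c x) \<bullet> i) \<longlonglongrightarrow> (Gr c x + (-1) *\<^sub>R Gr c x) \<bullet> i"
          by (intro tendsto_intros elim)
        then show ?case by simp
      qed
    qed measurable
    then have lim0: "(\<lambda>n. Bp * (\<integral>x. \<bar>?e n x\<bar> \<partial>?M)) \<longlonglongrightarrow> 0" using tendsto_mult_left[of _ 0 _ Bp] by simp
    have Gni: "integrable ?M (\<lambda>x. norm (?G n x))" for n
      using Lp_on_integrable[OF lmeas_dom p1] pair[of n] by (simp add: sobolev_pair_def)
    have Grni: "integrable ?M (\<lambda>x. norm (Gr c x))" using Lp_on_integrable[OF lmeas_dom p1 Gr_Lp] .
    have j1: "integrable ?M (\<lambda>x. (?G n x \<bullet> i) * \<phi> x)" for n by (rule is_weak_grad_integrable(2)[OF phi i Gni Gm])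
    have j2: "integrable ?M (\<lambda>x. (Gr c x \<bullet> i) * \<phi> x)" by (rule is_weak_grad_integrable(2)[OF phi i Grni Grm])
    have bnd: "norm ((\<integral>x. (?G n x \<bullet> i) * \<phi> x \<partial>?M) - (\<integral>x. (Gr c x \<bullet> i) * \<phi> x \<partial>?M)) \<le> Bp * (\<integral>x. \<bar>?e n x\<bar> \<partial>?M)" for n
    proof -
      have eint: "integrable ?M (\<lambda>x. \<bar>?e n x\<bar>)"
        using Lp_on_integrable[OF lmeas_dom p1, of "?e n"] ei[of n] by (auto simp: Lp_on_def)
      have 1: "(\<integral>x. (?G n x \<bullet> i) * \<phi> x \<partial>?M) - (\<integral>x. (Gr c x \<bullet> i) * \<phi> x \<partial>?M) = (\<integral>x. (?G n x \<bullet> i) * \<phi> x - (Gr c x \<bullet> i) * \<phi> x \<partial>?M)"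
        using j1 j2 by simp
      have 2: "(\<integral>x. (?G n x \<bullet> i) * \<phi> x - (Gr c x \<bullet> i) * \<phi> x \<partial>?M) = (\<integral>x. ?e n x * \<phi> x \<partial>?M)"
        by (intro Bochner_Integration.integral_cong) (auto simp: inner_add_left algebra_simps)
      have 3: "norm (\<integral>x. ?e n x * \<phi> x \<partial>?M) \<le> (\<integral>x. Bp * \<bar>?e n x\<bar> \<partial>?M)"
      proof (rule Bochner_Integration.integral_norm_bound_integral)
        have le: "norm (?e n x * \<phi> x) \<le> Bp * \<bar>?e n x\<bar>" for x
          unfolding real_norm_def abs_mult mult.commute[of Bp] by (intro mult_left_mono Bp) simp
        then show "norm (?e n x * \<phi> x) \<le> Bp * \<bar>?e n x\<bar>" for x .
        show i: "integrable ?M (\<lambda>x. Bp * \<bar>?e n x\<bar>)" using eint by simp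
        show "integrable ?M (\<lambda>x. ?e n x * \<phi> x)"
        proof (rule Bochner_Integration.integrable_bound[OF i])
          show "AE x in ?M. norm (?e n x * \<phi> x) \<le> norm (Bp * \<bar>?e n x\<bar>)"
            by (intro AE_I2 order_trans[OF le]) simp
        qed measurable
      qed
      have 4: "(\<integral>x. Bp * \<bar>?e n x\<bar> \<partial>?M) = Bp * (\<integral>x. \<bar>?e n x\<bar> \<partial>?M)" by simp
      show ?thesis unfolding 1 2 using 3 unfolding 4 .
    qed
    have "(\<lambda>n. (\<integral>x. (?G n x \<bullet> i) * \<phi> x \<partial>?M) - (\<integral>x. (Gr c x \<bullet> i) * \<phi> x \<partial>?M)) \<longlonglongrightarrow> 0"
      by (rule Lim_null_comparison[OF always_eventually[OF allI[OF bnd]] lim0])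
    then have lim2: "(\<lambda>n. - (\<integral>x. (?G n x \<bullet> i) * \<phi> x \<partial>?M)) \<longlonglongrightarrow> - (\<integral>x. (Gr c x \<bullet> i) * \<phi> x \<partial>?M)"
      by (intro tendsto_minus) (simp add: LIM_zero_iff)
    have "(\<integral>x. ?k n x * ?D x \<partial>?M) = - (\<integral>x. (?G n x \<bullet> i) * \<phi> x \<partial>?M)" for n
      using pair[of n] phi i by (simp add: sobolev_pair_def is_weak_grad_def)
    with lim1 have "(\<lambda>n. - (\<integral>x. (?G n x \<bullet> i) * \<phi> x \<partial>?M)) \<longlonglongrightarrow> (\<integral>x. U c x * ?D x \<partial>?M)" by simp
    from LIMSEQ_unique[OF this lim2] show "(\<integral>x. U c x * ?D x \<partial>?M) = - (\<integral>x. (Gr c x \<bullet> i) * \<phi> x \<partial>?M)" .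
  qed
  show pairU: "sobolev_pair p \<Omega> (U c) (Gr c)" using wg U_Lp Gr_Lp by (simp add: sobolev_pair_def)
  let ?g = "\<lambda>n x. ?k n x + (-1) * U c x"
  have pair': "sobolev_pair p \<Omega> (?g n) (?dG n)" for n
    by (intro sobolev_pair_add[OF p1 lmeas_dom pair] sobolev_pair_scale pairU)
  have gb: "(\<integral>x. \<bar>?g n x\<bar> powr p \<partial>?M) \<le> (2 * R) powr p * measure ?M (space ?M)" for n
  proof -
    have "(\<integral>x. \<bar>?g n x\<bar> powr p \<partial>?M) \<le> (\<integral>x. (2 * R) powr p \<partial>?M)"
    proof (rule integral_mono_AE)
      show "integrable ?M (\<lambda>x. \<bar>?g n x\<bar> powr p)" using pair'[of n] by (simp add: sobolev_pair_def Lp_on_def)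
      have "\<bar>?g n x\<bar> powr p \<le> (2 * R) powr p" if "x \<in> \<Omega>" for x
        using kb[OF that, of n] Ub[of x] p0 by (intro powr_mono2) auto
      then show "AE x in ?M. \<bar>?g n x\<bar> powr p \<le> (2 * R) powr p" by (intro AE_I2) simp
    qed simp
    then show ?thesis by (simp add: mult.commute)
  qed
  have "(\<lambda>n. f (?g n)) \<longlonglongrightarrow> 0"
  proof (rule W1p_dual_tendsto_0[OF f_dual open_dom lmeas_dom p pair', where C = "max ((2 * R) powr p * measure ?M (space ?M)) E"])
    show "AE x in ?M. (\<lambda>n. ?g n x) \<longlonglongrightarrow> 0"
      using limk
    proof eventually_elim
      case (elim x)
      have "(\<lambda>n. ?k n x + (-1) * U c x) \<longlonglongrightarrow> U c x + (-1) * U c x" by (intro tendsto_intros elim)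
      then show ?case by simp
    qed
    show "AE x in ?M. (\<lambda>n. ?dG n x) \<longlonglongrightarrow> 0"
      using limG
    proof eventually_elim
      case (elim x)
      have "(\<lambda>n. ?G n x + (-1) *\<^sub>R Gr c x) \<longlonglongrightarrow> Gr c x + (-1) *\<^sub>R Gr c x" by (intro tendsto_intros elim)
      then show ?case by simp
    qed
    fix n
    show "(\<integral>x. \<bar>?g n x\<bar> powr p \<partial>?M) \<le> max ((2 * R) powr p * measure ?M (space ?M)) E"
      using gb[of n] by (rule order_trans) simp
    show "(\<integral>x. norm (?dG n x) powr p \<partial>?M) \<le> max ((2 * R) powr p * measure ?M (space ?M)) E"
      using dG_le[of n] by (rule order_trans) simp
  qed
  moreover have "f (?k n) = f (?g n) + f (U c)" for n
  proof -
    have "f (\<lambda>x. ?g n x + U c x) = f (?g n) + f (U c)"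
      using f_dual pair'[of n] pairU unfolding W1p_dual_def W1p_iff_sobolev_pair by blast
    then show ?thesis by simp
  qed
  ultimately show "(\<lambda>n. f (?k n)) \<longlonglongrightarrow> f (U c)" using tendsto_add[of "\<lambda>n. f (?g n)" 0 sequentially "\<lambda>_. f (U c)"] by simp
qed

section \<open>Sobolev functions among the discrete ones\<close>

lemma AE_lborel_D: "AE x in lborel. x \<in> \<Omega> \<longrightarrow> x \<in> D"
proof -
  have "AE x in lebesgue. x \<in> \<Omega> \<longrightarrow> x \<in> D"
    by (rule AE_I'[of "\<Omega> - D"]) (use D(3) in \<open>auto simp: negligible_iff_null_sets\<close>)
  then show ?thesis by (simp only: AE_completion_iff)
qed

text \<open>Test functions supported in \<open>D\<close> see only the classical gradient, so any
  weak gradient agrees with \<open>Gr c\<close> almost everywhere on \<open>D\<close>, and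
  \<open>D\<close> has full measure.\<close>

lemma sobolev_pair_U_grad:
  assumes pair: "sobolev_pair p \<Omega> (U c) G"
  shows "AE x in Leb. G x = Gr c x" "sobolev_pair p \<Omega> (U c) (Gr c)"
proof -
  let ?M = "Leb"
  have lebs: "\<Omega> \<in> sets lebesgue" "D \<in> sets lebesgue" using open_dom D(1) by simp_all
  have Gm[measurable]: "G \<in> borel_measurable ?M" by (rule sobolev_pair_measurable[OF pair])
  have Grm[measurable]: "Gr c \<in> borel_measurable ?M" by (intro borel_measurable_lebesgue_on_borel Gr_meas)
  have Gi: "integrable ?M (\<lambda>x. norm (G x))" using Lp_on_integrable[OF lmeas_dom p1] pair by (simp add: sobolev_pair_def)
  have Gri: "integrable ?M (\<lambda>x. norm (Gr c x))" by (rule Lp_on_integrable[OF lmeas_dom p1 Gr_Lp])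
  have "AE x in lebesgue_on D. (G x - Gr c x) \<bullet> i = 0" if i: "i \<in> Basis" for i
  proof (rule AE_zero_if_test_fun_integrals_zero[OF D(1)])
    let ?h = "\<lambda>x. (G x - Gr c x) \<bullet> i"
    have hint: "integrable ?M ?h"
    proof (rule Bochner_Integration.integrable_bound[OF Bochner_Integration.integrable_add[OF Gi Gri]])
      have "norm (?h x) \<le> norm (norm (G x) + norm (Gr c x))" for x
        using Basis_le_norm[OF i, of "G x - Gr c x"] norm_triangle_ineq4[of "G x" "Gr c x"] by simp
      then show "AE x in ?M. norm (?h x) \<le> norm (norm (G x) + norm (Gr c x))" by simp
    qed measurable
    then have "integrable lebesgue (\<lambda>x. indicator \<Omega> x *\<^sub>R ?h x)" using lebs by (simp add: integrable_restrict_space)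
    from integrable_mult_indicator[OF lebs(2) this]
    have "integrable lebesgue (\<lambda>x. indicator D x *\<^sub>R indicator \<Omega> x *\<^sub>R ?h x)" .
    moreover have "(\<lambda>x. indicator D x *\<^sub>R indicator \<Omega> x *\<^sub>R ?h x) = (\<lambda>x. indicator D x *\<^sub>R ?h x)"
      using D(2) by (auto simp: indicator_def fun_eq_iff)
    ultimately show "integrable (lebesgue_on D) ?h" using lebs by (simp add: integrable_restrict_space)
    fix \<phi> assume phi: "test_fun D \<phi>"
    then have phiO: "test_fun \<Omega> \<phi>" using D(2) by (rule test_fun_mono)
    have phi0: "\<phi> x = 0" if "x \<notin> D" for x
      using that phi closure_subset[of "{x. \<phi> x \<noteq> 0}"] by (auto simp: test_fun_def)
    have "(\<integral>x. U c x * frechet_derivative \<phi> (at x) i \<partial>?M) = - (\<integral>x. (Gr c x \<bullet> i) * \<phi> x \<partial>?M)"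
    proof (rule directional_integration_by_parts[OF open_dom D(1,2) U_meas phi i])
      fix x assume x: "x \<in> D"
      have "((\<lambda>t. x + t *\<^sub>R i) has_derivative (\<lambda>t. t *\<^sub>R i)) (at 0)" by (auto intro!: derivative_eq_intros)
      from has_derivative_compose[OF this, of "U c" "\<lambda>h. Gr c x \<bullet> h"]
      have "((\<lambda>t. U c (x + t *\<^sub>R i)) has_derivative (\<lambda>t. Gr c x \<bullet> (t *\<^sub>R i))) (at 0)" using U_deriv[OF x] by simp
      moreover have "(\<lambda>t. Gr c x \<bullet> (t *\<^sub>R i)) = (\<lambda>t. (Gr c x \<bullet> i) * t)" by (auto simp: mult.commute)
      ultimately show "((\<lambda>t. U c (x + t *\<^sub>R i)) has_real_derivative Gr c x \<bullet> i) (at 0)"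
        by (simp add: has_field_derivative_def)
    next
      fix S :: "'a set"
      have "\<bar>U c x\<bar> \<le> csum c * Bb \<and> \<bar>Gr c x \<bullet> i\<bar> \<le> csum c * Bb" for x
        using U_bound[of c x] Basis_le_norm[OF i, of "Gr c x"] Gr_bound[of c x] by linarith
      then show "\<exists>B. \<forall>x\<in>S. \<bar>U c x\<bar> \<le> B \<and> \<bar>Gr c x \<bullet> i\<bar> \<le> B" by blast
    qed measurable
    moreover have "(\<integral>x. U c x * frechet_derivative \<phi> (at x) i \<partial>?M) = - (\<integral>x. (G x \<bullet> i) * \<phi> x \<partial>?M)"
      using pair phiO i by (simp add: sobolev_pair_def is_weak_grad_def)
    ultimately have eq: "(\<integral>x. (G x \<bullet> i) * \<phi> x \<partial>?M) = (\<integral>x. (Gr c x \<bullet> i) * \<phi> x \<partial>?M)" by simp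
    have "(\<integral>x. ?h x * \<phi> x \<partial>lebesgue_on D) = (\<integral>x. ?h x * \<phi> x \<partial>?M)"
    proof -
      have "(\<lambda>x. indicator D x *\<^sub>R (?h x * \<phi> x)) = (\<lambda>x. indicator \<Omega> x *\<^sub>R (?h x * \<phi> x))"
        using D(2) phi0 by (auto simp: indicator_def fun_eq_iff)
      then show ?thesis using lebs by (simp add: integral_restrict_space)
    qed
    also have "\<dots> = (\<integral>x. (G x \<bullet> i) * \<phi> x - (Gr c x \<bullet> i) * \<phi> x \<partial>?M)"
      by (simp only: inner_diff_left left_diff_distrib)
    also have "\<dots> = 0"
      using is_weak_grad_integrable(2)[OF phiO i Gi Gm] is_weak_grad_integrable(2)[OF phiO i Gri Grm] eq by simp
    finally show "(\<integral>x. ?h x * \<phi> x \<partial>lebesgue_on D) = 0" .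
  qed
  then have "AE x in lebesgue_on D. \<forall>i\<in>Basis. (G x - Gr c x) \<bullet> i = 0" by (intro AE_finite_allI) auto
  then have "AE x in lebesgue_on D. G x = Gr c x"
    by eventually_elim (simp add: euclidean_eq_iff[of "G _"] inner_diff_left)
  then have "AE x in lebesgue. x \<in> D \<longrightarrow> G x = Gr c x" using lebs by (simp add: AE_restrict_space_iff)
  moreover have "AE x in lebesgue. x \<in> \<Omega> \<longrightarrow> x \<in> D" using AE_lborel_D by (simp only: AE_completion_iff)
  ultimately have "AE x in lebesgue. x \<in> \<Omega> \<longrightarrow> G x = Gr c x" by eventually_elim blast
  then show ae: "AE x in ?M. G x = Gr c x" using lebs by (simp add: AE_restrict_space_iff)
  have "is_weak_grad \<Omega> (U c) (Gr c)"
    unfolding is_weak_grad_def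
  proof (intro conjI allI impI ballI Grm)
    fix \<phi> and i :: 'a assume phi: "test_fun \<Omega> \<phi>" and i: "i \<in> Basis"
    have [measurable]: "\<phi> \<in> borel_measurable ?M"
      by (intro borel_measurable_lebesgue_on_borel borel_measurable_continuous_onI test_fun_continuous[OF phi])
    have "(\<integral>x. (G x \<bullet> i) * \<phi> x \<partial>?M) = (\<integral>x. (Gr c x \<bullet> i) * \<phi> x \<partial>?M)"
      by (rule integral_cong_AE) (use ae in \<open>auto elim: eventually_mono\<close>)
    then show "(\<integral>x. U c x * frechet_derivative \<phi> (at x) i \<partial>?M) = - (\<integral>x. (Gr c x \<bullet> i) * \<phi> x \<partial>?M)"
      using pair phi i by (simp add: sobolev_pair_def is_weak_grad_def)
  qed
  then show "sobolev_pair p \<Omega> (U c) (Gr c)" using U_Lp Gr_Lp by (simp add: sobolev_pair_def)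
qed

text \<open>The weak gradient is tested against a bump that travels from \<open>x\<close> to \<open>y\<close>, which turns the
  almost everywhere bound of the gradient into a Lipschitz bound along the segment.\<close>

lemma U_lipschitz:
  assumes wg: "is_weak_grad \<Omega> (U c) (Gr c)" and L: "AE x in Leb. norm (Gr c x) \<le> L" "0 \<le> L"
    and xy: "x \<in> D" "y \<in> D" and seg: "closed_segment x y \<subseteq> \<Omega>"
  shows "\<bar>U c y - U c x\<bar> \<le> L * norm (y - x)"
proof (rule ccontr)
  assume neg: "\<not> ?thesis"
  define h where "h = y - x"
  \<comment> \<open>A third of the excess: continuity at the two ends loses at most \<tau> each, and
    the remaining third gives the contradiction.\<close>
  define \<tau> where "\<tau> = (\<bar>U c y - U c x\<bar> - L * norm h) / 3"
  have tau: "0 < \<tau>" using neg by (simp add: \<tau>_def h_def)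
  define sg :: real where "sg = (if U c x \<le> U c y then 1 else -1)"
  have sg: "sg * (U c y - U c x) = \<bar>U c y - U c x\<bar>" "\<bar>sg\<bar> = 1" by (auto simp: sg_def)
  have cont: "\<exists>r>0. \<forall>w. norm w < r \<longrightarrow> \<bar>U c (z + w) - U c z\<bar> < \<tau>" if "z \<in> D" for z
  proof -
    have "isCont (U c) z" using has_derivative_continuous[OF U_deriv[OF that]] .
    then obtain r where "r > 0" "\<And>z'. dist z' z < r \<Longrightarrow> dist (U c z') (U c z) < \<tau>"
      using tau unfolding continuous_at_eps_delta by blast
    then show ?thesis by (intro exI[of _ r]) (auto simp: dist_norm)
  qed
  obtain r1 where r1: "r1 > 0" "\<And>w. norm w < r1 \<Longrightarrow> \<bar>U c (x + w) - U c x\<bar> < \<tau>" using cont[OF xy(1)] by blast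
  obtain r2 where r2: "r2 > 0" "\<And>w. norm w < r2 \<Longrightarrow> \<bar>U c (y + w) - U c y\<bar> < \<tau>" using cont[OF xy(2)] by blast
  obtain r3 where r3: "r3 > 0" "(\<Union>z\<in>closed_segment x y. ball z r3) \<subseteq> \<Omega>"
    using compact_subset_open_imp_ball_epsilon_subset[OF compact_segment open_dom seg] by blast
  define r where "r = min r1 (min r2 r3)"
  have r: "0 < r" "r \<le> r1" "r \<le> r2" "r \<le> r3" using r1 r2 r3 by (auto simp: r_def)
  define t where "t = r / (2 * real DIM('a))"
  have t: "0 < t" "real DIM('a) * t < r" using r by (simp_all add: t_def)
  define a b' :: 'a where "a = - t *\<^sub>R One" and "b' = t *\<^sub>R One"
  have box_small: "norm w < r" if "w \<in> cbox a b'" for w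
  proof -
    have "norm w \<le> (\<Sum>i\<in>Basis. \<bar>w \<bullet> i\<bar>)" by (rule norm_le_l1)
    also have "\<dots> \<le> (\<Sum>i\<in>(Basis::'a set). t)"
      using that by (intro sum_mono) (fastforce simp: mem_box a_def b'_def abs_le_iff)
    finally show ?thesis using t(2) by simp
  qed
  define \<phi> where "\<phi> = box_bump 1 a b'"
  have phiT: "test_fun UNIV \<phi>" unfolding \<phi>_def by (rule box_bump_test_fun) auto
  have phi_nonneg: "0 \<le> \<phi> w" for w by (simp add: \<phi>_def box_bump_nonneg)
  have phi_out: "\<phi> w = 0" if "\<not> norm w < r" for w
  proof -
    have "w \<notin> box a b'" using that box_small box_subset_cbox by blast
    then show ?thesis by (simp add: \<phi>_def box_bump_eq_0)
  qed
  have phi_meas[measurable]: "\<phi> \<in> borel_measurable borel"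
    by (intro borel_measurable_continuous_onI test_fun_continuous[OF phiT])
  let ?D = "\<lambda>w v. frechet_derivative \<phi> (at w) v"
  have phi_der: "(\<phi> has_derivative ?D w) (at w)" for w by (rule test_fun_has_derivative[OF phiT])
  obtain Bp where Bp: "0 < Bp" "\<And>w. \<bar>\<phi> w\<bar> \<le> Bp" "\<And>w i. i \<in> Basis \<Longrightarrow> \<bar>?D w i\<bar> \<le> Bp"
    using test_fun_bounded[OF phiT] by metis
  have D_expand: "?D w v = (\<Sum>i\<in>Basis. (v \<bullet> i) * ?D w i)" for w v
  proof -
    have lin: "linear (?D w)" by (rule has_derivative_linear[OF phi_der])
    have "?D w v = ?D w (\<Sum>i\<in>Basis. (v \<bullet> i) *\<^sub>R i)" by (simp add: euclidean_representation)
    also have "\<dots> = (\<Sum>i\<in>Basis. (v \<bullet> i) * ?D w i)" by (simp add: linear_sum[OF lin] linear_cmul[OF lin])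
    finally show ?thesis .
  qed
  have Dm[measurable]: "(\<lambda>w. ?D w v) \<in> borel_measurable borel" for v
    unfolding D_expand[of _ v] by (intro borel_measurable_sum borel_measurable_times borel_measurable_const
       borel_measurable_continuous_onI test_fun_derivative_continuous[OF phiT])
  define Ch where "Ch = real DIM('a) * (norm h * Bp)"
  have Dh: "\<bar>?D w h\<bar> \<le> Ch" for w
  proof -
    have "\<bar>?D w h\<bar> \<le> (\<Sum>i\<in>Basis. \<bar>(h \<bullet> i) * ?D w i\<bar>)" unfolding D_expand[of w h] by (rule sum_abs)
    also have "\<dots> \<le> (\<Sum>i\<in>(Basis::'a set). norm h * Bp)"
    proof (rule sum_mono)
      fix i :: 'a assume i: "i \<in> Basis"
      show "\<bar>(h \<bullet> i) * ?D w i\<bar> \<le> norm h * Bp"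
        unfolding abs_mult using Basis_le_norm[OF i, of h] Bp(3)[OF i, of w] by (intro mult_mono) auto
    qed
    finally show ?thesis by (simp add: Ch_def)
  qed
  have line: "((\<lambda>s. \<phi> (w - s *\<^sub>R h)) has_real_derivative - ?D (w - s *\<^sub>R h) h) (at s)" for w s
  proof -
    have "((\<lambda>s. w - s *\<^sub>R h) has_derivative (\<lambda>s. - (s *\<^sub>R h))) (at s)" by (auto intro!: derivative_eq_intros)
    from has_derivative_compose[OF this phi_der]
    have "((\<lambda>s. \<phi> (w - s *\<^sub>R h)) has_derivative (\<lambda>k. ?D (w - s *\<^sub>R h) (- (k *\<^sub>R h)))) (at s)" .
    moreover have "(\<lambda>k. ?D (w - s *\<^sub>R h) (- (k *\<^sub>R h))) = (\<lambda>k. - ?D (w - s *\<^sub>R h) h * k)"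
      using has_derivative_linear[OF phi_der[of "w - s *\<^sub>R h"]] by (auto simp: linear_neg linear_cmul)
    ultimately show ?thesis unfolding has_field_derivative_def by (simp only:)
  qed
  have line_lip: "\<bar>\<phi> (w - s *\<^sub>R h) - \<phi> w\<bar> \<le> Ch * \<bar>s\<bar>" for w s
  proof -
    have "norm (\<phi> (w - s *\<^sub>R h) - \<phi> (w - 0 *\<^sub>R h)) \<le> Ch * norm (s - 0)"
      by (rule field_differentiable_bound[where S = UNIV and f' = "\<lambda>s. - ?D (w - s *\<^sub>R h) h"])
         (use line Dh in auto)
    then show ?thesis by simp
  qed
  \<comment> \<open>\<open>U c\<close> tested against the bump centred at
    \<open>x + s *\<^sub>R h\<close>. This is differentiable in \<open>s\<close> even though
    \<open>U c\<close> need not be continuous at the points of the segment outside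
    \<open>D\<close>.\<close>
  define F where "F s = (\<integral>z. U c z * \<phi> (z - (x + s *\<^sub>R h)) \<partial>lborel)" for s
  define m where "m = (\<integral>w. \<phi> w \<partial>lborel)"
  have ballint: "integrable lborel (\<lambda>z. K * indicator (cball (0::'a) q) z)" for K q :: real
    using emeasure_lborel_cball_finite by (intro integrable_mult_right integrable_real_indicator) auto
  let ?Ub = "\<bar>csum c * Bb\<bar>"
  have Ub: "\<bar>U c z\<bar> \<le> ?Ub" for z using U_bound[of c z] by linarith
  have Uphi_int: "integrable lborel (\<lambda>z. U c (z + v) * \<phi> z)" for v
  proof (rule Bochner_Integration.integrable_bound[OF ballint[of "?Ub * Bp" r]])
    have "norm (U c (z + v) * \<phi> z) \<le> ?Ub * Bp * indicator (cball 0 r) z" for z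
    proof (cases "norm z < r")
      case True
      have "\<bar>U c (z + v)\<bar> * \<bar>\<phi> z\<bar> \<le> ?Ub * Bp" using Ub Bp(2) by (intro mult_mono) auto
      then show ?thesis using True by (simp add: abs_mult indicator_def)
    next
      case False
      then show ?thesis using phi_out[OF False] Bp(1) by simp
    qed
    then show "AE z in lborel. norm (U c (z + v) * \<phi> z) \<le> norm (?Ub * Bp * indicator (cball 0 r) z)"
      by (intro AE_I2) (rule order_trans, assumption, simp only: real_norm_def abs_ge_self)
  qed measurable
  have phi_int: "integrable lborel \<phi>"
  proof (rule Bochner_Integration.integrable_bound[OF ballint[of Bp r]])
    have "norm (\<phi> z) \<le> Bp * indicator (cball 0 r) z" for z
      using phi_out[of z] Bp by (cases "norm z < r") (auto simp: indicator_def)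
    then show "AE z in lborel. norm (\<phi> z) \<le> norm (Bp * indicator (cball 0 r) z)"
      by (intro AE_I2) (rule order_trans, assumption, simp only: real_norm_def abs_ge_self)
  qed measurable
  have shift: "(\<integral>z. k z * \<phi> (z - v) \<partial>lborel) = (\<integral>z. k (z + v) * \<phi> z \<partial>lborel)"
    if [measurable]: "k \<in> borel_measurable borel" for k :: "'a \<Rightarrow> real" and v
    using integral_lborel_affine[where c = 1 and t = v, of "\<lambda>z. k z * \<phi> (z - v)"] by (simp add: add.commute)
  have Fder: "(F has_real_derivative - (\<integral>z. U c z * ?D (z - (x + s *\<^sub>R h)) h \<partial>lborel)) (at s)" for s
  proof -
    let ?R = "r + norm h + norm (x + s *\<^sub>R h)"
    have out: "\<phi> (z - (x + s *\<^sub>R h) - k *\<^sub>R h) = 0" if k: "\<bar>k\<bar> < 1" and z: "\<not> norm z \<le> ?R" for z k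
    proof (rule phi_out)
      have "norm z \<le> norm (z - (x + s *\<^sub>R h) - k *\<^sub>R h) + norm (x + s *\<^sub>R h) + norm (k *\<^sub>R h)"
        using norm_triangle_ineq[of "z - (x + s *\<^sub>R h) - k *\<^sub>R h" "(x + s *\<^sub>R h) + k *\<^sub>R h"]
          norm_triangle_ineq[of "x + s *\<^sub>R h" "k *\<^sub>R h"] by (simp add: algebra_simps)
      moreover have "norm (k *\<^sub>R h) \<le> norm h" using k by (simp add: mult_left_le_one_le)
      ultimately show "\<not> norm (z - (x + s *\<^sub>R h) - k *\<^sub>R h) < r" using z by linarith
    qed
    have "((\<lambda>k. \<integral>z. U c z * \<phi> (z - (x + s *\<^sub>R h) - k *\<^sub>R h) \<partial>lborel) has_real_derivative
        (\<integral>z. U c z * (- ?D (z - (x + s *\<^sub>R h)) h) \<partial>lborel)) (at 0)"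
    proof (rule has_real_derivative_integral[OF zero_less_one, where w = "\<lambda>z. ?Ub * Ch * indicator (cball 0 ?R) z"])
      fix k :: real assume k: "\<bar>k\<bar> < 1"
      have "integrable lborel (\<lambda>z. U c z * \<phi> (z - ((x + s *\<^sub>R h) + k *\<^sub>R h)))"
      proof -
        have "integrable (distr lborel borel ((+) ((x + s *\<^sub>R h) + k *\<^sub>R h))) (\<lambda>z. U c z * \<phi> (z - ((x + s *\<^sub>R h) + k *\<^sub>R h)))"
          using Uphi_int[of "(x + s *\<^sub>R h) + k *\<^sub>R h"] by (subst integrable_distr_eq) (auto simp: add.commute)
        then show ?thesis by (simp only: lborel_distr_plus)
      qed
      then show "integrable lborel (\<lambda>z. U c z * \<phi> (z - (x + s *\<^sub>R h) - k *\<^sub>R h))" by (simp only: diff_diff_eq)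
      fix z
      show "\<bar>U c z * \<phi> (z - (x + s *\<^sub>R h) - k *\<^sub>R h) - U c z * \<phi> (z - (x + s *\<^sub>R h) - 0 *\<^sub>R h)\<bar> \<le> \<bar>k\<bar> * (?Ub * Ch * indicator (cball 0 ?R) z)"
      proof (cases "norm z \<le> ?R")
        case True
        have "\<bar>U c z\<bar> * \<bar>\<phi> (z - (x + s *\<^sub>R h) - k *\<^sub>R h) - \<phi> (z - (x + s *\<^sub>R h))\<bar> \<le> ?Ub * (Ch * \<bar>k\<bar>)"
          using Ub line_lip by (intro mult_mono) auto
        then show ?thesis using True by (simp add: abs_mult[symmetric] right_diff_distrib[symmetric] mult_ac)
      next
        case False
        then show ?thesis using out[OF k False] out[of 0 z] False by simp
      qed
    next
      fix z
      have "((\<lambda>k. \<phi> (z - (x + s *\<^sub>R h) - k *\<^sub>R h)) has_real_derivative - ?D (z - (x + s *\<^sub>R h)) h) (at 0)"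
        using line[of "z - (x + s *\<^sub>R h)" 0] by simp
      then show "((\<lambda>k. U c z * \<phi> (z - (x + s *\<^sub>R h) - k *\<^sub>R h)) has_real_derivative U c z * (- ?D (z - (x + s *\<^sub>R h)) h)) (at 0)"
        by (rule DERIV_cmult)
      show "(\<lambda>z. U c z * (- ?D (z - (x + s *\<^sub>R h)) h)) \<in> borel_measurable lborel"
        using measurable_compose[OF _ Dm, of "\<lambda>z. z - (x + s *\<^sub>R h)" borel h] by simp
    qed (rule ballint)
    then have "((\<lambda>k. F (s + k)) has_real_derivative - (\<integral>z. U c z * ?D (z - (x + s *\<^sub>R h)) h \<partial>lborel)) (at 0)"
      by (simp add: F_def algebra_simps)
    then have "((\<lambda>k. F (k + s)) has_real_derivative - (\<integral>z. U c z * ?D (z - (x + s *\<^sub>R h)) h \<partial>lborel)) (at 0)"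
      by (simp only: add.commute[of s])
    from this[folded DERIV_shift] show ?thesis by (simp only: add_0_left)
  qed
  \<comment> \<open>A neighbourhood of the segment lies in \<Omega>, so the bump is an admissible
    test function in every position; the derivative of \<open>F\<close> is thereby the integral of
    \<open>h \<bullet> Gr c\<close> against the bump, whose mass is \<open>m\<close>.\<close>
  have Fder_le: "\<bar>\<integral>z. U c z * ?D (z - (x + s *\<^sub>R h)) h \<partial>lborel\<bar> \<le> L * norm h * m" if s: "s \<in> {0..1}" for s
  proof -
    define v where "v = x + s *\<^sub>R h"
    define \<phi>s where "\<phi>s = box_bump 1 (a + v) (b' + v)"
    have phis: "\<phi>s z = \<phi> (z - v)" for z by (simp add: \<phi>s_def \<phi>_def box_bump_translate)
    have vseg: "v \<in> closed_segment x y"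
      using s by (auto simp: closed_segment_def v_def h_def algebra_simps intro!: exI[of _ s])
    have "cbox (a + v) (b' + v) \<subseteq> \<Omega>"
    proof
      fix z assume "z \<in> cbox (a + v) (b' + v)"
      then have "z - v \<in> cbox a b'" by (simp add: mem_box inner_simps algebra_simps)
      then have "norm (z - v) < r3" using box_small[of "z - v"] r(4) by linarith
      then show "z \<in> \<Omega>" using r3(2) vseg by (force simp: dist_norm norm_minus_commute)
    qed
    then have T: "test_fun \<Omega> \<phi>s" unfolding \<phi>s_def by (intro box_bump_test_fun) auto
    have Dphis: "frechet_derivative \<phi>s (at z) i = ?D (z - v) i" for z i
    proof -
      have "((\<lambda>z. z - v) has_derivative (\<lambda>h. h)) (at z)" by (auto intro!: derivative_eq_intros)
      from has_derivative_compose[OF this phi_der] have "((\<lambda>z. \<phi> (z - v)) has_derivative ?D (z - v)) (at z)" .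
      moreover have "(\<lambda>z. \<phi> (z - v)) = \<phi>s" by (simp add: phis fun_eq_iff)
      ultimately have "(\<phi>s has_derivative ?D (z - v)) (at z)" by simp
      from frechet_derivative_at[OF this] show ?thesis by metis
    qed
    have phis_out: "\<phi>s z = 0" "?D (z - v) i = 0" if "z \<notin> \<Omega>" for z i
    proof -
      have z: "z \<notin> closure {x. \<phi>s x \<noteq> 0}" using T that by (auto simp: test_fun_def)
      show "\<phi>s z = 0" using z closure_subset[of "{x. \<phi>s x \<noteq> 0}"] by auto
      show "?D (z - v) i = 0" using test_fun_derivative_support[OF T z] Dphis[of z i] by simp
    qed
    have toO: "(\<integral>z. k z \<partial>Leb) = (\<integral>z. k z \<partial>lborel)" if [measurable]: "k \<in> borel_measurable borel" and "\<And>z. z \<notin> \<Omega> \<Longrightarrow> k z = 0" for k :: "'a \<Rightarrow> real"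
    proof -
      have "(\<lambda>z. indicator \<Omega> z * k z) = k" using that(2) by (auto simp: indicator_def fun_eq_iff)
      then show ?thesis by (simp add: integral_lebesgue_on_borel)
    qed
    have Dvm[measurable]: "(\<lambda>z. ?D (z - v) i) \<in> borel_measurable borel" for i
      using measurable_compose[OF _ Dm, of "\<lambda>z. z - v" borel i] by simp
    have psm[measurable]: "\<phi>s \<in> borel_measurable borel"
      by (intro borel_measurable_continuous_onI test_fun_continuous[OF T])
    note ibl = is_weak_grad_integrable[OF T]
    have Ui: "integrable Leb (U c)" by (rule Lp_on_integrable[OF lmeas_dom p1 U_Lp])
    have Gri: "integrable Leb (\<lambda>z. norm (Gr c z))" by (rule Lp_on_integrable[OF lmeas_dom p1 Gr_Lp])
    have Grm: "Gr c \<in> borel_measurable Leb" by (intro borel_measurable_lebesgue_on_borel Gr_meas)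
    have "(\<integral>z. U c z * ?D (z - v) h \<partial>lborel) = (\<integral>z. U c z * ?D (z - v) h \<partial>Leb)"
      using phis_out by (subst toO) simp_all
    also have "\<dots> = (\<integral>z. (\<Sum>i\<in>Basis. (h \<bullet> i) * (U c z * frechet_derivative \<phi>s (at z) i)) \<partial>Leb)"
      unfolding D_expand[of _ h] Dphis by (simp add: sum_distrib_left mult_ac)
    also have "\<dots> = (\<Sum>i\<in>Basis. (h \<bullet> i) * (\<integral>z. U c z * frechet_derivative \<phi>s (at z) i \<partial>Leb))"
      using ibl(1)[OF _ Ui] by (subst Bochner_Integration.integral_sum) auto
    also have "\<dots> = (\<Sum>i\<in>Basis. (h \<bullet> i) * - (\<integral>z. (Gr c z \<bullet> i) * \<phi>s z \<partial>Leb))"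
      using wg T by (intro sum.cong) (auto simp: is_weak_grad_def)
    finally have e1: "(\<integral>z. U c z * ?D (z - v) h \<partial>lborel) = (\<Sum>i\<in>Basis. (h \<bullet> i) * - (\<integral>z. (Gr c z \<bullet> i) * \<phi>s z \<partial>Leb))" .
    have e2: "(\<lambda>z. (h \<bullet> Gr c z) * \<phi>s z) = (\<lambda>z. \<Sum>i\<in>Basis. (h \<bullet> i) * ((Gr c z \<bullet> i) * \<phi>s z))"
      by (rule ext, subst euclidean_inner) (simp only: sum_distrib_right mult.assoc)
    have e3: "(\<integral>z. (\<Sum>i\<in>Basis. (h \<bullet> i) * ((Gr c z \<bullet> i) * \<phi>s z)) \<partial>Leb)
        = (\<Sum>i\<in>Basis. (h \<bullet> i) * (\<integral>z. (Gr c z \<bullet> i) * \<phi>s z \<partial>Leb))"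
      using ibl(2)[OF _ Gri Grm] by (subst Bochner_Integration.integral_sum) simp_all
    have eq: "(\<integral>z. U c z * ?D (z - v) h \<partial>lborel) = - (\<integral>z. (h \<bullet> Gr c z) * \<phi>s z \<partial>Leb)"
      unfolding e1 e2 e3 by (simp add: sum_negf)
    have mm: "(\<integral>z. \<phi>s z \<partial>Leb) = m"
    proof -
      have fe: "\<phi>s = (\<lambda>z. \<phi> (z - v))" by (rule ext) (rule phis)
      have "(\<integral>z. \<phi>s z \<partial>Leb) = (\<integral>z. \<phi>s z \<partial>lborel)" by (rule toO[OF psm]) (rule phis_out(1))
      also have "\<dots> = (\<integral>z. 1 * \<phi> (z - v) \<partial>lborel)" unfolding fe by simp
      also have "\<dots> = (\<integral>z. 1 * \<phi> z \<partial>lborel)" by (rule shift) simp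
      finally show ?thesis by (simp add: m_def)
    qed
    have phis_int: "integrable Leb \<phi>s"
    proof -
      interpret finite_measure "Leb" by (rule finite_measure_dom)
      show ?thesis
        by (rule integrable_const_bound[where B = Bp])
           (use Bp(2) phis in \<open>auto intro: borel_measurable_lebesgue_on_borel\<close>)
    qed
    have "\<bar>\<integral>z. (h \<bullet> Gr c z) * \<phi>s z \<partial>Leb\<bar> \<le> (\<integral>z. (norm h * L) * \<phi>s z \<partial>Leb)"
    proof -
      have le: "AE z in Leb. \<bar>(h \<bullet> Gr c z) * \<phi>s z\<bar> \<le> (norm h * L) * \<phi>s z"
        using L(1)
      proof eventually_elim
        case (elim z)
        have "\<bar>h \<bullet> Gr c z\<bar> \<le> norm h * L"
          using Cauchy_Schwarz_ineq2[of h "Gr c z"] mult_left_mono[OF elim, of "norm h"] by simp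
        then show ?case using phi_nonneg[of "z - v"] by (simp add: abs_mult phis mult_right_mono)
      qed
      have i1: "integrable Leb (\<lambda>z. (norm h * L) * \<phi>s z)" using phis_int by simp
      have i2: "integrable Leb (\<lambda>z. (h \<bullet> Gr c z) * \<phi>s z)"
        by (rule Bochner_Integration.integrable_bound[OF i1])
           (use le Grm borel_measurable_lebesgue_on_borel[OF psm] in \<open>auto elim!: eventually_mono\<close>)
      have "\<bar>\<integral>z. (h \<bullet> Gr c z) * \<phi>s z \<partial>Leb\<bar> \<le> (\<integral>z. \<bar>(h \<bullet> Gr c z) * \<phi>s z\<bar> \<partial>Leb)" by (rule integral_abs_bound)
      also have "\<dots> \<le> (\<integral>z. (norm h * L) * \<phi>s z \<partial>Leb)" using i1 i2 le by (intro integral_mono_AE) auto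
      finally show ?thesis .
    qed
    also have "\<dots> = L * norm h * m" by (simp add: mm)
    finally show ?thesis unfolding eq[unfolded v_def] by simp
  qed
  have "norm (F 1 - F 0) \<le> (L * norm h * m) * norm (1 - 0 :: real)"
    by (rule field_differentiable_bound[where S = "{0..1}" and f' = "\<lambda>s. - (\<integral>z. U c z * ?D (z - (x + s *\<^sub>R h)) h \<partial>lborel)"])
       (use Fder Fder_le in \<open>auto intro: has_field_derivative_at_within\<close>)
  then have up: "\<bar>F 1 - F 0\<bar> \<le> L * norm h * m" by simp
  have F01: "F 0 = (\<integral>w. U c (w + x) * \<phi> w \<partial>lborel)" "F 1 = (\<integral>w. U c (w + y) * \<phi> w \<partial>lborel)"
    using shift[OF U_meas[of c], of x] shift[OF U_meas[of c], of y] by (simp_all add: F_def h_def)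
  have mpos: "0 < m"
  proof -
    have "0 \<in> box a b'" using t by (simp add: mem_box a_def b'_def)
    then have "0 < \<phi> 0" by (simp add: \<phi>_def box_bump_pos)
    have "m \<noteq> 0"
    proof
      assume "m = 0"
      then have "AE w in lborel. \<phi> w = 0"
        using integral_nonneg_eq_0_iff_AE[OF phi_int] phi_nonneg by (simp add: m_def)
      then have "AE w in lborel. w \<notin> box a b'"
      proof eventually_elim
        case (elim w)
        then show ?case using box_bump_pos[of 1 w a b'] by (auto simp: \<phi>_def)
      qed
      then have "emeasure lborel (box a b') = 0" by (subst (asm) AE_iff_measurable[of "box a b'"]) auto
      moreover have "emeasure lborel (box a b') = ennreal (\<Prod>i\<in>(Basis::'a set). 2 * t)"
        using t by (subst emeasure_lborel_box) (auto simp: a_def b'_def inner_simps)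
      ultimately show False using t by simp
    qed
    moreover have "0 \<le> m" unfolding m_def using phi_nonneg by (intro integral_nonneg_AE) auto
    ultimately show ?thesis by simp
  qed
  \<comment> \<open>On the support of the bump \<open>U c\<close> is within \<tau> of its value at
    either end, so \<open>F\<close> grows by nearly \<open>m\<close> times the increment of
    \<open>U c\<close>.\<close>
  have low: "(\<bar>U c y - U c x\<bar> - 2 * \<tau>) * m \<le> sg * (F 1 - F 0)"
  proof -
    have "(\<bar>U c y - U c x\<bar> - 2 * \<tau>) * m = (\<integral>w. (\<bar>U c y - U c x\<bar> - 2 * \<tau>) * \<phi> w \<partial>lborel)" by (simp add: m_def)
    also have "\<dots> \<le> (\<integral>w. sg * (U c (w + y) * \<phi> w - U c (w + x) * \<phi> w) \<partial>lborel)"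
    proof (rule integral_mono)
      show "integrable lborel (\<lambda>w. (\<bar>U c y - U c x\<bar> - 2 * \<tau>) * \<phi> w)" using phi_int by simp
      show "integrable lborel (\<lambda>w. sg * (U c (w + y) * \<phi> w - U c (w + x) * \<phi> w))"
        using Uphi_int[of x] Uphi_int[of y] by simp
      fix w
      show "(\<bar>U c y - U c x\<bar> - 2 * \<tau>) * \<phi> w \<le> sg * (U c (w + y) * \<phi> w - U c (w + x) * \<phi> w)"
      proof (cases "norm w < r")
        case True
        have 1: "\<bar>U c (w + x) - U c x\<bar> < \<tau>" "\<bar>U c (w + y) - U c y\<bar> < \<tau>"
          using r1(2)[of w] r2(2)[of w] True r by (auto simp: add.commute)
        have "\<bar>U c y - U c x\<bar> - 2 * \<tau> \<le> sg * (U c (w + y) - U c (w + x))"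
          using 1 unfolding sg_def by (auto split: if_splits)
        then have "(\<bar>U c y - U c x\<bar> - 2 * \<tau>) * \<phi> w \<le> sg * (U c (w + y) - U c (w + x)) * \<phi> w"
          using phi_nonneg by (intro mult_right_mono)
        then show ?thesis by (simp add: left_diff_distrib mult.assoc)
      qed (simp add: phi_out)
    qed
    also have "\<dots> = sg * (F 1 - F 0)" unfolding F01 using Uphi_int[of x] Uphi_int[of y] by simp
    finally show ?thesis .
  qed
  have "sg * (F 1 - F 0) \<le> \<bar>F 1 - F 0\<bar>" by (auto simp: sg_def)
  with low up have "(\<bar>U c y - U c x\<bar> - 2 * \<tau>) * m \<le> L * norm h * m" by linarith
  then have "\<bar>U c y - U c x\<bar> - 2 * \<tau> \<le> L * norm h" using mpos by simp
  moreover have "3 * \<tau> = \<bar>U c y - U c x\<bar> - L * norm h" by (simp add: \<tau>_def)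
  ultimately show False using tau by linarith
qed

text \<open>Balls of radius \<eta> are convex subsets of \<Omega>, so \<open>U_lipschitz\<close>
  applies from their centres, and \<open>inner_energy_le\<close> yields one constant dominating all
  inner energies. The second conclusion records the resulting uniform bound.\<close>

lemma J_tendsto:
  assumes pair: "sobolev_pair p \<Omega> (U c) (Gr c)" and d: "\<And>n. 0 < d n" "d \<longlonglongrightarrow> 0" "\<And>n. d n \<le> \<delta>1"
  shows "(\<lambda>n. J (d n) (U c)) \<longlonglongrightarrow> ennreal (\<integral>x. norm (Gr c x) powr p \<partial>Leb)"
    "\<And>n. J (d n) (U c) \<le> ennreal (\<bar>csum c * Bb\<bar> powr p * Cbar DIM('a) p * measure lebesgue \<Omega>)"
proof -
  let ?L = "\<bar>csum c * Bb\<bar>" and ?M = "Leb"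
  let ?K = "?L powr p * Cbar DIM('a) p"
  have K0: "0 \<le> ?K" using Cbar_pos[OF p0, of "DIM('a)"] by simp
  have emO: "emeasure ?M (space ?M) = ennreal (measure lebesgue \<Omega>)"
    using lmeas_dom by (simp add: emeasure_restrict_space emeasure_eq_measure2 fmeasurableD)
  have wg: "is_weak_grad \<Omega> (U c) (Gr c)" using pair by (simp add: sobolev_pair_def)
  have GL: "AE x in ?M. norm (Gr c x) \<le> ?L" using Gr_bound[of c] by (intro AE_I2) (rule order_trans, assumption, simp)
  have le: "inner_energy (d n) (U c) x \<le> ennreal ?K" if x: "x \<in> D" for n x
  proof (rule inner_energy_le[OF d(1,3) _ U_meas])
    interpret K: collar_kernel_lip \<Omega> "\<eta> (d n)" "\<eta>' (d n)" \<psi> \<psi>' B by (rule collar[OF d(1,3)])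
    show xo: "x \<in> \<Omega>" using x D(2) by blast
    show "AE y in lborel. dist y x < \<eta> (d n) x \<longrightarrow> \<bar>U c y - U c x\<bar> \<le> ?L * dist y x"
      using AE_lborel_D
    proof eventually_elim
      case (elim y)
      show ?case
      proof
        assume y: "dist y x < \<eta> (d n) x"
        have ball: "ball x (\<eta> (d n) x) \<subseteq> \<Omega>" by (rule K.eta_ball[OF xo])
        have "closed_segment x y \<subseteq> ball x (\<eta> (d n) x)"
          using y K.eta_pos[OF xo] by (intro closed_segment_subset) (auto simp: dist_commute)
        then have "closed_segment x y \<subseteq> \<Omega>" using ball by blast
        moreover have "y \<in> D" using elim ball y by (auto simp: dist_commute)
        ultimately show "\<bar>U c y - U c x\<bar> \<le> ?L * dist y x"
          using U_lipschitz[OF wg GL _ x] by (simp add: dist_norm)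
      qed
    qed
  qed simp
  have ae: "AE x in ?M. inner_energy (d n) (U c) x \<le> ennreal ?K" for n
    using AE_dom_D by eventually_elim (rule le)
  have m: "(\<lambda>x. inner_energy (d n) (U c) x) \<in> borel_measurable ?M" for n
    by (intro borel_measurable_lebesgue_on_borel inner_energy_meas[OF d(1,3)] U_meas)
  have const: "(\<integral>\<^sup>+x. ennreal ?K \<partial>?M) = ennreal (?K * measure lebesgue \<Omega>)"
    using K0 emO by (simp add: ennreal_mult)
  have "(\<lambda>n. \<integral>\<^sup>+x. inner_energy (d n) (U c) x \<partial>?M) \<longlonglongrightarrow> (\<integral>\<^sup>+x. ennreal (norm (Gr c x) powr p) \<partial>?M)"
  proof (rule nn_integral_dominated_convergence[where w = "\<lambda>_. ennreal ?K"])
    show "AE x in ?M. (\<lambda>n. inner_energy (d n) (U c) x) \<longlonglongrightarrow> ennreal (norm (Gr c x) powr p)"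
      using AE_dom_D
      by eventually_elim (rule inner_energy_tendsto[where cs = "\<lambda>_. c", OF _ d], simp_all add: conv_def)
    show "(\<integral>\<^sup>+x. ennreal ?K \<partial>?M) < \<infinity>" unfolding const by simp
    show "(\<lambda>x. ennreal (norm (Gr c x) powr p)) \<in> borel_measurable ?M"
      by (intro borel_measurable_lebesgue_on_borel) measurable
  qed (use m ae in auto)
  then show "(\<lambda>n. J (d n) (U c)) \<longlonglongrightarrow> ennreal (\<integral>x. norm (Gr c x) powr p \<partial>?M)"
    by (simp add: J_def integral_Gr_powr)
  show "J (d n) (U c) \<le> ennreal (?K * measure lebesgue \<Omega>)" for n
    unfolding J_def const[symmetric] by (rule nn_integral_mono_AE[OF ae])
qed

text \<open>With \<open>L = 0\<close> the bound on segments makes \<open>U c\<close> constant on the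
  part of \<open>D\<close> in each ball; connectedness of \<Omega> joins these values, and the zero
  mean fixes the constant.\<close>

lemma U_eq_0_if_grad_0:
  assumes wg: "is_weak_grad \<Omega> (U c) (Gr c)" and G0: "AE x in Leb. Gr c x = 0"
    and mz: "mean_zero \<Omega> (U c)"
  shows "AE x in Leb. U c x = 0"
proof (cases "D = {}")
  case True
  with AE_dom_D show ?thesis by (auto elim: eventually_mono)
next
  case False
  then obtain x0 where x0: "x0 \<in> D" by blast
  have G0': "AE x in Leb. norm (Gr c x) \<le> 0" using G0 by eventually_elim simp
  have eq: "U c x = U c x0" if x: "x \<in> D" for x
  \<comment> \<open>\<open>D\<close> is in general disconnected. The induction runs over \<Omega>
    with the points of \<open>D\<close> as admissible points; they meet every nonempty open subset
    because the remainder is a null set.\<close>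
  proof (rule connected_induction[OF conn_dom, where P = "\<lambda>x. x \<in> D" and Q = "\<lambda>x. U c x = U c x0" and a = x0])
    show "\<exists>z. z \<in> T \<and> z \<in> D" if T: "openin (top_of_set \<Omega>) T" "a \<in> T" for T a
    proof (rule ccontr)
      assume neg: "\<not> ?thesis"
      have "open T" "T \<subseteq> \<Omega>" using T openin_open_eq[OF open_dom] by auto
      moreover have "negligible T" by (rule negligible_subset[OF D(3)]) (use neg \<open>T \<subseteq> \<Omega>\<close> in blast)
      ultimately show False using open_not_negligible T(2) by blast
    qed
    show "\<exists>T. openin (top_of_set \<Omega>) T \<and> a \<in> T \<and>
          (\<forall>x\<in>T. \<forall>y\<in>T. x \<in> D \<and> y \<in> D \<and> U c x = U c x0 \<longrightarrow> U c y = U c x0)" if a: "a \<in> \<Omega>" for a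
    proof -
      obtain r where r: "0 < r" "ball a r \<subseteq> \<Omega>" using open_dom a open_contains_ball by blast
      have "U c y = U c x" if "x \<in> ball a r" "y \<in> ball a r" "x \<in> D" "y \<in> D" for x y
      proof -
        have "closed_segment x y \<subseteq> ball a r" by (rule closed_segment_subset[OF that(1,2)]) simp
        then have "closed_segment x y \<subseteq> \<Omega>" using r(2) by blast
        from U_lipschitz[OF wg G0' order_refl that(3,4) this] show ?thesis by simp
      qed
      moreover have "openin (top_of_set \<Omega>) (ball a r)" using openin_open_eq[OF open_dom] r(2) by simp
      ultimately show ?thesis using r(1) by (intro exI[of _ "ball a r"]) (metis centre_in_ball)
    qed
  qed (use x x0 D(2) in auto)
  have ae: "AE x in Leb. U c x = U c x0" using AE_dom_D by eventually_elim (rule eq)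
  have "(\<integral>x. U c x \<partial>Leb) = (\<integral>x. U c x0 \<partial>Leb)"
    by (rule integral_cong_AE) (use ae in \<open>auto intro: borel_measurable_lebesgue_on_borel\<close>)
  then have "U c x0 * measure Leb \<Omega> = 0" using mz by (simp add: mean_zero_def mult.commute)
  moreover have "measure Leb \<Omega> \<noteq> 0"
  proof -
    have "\<not> negligible \<Omega>" using open_not_negligible[OF open_dom] x0 D(2) by blast
    then show ?thesis using lmeas_dom by (simp add: measure_restrict_space fmeasurableD negligible_iff_measure)
  qed
  ultimately have "U c x0 = 0" by simp
  then show ?thesis using ae by simp
qed

end

section \<open>Convergence of minimizers\<close>

text \<open>The mean value theorem on the two halves: the derivative of the power is strictly
  increasing, so the second increment is larger than the first.\<close>

lemma powr_midpoint_less: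
  fixes s t p :: real
  assumes "1 < p" "0 \<le> s" "s < t"
  shows "2 * ((s + t) / 2) powr p < s powr p + t powr p"
proof -
  let ?m = "(s + t) / 2"
  have m: "s < ?m" "?m < t" using assms by auto
  have cont: "continuous_on S (\<lambda>x. x powr p)" if "S \<subseteq> {0..}" for S :: "real set"
    using assms(1) that by (intro continuous_on_powr' continuous_intros) auto
  have der: "((\<lambda>x. x powr p) has_real_derivative p * x powr (p - 1)) (at x)" if "0 < x" for x
    using that by (rule has_real_derivative_powr)
  have dif: "(\<lambda>x. x powr p) differentiable at x" if "0 < x" for x
    using der[OF that] real_differentiable_def by blast
  obtain l1 z1 where 1: "s < z1" "z1 < ?m" "((\<lambda>x. x powr p) has_real_derivative l1) (at z1)" "?m powr p - s powr p = (?m - s) * l1"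
    using MVT[OF m(1) cont dif] assms(2) by fastforce
  obtain l2 z2 where 2: "?m < z2" "z2 < t" "((\<lambda>x. x powr p) has_real_derivative l2) (at z2)" "t powr p - ?m powr p = (t - ?m) * l2"
    using MVT[OF m(2) cont dif] assms(2,3) by fastforce
  have z: "0 < z1" "0 < z2" "z1 < z2" using 1 2 assms by linarith+
  have "l1 = p * z1 powr (p - 1)" "l2 = p * z2 powr (p - 1)"
    using DERIV_unique[OF 1(3) der[OF z(1)]] DERIV_unique[OF 2(3) der[OF z(2)]] by auto
  moreover have "z1 powr (p - 1) < z2 powr (p - 1)" using z assms(1) by (intro powr_less_mono2) auto
  ultimately have "l1 < l2" using assms(1) by simp
  then have "(?m - s) * l1 < (?m - s) * l2" using m by simp
  moreover have eqm: "t - ?m = ?m - s" by (simp add: field_simps)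
  ultimately have "?m powr p - s powr p < t powr p - ?m powr p" unfolding 1(4) 2(4) eqm by blast
  then show ?thesis by linarith
qed

text \<open>For different norms the triangle inequality reduces the claim to the scalar case; for
  equal norms strictness comes from the parallelogram law.\<close>

lemma norm_powr_midpoint_less:
  fixes a b :: "'a::real_inner"
  assumes p: "1 < p" and ne: "a \<noteq> b"
  shows "2 * norm ((1 / 2) *\<^sub>R (a + b)) powr p < norm a powr p + norm b powr p"
proof (cases "norm a = norm b")
  case False
  have "norm ((1 / 2) *\<^sub>R (a + b)) \<le> (norm a + norm b) / 2" using norm_triangle_ineq[of a b] by simp
  then have "norm ((1 / 2) *\<^sub>R (a + b)) powr p \<le> ((norm a + norm b) / 2) powr p" using p by (intro powr_mono2) auto
  moreover have "2 * ((norm a + norm b) / 2) powr p < norm a powr p + norm b powr p"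
    using False powr_midpoint_less[OF p, of "norm a" "norm b"] powr_midpoint_less[OF p, of "norm b" "norm a"]
    by (cases "norm a < norm b") (auto simp: add.commute)
  ultimately show ?thesis by linarith
next
  case True
  have "(norm (a + b))\<^sup>2 + (norm (a - b))\<^sup>2 = 2 * (norm a)\<^sup>2 + 2 * (norm b)\<^sup>2"
    by (simp add: power2_norm_eq_inner inner_simps inner_commute)
  moreover have "0 < (norm (a - b))\<^sup>2" using ne by simp
  moreover have "(2 * norm a)\<^sup>2 = 2 * (norm a)\<^sup>2 + 2 * (norm b)\<^sup>2" using True by (simp add: power_mult_distrib)
  ultimately have "(norm (a + b))\<^sup>2 < (2 * norm a)\<^sup>2" by linarith
  then have "norm (a + b) < 2 * norm a" by (rule power_less_imp_less_base) simp
  then have "norm ((1 / 2) *\<^sub>R (a + b)) powr p < norm a powr p" using p by (intro powr_less_mono2) auto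
  then show ?thesis using True by simp
qed

lemma norm_powr_midpoint_le:
  fixes a b :: "'a::real_inner"
  assumes p: "1 < p"
  shows "2 * norm ((1 / 2) *\<^sub>R (a + b)) powr p \<le> norm a powr p + norm b powr p"
proof (cases "a = b")
  case True
  then have "(1 / 2) *\<^sub>R (a + b) = b" by (simp flip: scaleR_2)
  then show ?thesis using True by simp
next
  case False
  from norm_powr_midpoint_less[OF p this] show ?thesis by linarith
qed

text \<open>Bolzano-Weierstrass one coordinate at a time, since the index type carries no
  structure.\<close>

lemma finite_convergent_subsequence:
  fixes cs :: "nat \<Rightarrow> 'i \<Rightarrow> real"
  assumes "finite I" and "\<And>j n. j \<in> I \<Longrightarrow> \<bar>cs n j\<bar> \<le> S"
  obtains s c where "strict_mono (s :: nat \<Rightarrow> nat)" "\<And>j. j \<in> I \<Longrightarrow> (\<lambda>n. cs (s n) j) \<longlonglongrightarrow> c j"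
proof -
  have "\<exists>s c. strict_mono (s :: nat \<Rightarrow> nat) \<and> (\<forall>j\<in>I. (\<lambda>n. cs (s n) j) \<longlonglongrightarrow> c j)"
    using assms
  proof (induction I rule: finite_induct)
    case empty
    show ?case by (intro exI[of _ id]) (auto simp: strict_mono_def)
  next
    case (insert i I)
    then obtain s c where s: "strict_mono s" "\<And>j. j \<in> I \<Longrightarrow> (\<lambda>n. cs (s n) j) \<longlonglongrightarrow> c j" by blast
    have "bounded (range (\<lambda>n. cs (s n) i))" using insert.prems by (auto simp: bounded_iff)
    then obtain l r where r: "strict_mono r" "((\<lambda>n. cs (s n) i) \<circ> r) \<longlonglongrightarrow> l"
      using bounded_imp_convergent_subsequence by blast
    have "(\<lambda>n. cs ((s \<circ> r) n) j) \<longlonglongrightarrow> (c(i := l)) j" if "j \<in> insert i I" for j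
    proof (cases "j = i")
      case True
      then show ?thesis using r(2) by (simp add: o_def)
    next
      case False
      then show ?thesis using LIMSEQ_subseq_LIMSEQ[OF s(2) r(1), of j] that by (simp add: o_def)
    qed
    then show ?case using strict_mono_o[OF s(1) r(1)] by blast
  qed
  then show ?thesis using that by blast
qed

section \<open>Coercivity, uniqueness and compactness in the coefficients\<close>

context piecewise_setting begin

lemma J_scale: "J \<delta> (U (\<lambda>j. s * c j)) = ennreal (\<bar>s\<bar> powr p) * J \<delta> (U c)" if d: "0 < \<delta>" "\<delta> \<le> \<delta>1"
proof -
  have ie: "inner_energy \<delta> (U (\<lambda>j. s * c j)) x = ennreal (\<bar>s\<bar> powr p) * inner_energy \<delta> (U c) x" for x
  proof -
    let ?k = "\<lambda>y. \<rho> (dist y x / \<eta> \<delta> x) / (\<eta> \<delta> x powr (real DIM('a) + p - \<beta>) * dist x y powr \<beta>)"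
    have "ennreal (?k y * \<bar>U (\<lambda>j. s * c j) x - U (\<lambda>j. s * c j) y\<bar> powr p) = ennreal (\<bar>s\<bar> powr p) * ennreal (?k y * \<bar>U c x - U c y\<bar> powr p)" for y
    proof -
      have "\<bar>U (\<lambda>j. s * c j) x - U (\<lambda>j. s * c j) y\<bar> powr p = \<bar>s\<bar> powr p * \<bar>U c x - U c y\<bar> powr p"
        unfolding U_scale right_diff_distrib[symmetric] abs_mult by (simp add: powr_mult)
      then have "?k y * \<bar>U (\<lambda>j. s * c j) x - U (\<lambda>j. s * c j) y\<bar> powr p = \<bar>s\<bar> powr p * (?k y * \<bar>U c x - U c y\<bar> powr p)" by simp
      then show ?thesis by (simp only: ennreal_mult'[OF powr_ge_zero])
    qed
    then show ?thesis unfolding inner_energy_def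
      by (simp only:) (intro nn_integral_cmult borel_measurable_lebesgue_on_borel, measurable)
  qed
  have "inner_energy \<delta> (U (\<lambda>j. s * c j)) = (\<lambda>x. ennreal (\<bar>s\<bar> powr p) * inner_energy \<delta> (U c) x)" by (rule ext) (rule ie)
  then show ?thesis unfolding J_def
    using nn_integral_cmult[OF borel_measurable_lebesgue_on_borel[OF inner_energy_meas[OF d U_meas]]] by simp
qed

lemma mean_zero_limit:
  assumes cv: "conv cs c" and mz: "\<And>n. mean_zero \<Omega> (U (cs n))"
  shows "mean_zero \<Omega> (U c)"
proof -
  interpret finite_measure "Leb" by (rule finite_measure_dom)
  obtain S where S: "0 < S" "\<And>n. csum (cs n) \<le> S" using conv_csum_bounded[OF cv] by blast
  have b: "norm (U (cs n) x) \<le> S * \<bar>Bb\<bar>" for n x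
  proof -
    have "\<bar>U (cs n) x\<bar> \<le> csum (cs n) * Bb" by (rule U_bound)
    also have "\<dots> \<le> csum (cs n) * \<bar>Bb\<bar>" using csum_nonneg by (intro mult_left_mono) auto
    also have "\<dots> \<le> S * \<bar>Bb\<bar>" using S by (intro mult_right_mono) auto
    finally show ?thesis by simp
  qed
  have "(\<lambda>n. \<integral>x. U (cs n) x \<partial>Leb) \<longlonglongrightarrow> (\<integral>x. U c x \<partial>Leb)"
    by (rule integral_dominated_convergence[where w = "\<lambda>_. S * \<bar>Bb\<bar>"])
       (use b conv_U[OF cv] in \<open>auto intro: borel_measurable_lebesgue_on_borel\<close>)
  then show ?thesis using mz by (simp add: mean_zero_def LIMSEQ_const_iff)
qed

text \<open>The mollified function is bounded by the coefficient sum and its gradient by the energy.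
  The load thus grows at most like the power \<open>1 / p\<close> of these quantities, and this
  sublinear growth in the energy is the source of coercivity.\<close>

lemma functional_bound:
  obtains C where "0 < C" "\<And>\<delta> c j. 0 < \<delta> \<Longrightarrow> \<delta> \<le> \<delta>1 \<Longrightarrow> 0 \<le> j \<Longrightarrow> J \<delta> (U c) = ennreal j \<Longrightarrow>
     \<bar>f (KK \<delta> (U c))\<bar> \<le> C * (csum c powr p + j) powr (1 / p)"
proof -
  let ?M = "Leb"
  interpret finite_measure ?M by (rule finite_measure_dom)
  obtain C1 where C1: "0 \<le> C1" "\<And>\<delta> u Cu. 0 < \<delta> \<Longrightarrow> \<delta> \<le> \<delta>1 \<Longrightarrow> u \<in> borel_measurable borel \<Longrightarrow> (\<And>y. \<bar>u y\<bar> \<le> Cu) \<Longrightarrow>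
     (\<integral>\<^sup>+x. ennreal (norm (GK \<delta> u x) powr p) \<partial>?M) \<le> ennreal C1 * J \<delta> u" using GK_energy_bound by blast
  obtain C2 where C2: "0 < C2" "\<And>u G. sobolev_pair p \<Omega> u G \<Longrightarrow>
    \<bar>f u\<bar> \<le> C2 * ((\<integral>x. \<bar>u x\<bar> powr p \<partial>?M) + (\<integral>x. norm (G x) powr p \<partial>?M)) powr (1 / p)"
    using W1p_dual_bound[OF f_dual open_dom lmeas_dom p1] by blast
  define K where "K = \<bar>Bb\<bar> powr p * measure ?M (space ?M) + C1 + 1"
  have K: "0 < K" using C1(1) by (simp add: K_def add_nonneg_pos)
  show ?thesis
  proof (rule that[of "C2 * K powr (1 / p)"])
    show "0 < C2 * K powr (1 / p)" using C2 K by simp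
    fix \<delta> c j assume d: "0 < \<delta>" "\<delta> \<le> \<delta>1" and j: "0 \<le> j" "J \<delta> (U c) = ennreal j"
    have "(\<integral>\<^sup>+x. ennreal (norm (GK \<delta> (U c) x) powr p) \<partial>?M) \<le> ennreal C1 * J \<delta> (U c)" by (rule C1(2)[OF d U_meas U_bound])
    then have "(\<integral>\<^sup>+x. ennreal (norm (GK \<delta> (U c) x) powr p) \<partial>?M) \<le> ennreal (C1 * j)" using C1 j by (simp add: ennreal_mult)
    moreover have "0 \<le> C1 * j" using C1 j by simp
    ultimately have pair: "sobolev_pair p \<Omega> (KK \<delta> (U c)) (GK \<delta> (U c))" and G: "(\<integral>x. norm (GK \<delta> (U c) x) powr p \<partial>?M) \<le> C1 * j"
      using KK_sobolev_pair[OF d] by blast+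
    have "(\<integral>x. \<bar>KK \<delta> (U c) x\<bar> powr p \<partial>?M) \<le> (\<integral>x. (csum c * \<bar>Bb\<bar>) powr p \<partial>?M)"
    proof (rule integral_mono_AE)
      show "integrable ?M (\<lambda>x. \<bar>KK \<delta> (U c) x\<bar> powr p)" using pair by (simp add: sobolev_pair_def Lp_on_def)
      have "\<bar>KK \<delta> (U c) x\<bar> powr p \<le> (csum c * \<bar>Bb\<bar>) powr p" if "x \<in> \<Omega>" for x
      proof -
        have "\<bar>KK \<delta> (U c) x\<bar> \<le> csum c * Bb" by (rule KK_abs_le[OF d that])
        also have "\<dots> \<le> csum c * \<bar>Bb\<bar>" using csum_nonneg by (intro mult_left_mono) auto
        finally show ?thesis using p0 by (intro powr_mono2) auto
      qed
      then show "AE x in ?M. \<bar>KK \<delta> (U c) x\<bar> powr p \<le> (csum c * \<bar>Bb\<bar>) powr p" by (intro AE_I2) simp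
    qed simp
    also have "\<dots> = csum c powr p * (\<bar>Bb\<bar> powr p * measure ?M (space ?M))" by (simp add: powr_mult)
    finally have "(\<integral>x. \<bar>KK \<delta> (U c) x\<bar> powr p \<partial>?M) + (\<integral>x. norm (GK \<delta> (U c) x) powr p \<partial>?M) \<le> csum c powr p * (\<bar>Bb\<bar> powr p * measure ?M (space ?M)) + j * C1"
      using G by (simp add: mult.commute)
    also have "\<dots> \<le> csum c powr p * K + j * K"
      using C1 j by (intro add_mono mult_left_mono) (auto simp: K_def)
    also have "\<dots> = K * (csum c powr p + j)" by (simp add: algebra_simps)
    finally have "((\<integral>x. \<bar>KK \<delta> (U c) x\<bar> powr p \<partial>?M) + (\<integral>x. norm (GK \<delta> (U c) x) powr p \<partial>?M)) powr (1 / p) \<le> (K * (csum c powr p + j)) powr (1 / p)"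
      using p by (intro powr_mono2) (auto intro!: add_nonneg_nonneg integral_nonneg_AE)
    also have "\<dots> = K powr (1 / p) * (csum c powr p + j) powr (1 / p)" by (rule powr_mult)
    finally have "C2 * ((\<integral>x. \<bar>KK \<delta> (U c) x\<bar> powr p \<partial>?M) + (\<integral>x. norm (GK \<delta> (U c) x) powr p \<partial>?M)) powr (1 / p)
       \<le> C2 * (K powr (1 / p) * (csum c powr p + j) powr (1 / p))" using C2(1) by (intro mult_left_mono) auto
    with C2(2)[OF pair] show "\<bar>f (KK \<delta> (U c))\<bar> \<le> C2 * K powr (1 / p) * (csum c powr p + j) powr (1 / p)"
      by (simp add: mult.assoc)
  qed
qed

lemma csum_cmult: "csum (\<lambda>j. s * c j) = \<bar>s\<bar> * csum c"
  by (simp add: csum_def abs_mult sum_distrib_left)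

text \<open>Since the load is linear, comparing the energies at the midpoint forces equality in the
  convexity inequality, hence equal gradients almost everywhere. The difference then has zero
  gradient and zero mean.\<close>

lemma minimizer_unique:
  assumes c: "sobolev_pair p \<Omega> (U c) (Gr c)" "mean_zero \<Omega> (U c)"
    and c': "sobolev_pair p \<Omega> (U c') (Gr c')" "mean_zero \<Omega> (U c')"
    and min: "\<And>a. sobolev_pair p \<Omega> (U a) (Gr a) \<Longrightarrow> mean_zero \<Omega> (U a) \<Longrightarrow>
       (1 / p) * (\<integral>x. norm (Gr c' x) powr p \<partial>Leb) - f (U c') \<le> (1 / p) * (\<integral>x. norm (Gr a x) powr p \<partial>Leb) - f (U a)"
    and le: "(1 / p) * (\<integral>x. norm (Gr c x) powr p \<partial>Leb) - f (U c) \<le> (1 / p) * (\<integral>x. norm (Gr c' x) powr p \<partial>Leb) - f (U c')"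
  shows "AE x in Leb. U (\<lambda>j. c j - c' j) x = 0"
proof -
  let ?M = "Leb"
  let ?I = "\<lambda>a. \<integral>x. norm (Gr a x) powr p \<partial>?M"
  have lin: "sobolev_pair p \<Omega> (U (\<lambda>j. s * c j + t * c' j)) (Gr (\<lambda>j. s * c j + t * c' j))"
    "mean_zero \<Omega> (U (\<lambda>j. s * c j + t * c' j))" "f (U (\<lambda>j. s * c j + t * c' j)) = s * f (U c) + t * f (U c')" for s t
  proof -
    have U: "U (\<lambda>j. s * c j + t * c' j) = (\<lambda>x. s * U c x + t * U c' x)" by (rule ext) (simp only: U_add U_scale)
    have G: "Gr (\<lambda>j. s * c j + t * c' j) = (\<lambda>x. s *\<^sub>R Gr c x + t *\<^sub>R Gr c' x)" by (rule ext) (simp only: Gr_add Gr_scale)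
    show "sobolev_pair p \<Omega> (U (\<lambda>j. s * c j + t * c' j)) (Gr (\<lambda>j. s * c j + t * c' j))"
      unfolding U G by (intro sobolev_pair_add[OF p1 lmeas_dom] sobolev_pair_scale c c')
    have i: "integrable ?M (U a)" for a by (rule Lp_on_integrable[OF lmeas_dom p1 U_Lp])
    show "mean_zero \<Omega> (U (\<lambda>j. s * c j + t * c' j))"
      unfolding U mean_zero_def using i[of c] i[of c'] c(2) c'(2) by (simp add: mean_zero_def)
    have w: "W1p p \<Omega> (U c)" "W1p p \<Omega> (U c')" using c c' by (auto simp: W1p_iff_sobolev_pair)
    have ws: "W1p p \<Omega> (\<lambda>x. s * U c x)" "W1p p \<Omega> (\<lambda>x. t * U c' x)"
      using sobolev_pair_scale[OF c(1)] sobolev_pair_scale[OF c'(1)] by (auto simp: W1p_iff_sobolev_pair)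
    have "f (\<lambda>x. s * U c x + t * U c' x) = f (\<lambda>x. s * U c x) + f (\<lambda>x. t * U c' x)"
      using f_dual ws unfolding W1p_dual_def by blast
    also have "f (\<lambda>x. s * U c x) = s * f (U c)" using f_dual w unfolding W1p_dual_def by blast
    also have "f (\<lambda>x. t * U c' x) = t * f (U c')" using f_dual w unfolding W1p_dual_def by blast
    finally show "f (U (\<lambda>j. s * c j + t * c' j)) = s * f (U c) + t * f (U c')" unfolding U .
  qed
  let ?m = "\<lambda>j. (1 / 2) * c j + (1 / 2) * c' j"
  have mid: "Gr ?m x = (1 / 2) *\<^sub>R (Gr c x + Gr c' x)" for x by (simp only: Gr_add Gr_scale scaleR_add_right)
  have ii: "integrable ?M (\<lambda>x. norm (Gr a x) powr p)" for a using Gr_Lp[of a] by (simp add: Lp_on_def)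
  have "(1 / p) * ?I c' - f (U c') \<le> (1 / p) * ?I ?m - (1 / 2 * f (U c) + 1 / 2 * f (U c'))"
    using min[OF lin(1,2)[of "1 / 2" "1 / 2"]] unfolding lin(3)[of "1 / 2" "1 / 2"] .
  with le have "(1 / p) * ?I c + (1 / p) * ?I c' \<le> (1 / p) * (2 * ?I ?m)" by simp
  then have "(1 / p) * (?I c + ?I c') \<le> (1 / p) * (2 * ?I ?m)" by (simp only: distrib_left)
  then have "?I c + ?I c' \<le> 2 * ?I ?m" using p0 by (simp add: divide_le_cancel)
  then have le0: "(\<integral>x. norm (Gr c x) powr p + norm (Gr c' x) powr p - 2 * norm (Gr ?m x) powr p \<partial>?M) \<le> 0"
    using ii[of c] ii[of c'] ii[of ?m] by simp
  have nn: "0 \<le> norm (Gr c x) powr p + norm (Gr c' x) powr p - 2 * norm (Gr ?m x) powr p" for x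
    unfolding mid using norm_powr_midpoint_le[OF p, of "Gr c x" "Gr c' x"] by simp
  have "(\<integral>x. norm (Gr c x) powr p + norm (Gr c' x) powr p - 2 * norm (Gr ?m x) powr p \<partial>?M) = 0"
    using le0 nn by (intro antisym integral_nonneg_AE) auto
  moreover have "integrable ?M (\<lambda>x. norm (Gr c x) powr p + norm (Gr c' x) powr p - 2 * norm (Gr ?m x) powr p)"
    using ii[of c] ii[of c'] ii[of ?m] by simp
  ultimately have ae: "AE x in ?M. norm (Gr c x) powr p + norm (Gr c' x) powr p - 2 * norm (Gr ?m x) powr p = 0"
    using integral_nonneg_eq_0_iff_AE[of ?M "\<lambda>x. norm (Gr c x) powr p + norm (Gr c' x) powr p - 2 * norm (Gr ?m x) powr p"] nn by simp
  let ?w = "\<lambda>j. 1 * c j + (-1) * c' j"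
  have "AE x in ?M. Gr ?w x = 0"
    using ae
  proof eventually_elim
    case (elim x)
    have "Gr c x = Gr c' x"
    proof (rule ccontr)
      assume "Gr c x \<noteq> Gr c' x"
      from norm_powr_midpoint_less[OF p this] elim show False unfolding mid by simp
    qed
    then show ?case unfolding Gr_add Gr_scale by simp
  qed
  moreover have "is_weak_grad \<Omega> (U ?w) (Gr ?w)" using lin(1)[of 1 "-1"] by (simp add: sobolev_pair_def)
  ultimately have "AE x in ?M. U ?w x = 0" using lin(2)[of 1 "-1"] by (intro U_eq_0_if_grad_0)
  then show ?thesis by simp
qed

text \<open>The hypothesis \<open>indep\<close> turns a limit function that vanishes almost
  everywhere into vanishing coefficients. Energies enter as reals \<open>jr n\<close>, which keeps
  the comparisons free of extended arithmetic.\<close>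

lemma minimizers_subsequence:
  assumes indep: "\<And>c. (AE x in Leb. U c x = 0) \<Longrightarrow> \<forall>j\<in>I. c j = 0"
    and d: "\<And>n. 0 < d n" "d \<longlonglongrightarrow> 0" "\<And>n. d n \<le> \<delta>1"
    and jr: "\<And>n. 0 \<le> jr n" "\<And>n. J (d n) (U (cs n)) = ennreal (jr n)"
    and mz: "\<And>n. mean_zero \<Omega> (U (cs n))"
    and min: "\<And>n a j. sobolev_pair p \<Omega> (U a) (Gr a) \<Longrightarrow> mean_zero \<Omega> (U a) \<Longrightarrow> 0 \<le> j \<Longrightarrow> J (d n) (U a) = ennreal j \<Longrightarrow>
       (1 / p) * jr n - f (KK (d n) (U (cs n))) \<le> (1 / p) * j - f (KK (d n) (U a))"
    and c: "sobolev_pair p \<Omega> (U c) (Gr c)" "mean_zero \<Omega> (U c)"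
    and cmin: "\<And>a. sobolev_pair p \<Omega> (U a) (Gr a) \<Longrightarrow> mean_zero \<Omega> (U a) \<Longrightarrow>
       (1 / p) * (\<integral>x. norm (Gr c x) powr p \<partial>Leb) - f (U c) \<le> (1 / p) * (\<integral>x. norm (Gr a x) powr p \<partial>Leb) - f (U a)"
  obtains s where "strict_mono (s :: nat \<Rightarrow> nat)" "conv (\<lambda>n. cs (s n)) c"
proof -
  let ?M = "Leb"
  obtain C where C: "0 < C" "\<And>\<delta> c j. 0 < \<delta> \<Longrightarrow> \<delta> \<le> \<delta>1 \<Longrightarrow> 0 \<le> j \<Longrightarrow> J \<delta> (U c) = ennreal j \<Longrightarrow>
     \<bar>f (KK \<delta> (U c))\<bar> \<le> C * (csum c powr p + j) powr (1 / p)" using functional_bound by blast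
  have sub: "d (s n) > 0" "d (s n) \<le> \<delta>1" "(\<lambda>n. d (s n)) \<longlonglongrightarrow> 0" if "strict_mono s" for s :: "nat \<Rightarrow> nat" and n
    using d LIMSEQ_subseq_LIMSEQ[OF d(2) that] by (auto simp: o_def)
  have csum_coord: "\<bar>a j\<bar> \<le> csum a" if "j \<in> I" for a j
    unfolding csum_def using that fin by (intro member_le_sum[of j I "\<lambda>j. \<bar>a j\<bar>"]) auto
  have zero: "sobolev_pair p \<Omega> (U (\<lambda>_. 0)) (Gr (\<lambda>_. 0))" "mean_zero \<Omega> (U (\<lambda>_. 0))" "J (d n) (U (\<lambda>_. 0)) = ennreal 0" for n
  proof -
    have z: "U (\<lambda>_. 0) = (\<lambda>x. 0 * U c x)" "Gr (\<lambda>_. 0) = (\<lambda>x. 0 *\<^sub>R Gr c x)" by (auto simp: U_def Gr_def)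
    show "sobolev_pair p \<Omega> (U (\<lambda>_. 0)) (Gr (\<lambda>_. 0))" unfolding z by (rule sobolev_pair_scale[OF c(1)])
    show "mean_zero \<Omega> (U (\<lambda>_. 0))" by (simp add: mean_zero_def U_def)
    show "J (d n) (U (\<lambda>_. 0)) = ennreal 0" by (simp add: J_def inner_energy_def U_def)
  qed
  \<comment> \<open>Comparison with the zero function.\<close>
  have jle: "jr n \<le> p * C * (csum (cs n) powr p + jr n) powr (1 / p)" for n
  proof -
    have "\<bar>f (KK (d n) (U (\<lambda>_. 0)))\<bar> \<le> C * (csum (\<lambda>_. 0) powr p + 0) powr (1 / p)" by (rule C(2)[OF d(1,3) order_refl zero(3)])
    then have f0: "f (KK (d n) (U (\<lambda>_. 0))) = 0" by (simp add: csum_def)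
    have "(1 / p) * jr n - f (KK (d n) (U (cs n))) \<le> 0"
      using min[OF zero(1,2) order_refl zero(3), of n] f0 by simp
    then have "(1 / p) * jr n \<le> C * (csum (cs n) powr p + jr n) powr (1 / p)"
      using C(2)[OF d(1,3) jr(1,2), of n] by linarith
    then show ?thesis using p0 by (simp add: field_simps)
  qed
  have "\<exists>S. \<forall>n. csum (cs n) \<le> S"
  proof (rule ccontr)
    assume "\<not> ?thesis"
    then have unb: "\<exists>n. r < csum (cs n)" for r by (meson not_le)
    have unb2: "\<exists>n>m. r < csum (cs n)" for m r
    proof -
      obtain n where n: "max r (Max ((\<lambda>n. csum (cs n)) ` {..m})) < csum (cs n)" using unb by blast
      have "\<not> n \<le> m"
      proof
        assume "n \<le> m"
        then have "csum (cs n) \<le> Max ((\<lambda>n. csum (cs n)) ` {..m})" by simp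
        moreover have "Max ((\<lambda>n. csum (cs n)) ` {..m}) < csum (cs n)" using n by (rule max.strict_boundedE)
        ultimately show False by linarith
      qed
      then show ?thesis using n by (intro exI[of _ n]) simp
    qed
    obtain s :: "nat \<Rightarrow> nat" where s: "\<And>n. s n < s (Suc n)" "\<And>n. real (Suc n) < csum (cs (s n))"
    proof -
      have "\<exists>s. \<forall>n. real (Suc n) < csum (cs (s n)) \<and> s n < s (Suc n)"
        by (rule dependent_nat_choice) (use unb unb2 in blast)+
      then show ?thesis using that by blast
    qed
    have sm: "strict_mono s" using s(1) by (simp add: strict_mono_Suc_iff)
    define Mn where "Mn n = csum (cs (s n))" for n
    have Mn: "real (Suc n) < Mn n" "0 < Mn n" for n
      using s(2)[of n] by (auto simp: Mn_def intro: less_trans[of 0 "real (Suc n)"])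
    \<comment> \<open>Coefficients scaled to sum 1. The energy scales with the power
      \<open>p\<close> and the load bound linearly, so after scaling the load carries the factor
      \<open>Mn n powr (1 - p)\<close>, which tends to 0 and drags the energy to 0.\<close>
    define vs where "vs n = (\<lambda>j. (1 / Mn n) * cs (s n) j)" for n
    have vsum: "csum (vs n) = 1" for n
    proof -
      have "csum (vs n) = \<bar>1 / Mn n\<bar> * csum (cs (s n))" unfolding vs_def by (rule csum_cmult)
      then show ?thesis using Mn(2)[of n] by (simp add: Mn_def)
    qed
    define jv where "jv n = jr (s n) / Mn n powr p" for n
    have jv0: "0 \<le> jv n" for n using jr(1) by (simp add: jv_def)
    have Jv: "J (d (s n)) (U (vs n)) = ennreal (jv n)" for n
    proof -
      have "J (d (s n)) (U (vs n)) = ennreal (\<bar>1 / Mn n\<bar> powr p) * ennreal (jr (s n))"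
        unfolding vs_def by (subst J_scale[OF d(1,3)]) (simp only: jr)
      also have "\<dots> = ennreal (\<bar>1 / Mn n\<bar> powr p * jr (s n))" using jr(1) by (simp add: ennreal_mult)
      also have "\<bar>1 / Mn n\<bar> powr p * jr (s n) = jv n" using Mn(2)[of n] by (simp add: jv_def powr_divide)
      finally show ?thesis .
    qed
    have jvle: "jv n \<le> (p * C) * Mn n powr (1 - p) * (1 + jv n)" for n
    proof -
      have M0: "0 < Mn n powr p" using Mn(2)[of n] by simp
      have "csum (cs (s n)) powr p + jr (s n) = Mn n powr p * (1 + jv n)"
        using M0 by (simp add: jv_def Mn_def[symmetric] distrib_left)
      then have "jr (s n) \<le> p * C * (Mn n powr p * (1 + jv n)) powr (1 / p)" using jle[of "s n"] by simp
      also have "(Mn n powr p * (1 + jv n)) powr (1 / p) = Mn n * (1 + jv n) powr (1 / p)"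
        using Mn(2)[of n] p0 by (simp add: powr_mult powr_powr)
      also have "(1 + jv n) powr (1 / p) \<le> (1 + jv n) powr 1" using jv0[of n] p by (intro powr_mono) auto
      finally have "jr (s n) \<le> p * C * (Mn n * (1 + jv n))"
        using jv0[of n] p0 C(1) Mn(2)[of n] by (simp add: mult_left_mono)
      then have "jv n \<le> p * C * (Mn n * (1 + jv n)) / Mn n powr p" unfolding jv_def by (intro divide_right_mono) auto
      also have "\<dots> = (p * C) * Mn n powr (1 - p) * (1 + jv n)" using Mn(2)[of n] by (simp add: powr_diff)
      finally show ?thesis .
    qed
    define th where "th n = (p * C) * real (Suc n) powr (1 - p)" for n
    have Mth: "(p * C) * Mn n powr (1 - p) \<le> th n" for n
      unfolding th_def using Mn[of n] p C(1) by (intro mult_left_mono powr_mono2') auto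
    have jv2: "jv n \<le> th n * (1 + jv n)" for n
      using jvle[of n] mult_right_mono[OF Mth[of n], of "1 + jv n"] jv0[of n] by linarith
    have th0: "th \<longlonglongrightarrow> 0"
    proof -
      have "((\<lambda>x. x powr (1 - p)) \<longlongrightarrow> 0) at_top" using p by (intro tendsto_neg_powr filterlim_ident) auto
      then have "(\<lambda>n. real (Suc n) powr (1 - p)) \<longlonglongrightarrow> 0"
        by (rule filterlim_compose) (rule filterlim_compose[OF filterlim_real_sequentially filterlim_Suc])
      from tendsto_mult_left[OF this, of "p * C"] show ?thesis by (simp add: th_def[abs_def])
    qed
    then have "\<forall>\<^sub>F n in sequentially. th n < 1 / 2" by (rule order_tendstoD) simp
    then obtain n0 where n0: "\<And>n. n \<ge> n0 \<Longrightarrow> th n < 1 / 2" by (auto simp: eventually_sequentially)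
    have jv1: "jv n \<le> 1" if "n \<ge> n0" for n
    proof -
      have "th n * (1 + jv n) \<le> 1 / 2 * (1 + jv n)" using n0[OF that] jv0[of n] by (intro mult_right_mono) auto
      then show ?thesis using jv2[of n] by (simp add: field_simps)
    qed
    have th_nn: "0 \<le> th n" for n using p0 C(1) by (simp add: th_def)
    have jv3: "jv n \<le> 2 * th n" if "n \<ge> n0" for n
    proof -
      have "th n * (1 + jv n) \<le> th n * 2" using jv1[OF that] th_nn[of n] by (intro mult_left_mono) auto
      then show ?thesis using jv2[of n] by linarith
    qed
    obtain s' c' where s': "strict_mono s'" "\<And>j. j \<in> I \<Longrightarrow> (\<lambda>n. vs (s' n) j) \<longlonglongrightarrow> c' j"
      using finite_convergent_subsequence[OF fin, of vs 1] csum_coord vsum by metis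
    define k where "k n = s' (n + n0)" for n
    have kge: "k n \<ge> n0" for n using seq_suble[OF s'(1), of "n + n0"] by (simp add: k_def)
    have cv: "conv (\<lambda>n. vs (k n)) c'"
      unfolding conv_def k_def using LIMSEQ_ignore_initial_segment[OF s'(2)] by blast
    have kmono: "strict_mono k" using s'(1) by (auto simp: k_def strict_mono_def)
    have dk: "\<And>n. 0 < d (s (k n))" "(\<lambda>n. d (s (k n))) \<longlonglongrightarrow> 0" "\<And>n. d (s (k n)) \<le> \<delta>1"
      using sub[OF strict_mono_o[OF sm kmono]] by (auto simp: o_def)
    have A: "J (d (s (k n))) (U (vs (k n))) \<le> ennreal 1" for n unfolding Jv using jv1[OF kge] by (intro ennreal_leI)
    have pairc: "sobolev_pair p \<Omega> (U c') (Gr c')" by (rule limit_pair_and_functional(1)[OF cv dk zero_le_one A])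
    have "ennreal (\<integral>x. norm (Gr c' x) powr p \<partial>?M) \<le> liminf (\<lambda>n. J (d (s (k n))) (U (vs (k n))))" by (rule J_liminf[OF cv dk])
    also have "\<dots> = 0"
    proof -
      have jv_lim: "(\<lambda>n. jv (k n)) \<longlonglongrightarrow> 0"
      proof (rule tendsto_sandwich[of "\<lambda>_. 0" _ _ "\<lambda>n. 2 * th (k n)"])
        show "(\<lambda>n. 2 * th (k n)) \<longlonglongrightarrow> 0"
          using tendsto_mult_left[OF LIMSEQ_subseq_LIMSEQ[OF th0 kmono], of 2] by (simp add: o_def)
      qed (use jv0 jv3[OF kge] in auto)
      then have "(\<lambda>n. J (d (s (k n))) (U (vs (k n)))) \<longlonglongrightarrow> ennreal 0" unfolding Jv by (rule tendsto_ennrealI)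
      then show ?thesis using lim_imp_Liminf[OF sequentially_bot] by fastforce
    qed
    finally have "ennreal (\<integral>x. norm (Gr c' x) powr p \<partial>?M) \<le> 0" .
    moreover have nn: "0 \<le> (\<integral>x. norm (Gr c' x) powr p \<partial>?M)" by (intro integral_nonneg_AE) simp
    ultimately have i0: "(\<integral>x. norm (Gr c' x) powr p \<partial>?M) = 0" by (simp add: ennreal_eq_0_iff)
    have "integrable ?M (\<lambda>x. norm (Gr c' x) powr p)" using Gr_Lp[of c'] by (simp add: Lp_on_def)
    from integral_nonneg_eq_0_iff_AE[OF this] i0 have "AE x in ?M. norm (Gr c' x) powr p = 0" by simp
    then have G0: "AE x in ?M. Gr c' x = 0" by eventually_elim simp
    have mzv: "mean_zero \<Omega> (U (vs n))" for n
      using mz[of "s n"] unfolding mean_zero_def vs_def U_scale by simp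
    have "AE x in ?M. U c' x = 0"
      using pairc by (intro U_eq_0_if_grad_0[OF _ G0] mean_zero_limit[OF cv mzv]) (simp add: sobolev_pair_def)
    from indep[OF this] have "csum c' = 0" by (simp add: csum_def)
    moreover have "(\<lambda>n. csum (vs (k n))) \<longlonglongrightarrow> csum c'" by (rule conv_csum[OF cv])
    ultimately show False unfolding vsum by (simp add: LIMSEQ_const_iff)
  qed
  then obtain S0 where S0: "\<And>n. csum (cs n) \<le> S0" by blast
  define S where "S = max S0 0"
  have S: "\<And>n. csum (cs n) \<le> S" "0 \<le> S" using S0 by (auto simp: S_def le_max_iff_disj)
  obtain A where A: "0 \<le> A" "\<And>n. jr n \<le> A"
  proof -
    \<comment> \<open>Chosen so that \<open>(p * C) * a powr (1 - p) = 1 / 2\<close>: half of the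
      energy on the right of \<open>jle\<close> is then absorbed on the left.\<close>
    define a where "a = (2 * (p * C)) powr (1 / (p - 1))"
    have a: "0 < a" using p0 C(1) by (simp add: a_def)
    have ap: "(p * C) * a powr (1 - p) = 1 / 2"
    proof -
      have "a powr (1 - p) = (2 * (p * C)) powr ((1 / (p - 1)) * (1 - p))" unfolding a_def by (rule powr_powr)
      also have "(1 / (p - 1)) * (1 - p) = - 1" using p by (simp add: field_simps)
      also have "(2 * (p * C)) powr (- 1) = 1 / (2 * (p * C))" using p0 C(1) by (simp add: powr_minus_divide)
      finally show ?thesis using p0 C(1) by simp
    qed
    have "jr n \<le> S powr p + 2 * (p * C * a)" for n
    proof -
      define Y where "Y = S powr p + jr n"
      have Y0: "0 \<le> Y" using jr(1)[of n] by (simp add: Y_def)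
      have "csum (cs n) powr p \<le> S powr p" using S csum_nonneg p0 by (intro powr_mono2) auto
      then have "(csum (cs n) powr p + jr n) powr (1 / p) \<le> Y powr (1 / p)"
        using jr(1)[of n] p0 unfolding Y_def by (intro powr_mono2) auto
      also have "Y powr (1 / p) \<le> a + a powr (1 - p) * Y"
      proof (cases "Y powr (1 / p) \<le> a")
        case True
        then show ?thesis using Y0 by (simp add: add_increasing2)
      next
        case False
        define t where "t = Y powr (1 / p)"
        have "a < t" using False by (simp only: t_def not_le)
        with a have t: "a < t" "0 < t" by linarith+
        have tp: "t powr p = Y" using Y0 p0 by (simp add: t_def powr_powr)
        have "t powr (1 - p) \<le> a powr (1 - p)" using t a p by (intro powr_mono2') auto
        then have "t powr (1 - p) * t powr p \<le> a powr (1 - p) * Y" unfolding tp using Y0 by (intro mult_right_mono) auto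
        moreover have "t powr (1 - p) * t powr p = t" using t by (simp add: powr_add[symmetric])
        ultimately show ?thesis using a unfolding t_def[symmetric] by linarith
      qed
      finally have "(p * C) * (csum (cs n) powr p + jr n) powr (1 / p) \<le> (p * C) * (a + a powr (1 - p) * Y)"
        using p0 C(1) by (intro mult_left_mono) auto
      also have "\<dots> = p * C * a + ((p * C) * a powr (1 - p)) * Y" by (simp only: distrib_left mult.assoc)
      finally have "jr n \<le> p * C * a + 1 / 2 * Y" using jle[of n] unfolding ap by linarith
      then show ?thesis unfolding Y_def by (simp add: field_simps)
    qed
    moreover have "0 \<le> S powr p + 2 * (p * C * a)" using a p0 C(1) by simp
    ultimately show ?thesis using that by blast
  qed
  obtain s c' where s: "strict_mono s" "\<And>j. j \<in> I \<Longrightarrow> (\<lambda>n. cs (s n) j) \<longlonglongrightarrow> c' j"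
    using finite_convergent_subsequence[OF fin, of cs S] order_trans[OF csum_coord S(1)] by metis
  have cv: "conv (\<lambda>n. cs (s n)) c'" using s(2) by (simp add: conv_def)
  note ds = sub(1)[OF s(1)] sub(3)[OF s(1)] sub(2)[OF s(1)]
  have JA: "J (d (s n)) (U (cs (s n))) \<le> ennreal A" for n unfolding jr by (intro ennreal_leI A)
  have pairc: "sobolev_pair p \<Omega> (U c') (Gr c')" and fl: "(\<lambda>n. f (KK (d (s n)) (U (cs (s n))))) \<longlonglongrightarrow> f (U c')"
    using limit_pair_and_functional[OF cv ds A(1) JA] by auto
  have mzc: "mean_zero \<Omega> (U c')" by (rule mean_zero_limit[OF cv mz])
  define B1 where "B1 = \<bar>csum c * Bb\<bar> powr p * Cbar DIM('a) p * measure lebesgue \<Omega>"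
  have B1: "0 \<le> B1" using Cbar_pos[OF p0, of "DIM('a)"] by (simp add: B1_def)
  have JB: "J (d (s n)) (U c) \<le> ennreal B1" for n using J_tendsto(2)[OF c(1) ds] by (simp add: B1_def)
  define jc where "jc n = enn2real (J (d (s n)) (U c))" for n
  have jc: "0 \<le> jc n" "J (d (s n)) (U c) = ennreal (jc n)" for n
  proof -
    have "J (d (s n)) (U c) < top" using JB[of n] by (rule le_less_trans) simp
    then show "0 \<le> jc n" "J (d (s n)) (U c) = ennreal (jc n)" by (simp_all add: jc_def)
  qed
  have nnI: "0 \<le> (\<integral>x. norm (Gr a x) powr p \<partial>?M)" for a by (intro integral_nonneg_AE) simp
  have jcl: "jc \<longlonglongrightarrow> (\<integral>x. norm (Gr c x) powr p \<partial>?M)"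
    by (rule tendsto_ennrealD[OF J_tendsto(1)[OF c(1) ds, unfolded jc(2)]]) (use nnI jc(1) in auto)
  have cvc: "conv (\<lambda>_. c) c" by (simp add: conv_def)
  have fc: "(\<lambda>n. f (KK (d (s n)) (U c))) \<longlonglongrightarrow> f (U c)"
    by (rule limit_pair_and_functional(2)[OF cvc ds B1 JB])
  have upper: "(\<lambda>n. (1 / p) * jc n - f (KK (d (s n)) (U c)) + f (KK (d (s n)) (U (cs (s n))))) \<longlonglongrightarrow>
      (1 / p) * (\<integral>x. norm (Gr c x) powr p \<partial>?M) - f (U c) + f (U c')"
    by (intro tendsto_intros jcl fc fl)
  \<comment> \<open>For the energies of the minimizers only a bound from below in the limit is
    known, whereas the load terms and the energies of the fixed competitor \<open>c\<close>
    converge; the two are combined up to an arbitrary \<open>e\<close>.\<close>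
  have "(1 / p) * (\<integral>x. norm (Gr c' x) powr p \<partial>?M) \<le> (1 / p) * (\<integral>x. norm (Gr c x) powr p \<partial>?M) - f (U c) + f (U c')"
  proof (rule field_le_epsilon)
    fix e :: real assume e: "0 < e"
    let ?Ic = "\<integral>x. norm (Gr c' x) powr p \<partial>?M"
    let ?r = "(1 / p) * (\<integral>x. norm (Gr c x) powr p \<partial>?M) - f (U c) + f (U c')"
    have "\<forall>\<^sub>F n in sequentially. (1 / p) * ?Ic - e / 2 \<le> (1 / p) * jr (s n)"
    proof (cases "(1 / p) * ?Ic - e / 2 < 0")
      case True
      have "0 \<le> (1 / p) * jr (s n)" for n using jr(1) p0 by simp
      then have "(1 / p) * ?Ic - e / 2 \<le> (1 / p) * jr (s n)" for n using True by (meson less_imp_le order_trans)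
      then show ?thesis by simp
    next
      case False
      define x where "x = ?Ic - p * (e / 2)"
      have x: "0 \<le> x" "x < ?Ic" using False p0 e by (auto simp: x_def field_simps)
      have "ennreal x < ennreal ?Ic" using x by (simp add: ennreal_less_iff)
      also have "\<dots> \<le> liminf (\<lambda>n. J (d (s n)) (U (cs (s n))))" by (rule J_liminf[OF cv ds])
      finally have "\<forall>\<^sub>F n in sequentially. ennreal x < J (d (s n)) (U (cs (s n)))" by (rule less_LiminfD)
      then show ?thesis
      proof eventually_elim
        case (elim n)
        then have "x < jr (s n)" using x jr(1) unfolding jr by (simp add: ennreal_less_iff)
        then have "(1 / p) * x \<le> (1 / p) * jr (s n)" using p0 by (intro mult_left_mono) auto
        moreover have "(1 / p) * x = (1 / p) * ?Ic - e / 2" using p0 by (simp add: x_def right_diff_distrib)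
        ultimately show ?case by linarith
      qed
    qed
    moreover have "\<forall>\<^sub>F n in sequentially. (1 / p) * jc n - f (KK (d (s n)) (U c)) + f (KK (d (s n)) (U (cs (s n)))) < ?r + e / 2"
      using upper by (rule order_tendstoD) (use e in simp)
    ultimately have "\<forall>\<^sub>F n in sequentially. (1 / p) * ?Ic \<le> ?r + e"
    proof eventually_elim
      case (elim n)
      have "(1 / p) * jr (s n) - f (KK (d (s n)) (U (cs (s n)))) \<le> (1 / p) * jc n - f (KK (d (s n)) (U c))"
        by (rule min[OF c jc])
      then show ?case using elim by linarith
    qed
    then show "(1 / p) * ?Ic \<le> ?r + e" by simp
  qed
  then have le: "(1 / p) * (\<integral>x. norm (Gr c' x) powr p \<partial>?M) - f (U c') \<le> (1 / p) * (\<integral>x. norm (Gr c x) powr p \<partial>?M) - f (U c)" by simp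
  have "AE x in ?M. U (\<lambda>j. c' j - c j) x = 0"
    by (rule minimizer_unique[OF pairc mzc c cmin le])
  from indep[OF this] have "c' j = c j" if "j \<in> I" for j using that by simp
  then have "conv (\<lambda>n. cs (s n)) c" using cv by (simp add: conv_def)
  then show ?thesis using that[OF s(1)] by blast
qed

end

section \<open>Admissible competitors and the concrete functionals\<close>

lemma nn_integral_ball_powr_scale:
  fixes x :: "'a::euclidean_space"
  assumes R: "0 < R"
  shows "(\<integral>\<^sup>+y. ennreal (indicator (ball x R) y * (dist x y powr a * R powr - (real DIM('a) + a))) \<partial>lborel)
    = (\<integral>\<^sup>+(z::'a). ennreal (indicator (ball 0 1) z * norm z powr a) \<partial>lborel)"
proof -
  let ?h = "\<lambda>y. ennreal (indicator (ball x R) y * (dist x y powr a * R powr - (real DIM('a) + a)))"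
  have m: "?h \<in> borel_measurable borel"
    by (intro measurable_compose[OF _ measurable_ennreal] borel_measurable_times borel_measurable_indicator) auto
  have "(\<integral>\<^sup>+y. ?h y \<partial>lborel) = ennreal (\<bar>R\<bar> ^ DIM('a)) * (\<integral>\<^sup>+z. ?h (x + R *\<^sub>R z) \<partial>lborel)"
    using R m by (intro nn_integral_lborel_affine) auto
  also have "\<dots> = (\<integral>\<^sup>+z. ennreal (\<bar>R\<bar> ^ DIM('a)) * ?h (x + R *\<^sub>R z) \<partial>lborel)"
    by (rule nn_integral_cmult[symmetric]) (rule measurable_compose[OF _ m], simp)
  also have "\<dots> = (\<integral>\<^sup>+(z::'a). ennreal (indicator (ball 0 1) z * norm z powr a) \<partial>lborel)"
  proof (rule nn_integral_cong)
    fix z :: 'a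
    have i: "indicator (ball x R) (x + R *\<^sub>R z) = (indicator (ball 0 1) z :: real)"
      using R by (auto simp: indicator_def dist_norm)
    have "R ^ DIM('a) * ((R * norm z) powr a * R powr - (real DIM('a) + a))
        = norm z powr a * (R powr real DIM('a) * R powr a * R powr - (real DIM('a) + a))"
      using R by (simp add: powr_mult powr_realpow mult_ac)
    also have "R powr real DIM('a) * R powr a * R powr - (real DIM('a) + a) = 1"
      using R by (simp add: powr_add[symmetric])
    finally have "R ^ DIM('a) * (indicator (ball 0 1) z * ((R * norm z) powr a * R powr - (real DIM('a) + a))) = indicator (ball 0 1) z * norm z powr a"
      by (simp only: mult.left_commute[of "R ^ DIM('a)"] mult_1_right)
    moreover have "dist x (x + R *\<^sub>R z) = R * norm z" using R by (simp add: dist_norm)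
    ultimately show "ennreal (\<bar>R\<bar> ^ DIM('a)) * ?h (x + R *\<^sub>R z) = ennreal (indicator (ball 0 1) z * norm z powr a)"
      using R unfolding i by (simp add: ennreal_mult'[symmetric])
  qed
  finally show ?thesis .
qed

context piecewise_setting begin

text \<open>The exponent may be negative. Near the origin \<rho> is bounded below, so finiteness
  follows from its normalisation; away from the origin the power is bounded.\<close>

lemma unit_ball_powr_finite: "(\<integral>\<^sup>+(z::'a). ennreal (indicator (ball 0 1) z * norm z powr (p - \<beta>)) \<partial>lborel) < \<infinity>"
proof -
  define K where "K = 1 + c\<^sub>\<rho> powr (p - \<beta>)"
  have K0: "0 \<le> K" by (simp add: K_def)
  have "(\<integral>\<^sup>+(z::'a). ennreal (indicator (ball 0 1) z * norm z powr (p - \<beta>)) \<partial>lborel)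
    \<le> (\<integral>\<^sup>+(z::'a). ennreal (1 / C\<^sub>\<rho>) * ennreal (norm z powr (p - \<beta>) * \<rho> (norm z)) + ennreal K * indicator (ball 0 1) z \<partial>lborel)"
  proof (rule nn_integral_mono)
    fix z :: 'a
    let ?r = "norm z powr (p - \<beta>)"
    have "indicator (ball 0 1) z * ?r \<le> 1 / C\<^sub>\<rho> * (?r * \<rho> (norm z)) + K * indicator (ball 0 1) z"
    proof (cases "norm z \<le> c\<^sub>\<rho>")
      case True
      have "?r * C\<^sub>\<rho> \<le> ?r * \<rho> (norm z)" using True rho_pos(4)[of "norm z"] by (intro mult_left_mono) auto
      then have "?r \<le> 1 / C\<^sub>\<rho> * (?r * \<rho> (norm z))" using rho_pos(1) by (simp add: pos_le_divide_eq)
      moreover have "z \<in> ball 0 1" using True rho_pos by simp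
      ultimately show ?thesis using K0 by simp
    next
      case False
      have nn: "0 \<le> 1 / C\<^sub>\<rho> * (?r * \<rho> (norm z))" using rho_pos(1) rho_nonneg by simp
      show ?thesis
      proof (cases "norm z < 1")
        case True
        have "?r \<le> K"
        proof (cases "0 \<le> p - \<beta>")
          case t: True
          have "?r \<le> 1 powr (p - \<beta>)" using True t by (intro powr_mono2) auto
          then show ?thesis unfolding K_def by (simp add: add_increasing2)
        next
          case f: False
          have "?r \<le> c\<^sub>\<rho> powr (p - \<beta>)" using False f rho_pos by (intro powr_mono2') auto
          then show ?thesis unfolding K_def by simp
        qed
        then show ?thesis using nn True by simp
      next
        case False
        then show ?thesis using nn by simp
      qed
    qed
    then have "ennreal (indicator (ball 0 1) z * ?r) \<le> ennreal (1 / C\<^sub>\<rho> * (?r * \<rho> (norm z)) + K * indicator (ball 0 1) z)" by (rule ennreal_leI)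
    also have "\<dots> = ennreal (1 / C\<^sub>\<rho>) * ennreal (?r * \<rho> (norm z)) + ennreal K * indicator (ball 0 1) z"
    proof -
      have "0 \<le> ?r * \<rho> (norm z)" "0 \<le> 1 / C\<^sub>\<rho>" using rho_nonneg[of "norm z"] rho_pos(1) by auto
      then show ?thesis using K0 by (simp only: ennreal_plus ennreal_mult mult_nonneg_nonneg indicator_pos_le) (simp add: ennreal_indicator)
    qed
    finally show "ennreal (indicator (ball 0 1) z * ?r) \<le> ennreal (1 / C\<^sub>\<rho>) * ennreal (?r * \<rho> (norm z)) + ennreal K * indicator (ball 0 1) z" .
  qed
  also have "\<dots> = ennreal (1 / C\<^sub>\<rho>) * ennreal (Cbar DIM('a) p) + ennreal K * emeasure lborel (ball (0::'a) 1)"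
    by (subst nn_integral_add) (auto simp: nn_integral_cmult rho_norm nn_integral_cmult_indicator intro!: borel_measurable_times_ennreal borel_measurable_indicator)
  also have "\<dots> < \<infinity>" using emeasure_lborel_ball_finite[of "0::'a" 1] by (simp add: ennreal_mult_less_top)
  finally show ?thesis .
qed

text \<open>A competitor must lie in the nonlocal space, whose kernel is built from the distance to
  the boundary itself instead of \<lambda>. Its balls also stay in \<Omega>, as \<delta> is at most
  1 and \<open>qfun r \<le> r\<close>, so the Lipschitz bound on segments applies again.\<close>

lemma seminorm_p_U_finite:
  assumes pair: "sobolev_pair p \<Omega> (U c) (Gr c)" and d: "0 < \<delta>" "\<delta> \<le> 1"
  shows "seminorm_p \<Omega> \<beta> p \<delta> (U c) < \<infinity>"
proof -
  let ?L = "\<bar>csum c * Bb\<bar>" and ?M = "Leb" and ?d = "real DIM('a)"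
  let ?C = "\<bar>Cgamma TYPE('a) \<beta> p\<bar> * ?L powr p"
  define V where "V = (\<integral>\<^sup>+(z::'a). ennreal (indicator (ball 0 1) z * norm z powr (p - \<beta>)) \<partial>lborel)"
  have V: "V < \<infinity>" unfolding V_def by (rule unit_ball_powr_finite)
  have wg: "is_weak_grad \<Omega> (U c) (Gr c)" using pair by (simp add: sobolev_pair_def)
  have GL: "AE x in ?M. norm (Gr c x) \<le> ?L" using Gr_bound[of c] by (intro AE_I2) (rule order_trans, assumption, simp)
  have le: "(\<integral>\<^sup>+y. ennreal (gamma_kernel \<Omega> \<beta> p \<delta> x y * \<bar>U c y - U c x\<bar> powr p) \<partial>?M) \<le> ennreal ?C * V" if x: "x \<in> D" for x
  proof -
    have xo: "x \<in> \<Omega>" using x D(2) by blast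
    define R where "R = \<delta> * qfun (dist_bd \<Omega> x)"
    have db: "0 < dist_bd \<Omega> x" by (rule dist_bd_pos[OF open_dom bounded_dom xo])
    have R: "0 < R" unfolding R_def using d(1) qfun_pos[OF db] by simp
    have "R \<le> 1 * dist_bd \<Omega> x" unfolding R_def using d qfun_le[of "dist_bd \<Omega> x"] qfun_pos[OF db] db by (intro mult_mono) auto
    then have ball: "ball x R \<subseteq> \<Omega>" using ball_dist_bd_subset[OF xo] by auto
    let ?h = "\<lambda>y. indicator (ball x R) y * (dist x y powr (p - \<beta>) * R powr - (?d + (p - \<beta>)))"
    have "(\<integral>\<^sup>+y. ennreal (gamma_kernel \<Omega> \<beta> p \<delta> x y * \<bar>U c y - U c x\<bar> powr p) \<partial>?M)
       = (\<integral>\<^sup>+y. ennreal (gamma_kernel \<Omega> \<beta> p \<delta> x y * \<bar>U c y - U c x\<bar> powr p) * indicator \<Omega> y \<partial>lborel)"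
      by (rule nn_integral_lebesgue_on) (use open_dom in simp)
    also have "\<dots> \<le> (\<integral>\<^sup>+y. ennreal ?C * ennreal (?h y) \<partial>lborel)"
    proof (rule nn_integral_mono_AE)
      show "AE y in lborel. ennreal (gamma_kernel \<Omega> \<beta> p \<delta> x y * \<bar>U c y - U c x\<bar> powr p) * indicator \<Omega> y \<le> ennreal ?C * ennreal (?h y)"
        using AE_lborel_D
      proof eventually_elim
        case (elim y)
        show ?case
        proof (cases "dist y x < R")
          case False
          then have "gamma_kernel \<Omega> \<beta> p \<delta> x y = 0" by (simp add: gamma_kernel_def R_def)
          then show ?thesis by simp
        next
          case True
          then have yb: "y \<in> ball x R" by (simp add: dist_commute)
          then have yo: "y \<in> \<Omega>" using ball by blast
          then have yD: "y \<in> D" using elim by blast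
          have "closed_segment x y \<subseteq> ball x R" using yb R by (intro closed_segment_subset) auto
          then have "closed_segment x y \<subseteq> \<Omega>" using ball by blast
          then have "\<bar>U c y - U c x\<bar> \<le> ?L * norm (y - x)" using U_lipschitz[OF wg GL _ x yD] by simp
          then have "\<bar>U c y - U c x\<bar> powr p \<le> (?L * dist x y) powr p"
            using p0 by (intro powr_mono2) (auto simp: dist_norm norm_minus_commute)
          also have "\<dots> = ?L powr p * dist x y powr p" by (simp only: powr_mult)
          finally have *: "\<bar>U c y - U c x\<bar> powr p \<le> ?L powr p * dist x y powr p" .
          have "gamma_kernel \<Omega> \<beta> p \<delta> x y = Cgamma TYPE('a) \<beta> p * (dist x y powr (- \<beta>) * R powr - (?d + p - \<beta>))"
            using True by (simp add: gamma_kernel_def R_def)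
          also have "\<dots> \<le> \<bar>Cgamma TYPE('a) \<beta> p\<bar> * (dist x y powr (- \<beta>) * R powr - (?d + p - \<beta>))"
            by (intro mult_right_mono) auto
          finally have "gamma_kernel \<Omega> \<beta> p \<delta> x y * \<bar>U c y - U c x\<bar> powr p
             \<le> (\<bar>Cgamma TYPE('a) \<beta> p\<bar> * (dist x y powr (- \<beta>) * R powr - (?d + p - \<beta>))) * (?L powr p * dist x y powr p)"
            using * by (intro mult_mono) auto
          also have "\<dots> = ?C * ((dist x y powr (- \<beta>) * dist x y powr p) * R powr - (?d + p - \<beta>))" by (simp only: mult_ac)
          also have "dist x y powr (- \<beta>) * dist x y powr p = dist x y powr (p - \<beta>)" by (simp add: powr_add[symmetric])
          also have "?d + p - \<beta> = ?d + (p - \<beta>)" by simp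
          also have "?C * (dist x y powr (p - \<beta>) * R powr - (?d + (p - \<beta>))) = ?C * ?h y" using yb by simp
          finally have "ennreal (gamma_kernel \<Omega> \<beta> p \<delta> x y * \<bar>U c y - U c x\<bar> powr p) \<le> ennreal (?C * ?h y)" by (rule ennreal_leI)
          also have "\<dots> = ennreal ?C * ennreal (?h y)" by (rule ennreal_mult) auto
          finally show ?thesis using yo by simp
        qed
      qed
    qed
    also have "\<dots> = ennreal ?C * (\<integral>\<^sup>+y. ennreal (?h y) \<partial>lborel)"
      by (intro nn_integral_cmult measurable_compose[OF _ measurable_ennreal] borel_measurable_times borel_measurable_indicator) auto
    also have "(\<integral>\<^sup>+y. ennreal (?h y) \<partial>lborel) = V" unfolding V_def by (rule nn_integral_ball_powr_scale[OF R])
    finally show ?thesis .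
  qed
  interpret F: finite_measure ?M by (rule finite_measure_dom)
  define E where "E = emeasure ?M (space ?M)"
  have E: "E < top" unfolding E_def using F.emeasure_finite[of "space ?M"] by (simp only: less_top)
  have "seminorm_p \<Omega> \<beta> p \<delta> (U c) \<le> (\<integral>\<^sup>+x. ennreal ?C * V \<partial>?M)"
    unfolding seminorm_p_def
  proof (rule nn_integral_mono_AE)
    show "AE x in ?M. (\<integral>\<^sup>+y. ennreal (gamma_kernel \<Omega> \<beta> p \<delta> x y * \<bar>U c y - U c x\<bar> powr p) \<partial>?M) \<le> ennreal ?C * V"
      using AE_dom_D by eventually_elim (rule le)
  qed
  also have "\<dots> = (ennreal ?C * V) * E" unfolding E_def by (rule nn_integral_const)
  also have "\<dots> < \<infinity>" using V E by (simp add: ennreal_mult_less_top)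
  finally show ?thesis .
qed

lemma energy_eq_J:
  assumes eta: "\<forall>x\<in>\<Omega>. eta lam \<delta> x = \<eta> \<delta> x" and ae: "AE x in Leb. u x = U c x"
  shows "(\<integral>\<^sup>+x. (\<integral>\<^sup>+y. ennreal (\<rho> (dist y x / eta lam \<delta> x)
               / (eta lam \<delta> x powr (real DIM('a) + p - \<beta>) * dist x y powr \<beta>)
               * \<bar>u x - u y\<bar> powr p) \<partial>Leb) \<partial>Leb) = J \<delta> (U c)"
  unfolding J_def inner_energy_def
proof (rule nn_integral_cong_AE)
  show "AE x in Leb. (\<integral>\<^sup>+y. ennreal (\<rho> (dist y x / eta lam \<delta> x)
               / (eta lam \<delta> x powr (real DIM('a) + p - \<beta>) * dist x y powr \<beta>) * \<bar>u x - u y\<bar> powr p) \<partial>Leb)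
      = (\<integral>\<^sup>+y. ennreal (\<rho> (dist y x / \<eta> \<delta> x)
               / (\<eta> \<delta> x powr (real DIM('a) + p - \<beta>) * dist x y powr \<beta>) * \<bar>U c x - U c y\<bar> powr p) \<partial>Leb)"
    using ae AE_space
  proof eventually_elim
    case (elim x)
    then have e: "eta lam \<delta> x = \<eta> \<delta> x" using eta by simp
    show ?case unfolding e elim(1)
      by (rule nn_integral_cong_AE) (use ae in \<open>eventually_elim, simp\<close>)
  qed
qed

lemma KK_W1p:
  assumes d: "0 < \<delta>" "\<delta> \<le> \<delta>1" and j: "0 \<le> j" "J \<delta> (U c) = ennreal j"
  shows "sobolev_pair p \<Omega> (KK \<delta> (U c)) (GK \<delta> (U c))"
proof -
  obtain C where C: "0 \<le> C" "\<And>\<delta> u Cu. 0 < \<delta> \<Longrightarrow> \<delta> \<le> \<delta>1 \<Longrightarrow> u \<in> borel_measurable borel \<Longrightarrow> (\<And>y. \<bar>u y\<bar> \<le> Cu) \<Longrightarrow>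
     (\<integral>\<^sup>+x. ennreal (norm (GK \<delta> u x) powr p) \<partial>Leb) \<le> ennreal C * J \<delta> u" using GK_energy_bound by blast
  have "(\<integral>\<^sup>+x. ennreal (norm (GK \<delta> (U c) x) powr p) \<partial>Leb) \<le> ennreal (C * j)"
    using C(2)[OF d U_meas U_bound, of c] j C(1) by (simp add: ennreal_mult)
  then show ?thesis using C(1) j(1) by (intro KK_sobolev_pair[OF d, of "C * j"]) auto
qed

lemma sobolev_pair_cong_AE:
  assumes "AE x in Leb. u x = v x" "v \<in> borel_measurable Leb" "sobolev_pair p \<Omega> u G"
  shows "sobolev_pair p \<Omega> v G"
  using Lp_on_cong_AE[OF assms(1,2)] is_weak_grad_cong_AE[OF assms(1) _ assms(2)] sobolev_pair_measurable(1)[OF assms(3)] assms(3)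
  by (auto simp: sobolev_pair_def)

lemma Kop_eq_KK:
  assumes d: "0 < \<delta>" "\<delta> \<le> \<delta>1" and eta: "\<forall>x\<in>\<Omega>. eta lam \<delta> x = \<eta> \<delta> x"
    and um[measurable]: "u \<in> borel_measurable Leb"
    and ae: "AE x in Leb. u x = U c x" and x: "x \<in> \<Omega>"
  shows "Kop \<Omega> lam \<psi> \<delta> u x = KK \<delta> (U c) x"
proof -
  interpret K: collar_kernel_lip \<Omega> "\<eta> \<delta>" "\<eta>' \<delta>" \<psi> \<psi>' B by (rule collar[OF d])
  have [measurable]: "(\<lambda>y. K.ker x y) \<in> borel_measurable Leb" "U c \<in> borel_measurable Leb"
    by (intro borel_measurable_lebesgue_on_borel, measurable)+
  have "Kop \<Omega> lam \<psi> \<delta> u x = (\<integral>y. K.ker x y * u y \<partial>Leb)"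
    unfolding Kop_def bspec[OF eta x] K.ker_def dist_norm ..
  also have "\<dots> = (\<integral>y. K.ker x y * U c y \<partial>Leb)"
  proof (rule integral_cong_AE)
    show "AE y in Leb. K.ker x y * u y = K.ker x y * U c y" using ae by eventually_elim simp
  qed measurable
  also have "\<dots> = (\<integral>y. indicator \<Omega> y * (K.ker x y * U c y) \<partial>lborel)"
    by (rule integral_lebesgue_on_borel) measurable
  finally show ?thesis by (simp only: K.Kc_def)
qed

text \<open>\<open>Kop\<close> and \<open>KK\<close> agree on \<Omega> but may differ as functions
  on the whole space, so the values of \<open>f\<close> are compared through
  \<open>W1p_dual_cong_AE\<close>.\<close>

lemma f_Kop_eq:
  assumes d: "0 < \<delta>" "\<delta> \<le> \<delta>1" and eta: "\<forall>x\<in>\<Omega>. eta lam \<delta> x = \<eta> \<delta> x"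
    and um: "u \<in> borel_measurable Leb"
    and ae: "AE x in Leb. u x = U c x" and j: "0 \<le> j" "J \<delta> (U c) = ennreal j"
  shows "f (Kop \<Omega> lam \<psi> \<delta> u) = f (KK \<delta> (U c))"
proof -
  interpret K: collar_kernel_lip \<Omega> "\<eta> \<delta>" "\<eta>' \<delta>" \<psi> \<psi>' B by (rule collar[OF d])
  have eq: "Kop \<Omega> lam \<psi> \<delta> u x = KK \<delta> (U c) x" if "x \<in> \<Omega>" for x by (rule Kop_eq_KK[OF d eta um ae that])
  have pair: "sobolev_pair p \<Omega> (KK \<delta> (U c)) (GK \<delta> (U c))" by (rule KK_W1p[OF d j])
  have aeq: "AE x in Leb. KK \<delta> (U c) x = Kop \<Omega> lam \<psi> \<delta> u x" using eq by (intro AE_I2) simp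
  have "Kop \<Omega> lam \<psi> \<delta> u \<in> borel_measurable Leb \<longleftrightarrow> KK \<delta> (U c) \<in> borel_measurable Leb"
    by (rule measurable_cong) (simp add: eq)
  then have "Kop \<Omega> lam \<psi> \<delta> u \<in> borel_measurable Leb" using sobolev_pair_measurable(1)[OF pair] by blast
  from sobolev_pair_cong_AE[OF aeq this pair] pair have "W1p p \<Omega> (Kop \<Omega> lam \<psi> \<delta> u)" "W1p p \<Omega> (KK \<delta> (U c))"
    by (auto simp: W1p_iff_sobolev_pair)
  from W1p_dual_cong_AE[OF f_dual open_dom lmeas_dom p1 this(2,1) aeq] show ?thesis by simp
qed

lemma E_nl_eq:
  assumes d: "0 < \<delta>" "\<delta> \<le> \<delta>1" and eta: "\<forall>x\<in>\<Omega>. eta lam \<delta> x = \<eta> \<delta> x"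
    and um: "u \<in> borel_measurable Leb"
    and ae: "AE x in Leb. u x = U c x" and j: "0 \<le> j" "J \<delta> (U c) = ennreal j"
  shows "E_nl \<Omega> \<beta> p lam \<rho> \<psi> f \<delta> u = ereal ((1 / p) * j - f (KK \<delta> (U c)))"
proof -
  have "E_nl \<Omega> \<beta> p lam \<rho> \<psi> f \<delta> u = ereal (1 / p) * enn2ereal (J \<delta> (U c)) - ereal (f (KK \<delta> (U c)))"
    unfolding E_nl_def energy_eq_J[OF eta ae] f_Kop_eq[OF d eta um ae j] ..
  then show ?thesis using j(1) unfolding j(2) by (simp add: enn2ereal_ennreal)
qed

text \<open>An infinite energy cannot be compensated, because the load term is a real
  number.\<close>

lemma E_nl_less_top_imp_J_finite:
  assumes eta: "\<forall>x\<in>\<Omega>. eta lam \<delta> x = \<eta> \<delta> x"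
    and ae: "AE x in Leb. u x = U c x" and fin: "E_nl \<Omega> \<beta> p lam \<rho> \<psi> f \<delta> u < \<infinity>"
  obtains j where "0 \<le> j" "J \<delta> (U c) = ennreal j"
proof -
  have "E_nl \<Omega> \<beta> p lam \<rho> \<psi> f \<delta> u = ereal (1 / p) * enn2ereal (J \<delta> (U c)) - ereal (f (Kop \<Omega> lam \<psi> \<delta> u))"
    unfolding E_nl_def energy_eq_J[OF eta ae] ..
  then have "J \<delta> (U c) \<noteq> top" using fin p0 by auto
  then show ?thesis using that[of "enn2real (J \<delta> (U c))"] by (simp add: less_top)
qed

lemma E_loc_eq:
  assumes W: "W1p p \<Omega> u" and ae: "AE x in Leb. u x = U c x"
  shows "sobolev_pair p \<Omega> (U c) (Gr c)"
    "E_loc \<Omega> p f u = ereal ((1 / p) * (\<integral>x. norm (Gr c x) powr p \<partial>Leb) - f (U c))"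
proof -
  obtain G where G: "sobolev_pair p \<Omega> u G" using W by (auto simp: W1p_iff_sobolev_pair)
  have Um: "U c \<in> borel_measurable Leb" by (rule borel_measurable_lebesgue_on_borel[OF U_meas])
  have "sobolev_pair p \<Omega> (U c) G" by (rule sobolev_pair_cong_AE[OF ae Um G])
  then show pair: "sobolev_pair p \<Omega> (U c) (Gr c)" by (rule sobolev_pair_U_grad(2))
  have "AE x in Leb. U c x = u x" using ae by eventually_elim simp
  from sobolev_pair_cong_AE[OF this sobolev_pair_measurable(1)[OF G] pair]
  have pu: "Lp_on p \<Omega> u" "is_weak_grad \<Omega> u (Gr c)" "Lp_on p \<Omega> (\<lambda>x. norm (Gr c x))" by (auto simp: sobolev_pair_def)
  have "f u = f (U c)"
    by (rule W1p_dual_cong_AE[OF f_dual open_dom lmeas_dom p1 W _ ae]) (use pair in \<open>auto simp: W1p_iff_sobolev_pair\<close>)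
  then show "E_loc \<Omega> p f u = ereal ((1 / p) * (\<integral>x. norm (Gr c x) powr p \<partial>Leb) - f (U c))"
    unfolding E_loc_def integral_weak_grad_eq[OF open_dom lmeas_dom p1 pu] by simp
qed

lemma mean_zero_cong_AE:
  assumes "AE x in Leb. u x = v x" "u \<in> borel_measurable Leb" "v \<in> borel_measurable Leb" "mean_zero \<Omega> u"
  shows "mean_zero \<Omega> v"
  using integral_cong_AE[OF assms(2,3,1)] assms(4) by (simp add: mean_zero_def)

lemma Lp_norm_tendsto:
  assumes cv: "conv cs c" and us: "\<And>n. AE x in Leb. us n x = U (cs n) x" and v: "AE x in Leb. v x = U c x"
    and m: "\<And>n. us n \<in> borel_measurable Leb" "v \<in> borel_measurable Leb"
  shows "(\<lambda>n. Lp_norm p \<Omega> (\<lambda>x. us n x - v x)) \<longlonglongrightarrow> 0"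
proof -
  let ?M = "Leb"
  interpret F: finite_measure ?M by (rule finite_measure_dom)
  obtain S where S: "0 < S" "\<And>n. csum (cs n) \<le> S" using conv_csum_bounded[OF cv] by blast
  have Um[measurable]: "U c \<in> borel_measurable ?M" for c by (rule borel_measurable_lebesgue_on_borel[OF U_meas])
  note m[measurable]
  let ?R = "S * \<bar>Bb\<bar> + csum c * \<bar>Bb\<bar>"
  have lim: "(\<lambda>n. \<bar>U (cs n) x - U c x\<bar> powr p) \<longlonglongrightarrow> 0" for x
  proof -
    have "(\<lambda>n. \<bar>U (cs n) x - U c x\<bar>) \<longlonglongrightarrow> 0"
      using tendsto_rabs[OF LIM_zero[OF conv_U[OF cv, of x]]] by simp
    from tendsto_powr'[OF this tendsto_const[of p]] p0 show ?thesis by simp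
  qed
  have bd: "\<bar>U (cs n) x - U c x\<bar> powr p \<le> ?R powr p" for n x
  proof (rule powr_mono2)
    have a: "\<bar>U c' x\<bar> \<le> csum c' * \<bar>Bb\<bar>" for c'
      using U_bound[of c' x] mult_left_mono[OF abs_ge_self[of Bb] csum_nonneg[of c']] by linarith
    have "csum (cs n) * \<bar>Bb\<bar> \<le> S * \<bar>Bb\<bar>" using S(2)[of n] by (intro mult_right_mono) auto
    then show "\<bar>U (cs n) x - U c x\<bar> \<le> ?R" using a[of "cs n"] a[of c] by linarith
  qed (use p0 in auto)
  have "(\<lambda>n. \<integral>x. \<bar>U (cs n) x - U c x\<bar> powr p \<partial>?M) \<longlonglongrightarrow> (\<integral>x. 0 \<partial>?M)"
    by (rule integral_dominated_convergence[where w = "\<lambda>_. ?R powr p"]) (use lim bd in auto)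
  moreover have "(\<integral>x. \<bar>U (cs n) x - U c x\<bar> powr p \<partial>?M) = (\<integral>x. \<bar>us n x - v x\<bar> powr p \<partial>?M)" for n
  proof (rule integral_cong_AE)
    show "AE x in ?M. \<bar>U (cs n) x - U c x\<bar> powr p = \<bar>us n x - v x\<bar> powr p" using us[of n] v by eventually_elim simp
  qed measurable
  ultimately have "(\<lambda>n. \<integral>x. \<bar>us n x - v x\<bar> powr p \<partial>?M) \<longlonglongrightarrow> 0" by simp
  from tendsto_powr'[OF this tendsto_const[of "1 / p"]] p0 show ?thesis by (simp add: Lp_norm_def)
qed

text \<open>Translates from function spaces to coefficients. The \<open>us n\<close> and
  \<open>v\<close> are arbitrary representatives, so each functional is rewritten as an expression
  in the coefficients before \<open>minimizers_subsequence\<close> applies.\<close>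

lemma discrete_minimizers_subsequence:
  assumes indep: "\<And>c. (AE x in Leb. U c x = 0) \<Longrightarrow> \<forall>j\<in>I. c j = 0"
    and d: "\<And>n. 0 < d n" "d \<longlonglongrightarrow> 0" "\<And>n. d n \<le> \<delta>1" "\<And>n. d n \<le> 1"
    and eta: "\<And>\<delta>. \<forall>x\<in>\<Omega>. eta lam \<delta> x = \<eta> \<delta> x"
    and us: "\<And>n. is_minimizer (E_nl \<Omega> \<beta> p lam \<rho> \<psi> f (d n))
        {w \<in> nonlocal_space0 \<Omega> \<beta> p (d n). \<exists>c. AE x in Leb. w x = U c x} (us n)"
    and v: "is_minimizer (E_loc \<Omega> p f) {w \<in> W1p0 p \<Omega>. \<exists>c. AE x in Leb. w x = U c x} v"
  obtains s where "strict_mono (s :: nat \<Rightarrow> nat)" "(\<lambda>n. Lp_norm p \<Omega> (\<lambda>x. us (s n) x - v x)) \<longlonglongrightarrow> 0"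
proof -
  let ?M = "Leb"
  have Um: "U c \<in> borel_measurable ?M" for c by (rule borel_measurable_lebesgue_on_borel[OF U_meas])
  have vW: "W1p p \<Omega> v" "mean_zero \<Omega> v" "\<exists>c. AE x in ?M. v x = U c x"
    and vmin: "\<And>w. W1p p \<Omega> w \<Longrightarrow> mean_zero \<Omega> w \<Longrightarrow> (\<exists>c. AE x in ?M. w x = U c x) \<Longrightarrow> E_loc \<Omega> p f v \<le> E_loc \<Omega> p f w"
    using v by (auto simp: is_minimizer_def W1p0_def)
  obtain c where c: "AE x in ?M. v x = U c x" using vW(3) by blast
  have vm: "v \<in> borel_measurable ?M" using vW(1) by (simp add: W1p_def Lp_on_def)
  have pc: "sobolev_pair p \<Omega> (U c) (Gr c)" by (rule E_loc_eq(1)[OF vW(1) c])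
  have mc: "mean_zero \<Omega> (U c)" by (rule mean_zero_cong_AE[OF c vm Um vW(2)])
  have cmin: "(1 / p) * (\<integral>x. norm (Gr c x) powr p \<partial>?M) - f (U c) \<le> (1 / p) * (\<integral>x. norm (Gr a x) powr p \<partial>?M) - f (U a)"
    if a: "sobolev_pair p \<Omega> (U a) (Gr a)" "mean_zero \<Omega> (U a)" for a
  proof -
    have Wa: "W1p p \<Omega> (U a)" using a(1) by (auto simp: W1p_iff_sobolev_pair)
    have "E_loc \<Omega> p f v \<le> E_loc \<Omega> p f (U a)" by (rule vmin[OF Wa a(2)]) (intro exI[of _ a], simp)
    then show ?thesis unfolding E_loc_eq(2)[OF vW(1) c] E_loc_eq(2)[OF Wa AE_I2[OF refl]] by simp
  qed
  have uV: "Lp_on p \<Omega> (us n)" "mean_zero \<Omega> (us n)" "\<exists>c. AE x in ?M. us n x = U c x"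
    and umin: "\<And>w. Lp_on p \<Omega> w \<Longrightarrow> seminorm_p \<Omega> \<beta> p (d n) w < \<infinity> \<Longrightarrow> mean_zero \<Omega> w \<Longrightarrow> (\<exists>c. AE x in ?M. w x = U c x) \<Longrightarrow>
       E_nl \<Omega> \<beta> p lam \<rho> \<psi> f (d n) (us n) \<le> E_nl \<Omega> \<beta> p lam \<rho> \<psi> f (d n) w" for n
    using us[of n] by (auto simp: is_minimizer_def nonlocal_space0_def)
  obtain cs where cs: "\<And>n. AE x in ?M. us n x = U (cs n) x" using uV(3) by metis
  have um: "us n \<in> borel_measurable ?M" for n using uV(1)[of n] by (simp add: Lp_on_def)
  have compet: "E_nl \<Omega> \<beta> p lam \<rho> \<psi> f (d n) (us n) \<le> E_nl \<Omega> \<beta> p lam \<rho> \<psi> f (d n) (U a)"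
    if a: "sobolev_pair p \<Omega> (U a) (Gr a)" "mean_zero \<Omega> (U a)" for n a
    by (rule umin[OF _ seminorm_p_U_finite[OF a(1) d(1,4)] a(2)]) (use a(1) in \<open>auto simp: sobolev_pair_def\<close>)
  \<comment> \<open>Finiteness of the energy of a minimizer comes from comparison with the zero
    function.\<close>
  have "\<exists>j\<ge>0. J (d n) (U (cs n)) = ennreal j" for n
  proof -
    have z: "U (\<lambda>_. 0) = (\<lambda>x. 0 * U c x)" "Gr (\<lambda>_. 0) = (\<lambda>x. 0 *\<^sub>R Gr c x)" by (auto simp: U_def Gr_def)
    have s0: "sobolev_pair p \<Omega> (U (\<lambda>_. 0)) (Gr (\<lambda>_. 0))" unfolding z by (rule sobolev_pair_scale[OF pc])
    have m0: "mean_zero \<Omega> (U (\<lambda>_. 0))" by (simp add: mean_zero_def U_def)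
    have J0: "J (d n) (U (\<lambda>_. 0)) = ennreal 0" by (simp add: J_def inner_energy_def U_def)
    have "E_nl \<Omega> \<beta> p lam \<rho> \<psi> f (d n) (us n) < \<infinity>"
      using compet[OF s0 m0, of n] unfolding E_nl_eq[OF d(1,3) eta Um AE_I2[OF refl] order_refl J0] by (rule le_less_trans) simp
    from E_nl_less_top_imp_J_finite[OF eta cs this] show ?thesis by blast
  qed
  then obtain jr where jr: "\<And>n. 0 \<le> jr n" "\<And>n. J (d n) (U (cs n)) = ennreal (jr n)" by metis
  have mz: "mean_zero \<Omega> (U (cs n))" for n by (rule mean_zero_cong_AE[OF cs um Um uV(2)])
  have min: "(1 / p) * jr n - f (KK (d n) (U (cs n))) \<le> (1 / p) * j - f (KK (d n) (U a))"
    if a: "sobolev_pair p \<Omega> (U a) (Gr a)" "mean_zero \<Omega> (U a)" "0 \<le> j" "J (d n) (U a) = ennreal j" for n a j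
    using compet[OF a(1,2), of n]
    unfolding E_nl_eq[OF d(1,3) eta um cs jr] E_nl_eq[OF d(1,3) eta Um AE_I2[OF refl] a(3,4)] by simp
  obtain s where s: "strict_mono (s :: nat \<Rightarrow> nat)" "conv (\<lambda>n. cs (s n)) c"
    by (rule minimizers_subsequence[OF indep d(1-3) jr mz min pc mc cmin])
  have "(\<lambda>n. Lp_norm p \<Omega> (\<lambda>x. us (s n) x - v x)) \<longlonglongrightarrow> 0" by (rule Lp_norm_tendsto[OF s(2) cs c um vm])
  then show ?thesis using that[OF s(1)] by blast
qed

end

section \<open>Piecewise polynomials on a triangulation\<close>

text \<open>A basis modulo null sets, built by leaving out each function that depends almost
  everywhere on those kept. Independence makes the coefficients determined by the class, so that
  they can serve as coordinates.\<close>

lemma AE_independent_spanning_subset: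
  fixes b :: "'i \<Rightarrow> 'b \<Rightarrow> real"
  assumes "finite I0"
  obtains I where "I \<subseteq> I0" "\<And>c. (AE x in M. (\<Sum>j\<in>I. c j * b j x) = 0) \<Longrightarrow> \<forall>j\<in>I. c j = 0"
    "\<And>c. \<exists>c'. AE x in M. (\<Sum>j\<in>I0. c j * b j x) = (\<Sum>j\<in>I. c' j * b j x)"
proof -
  have "\<exists>I\<subseteq>I0. (\<forall>c. (AE x in M. (\<Sum>j\<in>I. c j * b j x) = 0) \<longrightarrow> (\<forall>j\<in>I. c j = 0)) \<and>
    (\<forall>c. \<exists>c'. AE x in M. (\<Sum>j\<in>I0. c j * b j x) = (\<Sum>j\<in>I. c' j * b j x))"
    using assms
  proof (induction I0 rule: finite_induct)
    case empty
    show ?case by auto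
  next
    case (insert k I0)
    then obtain I where I: "I \<subseteq> I0" "\<And>c. (AE x in M. (\<Sum>j\<in>I. c j * b j x) = 0) \<Longrightarrow> \<forall>j\<in>I. c j = 0"
      "\<And>c. \<exists>c'. AE x in M. (\<Sum>j\<in>I0. c j * b j x) = (\<Sum>j\<in>I. c' j * b j x)" by blast
    have fin: "finite I" "k \<notin> I" using I(1) insert finite_subset by auto
    show ?case
    proof (cases "\<exists>a. AE x in M. b k x = (\<Sum>j\<in>I. a j * b j x)")
      case True
      then obtain a where a: "AE x in M. b k x = (\<Sum>j\<in>I. a j * b j x)" by blast
      have "\<exists>c'. AE x in M. (\<Sum>j\<in>insert k I0. c j * b j x) = (\<Sum>j\<in>I. c' j * b j x)" for c
      proof -
        obtain c' where c': "AE x in M. (\<Sum>j\<in>I0. c j * b j x) = (\<Sum>j\<in>I. c' j * b j x)" using I(3) by blast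
        have "AE x in M. (\<Sum>j\<in>insert k I0. c j * b j x) = (\<Sum>j\<in>I. (c k * a j + c' j) * b j x)"
          using a c'
        proof eventually_elim
          case (elim x)
          have "(\<Sum>j\<in>I. (c k * a j + c' j) * b j x) = c k * (\<Sum>j\<in>I. a j * b j x) + (\<Sum>j\<in>I. c' j * b j x)"
            by (simp add: distrib_right sum.distrib sum_distrib_left mult.assoc)
          then show ?case using insert(1,2) elim by simp
        qed
        then show ?thesis by (rule exI[of _ "\<lambda>j. c k * a j + c' j"])
      qed
      then show ?thesis using I by (intro exI[of _ I]) auto
    next
      case False
      have "\<forall>j\<in>insert k I. c j = 0" if c: "AE x in M. (\<Sum>j\<in>insert k I. c j * b j x) = 0" for c
      proof -
        have c0: "c k = 0"
        proof (rule ccontr)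
          assume ne: "c k \<noteq> 0"
          have "AE x in M. b k x = (\<Sum>j\<in>I. (- c j / c k) * b j x)"
            using c
          proof eventually_elim
            case (elim x)
            have "(\<Sum>j\<in>I. (- c j / c k) * b j x) = (- 1 / c k) * (\<Sum>j\<in>I. c j * b j x)"
              by (simp add: sum_distrib_left sum_negf[symmetric])
            moreover have "(\<Sum>j\<in>I. c j * b j x) = - (c k * b k x)" using elim fin by simp
            ultimately show ?case using ne by simp
          qed
          then have "\<exists>a. AE x in M. b k x = (\<Sum>j\<in>I. a j * b j x)" by (rule exI[of _ "\<lambda>j. - c j / c k"])
          with False show False ..
        qed
        then have "AE x in M. (\<Sum>j\<in>I. c j * b j x) = 0" using c fin by simp
        then show ?thesis using I(2) c0 by blast
      qed
      moreover have "\<exists>c'. AE x in M. (\<Sum>j\<in>insert k I0. c j * b j x) = (\<Sum>j\<in>insert k I. c' j * b j x)" for c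
      proof -
        obtain c' where c': "AE x in M. (\<Sum>j\<in>I0. c j * b j x) = (\<Sum>j\<in>I. c' j * b j x)" using I(3) by blast
        have s: "(\<Sum>j\<in>I. (c'(k := c k)) j * b j x) = (\<Sum>j\<in>I. c' j * b j x)" for x
          using fin by (intro sum.cong) auto
        have "AE x in M. (\<Sum>j\<in>insert k I0. c j * b j x) = (\<Sum>j\<in>insert k I. (c'(k := c k)) j * b j x)"
          using c'
        proof eventually_elim
          case (elim x)
          then show ?case unfolding sum.insert[OF insert(1,2)] sum.insert[OF fin] s by simp
        qed
        then show ?thesis by (rule exI[of _ "c'(k := c k)"])
      qed
      ultimately show ?thesis using I(1) by (intro exI[of _ "insert k I"]) blast
    qed
  qed
  then show ?thesis using that by blast
qed

section \<open>Monomials and their restrictions to cells\<close>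

definition monomial :: "('a::euclidean_space \<Rightarrow> nat) \<Rightarrow> 'a \<Rightarrow> real" where
  "monomial k x = (\<Prod>i\<in>Basis. (x \<bullet> i) ^ k i)"

definition monomial_grad :: "('a::euclidean_space \<Rightarrow> nat) \<Rightarrow> 'a \<Rightarrow> 'a" where
  "monomial_grad k x = (\<Sum>i\<in>Basis. (real (k i) * (x \<bullet> i) ^ (k i - 1) * (\<Prod>j\<in>Basis - {i}. (x \<bullet> j) ^ k j)) *\<^sub>R i)"

definition multi_index :: "nat \<Rightarrow> ('a::euclidean_space \<Rightarrow> nat) set" where
  "multi_index N = {k. (\<forall>i. i \<notin> Basis \<longrightarrow> k i = 0) \<and> (\<Sum>i\<in>Basis. k i) \<le> N}"

lemma finite_multi_index: "finite (multi_index N :: ('a::euclidean_space \<Rightarrow> nat) set)"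
proof (rule finite_subset)
  show "(multi_index N :: ('a \<Rightarrow> nat) set) \<subseteq> {k. \<forall>i. (i \<in> Basis \<longrightarrow> k i \<in> {..N}) \<and> (i \<notin> Basis \<longrightarrow> k i = 0)}"
  proof
    fix k :: "'a \<Rightarrow> nat" assume k: "k \<in> multi_index N"
    have "k i \<le> N" if "i \<in> Basis" for i
      using member_le_sum[of i Basis k] that k by (simp add: multi_index_def)
    then show "k \<in> {k. \<forall>i. (i \<in> Basis \<longrightarrow> k i \<in> {..N}) \<and> (i \<notin> Basis \<longrightarrow> k i = 0)}"
      using k by (auto simp: multi_index_def)
  qed
  show "finite {k. \<forall>i::'a. (i \<in> Basis \<longrightarrow> k i \<in> {..N}) \<and> (i \<notin> Basis \<longrightarrow> k i = 0)}"
    by (rule finite_set_of_finite_funs) auto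
qed

lemma poly_deg_le_iff: "poly_deg_le N P \<longleftrightarrow> (\<exists>c. P = (\<lambda>x. \<Sum>k\<in>multi_index N. c k * monomial k x))"
  unfolding poly_deg_le_def multi_index_def monomial_def ..

lemma monomial_has_derivative: "(monomial k has_derivative (\<lambda>h. monomial_grad k x \<bullet> h)) (at x)"
proof -
  have "((\<lambda>x. \<Prod>i\<in>Basis. (x \<bullet> i) ^ k i) has_derivative
      (\<lambda>h. \<Sum>i\<in>Basis. (of_nat (k i) * (h \<bullet> i) * (x \<bullet> i) ^ (k i - 1)) * (\<Prod>j\<in>Basis - {i}. (x \<bullet> j) ^ k j))) (at x)"
    by (rule has_derivative_prod) (rule has_derivative_power, auto intro!: derivative_eq_intros)
  moreover have "(\<Sum>i\<in>Basis. (of_nat (k i) * (h \<bullet> i) * (x \<bullet> i) ^ (k i - 1)) * (\<Prod>j\<in>Basis - {i}. (x \<bullet> j) ^ k j))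
     = monomial_grad k x \<bullet> h" for h
    unfolding monomial_grad_def inner_sum_left inner_scaleR_left by (intro sum.cong refl) (simp add: inner_commute mult_ac)
  ultimately show ?thesis by (simp add: monomial_def[abs_def])
qed

lemma continuous_on_monomial: "continuous_on S (monomial k)"
  unfolding monomial_def[abs_def] by (intro continuous_intros)

lemma continuous_on_monomial_grad: "continuous_on S (monomial_grad k)"
  unfolding monomial_grad_def[abs_def] by (intro continuous_intros)

text \<open>Cut off by the open cell: the function vanishes on the skeleton, a null set, and is
  differentiable at the interior points of every cell.\<close>

definition cell_monomial :: "'a::euclidean_space set \<times> ('a \<Rightarrow> nat) \<Rightarrow> 'a \<Rightarrow> real" where
  "cell_monomial = (\<lambda>(t, k) x. indicator (interior t) x * monomial k x)"

definition cell_monomial_grad :: "'a::euclidean_space set \<times> ('a \<Rightarrow> nat) \<Rightarrow> 'a \<Rightarrow> 'a" where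
  "cell_monomial_grad = (\<lambda>(t, k) x. indicator (interior t) x *\<^sub>R monomial_grad k x)"

lemma cell_monomial_measurable: "cell_monomial j \<in> borel_measurable borel"
proof -
  obtain t k where j: "j = (t, k)" by (cases j)
  have "monomial k \<in> borel_measurable borel" by (intro borel_measurable_continuous_onI continuous_on_monomial)
  then show ?thesis unfolding j cell_monomial_def prod.case by (intro borel_measurable_times borel_measurable_indicator) auto
qed

lemma cell_monomial_grad_measurable: "cell_monomial_grad j \<in> borel_measurable borel"
proof -
  obtain t k where j: "j = (t, k)" by (cases j)
  have "monomial_grad k \<in> borel_measurable borel" by (intro borel_measurable_continuous_onI continuous_on_monomial_grad)
  then show ?thesis unfolding j cell_monomial_grad_def prod.case by (intro borel_measurable_scaleR borel_measurable_indicator) auto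
qed

lemma cell_monomials_bounded:
  fixes T :: "'a::euclidean_space set set"
  assumes "finite T" "\<And>t. t \<in> T \<Longrightarrow> compact t"
  obtains Bb where "\<And>j x. j \<in> T \<times> multi_index N \<Longrightarrow> \<bar>cell_monomial j x\<bar> \<le> Bb"
    "\<And>j x. j \<in> T \<times> multi_index N \<Longrightarrow> norm (cell_monomial_grad j x) \<le> Bb"
proof -
  have "\<exists>b. 0 \<le> b \<and> (\<forall>x. \<bar>cell_monomial j x\<bar> \<le> b \<and> norm (cell_monomial_grad j x) \<le> b)" if j: "j \<in> T \<times> multi_index N" for j
  proof -
    obtain t k where tk: "j = (t, k)" "t \<in> T" using j by auto
    have c: "compact t" using assms(2) tk by blast
    obtain b1 where b1: "\<And>x. x \<in> t \<Longrightarrow> norm (monomial k x) \<le> b1"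
      using compact_imp_bounded[OF compact_continuous_image[OF continuous_on_monomial[of t k] c]] by (auto simp: bounded_iff)
    obtain b2 where b2: "\<And>x. x \<in> t \<Longrightarrow> norm (monomial_grad k x) \<le> b2"
      using compact_imp_bounded[OF compact_continuous_image[OF continuous_on_monomial_grad[of t k] c]] by (auto simp: bounded_iff)
    let ?b = "\<bar>b1\<bar> + \<bar>b2\<bar>"
    have "\<bar>cell_monomial j x\<bar> \<le> ?b \<and> norm (cell_monomial_grad j x) \<le> ?b" for x
    proof (cases "x \<in> interior t")
      case True
      then have "x \<in> t" using interior_subset by blast
      then have "norm (monomial k x) \<le> ?b" "norm (monomial_grad k x) \<le> ?b" using b1[of x] b2[of x] by linarith+
      then show ?thesis using True by (simp add: tk cell_monomial_def cell_monomial_grad_def)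
    next
      case False
      then show ?thesis by (simp add: tk cell_monomial_def cell_monomial_grad_def)
    qed
    then show ?thesis by (intro exI[of _ ?b]) simp
  qed
  then obtain b where b: "\<And>j. j \<in> T \<times> multi_index N \<Longrightarrow> 0 \<le> b j"
    "\<And>j x. j \<in> T \<times> multi_index N \<Longrightarrow> \<bar>cell_monomial j x\<bar> \<le> b j \<and> norm (cell_monomial_grad j x) \<le> b j" by metis
  have fin: "finite (T \<times> multi_index N :: ('a set \<times> ('a \<Rightarrow> nat)) set)" by (intro finite_cartesian_product assms finite_multi_index)
  have le: "b j \<le> (\<Sum>j\<in>T \<times> multi_index N. b j)" if "j \<in> T \<times> multi_index N" for j
    by (rule member_le_sum[OF that _ fin]) (use b(1) in blast)
  show ?thesis
  proof (rule that[of "\<Sum>j\<in>T \<times> multi_index N. b j"])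
    fix j :: "'a set \<times> ('a \<Rightarrow> nat)" and x assume j: "j \<in> T \<times> multi_index N"
    show "\<bar>cell_monomial j x\<bar> \<le> (\<Sum>j\<in>T \<times> multi_index N. b j)" "norm (cell_monomial_grad j x) \<le> (\<Sum>j\<in>T \<times> multi_index N. b j)"
      using b(2)[OF j, of x] le[OF j] by linarith+
  qed
qed

section \<open>Cells of a triangulation and coordinates on the finite element space\<close>

context
  fixes \<Omega> :: "'a::euclidean_space set" and T :: "'a set set"
  assumes mesh: "mesh_of \<Omega> T"
begin

lemma mesh_finite: "finite T" and mesh_simplex: "t \<in> T \<Longrightarrow> int DIM('a) simplex t"
  and mesh_Union: "\<Union>T = closure \<Omega>" and mesh_face: "t \<in> T \<Longrightarrow> t' \<in> T \<Longrightarrow> (t \<inter> t') face_of t"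
  using mesh by (auto simp: mesh_of_def triangulation_def)

text \<open>The intersection is a face of both cells, and a proper face misses the interior. If the
  intersection is the whole of \<open>t\<close>, then \<open>t\<close> is a proper face of
  \<open>t'\<close>.\<close>

lemma mesh_disjoint_interiors:
  assumes t: "t \<in> T" "t' \<in> T" "t \<noteq> t'"
  shows "interior t \<inter> interior t' = {}"
proof (cases "t \<inter> t' = t")
  case False
  then have "(t \<inter> t') \<inter> interior t = {}" by (intro face_of_disjoint_interior mesh_face t)
  then show ?thesis using interior_subset[of t] interior_subset[of t'] by blast
next
  case True
  then have "t' \<inter> t = t" by blast
  then have "t face_of t'" using mesh_face[OF t(2,1)] by simp
  then have "t \<inter> interior t' = {}" using t(3) by (intro face_of_disjoint_interior)
  then show ?thesis using interior_subset[of t] by blast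
qed

lemma negligible_mesh_skeleton: "negligible (closure \<Omega> - \<Union>(interior ` T))"
proof (rule negligible_subset)
  show "negligible (\<Union>(frontier ` T))"
    using mesh_finite mesh_simplex convex_simplex by (intro negligible_Union) (auto intro: negligible_convex_frontier)
  show "closure \<Omega> - \<Union>(interior ` T) \<subseteq> \<Union>(frontier ` T)"
    unfolding mesh_Union[symmetric] frontier_def using closure_subset by fastforce
qed

lemma cell_monomial_has_derivative:
  assumes j: "j \<in> T \<times> multi_index N" and x: "x \<in> \<Union>(interior ` T)"
  shows "(cell_monomial j has_derivative (\<lambda>h. cell_monomial_grad j x \<bullet> h)) (at x)"
proof -
  obtain t k where tk: "j = (t, k)" "t \<in> T" using j by auto
  show ?thesis
  proof (cases "x \<in> interior t")
    case True
    have "(cell_monomial j has_derivative (\<lambda>h. monomial_grad k x \<bullet> h)) (at x)"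
      by (rule has_derivative_transform_within_open[OF monomial_has_derivative open_interior True])
         (simp add: tk cell_monomial_def)
    then show ?thesis using True by (simp add: tk cell_monomial_grad_def)
  next
    case False
    obtain t' where t': "t' \<in> T" "x \<in> interior t'" using x by blast
    then have "interior t \<inter> interior t' = {}" using False by (intro mesh_disjoint_interiors tk) auto
    then have "0 = cell_monomial j y" if "y \<in> interior t'" for y
      using that by (auto simp: tk cell_monomial_def indicator_def)
    then have "(cell_monomial j has_derivative (\<lambda>h. 0)) (at x)"
      by (intro has_derivative_transform_within_open[OF has_derivative_const open_interior t'(2)])
    then show ?thesis using False by (simp add: tk cell_monomial_grad_def)
  qed
qed

lemma sum_cell_monomials:
  assumes t: "t \<in> T" "x \<in> interior t"
  shows "(\<Sum>j\<in>T \<times> multi_index N. c j * cell_monomial j x) = (\<Sum>k\<in>multi_index N. c (t, k) * monomial k x)"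
proof -
  have "(\<Sum>j\<in>T \<times> multi_index N. c j * cell_monomial j x) = (\<Sum>s\<in>T. \<Sum>k\<in>multi_index N. c (s, k) * cell_monomial (s, k) x)"
    by (simp add: sum.cartesian_product split_def)
  also have "\<dots> = (\<Sum>s\<in>T. if s = t then \<Sum>k\<in>multi_index N. c (t, k) * monomial k x else 0)"
  proof (rule sum.cong[OF refl])
    fix s assume s: "s \<in> T"
    show "(\<Sum>k\<in>multi_index N. c (s, k) * cell_monomial (s, k) x) = (if s = t then \<Sum>k\<in>multi_index N. c (t, k) * monomial k x else 0)"
    proof (cases "s = t")
      case True
      then show ?thesis using t by (simp add: cell_monomial_def)
    next
      case False
      then have "x \<notin> interior s" using mesh_disjoint_interiors[OF s t(1)] t(2) by blast
      then show ?thesis using False by (simp add: cell_monomial_def)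
    qed
  qed
  also have "\<dots> = (\<Sum>k\<in>multi_index N. c (t, k) * monomial k x)" using mesh_finite t by simp
  finally show ?thesis .
qed

text \<open>The cells cover the closure of \<Omega>, whereas the coefficient form is an equation on
  \<Omega>. Skeleton, cell boundaries and the frontier of \<Omega> are null sets, which reconciles
  the two.\<close>

lemma piecewise_polynomial_iff:
  assumes op: "open \<Omega>" and fr: "negligible (frontier \<Omega>)"
  shows "(\<forall>t\<in>T. \<exists>P. poly_deg_le N P \<and> (AE x in lebesgue_on t. v x = P x)) \<longleftrightarrow>
    (\<exists>c. AE x in lebesgue_on \<Omega>. v x = (\<Sum>j\<in>T \<times> multi_index N. c j * cell_monomial j x))"
proof -
  have lo: "\<Omega> \<in> sets lebesgue" using op by simp
  have lt: "t \<in> sets lebesgue" if "t \<in> T" for t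
    using closed_simplex[OF mesh_simplex[OF that]] by simp
  have sk: "AE x in lebesgue. x \<in> closure \<Omega> \<longrightarrow> x \<in> \<Union>(interior ` T)"
    by (rule AE_I'[of "closure \<Omega> - \<Union>(interior ` T)"]) (use negligible_mesh_skeleton in \<open>auto simp: negligible_iff_null_sets\<close>)
  have bd: "AE x in lebesgue. x \<notin> frontier \<Omega>"
    by (rule AE_I'[of "frontier \<Omega>"]) (use fr in \<open>auto simp: negligible_iff_null_sets\<close>)
  show ?thesis
  proof
    assume "\<forall>t\<in>T. \<exists>P. poly_deg_le N P \<and> (AE x in lebesgue_on t. v x = P x)"
    then have "\<forall>t\<in>T. \<exists>a. AE x in lebesgue_on t. v x = (\<Sum>k\<in>multi_index N. a k * monomial k x)"
      unfolding poly_deg_le_iff by blast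
    then obtain a where a: "\<And>t. t \<in> T \<Longrightarrow> AE x in lebesgue_on t. v x = (\<Sum>k\<in>multi_index N. a t k * monomial k x)" by metis
    have "\<forall>t\<in>T. AE x in lebesgue. x \<in> t \<longrightarrow> v x = (\<Sum>k\<in>multi_index N. a t k * monomial k x)"
      using a lt by (simp add: AE_restrict_space_iff)
    then have "AE x in lebesgue. \<forall>t\<in>T. x \<in> t \<longrightarrow> v x = (\<Sum>k\<in>multi_index N. a t k * monomial k x)"
      by (simp add: AE_finite_all[OF mesh_finite])
    then have "AE x in lebesgue. x \<in> \<Omega> \<longrightarrow> v x = (\<Sum>j\<in>T \<times> multi_index N. (\<lambda>(t, k). a t k) j * cell_monomial j x)"
      using sk
    proof eventually_elim
      case (elim x)
      show ?case
      proof
        assume "x \<in> \<Omega>"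
        then obtain t where t: "t \<in> T" "x \<in> interior t" using elim(2) closure_subset by blast
        then have "x \<in> t" using interior_subset by blast
        then show "v x = (\<Sum>j\<in>T \<times> multi_index N. (\<lambda>(t, k). a t k) j * cell_monomial j x)"
          unfolding sum_cell_monomials[OF t] using elim(1) t(1) by simp
      qed
    qed
    then show "\<exists>c. AE x in lebesgue_on \<Omega>. v x = (\<Sum>j\<in>T \<times> multi_index N. c j * cell_monomial j x)"
      using lo by (intro exI[of _ "\<lambda>(t, k). a t k"]) (simp add: AE_restrict_space_iff)
  next
    assume "\<exists>c. AE x in lebesgue_on \<Omega>. v x = (\<Sum>j\<in>T \<times> multi_index N. c j * cell_monomial j x)"
    then obtain c where "AE x in lebesgue_on \<Omega>. v x = (\<Sum>j\<in>T \<times> multi_index N. c j * cell_monomial j x)" by blast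
    then have c: "AE x in lebesgue. x \<in> \<Omega> \<longrightarrow> v x = (\<Sum>j\<in>T \<times> multi_index N. c j * cell_monomial j x)"
      using lo by (simp add: AE_restrict_space_iff)
    show "\<forall>t\<in>T. \<exists>P. poly_deg_le N P \<and> (AE x in lebesgue_on t. v x = P x)"
    proof
      fix t assume t: "t \<in> T"
      let ?P = "\<lambda>x. \<Sum>k\<in>multi_index N. c (t, k) * monomial k x"
      have "negligible (frontier t)" by (rule negligible_convex_frontier[OF convex_simplex[OF mesh_simplex[OF t]]])
      then have "AE x in lebesgue. x \<notin> frontier t"
        by (intro AE_I'[of "frontier t"]) (auto simp: negligible_iff_null_sets)
      with c bd have "AE x in lebesgue. x \<in> t \<longrightarrow> v x = ?P x"
      proof eventually_elim
        case (elim x)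
        show ?case
        proof
          assume x: "x \<in> t"
          have "x \<in> interior t" using x elim(3) closure_subset[of t] by (auto simp: frontier_def)
          moreover have "x \<in> \<Omega>"
            using x t mesh_Union elim(2) op by (auto simp: frontier_def interior_open)
          ultimately show "v x = ?P x" using elim(1) sum_cell_monomials[OF t] by simp
        qed
      qed
      then have "AE x in lebesgue_on t. v x = ?P x" using lt[OF t] by (simp add: AE_restrict_space_iff)
      moreover have "poly_deg_le N ?P" unfolding poly_deg_le_iff by (rule exI[of _ "\<lambda>k. c (t, k)"]) (rule refl)
      ultimately show "\<exists>P. poly_deg_le N P \<and> (AE x in lebesgue_on t. v x = P x)" by blast
    qed
  qed
qed

text \<open>One index set works for every \<open>V\<close>, so the discrete spaces for all \<sigma>,
  finite or infinite, share the same coordinates.\<close>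

lemma fe_space_basis:
  assumes op: "open \<Omega>" and fr: "negligible (frontier \<Omega>)"
  obtains I where "I \<subseteq> T \<times> multi_index N"
    "\<And>c. (AE x in lebesgue_on \<Omega>. (\<Sum>j\<in>I. c j * cell_monomial j x) = 0) \<Longrightarrow> \<forall>j\<in>I. c j = 0"
    "\<And>V. fe_space V T N = {v \<in> V. \<exists>c. AE x in lebesgue_on \<Omega>. v x = (\<Sum>j\<in>I. c j * cell_monomial j x)}"
proof -
  have fin: "finite (T \<times> multi_index N :: ('a set \<times> ('a \<Rightarrow> nat)) set)" by (intro finite_cartesian_product mesh_finite finite_multi_index)
  obtain I where I: "I \<subseteq> T \<times> multi_index N"
    "\<And>c. (AE x in lebesgue_on \<Omega>. (\<Sum>j\<in>I. c j * cell_monomial j x) = 0) \<Longrightarrow> \<forall>j\<in>I. c j = 0"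
    "\<And>c. \<exists>c'. AE x in lebesgue_on \<Omega>. (\<Sum>j\<in>T \<times> multi_index N. c j * cell_monomial j x) = (\<Sum>j\<in>I. c' j * cell_monomial j x)"
    using AE_independent_spanning_subset[OF fin, where M = "lebesgue_on \<Omega>" and b = cell_monomial] by blast
  have "(\<exists>c. AE x in lebesgue_on \<Omega>. v x = (\<Sum>j\<in>T \<times> multi_index N. c j * cell_monomial j x)) \<longleftrightarrow>
     (\<exists>c. AE x in lebesgue_on \<Omega>. v x = (\<Sum>j\<in>I. c j * cell_monomial j x))" (is "?l \<longleftrightarrow> ?r") for v
  proof
    assume ?l
    then obtain c where c: "AE x in lebesgue_on \<Omega>. v x = (\<Sum>j\<in>T \<times> multi_index N. c j * cell_monomial j x)" by blast
    obtain c' where c': "AE x in lebesgue_on \<Omega>. (\<Sum>j\<in>T \<times> multi_index N. c j * cell_monomial j x) = (\<Sum>j\<in>I. c' j * cell_monomial j x)"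
      using I(3) by blast
    have "AE x in lebesgue_on \<Omega>. v x = (\<Sum>j\<in>I. c' j * cell_monomial j x)" using c c' by eventually_elim simp
    then show ?r by blast
  next
    assume ?r
    then obtain c where c: "AE x in lebesgue_on \<Omega>. v x = (\<Sum>j\<in>I. c j * cell_monomial j x)" by blast
    have "(\<Sum>j\<in>I. c j * cell_monomial j x) = (\<Sum>j\<in>T \<times> multi_index N. (if j \<in> I then c j else 0) * cell_monomial j x)" for x
      by (rule sum.mono_neutral_cong_left) (use fin I(1) in auto)
    then show ?l using c by (intro exI[of _ "\<lambda>j. if j \<in> I then c j else 0"]) simp
  qed
  then have "fe_space V T N = {v \<in> V. \<exists>c. AE x in lebesgue_on \<Omega>. v x = (\<Sum>j\<in>I. c j * cell_monomial j x)}" for V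
    unfolding fe_space_def piecewise_polynomial_iff[OF op fr] by simp
  then show ?thesis using that I by blast
qed

end

lemma negligible_piecewise_flat_frontier:
  assumes "piecewise_flat_boundary \<Omega>"
  shows "negligible (frontier \<Omega>)"
proof -
  obtain H where H: "finite H" "\<And>P. P \<in> H \<Longrightarrow> \<exists>a b. a \<noteq> 0 \<and> P = {x. a \<bullet> x = b}" "frontier \<Omega> \<subseteq> \<Union>H"
    using assms by (auto simp: piecewise_flat_boundary_def)
  have "negligible (\<Union>H)"
  proof (rule negligible_Union[OF H(1)])
    fix P assume "P \<in> H"
    then obtain a b where "a \<noteq> 0" "P = {x. a \<bullet> x = b}" using H(2) by blast
    then show "negligible P" using negligible_hyperplane[of a b] by simp
  qed
  then show ?thesis using H(3) negligible_subset by blast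
qed

lemma dist_bd_bounded:
  assumes "bounded \<Omega>"
  obtains M where "\<And>x. x \<in> \<Omega> \<Longrightarrow> dist_bd \<Omega> x \<le> M"
proof -
  have "continuous_on (closure \<Omega>) (dist_bd \<Omega>)" unfolding dist_bd_def[abs_def] by (intro continuous_intros)
  then have "bounded (dist_bd \<Omega> ` closure \<Omega>)"
    using assms by (intro compact_imp_bounded compact_continuous_image) (simp_all add: compact_closure)
  then obtain b where b: "\<And>x. x \<in> closure \<Omega> \<Longrightarrow> norm (dist_bd \<Omega> x) \<le> b" by (auto simp: bounded_iff)
  have "dist_bd \<Omega> x \<le> b" if "x \<in> \<Omega>" for x
    using b[of x] that closure_subset[of \<Omega>] by auto
  then show ?thesis by (rule that)
qed

lemma nn_integral_rho_eq_Cbar: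
  fixes \<rho> :: "real \<Rightarrow> real"
  assumes p: "0 < p" and nonneg: "\<And>s. 0 \<le> s \<Longrightarrow> 0 \<le> \<rho> s" and supp: "\<And>s. 1 \<le> s \<Longrightarrow> \<rho> s = 0"
    and norm: "set_lebesgue_integral lborel (ball (0::'a::euclidean_space) 1) (\<lambda>z. norm z powr (p - \<beta>) * \<rho> (norm z)) = Cbar DIM('a) p"
  shows "(\<integral>\<^sup>+(z::'a). ennreal (norm z powr (p - \<beta>) * \<rho> (norm z)) \<partial>lborel) = ennreal (Cbar DIM('a) p)"
proof -
  let ?g = "\<lambda>z::'a. norm z powr (p - \<beta>) * \<rho> (norm z)"
  have ind: "indicator (ball 0 1) z *\<^sub>R ?g z = ?g z" for z
    using supp[of "norm z"] by (cases "norm z < 1") auto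
  have I: "(\<integral>z. ?g z \<partial>lborel) = Cbar DIM('a) p" using norm unfolding set_lebesgue_integral_def ind .
  \<comment> \<open>A function that is not integrable has Bochner integral 0 by convention, so the
    positive value of \<open>Cbar\<close> entails integrability.\<close>
  then have "(\<integral>z. ?g z \<partial>lborel) \<noteq> 0" using Cbar_pos[OF p, of "DIM('a)"] by simp
  then have "integrable lborel ?g" using not_integrable_integral_eq by blast
  from nn_integral_eq_integral[OF this] show ?thesis unfolding I using nonneg by simp
qed

theorem theorem3p13:
  fixes \<Omega> :: "'a::euclidean_space set"
    and p \<beta> :: real
    and lam :: "'a \<Rightarrow> real" and \<kappa>0 :: real and \<kappa> :: "'a list \<Rightarrow> real"
    and \<rho> \<psi> :: "real \<Rightarrow> real"
    and f :: "('a \<Rightarrow> real) \<Rightarrow> real"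
    and T :: "real \<Rightarrow> 'a set set" and h0 :: real and N :: nat
    and u :: "real \<Rightarrow> real \<Rightarrow> 'a \<Rightarrow> real" and u_inf :: "real \<Rightarrow> 'a \<Rightarrow> real"
  assumes dom: "lipschitz_domain \<Omega>" "piecewise_flat_boundary \<Omega>"
    and p: "1 < p" and beta: "0 \<le> \<beta>" "\<beta> < real DIM('a) + p"
    (* the function lambda *)
    and lam_cont: "continuous_on (closure \<Omega>) lam" and lam_smooth: "smooth_in \<Omega> lam"
    and lam_nonneg: "\<forall>x\<in>closure \<Omega>. 0 \<le> lam x"
    and kappa0: "1 \<le> \<kappa>0"
    and lam_comp: "\<forall>x\<in>closure \<Omega>. dist_bd \<Omega> x / \<kappa>0 \<le> lam x \<and> lam x \<le> \<kappa>0 * dist_bd \<Omega> x"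
    and lam_deriv: "\<forall>es. set es \<subseteq> Basis \<longrightarrow> 0 < \<kappa> es \<and>
          (\<forall>x\<in>\<Omega>. \<bar>iter_pd es lam x\<bar> \<le> \<kappa> es * dist_bd \<Omega> x powr (1 - real (length es)))"
    (* the kernel rho *)
    and rho_meas: "\<rho> \<in> borel_measurable borel" and rho_bdd: "bounded (range \<rho>)"
    and rho_even: "\<forall>x. \<rho> (- x) = \<rho> x"
    and rho_supp: "compact (closure {x. \<rho> x \<noteq> 0})" "closure {x. \<rho> x \<noteq> 0} \<subseteq> {-1<..<1}"
    and rho_nonneg: "\<forall>x\<in>{0..<1}. 0 \<le> \<rho> x"
    and rho_noninc: "\<forall>x y. 0 \<le> x \<longrightarrow> x \<le> y \<longrightarrow> y < 1 \<longrightarrow> \<rho> y \<le> \<rho> x"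
    and rho_pos: "\<exists>C\<^sub>\<rho>>0. \<exists>c\<^sub>\<rho>. 0 < c\<^sub>\<rho> \<and> c\<^sub>\<rho> < 1 \<and> (\<forall>x\<in>{-c\<^sub>\<rho>..c\<^sub>\<rho>}. C\<^sub>\<rho> \<le> \<rho> x)"
    and rho_norm: "set_lebesgue_integral lborel (ball (0::'a) 1) (\<lambda>z. norm z powr (p - \<beta>) * \<rho> (norm z))
                     = Cbar DIM('a) p"
    (* the mollifier psi *)
    and psi_C1: "\<psi> C1_differentiable_on UNIV"
    and psi_even: "\<forall>x. \<psi> (- x) = \<psi> x" and psi_nonneg: "\<forall>x. 0 \<le> \<psi> x"
    and psi_supp: "\<exists>c\<^sub>\<psi>>0. {-c\<^sub>\<psi>..c\<^sub>\<psi>} \<subseteq> closure {x. \<psi> x \<noteq> 0}"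
      "compact (closure {x. \<psi> x \<noteq> 0})" "closure {x. \<psi> x \<noteq> 0} \<subseteq> {-1<..<1}"
    and psi_norm: "integral\<^sup>L lborel (\<lambda>x::'a. \<psi> (norm x)) = 1"
    (* the load *)
    and f_dual: "W1p_dual p \<Omega> f" and f_one: "f (\<lambda>_. 1) = 0"
    (* triangulations *)
    and h0: "0 < h0"
    and mesh: "\<forall>h\<in>{0<..h0}. mesh_of \<Omega> (T h) \<and> Max (diameter ` T h) = h"
    and shape_reg: "\<exists>C. \<forall>h\<in>{0<..h0}. \<forall>t\<in>T h. diameter t \<le> C * inradius t"
    and quasi_unif: "\<exists>c>0. \<forall>h\<in>{0<..h0}. \<forall>t\<in>T h. c * h \<le> diameter t"
    (* inclusion of the P1 space *)
    and incl_fin: "\<forall>\<sigma>>0. \<forall>h\<in>{0<..h0}. P1_space \<Omega> (T h) \<subseteq>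
          fe_space (nonlocal_space0 \<Omega> \<beta> p
             (min (delta0 \<kappa>0 (Max ((\<lambda>e. \<kappa> [e]) ` Basis))) (1 / \<sigma>))) (T h) N"
    and incl_inf: "\<forall>h\<in>{0<..h0}. P1_space \<Omega> (T h) \<subseteq> fe_space (W1p0 p \<Omega>) (T h) N"
    (* minimizers *)
    and min_fin: "\<forall>\<sigma>>0. \<forall>h\<in>{0<..h0}.
          is_minimizer
            (E_nl \<Omega> \<beta> p lam \<rho> \<psi> f (min (delta0 \<kappa>0 (Max ((\<lambda>e. \<kappa> [e]) ` Basis))) (1 / \<sigma>)))
            (fe_space (nonlocal_space0 \<Omega> \<beta> p
               (min (delta0 \<kappa>0 (Max ((\<lambda>e. \<kappa> [e]) ` Basis))) (1 / \<sigma>))) (T h) N)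
            (u \<sigma> h)"
    and min_inf: "\<forall>h\<in>{0<..h0}. is_minimizer (E_loc \<Omega> p f) (fe_space (W1p0 p \<Omega>) (T h) N) (u_inf h)"
  shows "\<forall>h\<in>{0<..h0}. ((\<lambda>\<sigma>. Lp_norm p \<Omega> (\<lambda>x. u \<sigma> h x - u_inf h x)) \<longlongrightarrow> 0) at_top"
proof
  fix h assume h: "h \<in> {0<..h0}"
  have op: "open \<Omega>" and bdd: "bounded \<Omega>" and conn: "connected \<Omega>" using dom(1) by (auto simp: lipschitz_domain_def)
  have fr: "negligible (frontier \<Omega>)" by (rule negligible_piecewise_flat_frontier[OF dom(2)])
  have meshh: "mesh_of \<Omega> (T h)" using mesh h by blast
  have sub: "\<Omega> \<subseteq> closure \<Omega>" by (rule closure_subset)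
  interpret W: domain_weight \<Omega> lam \<kappa>0 "\<lambda>e. \<kappa> [e]"
  proof
    fix i x :: 'a assume i: "i \<in> Basis" and x: "x \<in> \<Omega>"
    \<comment> \<open>For one derivative the exponent of the distance is 0, and the power equals 1
      only when the base is nonzero.\<close>
    have "0 < dist_bd \<Omega> x" by (rule dist_bd_pos[OF op bdd x])
    moreover have "\<bar>iter_pd [i] lam x\<bar> \<le> \<kappa> [i] * dist_bd \<Omega> x powr (1 - real (length [i]))"
      using lam_deriv[rule_format, of "[i]"] i x by (simp del: iter_pd.simps)
    ultimately show "\<bar>frechet_derivative lam (at x) i\<bar> \<le> \<kappa> [i]" by simp
  qed (use op bdd lam_smooth kappa0 lam_comp sub in auto)
  obtain \<psi>' B where psi: "\<And>s. (\<psi> has_real_derivative \<psi>' s) (at s)" "\<psi>' \<in> borel_measurable borel"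
    "\<And>s. \<bar>\<psi> s\<bar> \<le> B" "\<And>s. \<bar>\<psi>' s\<bar> \<le> B" "\<psi>' 0 = 0" "\<And>s. 1 \<le> s \<Longrightarrow> \<psi> s = 0" "\<And>s. 1 \<le> s \<Longrightarrow> \<psi>' s = 0"
  proof (rule C1_compact_support_bounds[OF psi_C1 psi_even psi_supp(3)])
    fix \<psi>' B assume *: "\<And>s. (\<psi> has_real_derivative \<psi>' s) (at s)" "\<psi>' \<in> borel_measurable borel"
    "\<And>s. \<bar>\<psi> s\<bar> \<le> B" "\<And>s. \<bar>\<psi>' s\<bar> \<le> B" "\<psi>' 0 = 0" "\<And>s. 1 \<le> s \<Longrightarrow> \<psi> s = 0" "\<And>s. 1 \<le> s \<Longrightarrow> \<psi>' s = 0"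
    show thesis by (rule that) (fact *)+
  qed
  obtain C\<^sub>\<rho> c\<^sub>\<rho> where rp: "C\<^sub>\<rho> > 0" "0 < c\<^sub>\<rho>" "c\<^sub>\<rho> < 1" "\<forall>x\<in>{-c\<^sub>\<rho>..c\<^sub>\<rho>}. C\<^sub>\<rho> \<le> \<rho> x" using rho_pos by (elim exE conjE) (rule that)
  have rs: "\<rho> s = 0" if "1 \<le> s" for s
  proof (rule ccontr)
    assume "\<rho> s \<noteq> 0"
    then have "s \<in> closure {x. \<rho> x \<noteq> 0}" by (intro subsetD[OF closure_subset]) simp
    then have "s \<in> {-1<..<1}" by (rule subsetD[OF rho_supp(2)])
    then show False using that by simp
  qed
  have rn: "0 \<le> \<rho> s" if "0 \<le> s" for s
    using rho_nonneg rs[of s] that by (cases "s < 1") auto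
  obtain M0 where M0: "\<And>x. x \<in> \<Omega> \<Longrightarrow> dist_bd \<Omega> x \<le> M0"
  proof (rule dist_bd_bounded[OF bdd])
    fix M0 assume "\<And>x. x \<in> \<Omega> \<Longrightarrow> dist_bd \<Omega> x \<le> M0"
    then show thesis by (rule that)
  qed
  have p0: "0 < p" using p by simp
  note rint = nn_integral_rho_eq_Cbar[OF p0 rn rs rho_norm]
  obtain Bb where Bb: "\<And>j x. j \<in> T h \<times> multi_index N \<Longrightarrow> \<bar>cell_monomial j x\<bar> \<le> Bb"
    "\<And>j x. j \<in> T h \<times> multi_index N \<Longrightarrow> norm (cell_monomial_grad j x) \<le> Bb"
  proof (rule cell_monomials_bounded[OF mesh_finite[OF meshh] compact_simplex[OF mesh_simplex[OF meshh]]])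
    fix Bb assume *: "\<And>j x. j \<in> T h \<times> multi_index N \<Longrightarrow> \<bar>cell_monomial j x\<bar> \<le> Bb"
      "\<And>j x. j \<in> T h \<times> multi_index N \<Longrightarrow> norm (cell_monomial_grad j x) \<le> Bb"
    show thesis by (rule that) (fact *)+
  qed
  obtain I where I: "I \<subseteq> T h \<times> multi_index N"
    "\<And>c. (AE x in lebesgue_on \<Omega>. (\<Sum>j\<in>I. c j * cell_monomial j x) = 0) \<Longrightarrow> \<forall>j\<in>I. c j = 0"
    "\<And>V. fe_space V (T h) N = {v \<in> V. \<exists>c. AE x in lebesgue_on \<Omega>. v x = (\<Sum>j\<in>I. c j * cell_monomial j x)}"
  proof (rule fe_space_basis[OF meshh op fr])
    fix I assume 1: "I \<subseteq> T h \<times> multi_index N"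
      and 2: "\<And>c. (AE x in lebesgue_on \<Omega>. (\<Sum>j\<in>I. c j * cell_monomial j x) = 0) \<Longrightarrow> \<forall>j\<in>I. c j = 0"
      and 3: "\<And>V. fe_space V (T h) N = {v \<in> V. \<exists>c. AE x in lebesgue_on \<Omega>. v x = (\<Sum>j\<in>I. c j * cell_monomial j x)}"
    show thesis by (rule that) (fact 1 2 3)+
  qed
  \<comment> \<open>The cells cover the closure, so their interiors are intersected with \<Omega>;
    only a null subset of \<Omega> is lost.\<close>
  let ?D = "\<Omega> \<inter> \<Union>(interior ` T h)"
  have finI: "finite I" using I(1) finite_cartesian_product[OF mesh_finite[OF meshh] finite_multi_index] by (rule finite_subset)
  have pws: "piecewise_setting \<Omega> ?D p \<beta> W.width W.dwidth W.delta_max (\<kappa>0 * M0) \<psi> \<psi>' \<rho> B c\<^sub>\<rho> C\<^sub>\<rho> f I cell_monomial cell_monomial_grad Bb"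
  proof (rule piecewise_setting.intro)
    show "open ?D" using op by auto
    show "negligible (\<Omega> - ?D)" by (rule negligible_subset[OF negligible_mesh_skeleton[OF meshh]]) (use sub in auto)
    show "0 < W.delta_max" by (rule W.delta_max_pos)
    show "collar_kernel_lip \<Omega> (W.width \<delta>) (W.dwidth \<delta>) \<psi> \<psi>' B" if "0 < \<delta>" "\<delta> \<le> W.delta_max" for \<delta>
      using psi_nonneg by (intro W.collar_kernel_lip_width psi psi_norm that) auto
    show "W.width \<delta> x \<le> \<delta> * (\<kappa>0 * M0)" if "0 < \<delta>" "x \<in> \<Omega>" for \<delta> x
    proof -
      have "\<delta> * \<kappa>0 * dist_bd \<Omega> x \<le> \<delta> * \<kappa>0 * M0" using that kappa0 M0 by (intro mult_left_mono) auto
      then show ?thesis using W.width_le[OF that] by (simp only: mult.assoc)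
    qed
    show "(cell_monomial j has_derivative (\<lambda>h. cell_monomial_grad j x \<bullet> h)) (at x)" if "j \<in> I" "x \<in> ?D" for j x
      using that I(1) by (intro cell_monomial_has_derivative[OF meshh]) auto
    show "C\<^sub>\<rho> \<le> \<rho> s" if "0 \<le> s" "s \<le> c\<^sub>\<rho>" for s using that rp by auto
    show "(\<integral>\<^sup>+z. ennreal (norm z powr (p - \<beta>) * \<rho> (norm (z::'a))) \<partial>lborel) = ennreal (Cbar DIM('a) p)" by (rule rint)
  qed (use conn p beta rho_meas rn rs rp f_dual finI cell_monomial_measurable cell_monomial_grad_measurable Bb I(1) in auto)
  interpret P: piecewise_setting \<Omega> ?D p \<beta> W.width W.dwidth W.delta_max "\<kappa>0 * M0" \<psi> \<psi>' \<rho> B c\<^sub>\<rho> C\<^sub>\<rho> f I cell_monomial cell_monomial_grad Bb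
    by (rule pws)
  define d0 where "d0 = delta0 \<kappa>0 (Max ((\<lambda>e. \<kappa> [e]) ` Basis))"
  have d0: "0 < d0" "d0 \<le> 1" by (simp_all add: d0_def delta0_def)
  let ?F = "\<lambda>\<sigma>. Lp_norm p \<Omega> (\<lambda>x. u \<sigma> h x - u_inf h x)"
  show "(?F \<longlongrightarrow> 0) at_top"
  proof (rule ccontr)
    assume "\<not> ?thesis"
    then obtain e where e: "0 < e" "\<not> (\<forall>\<^sub>F \<sigma> in at_top. dist (?F \<sigma>) 0 < e)" by (auto simp: tendsto_iff)
    \<comment> \<open>Failure of the limit provides arbitrarily large \<sigma> with norm at least
      \<open>e\<close>. The first entry of the maximum drives the width parameters to 0, the second
      puts them below \<open>W.delta_max\<close>.\<close>
    then have "\<exists>\<sigma>\<ge>max (real n + 1) (1 / W.delta_max). e \<le> dist (?F \<sigma>) 0" for n :: nat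
      unfolding eventually_at_top_linorder by (meson not_le)
    then obtain X where X: "\<And>n. max (real n + 1) (1 / W.delta_max) \<le> X n" "\<And>n. e \<le> dist (?F (X n)) 0" by metis
    have X1: "real n + 1 \<le> X n" "1 / W.delta_max \<le> X n" for n using X(1)[of n] by auto
    have Xp: "0 < X n" for n using X1(1)[of n] by linarith
    define d where "d n = min d0 (1 / X n)" for n
    have d1: "0 < d n" "d n \<le> 1" for n using d0 Xp[of n] by (auto simp: d_def)
    have d2: "d n \<le> W.delta_max" for n
    proof -
      have "1 \<le> X n * W.delta_max" using X1(2)[of n] W.delta_max_pos by (simp add: pos_divide_le_eq)
      then have "1 / X n \<le> W.delta_max" using Xp[of n] by (simp add: pos_divide_le_eq mult.commute)
      then show ?thesis by (simp add: d_def)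
    qed
    have d3: "d \<longlonglongrightarrow> 0"
    proof (rule tendsto_sandwich[of "\<lambda>_. 0" d sequentially "\<lambda>n. inverse (real (Suc n))" 0])
      show "\<forall>\<^sub>F n in sequentially. d n \<le> inverse (real (Suc n))"
      proof (intro always_eventually allI)
        fix n
        have "1 / X n \<le> 1 / (real n + 1)" using X1(1)[of n] by (intro divide_left_mono) auto
        then show "d n \<le> inverse (real (Suc n))" by (simp add: d_def inverse_eq_divide add.commute)
      qed
      show "\<forall>\<^sub>F n in sequentially. 0 \<le> d n" by (intro always_eventually allI less_imp_le d1)
    qed (rule tendsto_const, rule LIMSEQ_inverse_real_of_nat)
    \<comment> \<open>Every such sequence has a subsequence along which the norm tends to 0, against
      the lower bound \<open>e\<close>; this upgrades subsequences to the limit in \<sigma>.\<close>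
    obtain s :: "nat \<Rightarrow> nat" where "strict_mono s" "(\<lambda>n. ?F (X (s n))) \<longlonglongrightarrow> 0"
    proof (rule P.discrete_minimizers_subsequence[where d = d and lam = lam and us = "\<lambda>n. u (X n) h" and v = "u_inf h"])
      show "\<forall>j\<in>I. c j = 0" if "AE x in lebesgue_on \<Omega>. P.U c x = 0" for c
        using that unfolding P.U_def by (rule I(2))
      show "\<forall>x\<in>\<Omega>. eta lam \<delta> x = W.width \<delta> x" for \<delta> by (simp add: W.width_def)
      show "is_minimizer (E_nl \<Omega> \<beta> p lam \<rho> \<psi> f (d n))
          {w \<in> nonlocal_space0 \<Omega> \<beta> p (d n). \<exists>c. AE x in lebesgue_on \<Omega>. w x = P.U c x} (u (X n) h)" for n
        using min_fin[rule_format, OF Xp[of n] h] unfolding P.U_def I(3) d_def d0_def .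
      show "is_minimizer (E_loc \<Omega> p f) {w \<in> W1p0 p \<Omega>. \<exists>c. AE x in lebesgue_on \<Omega>. w x = P.U c x} (u_inf h)"
        using bspec[OF min_inf h] unfolding P.U_def I(3) .
    qed (use d1 d2 d3 in auto)
    then have "\<forall>\<^sub>F n in sequentially. dist (?F (X (s n))) 0 < e" using e(1) by (auto simp: tendsto_iff)
    then obtain n where "dist (?F (X (s n))) 0 < e" by (auto simp: eventually_sequentially)
    with X(2)[of "s n"] show False by linarith
  qed
qed

end
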